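(* Fix a dimension $d\ge1$ and let $N=n^d$. Let $\eta^N$ be the stationary slowed-down random stirring process on the torus $\mathbb T^N$, started from $\eta^N(0)\sim\mu^N$, and let $\xi^N(t)=\mathbf p(\eta^N(t))$ be its process of normalized ordered cycle lengths. Let $\zeta$ be the stationary canonical split-and-merge process on $\Omega$, with $\zeta(0)\sim\mathsf{PD}(1)$. Then, on any compact time interval $[0,T]$, $$\xi^N(\cdot)\Rightarrow\zeta(\cdot)\qquad\text{as }N\to\infty,$$ where $\Rightarrow$ denotes weak convergence in the space of càdlàg trajectories $[0,T]\to\Omega$ endowed with the Skorohod topology based on the $\ell^1$-distance $d(\mathbf p,\mathbf p')=\sum_i|p_i-p_i'|$ on $\Omega$.
   Context: **Partitions.** $\Omega=\{\mathbf p=(p_i)_{i\ge1}: p_i\in[0,1],\ p_1\ge p_2\ge\dots\ge0,\ \sum_i p_i=1\}$ with the metric $d(\mathbf p,\mathbf p')=\sum_i|p_i-p_i'|$. **Permutations.** $\Sigma^N$ is the group of all permutations of $N$ elements (the vertices of $\mathbb T^N$), $\mu^N$ the uniform distribution on $\Sigma^N$. For $\sigma\in\Sigma^N$, $\mathbf p(\sigma)\in\Omega$ is the sequence of cycle lengths of $\sigma$ (fixed points are cycles of length 1) divided by $N$, listed in decreasing order and padded with zeros. **Random stirring.** $\mathbb T^N=(\mathbb Z/n\mathbb Z)^d$ is the discrete torus with $N=n^d$ vertices, and $\mathbb B^N$ its set of unoriented nearest-neighbour edges, with $n\ge3$ so that $|\mathbb B^N|=dN$. For $\mathsf b\in\mathbb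 B^N$, $\tau_{\mathsf b}$ is the transposition of the two endpoints of $\mathsf b$. $\eta^N$ is the continuous-time Markov jump process on $\Sigma^N$ which jumps from $\sigma$ to $\tau_{\mathsf b}\sigma$ at rate $1/(dN)$ for each $\mathsf b\in\mathbb B^N$. It is stationary when started from $\mu^N$. **Canonical split-and-merge.** For $i<j$, $\mathsf M_{ij}\mathbf p$ is obtained from $\mathbf p\in\Omega$ by replacing the entries $p_i,p_j$ by the single entry $p_i+p_j$ and rearranging in decreasing order; for $u\in[0,1)$, $\mathsf S_i^u\mathbf p$ is obtained by replacing $p_i$ by $up_i,(1-u)p_i$ and rearranging in decreasing order. $\zeta$ is the continuous-time Markov jump process on $\Omega$ (total jump rate 1) with generator, on bounded continuous $f$, $$\mathcal Gf(\mathbf p)=2\sum_{i<j}p_ip_j\big(f(\mathsf M_{ij}\mathbf p)-f(\mathbf p)\big)+\sum_ip_i^2\int_0^1\big(f(\mathsf S_i^u\mathbf p)-f(\mathbf p)\big)\,du .$$ **Poisson–Dirichlet law.** $\mathsf{PD}(1)$ is the law on $\Omega$ of the decreasing rearrangement of $\big(\chi_j/\sum_k\chi_k\big)_{j\ge1}$, where $(\chi_j)$ are the points of a Poisson point process on $(0,\infty)$ with intensity $t^{-1}e^{-t}dt$; it is a stationary law of $\zeta$. *)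

theory Defs
  imports "HOL-Probability.Probability" "HOL-Combinatorics.Combinatorics"
begin

section \<open>Partitions of unity with the \<open>\<ell>\<^sup>1\<close> metric\<close>

typedef mass_partition =
  "{p :: nat \<Rightarrow> real. (\<forall>i. 0 \<le> p i \<and> p i \<le> 1) \<and> decseq p \<and> p sums 1}"
  morphisms mass Abs_mass_partition
proof -
  have "(\<lambda>i::nat. if i = 0 then 1 else 0 :: real) sums 1"
    using sums_If_finite[of "\<lambda>i::nat. i = 0" "\<lambda>_. 1 :: real"] by simp
  moreover have "decseq (\<lambda>i::nat. if i = 0 then 1 else 0 :: real)"
    by (auto simp: decseq_def)
  ultimately show ?thesis
    by (intro exI[of _ "\<lambda>i::nat. if i = 0 then 1 else 0"]) auto
qed

lemma mass_nonneg: "0 \<le> mass p i"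
  and mass_le_1: "mass p i \<le> 1"
  and mass_decseq: "decseq (mass p)"
  and mass_sums: "mass p sums 1"
  using mass[of p] by auto

lemma summable_mass_diff: "summable (\<lambda>i. \<bar>mass p i - mass q i\<bar>)"
proof (rule summable_comparison_test')
  show "summable (\<lambda>i. mass p i + mass q i)"
    by (intro summable_add sums_summable[OF mass_sums])
  show "norm \<bar>mass p i - mass q i\<bar> \<le> mass p i + mass q i" if "0 \<le> i" for i
    using mass_nonneg[of p i] mass_nonneg[of q i] by auto
qed

instantiation mass_partition :: metric_space
begin

definition dist_mass_partition :: "mass_partition \<Rightarrow> mass_partition \<Rightarrow> real" where
  "dist p q = (\<Sum>i. \<bar>mass p i - mass q i\<bar>)"

definition uniformity_mass_partition :: "(mass_partition \<times> mass_partition) filter" where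
  "uniformity_mass_partition = (INF e\<in>{0<..}. principal {(x, y). dist x y < e})"

definition open_mass_partition :: "mass_partition set \<Rightarrow> bool" where
  "open_mass_partition U \<longleftrightarrow>
     (\<forall>x\<in>U. eventually (\<lambda>(x', y). x' = x \<longrightarrow> y \<in> U) uniformity)"

instance
proof
  fix p q r :: mass_partition
  show "dist p q = 0 \<longleftrightarrow> p = q"
    by (subst dist_mass_partition_def, subst suminf_eq_zero_iff[OF summable_mass_diff])
       (auto simp: mass_inject[symmetric])
  show "dist p q \<le> dist p r + dist q r"
    unfolding dist_mass_partition_def
    by (subst suminf_add[OF summable_mass_diff summable_mass_diff], rule suminf_le)
       (auto intro: summable_mass_diff summable_add)
qed (simp_all add: uniformity_mass_partition_def open_mass_partition_def)

end

text \<open>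
  The decreasing rearrangement of a family \<open>a\<close> of nonnegative reals with sum 1, padded with zeros:
  the unique \<open>p\<close> whose positive entries are the positive entries of \<open>a\<close>, with multiplicity.
\<close>

definition rearranged :: "'i set \<Rightarrow> ('i \<Rightarrow> real) \<Rightarrow> mass_partition" where
  "rearranged I a =
     (THE p. \<exists>\<pi>. bij_betw \<pi> {k. 0 < mass p k} {i \<in> I. 0 < a i} \<and>
                 (\<forall>k. 0 < mass p k \<longrightarrow> mass p k = a (\<pi> k)))"


section \<open>Markov jump processes\<close>

text \<open>
  \<open>q x A\<close> is the rate of jumping from \<open>x\<close> into \<open>A\<close>.
\<close>

definition rate_kernel :: "'s measure \<Rightarrow> ('s \<Rightarrow> 's measure) \<Rightarrow> bool" where
  "rate_kernel S q \<longleftrightarrow>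
     (\<forall>x\<in>space S. sets (q x) = sets S \<and> emeasure (q x) (space S) < \<infinity>) \<and>
     (\<forall>A\<in>sets S. (\<lambda>x. emeasure (q x) A) \<in> borel_measurable S)"

definition total_rate :: "'s measure \<Rightarrow> ('s \<Rightarrow> 's measure) \<Rightarrow> 's \<Rightarrow> real" where
  "total_rate S q x = measure (q x) (space S)"

definition jump_generator :: "('s \<Rightarrow> 's measure) \<Rightarrow> ('s \<Rightarrow> real) \<Rightarrow> 's \<Rightarrow> real" where
  "jump_generator q f x = (\<integral>y. (f y - f x) \<partial>q x)"

definition jump_history ::
  "'w measure \<Rightarrow> 's measure \<Rightarrow> (nat \<Rightarrow> 'w \<Rightarrow> 's) \<Rightarrow> (nat \<Rightarrow> 'w \<Rightarrow> real) \<Rightarrow> nat \<Rightarrow> 'w measure" where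
  "jump_history M S Y W n =
     vimage_algebra (space M) (\<lambda>\<omega>. (\<lambda>k\<in>{..n}. Y k \<omega>, \<lambda>k\<in>{..<n}. W k \<omega>))
       ((\<Pi>\<^sub>M k\<in>{..n}. S) \<Otimes>\<^sub>M (\<Pi>\<^sub>M k\<in>{..<n}. (borel :: real measure)))"

text \<open>
  \<open>Y\<close> is the sequence of visited states and \<open>W k\<close> the time spent in \<open>Y k\<close>. Given the past up to
  the arrival in \<open>Y n\<close>, the holding time \<open>W n\<close> is exponential with parameter the total rate at
  \<open>Y n\<close>, and is independent of \<open>Y (Suc n)\<close>, which is drawn from the normalised rate kernel.
  States with total rate 0 are not catered for.
\<close>

definition markov_jump_process ::
  "'w measure \<Rightarrow> 's measure \<Rightarrow> ('s \<Rightarrow> 's measure) \<Rightarrow> (real \<Rightarrow> 'w \<Rightarrow> 's) \<Rightarrow> bool" where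
  "markov_jump_process M S q X \<longleftrightarrow>
     prob_space M \<and> rate_kernel S q \<and>
     (\<exists>Y W. (\<forall>n. Y n \<in> M \<rightarrow>\<^sub>M S) \<and> (\<forall>n. W n \<in> borel_measurable M) \<and>
        (\<forall>n. \<forall>\<omega>\<in>space M. 0 < W n \<omega>) \<and>
        (\<forall>\<omega>\<in>space M. \<forall>t. \<exists>n. t < (\<Sum>k<n. W k \<omega>)) \<and>
        (\<forall>n s. \<forall>A\<in>sets S. 0 \<le> s \<longrightarrow>
           (AE \<omega> in M.
              real_cond_exp M (jump_history M S Y W n)
                (indicator {\<omega>. s < W n \<omega> \<and> Y (Suc n) \<omega> \<in> A}) \<omega> =
              exp (- total_rate S q (Y n \<omega>) * s) *
                (measure (q (Y n \<omega>)) A / total_rate S q (Y n \<omega>)))) \<and>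
        (\<forall>\<omega>\<in>space M. \<forall>n t. (\<Sum>k<n. W k \<omega>) \<le> t \<and> t < (\<Sum>k<Suc n. W k \<omega>) \<longrightarrow>
           X t \<omega> = Y n \<omega>))"


section \<open>Random stirring on the torus\<close>

definition torus :: "nat \<Rightarrow> nat \<Rightarrow> (nat \<Rightarrow> nat) set" where
  "torus d n = {..<d} \<rightarrow>\<^sub>E {..<n}"

definition torus_edges :: "nat \<Rightarrow> nat \<Rightarrow> (nat \<Rightarrow> nat) set set" where
  "torus_edges d n = {{x, x(i := (x i + 1) mod n)} | x i. x \<in> torus d n \<and> i < d}"

definition edge_transposition :: "'v set \<Rightarrow> 'v \<Rightarrow> 'v" where
  "edge_transposition b = (THE \<tau>. \<exists>x y. b = {x, y} \<and> \<tau> = Transposition.transpose x y)"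

definition torus_perms :: "nat \<Rightarrow> nat \<Rightarrow> ((nat \<Rightarrow> nat) \<Rightarrow> nat \<Rightarrow> nat) set" where
  "torus_perms d n = {\<sigma>. \<sigma> permutes torus d n}"

definition stirring_rates ::
  "nat \<Rightarrow> nat \<Rightarrow> ((nat \<Rightarrow> nat) \<Rightarrow> nat \<Rightarrow> nat) \<Rightarrow> ((nat \<Rightarrow> nat) \<Rightarrow> nat \<Rightarrow> nat) measure" where
  "stirring_rates d n \<sigma> =
     distr (point_measure (torus_edges d n) (\<lambda>b. ennreal (1 / (real d * real (n ^ d)))))
       (count_space (torus_perms d n)) (\<lambda>b. edge_transposition b \<circ> \<sigma>)"

definition stirring_process ::
  "nat \<Rightarrow> nat \<Rightarrow> 'w measure \<Rightarrow> (real \<Rightarrow> 'w \<Rightarrow> (nat \<Rightarrow> nat) \<Rightarrow> nat \<Rightarrow> nat) \<Rightarrow> bool" where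
  "stirring_process d n M \<eta> \<longleftrightarrow>
     markov_jump_process M (count_space (torus_perms d n)) (stirring_rates d n) \<eta>"

text \<open>A fixed point \<open>x\<close> has the orbit \<open>{x}\<close>.\<close>

definition cycle_partition ::
  "nat \<Rightarrow> nat \<Rightarrow> ((nat \<Rightarrow> nat) \<Rightarrow> nat \<Rightarrow> nat) \<Rightarrow> mass_partition" where
  "cycle_partition d n \<sigma> =
     rearranged (orbit \<sigma> ` torus d n) (\<lambda>C. real (card C) / real (n ^ d))"


section \<open>The canonical split-and-merge process\<close>

definition merge_masses :: "nat \<Rightarrow> nat \<Rightarrow> mass_partition \<Rightarrow> mass_partition" where
  "merge_masses i j p = rearranged UNIV ((mass p)(i := mass p i + mass p j, j := 0))"

definition split_mass :: "nat \<Rightarrow> real \<Rightarrow> mass_partition \<Rightarrow> mass_partition" where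
  "split_mass i u p =
     rearranged UNIV (case_nat ((1 - u) * mass p i) ((mass p)(i := u * mass p i)))"

definition split_merge_generator :: "(mass_partition \<Rightarrow> real) \<Rightarrow> mass_partition \<Rightarrow> real" where
  "split_merge_generator f p =
     2 * (\<Sum>\<^sub>\<infinity>(i, j)\<in>{(i, j). i < j}. mass p i * mass p j * (f (merge_masses i j p) - f p)) +
     (\<Sum>i. (mass p i)\<^sup>2 * (LINT u:{0..<1}|lborel. f (split_mass i u p) - f p))"

text \<open>
  Since the total rate is fixed to be 1, the generator determines the rate kernel.
\<close>

definition split_merge_process ::
  "'w measure \<Rightarrow> (real \<Rightarrow> 'w \<Rightarrow> mass_partition) \<Rightarrow> bool" where
  "split_merge_process M \<zeta> \<longleftrightarrow>
     (\<exists>q. markov_jump_process M borel q \<zeta> \<and>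
        (\<forall>p. total_rate borel q p = 1) \<and>
        (\<forall>f. continuous_on UNIV f \<and> bounded (range f) \<longrightarrow>
           (\<forall>p. jump_generator q f p = split_merge_generator f p)))"


section \<open>The Poisson--Dirichlet law\<close>

text \<open>
  \<open>pt\<close> enumerates, with multiplicity, the points of a Poisson point process with intensity \<open>\<nu>\<close> of
  infinite total mass. Finiteness of the counts is required explicitly because \<^term>\<open>card\<close>
  vanishes on infinite sets.
\<close>

definition poisson_points :: "'w measure \<Rightarrow> 'e measure \<Rightarrow> (nat \<Rightarrow> 'w \<Rightarrow> 'e) \<Rightarrow> bool" where
  "poisson_points M \<nu> pt \<longleftrightarrow>
     prob_space M \<and> (\<forall>j. pt j \<in> M \<rightarrow>\<^sub>M \<nu>) \<and>
     (\<forall>A\<in>sets \<nu>. emeasure \<nu> A < \<infinity> \<longrightarrow>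
        (AE \<omega> in M. finite {j. pt j \<omega> \<in> A}) \<and>
        (\<forall>k. measure M {\<omega> \<in> space M. card {j. pt j \<omega> \<in> A} = k} =
             exp (- measure \<nu> A) * measure \<nu> A ^ k / fact k)) \<and>
     (\<forall>(m :: nat) A. (\<forall>i<m. A i \<in> sets \<nu> \<and> emeasure \<nu> (A i) < \<infinity>) \<and>
            disjoint_family_on A {..<m} \<longrightarrow>
        prob_space.indep_vars M (\<lambda>_. count_space UNIV)
          (\<lambda>i \<omega>. card {j. pt j \<omega> \<in> A i}) {..<m})"

definition PD1_intensity :: "real measure" where
  "PD1_intensity =
     density (restrict_space lborel {0<..}) (\<lambda>t. ennreal (exp (- t) / t))"

text \<open>
  The Poisson points may be taken on the canonical space of real sequences.
\<close>

definition is_PD1 :: "mass_partition measure \<Rightarrow> bool" where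
  "is_PD1 \<mu> \<longleftrightarrow>
     (\<exists>(M :: (nat \<Rightarrow> real) measure) pt. poisson_points M PD1_intensity pt \<and>
        \<mu> = distr M borel (\<lambda>\<omega>. rearranged UNIV (\<lambda>j. pt j \<omega> / (\<Sum>k. pt k \<omega>))))"


section \<open>The Skorohod topology and weak convergence\<close>

definition cadlag_paths :: "real \<Rightarrow> (real \<Rightarrow> 'a::metric_space) set" where
  "cadlag_paths T =
     {x \<in> extensional {0..T}.
        (\<forall>t\<in>{0..<T}. (x \<longlongrightarrow> x t) (at_right t)) \<and>
        (\<forall>t\<in>{0<..T}. \<exists>l. (x \<longlongrightarrow> l) (at_left t))}"

definition time_changes :: "real \<Rightarrow> (real \<Rightarrow> real) set" where
  "time_changes T =
     {\<theta>. continuous_on {0..T} \<theta> \<and> strict_mono_on {0..T} \<theta> \<and> \<theta> ` {0..T} = {0..T}}"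

text \<open>
  The infimum over time changes \<open>\<theta>\<close> of the maximum of \<open>sup \<bar>\<theta> t - t\<bar>\<close> and \<open>sup dist (x t) (y (\<theta> t))\<close>,
  written with common bounds \<open>e\<close> of the two suprema. The value off the path space only serves
  \<^locale>\<open>Metric_space\<close>, which asks for nonnegativity and symmetry everywhere.
\<close>

definition skorohod_dist ::
  "real \<Rightarrow> (real \<Rightarrow> 'a::metric_space) \<Rightarrow> (real \<Rightarrow> 'a) \<Rightarrow> real" where
  "skorohod_dist T x y =
     (if x \<in> cadlag_paths T \<and> y \<in> cadlag_paths T
      then Inf {e. 0 < e \<and> (\<exists>\<theta>\<in>time_changes T.
             \<forall>t\<in>{0..T}. \<bar>\<theta> t - t\<bar> \<le> e \<and> dist (x t) (y (\<theta> t)) \<le> e)}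
      else 0)"

lemma time_changes_id: "(\<lambda>t. t) \<in> time_changes T"
  by (auto simp: time_changes_def strict_mono_on_def)

lemma time_changes_in: "\<theta> \<in> time_changes T \<Longrightarrow> t \<in> {0..T} \<Longrightarrow> \<theta> t \<in> {0..T}"
  by (auto simp: time_changes_def)

lemma time_changes_comp:
  assumes "\<kappa> \<in> time_changes T" "\<theta> \<in> time_changes T"
  shows "(\<lambda>t. \<kappa> (\<theta> t)) \<in> time_changes T"
proof -
  have im: "\<theta> ` {0..T} = {0..T}" "\<kappa> ` {0..T} = {0..T}"
    using assms by (auto simp: time_changes_def)
  have "continuous_on {0..T} (\<lambda>t. \<kappa> (\<theta> t))"
    by (rule continuous_on_compose2[of "{0..T}" \<kappa> "{0..T}" \<theta>])
       (use assms im in \<open>simp_all add: time_changes_def\<close>)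
  moreover have "strict_mono_on {0..T} (\<lambda>t. \<kappa> (\<theta> t))"
  proof (rule strict_mono_onI)
    fix r s assume "r \<in> {0..T}" "s \<in> {0..T}" "r < s"
    moreover have "strict_mono_on {0..T} \<kappa>" "strict_mono_on {0..T} \<theta>"
      using assms by (simp_all add: time_changes_def)
    ultimately show "\<kappa> (\<theta> r) < \<kappa> (\<theta> s)"
      using time_changes_in[OF assms(2)] by (blast dest: strict_mono_onD)
  qed
  moreover have "(\<lambda>t. \<kappa> (\<theta> t)) ` {0..T} = {0..T}"
    using im by (metis image_image)
  ultimately show ?thesis by (auto simp: time_changes_def)
qed

lemma time_changes_inverse:
  assumes "\<theta> \<in> time_changes T"
  obtains \<kappa> where "\<kappa> \<in> time_changes T" "\<And>t. t \<in> {0..T} \<Longrightarrow> \<theta> (\<kappa> t) = t"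
proof -
  have l: "continuous_on {0..T} \<theta>" "strict_mono_on {0..T} \<theta>" "\<theta> ` {0..T} = {0..T}"
    using assms by (auto simp: time_changes_def)
  have inj: "inj_on \<theta> {0..T}" using l(2) by (rule strict_mono_on_imp_inj_on)
  define \<kappa> where "\<kappa> = inv_into {0..T} \<theta>"
  have inv: "\<theta> (\<kappa> t) = t" if "t \<in> {0..T}" for t
    unfolding \<kappa>_def using that l(3) by (intro f_inv_into_f) auto
  have im: "\<kappa> ` {0..T} = {0..T}"
    using inj_on_imp_bij_betw[OF inj] l(3) unfolding \<kappa>_def
    by (metis bij_betw_imp_surj_on bij_betw_inv_into)
  have "continuous_on {0..T} \<kappa>"
    using continuous_on_inv[OF l(1), of \<kappa>] l(3) inj by (auto simp: \<kappa>_def)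
  moreover have "strict_mono_on {0..T} \<kappa>"
    unfolding strict_mono_on_def
  proof (intro allI impI, elim conjE)
    fix r s assume rs: "r \<in> {0..T}" "s \<in> {0..T}" "r < s"
    have k: "\<kappa> r \<in> {0..T}" "\<kappa> s \<in> {0..T}" using im rs by blast+
    show "\<kappa> r < \<kappa> s"
    proof (rule ccontr)
      assume "\<not> \<kappa> r < \<kappa> s"
      then have "\<theta> (\<kappa> s) \<le> \<theta> (\<kappa> r)"
        using k l(2) by (metis linorder_not_less not_less_iff_gr_or_eq order_less_imp_le strict_mono_onD)
      with inv rs show False by simp
    qed
  qed
  ultimately have "\<kappa> \<in> time_changes T" using im by (auto simp: time_changes_def)
  with inv that show thesis by blast
qed

lemma cadlag_bounded:
  assumes "x \<in> cadlag_paths T"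
  shows "bounded (x ` {0..T})"
proof -
  have "\<exists>U. open U \<and> t \<in> U \<and> bounded (x ` (U \<inter> {0..T}))" if t: "t \<in> {0..T}" for t
  proof -
    have r: "\<exists>b>t. bounded (x ` ({t<..<b} \<inter> {0..T}))"
    proof (cases "t < T")
      case True
      then have "(x \<longlongrightarrow> x t) (at_right t)" using assms t by (auto simp: cadlag_paths_def)
      then have "\<forall>\<^sub>F s in at_right t. dist (x s) (x t) < 1" by (rule tendstoD) simp
      then obtain b where b: "b > t" "\<And>s. t < s \<Longrightarrow> s < b \<Longrightarrow> dist (x s) (x t) < 1"
        by (auto simp: eventually_at_right_field)
      have "x ` ({t<..<b} \<inter> {0..T}) \<subseteq> cball (x t) 1"
        using b(2) by (force simp: dist_commute)
      then show ?thesis using b(1) bounded_cball bounded_subset by blast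
    next
      case False
      then have "{t<..<t + 1} \<inter> {0..T} = {}" using t by auto
      then show ?thesis by (intro exI[of _ "t + 1"]) auto
    qed
    have l: "\<exists>a<t. bounded (x ` ({a<..<t} \<inter> {0..T}))"
    proof (cases "0 < t")
      case True
      then have "t \<in> {0<..T}" using t by simp
      then obtain z where "(x \<longlongrightarrow> z) (at_left t)"
        using assms unfolding cadlag_paths_def by blast
      then have "\<forall>\<^sub>F s in at_left t. dist (x s) z < 1" by (rule tendstoD) simp
      then obtain a where a: "a < t" "\<And>s. a < s \<Longrightarrow> s < t \<Longrightarrow> dist (x s) z < 1"
        by (auto simp: eventually_at_left_field)
      have "x ` ({a<..<t} \<inter> {0..T}) \<subseteq> cball z 1"
        using a(2) by (force simp: dist_commute)
      then show ?thesis using a(1) bounded_cball bounded_subset by blast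
    next
      case False
      then have "{t - 1<..<t} \<inter> {0..T} = {}" using t by auto
      then show ?thesis by (intro exI[of _ "t - 1"]) auto
    qed
    obtain a b where ab: "a < t" "t < b" "bounded (x ` ({a<..<t} \<inter> {0..T}))"
      "bounded (x ` ({t<..<b} \<inter> {0..T}))" using l r by blast
    have "x ` ({a<..<b} \<inter> {0..T}) \<subseteq>
        x ` ({a<..<t} \<inter> {0..T}) \<union> x ` ({t<..<b} \<inter> {0..T}) \<union> {x t}"
      by (force simp: not_less_iff_gr_or_eq)
    moreover have "bounded (x ` ({a<..<t} \<inter> {0..T}) \<union> x ` ({t<..<b} \<inter> {0..T}) \<union> {x t})"
      using ab(3,4) by (simp only: bounded_Un bounded_insert bounded_empty simp_thms)
    ultimately have "bounded (x ` ({a<..<b} \<inter> {0..T}))" by (rule bounded_subset[rotated])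
    moreover have "t \<in> {a<..<b}" using ab(1,2) by simp
    ultimately show ?thesis using open_greaterThanLessThan by blast
  qed
  then have "\<forall>t\<in>{0..T}. \<exists>U. open U \<and> t \<in> U \<and> bounded (x ` (U \<inter> {0..T}))" by blast
  from bchoice[OF this] obtain U
    where U: "\<And>t. t \<in> {0..T} \<Longrightarrow> open (U t) \<and> t \<in> U t \<and> bounded (x ` (U t \<inter> {0..T}))"
    by blast
  obtain D where D: "D \<subseteq> {0..T}" "finite D" "{0..T} \<subseteq> (\<Union>t\<in>D. U t)"
    by (rule compactE_image[OF compact_Icc, of "{0..T}" U 0 T]) (use U in auto)
  have "x ` {0..T} \<subseteq> (\<Union>t\<in>D. x ` (U t \<inter> {0..T}))" using D(3) by blast
  moreover have "bounded (\<Union>t\<in>D. x ` (U t \<inter> {0..T}))"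
    using D U by (intro bounded_UN) auto
  ultimately show ?thesis by (rule bounded_subset[rotated])
qed

lemma skorohod_dist_le:
  assumes e: "0 < e" "\<theta> \<in> time_changes T"
    "\<And>t. t \<in> {0..T} \<Longrightarrow> \<bar>\<theta> t - t\<bar> \<le> e" "\<And>t. t \<in> {0..T} \<Longrightarrow> dist (x t) (y (\<theta> t)) \<le> e"
  shows "skorohod_dist T x y \<le> e"
proof -
  have "Inf {e. 0 < e \<and> (\<exists>\<theta>\<in>time_changes T.
      \<forall>t\<in>{0..T}. \<bar>\<theta> t - t\<bar> \<le> e \<and> dist (x t) (y (\<theta> t)) \<le> e)} \<le> e"
    using e by (intro cInf_lower bdd_belowI[of _ 0] CollectI conjI bexI[of _ \<theta>] ballI) auto
  then show ?thesis using e(1) by (auto simp: skorohod_dist_def)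
qed

lemma skorohod_dist_lessE:
  assumes "x \<in> cadlag_paths T" "y \<in> cadlag_paths T" "skorohod_dist T x y < r"
  obtains e \<theta> where "0 < e" "e < r" "\<theta> \<in> time_changes T"
    "\<And>t. t \<in> {0..T} \<Longrightarrow> \<bar>\<theta> t - t\<bar> \<le> e" "\<And>t. t \<in> {0..T} \<Longrightarrow> dist (x t) (y (\<theta> t)) \<le> e"
proof -
  let ?E = "{e. 0 < e \<and> (\<exists>\<theta>\<in>time_changes T. \<forall>t\<in>{0..T}. \<bar>\<theta> t - t\<bar> \<le> e \<and> dist (x t) (y (\<theta> t)) \<le> e)}"
  have "bounded (x ` {0..T} \<union> y ` {0..T})" using assms cadlag_bounded by (auto simp: bounded_Un)
  then have "\<exists>c. \<forall>u\<in>x ` {0..T} \<union> y ` {0..T}. \<forall>v\<in>x ` {0..T} \<union> y ` {0..T}. dist u v \<le> c"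
    by (simp only: bounded_two_points)
  then obtain c where c: "\<And>u v. u \<in> x ` {0..T} \<union> y ` {0..T} \<Longrightarrow> v \<in> x ` {0..T} \<union> y ` {0..T} \<Longrightarrow> dist u v \<le> c"
    by blast
  have "max 1 c \<in> ?E"
    using time_changes_id[of T] c by (auto intro!: bexI[of _ "\<lambda>t. t"] simp: le_max_iff_disj)
  then obtain e where "e \<in> ?E" "e < r"
    using cInf_lessD[of ?E r] assms by (auto simp: skorohod_dist_def)
  then show thesis using that by blast
qed

lemma skorohod_dist_nonneg: "0 \<le> skorohod_dist T x y"
proof (rule ccontr)
  assume "\<not> ?thesis"
  then have "skorohod_dist T x y < 0" by simp
  moreover from this have "x \<in> cadlag_paths T" "y \<in> cadlag_paths T"
    by (auto simp: skorohod_dist_def split: if_splits)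
  ultimately show False by (metis skorohod_dist_lessE less_asym)
qed

lemma skorohod_dist_commute_le:
  assumes x: "x \<in> cadlag_paths T" and y: "y \<in> cadlag_paths T"
  shows "skorohod_dist T y x \<le> skorohod_dist T x y"
proof (rule dense_ge)
  fix r assume "skorohod_dist T x y < r"
  then obtain e \<theta> where e: "0 < e" "e < r" "\<theta> \<in> time_changes T"
    "\<And>t. t \<in> {0..T} \<Longrightarrow> \<bar>\<theta> t - t\<bar> \<le> e" "\<And>t. t \<in> {0..T} \<Longrightarrow> dist (x t) (y (\<theta> t)) \<le> e"
    by (rule skorohod_dist_lessE[OF x y]) blast
  obtain \<kappa> where k: "\<kappa> \<in> time_changes T" "\<And>t. t \<in> {0..T} \<Longrightarrow> \<theta> (\<kappa> t) = t"
    using time_changes_inverse[OF e(3)] by blast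
  have "skorohod_dist T y x \<le> e"
    using e(4,5)[OF time_changes_in[OF k(1)]] k(2) e(1)
    by (intro skorohod_dist_le[OF _ k(1)]) (auto simp: abs_minus_commute dist_commute)
  then show "skorohod_dist T y x \<le> r" using e(2) by simp
qed

lemma skorohod_dist_triangle:
  assumes x: "x \<in> cadlag_paths T" and y: "y \<in> cadlag_paths T" and z: "z \<in> cadlag_paths T"
  shows "skorohod_dist T x z \<le> skorohod_dist T x y + skorohod_dist T y z"
proof (rule field_le_epsilon)
  fix r :: real assume "0 < r"
  have "skorohod_dist T x y < skorohod_dist T x y + r / 2" using \<open>0 < r\<close> by simp
  from skorohod_dist_lessE[OF x y this] obtain a \<theta> where a: "0 < a" "a < skorohod_dist T x y + r / 2"
    "\<theta> \<in> time_changes T" "\<And>t. t \<in> {0..T} \<Longrightarrow> \<bar>\<theta> t - t\<bar> \<le> a"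
    "\<And>t. t \<in> {0..T} \<Longrightarrow> dist (x t) (y (\<theta> t)) \<le> a" by metis
  have "skorohod_dist T y z < skorohod_dist T y z + r / 2" using \<open>0 < r\<close> by simp
  from skorohod_dist_lessE[OF y z this] obtain b \<kappa> where b: "0 < b" "b < skorohod_dist T y z + r / 2"
    "\<kappa> \<in> time_changes T" "\<And>t. t \<in> {0..T} \<Longrightarrow> \<bar>\<kappa> t - t\<bar> \<le> b"
    "\<And>t. t \<in> {0..T} \<Longrightarrow> dist (y t) (z (\<kappa> t)) \<le> b" by metis
  have "skorohod_dist T x z \<le> a + b"
  proof (rule skorohod_dist_le[OF _ time_changes_comp[OF b(3) a(3)]])
    fix t assume t: "t \<in> {0..T}"
    note lt = time_changes_in[OF a(3) t]
    show "\<bar>\<kappa> (\<theta> t) - t\<bar> \<le> a + b" using a(4)[OF t] b(4)[OF lt] by linarith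
    show "dist (x t) (z (\<kappa> (\<theta> t))) \<le> a + b"
      using a(5)[OF t] b(5)[OF lt] dist_triangle[of "x t" "z (\<kappa> (\<theta> t))" "y (\<theta> t)"] by linarith
  qed (use a b in simp)
  then show "skorohod_dist T x z \<le> skorohod_dist T x y + skorohod_dist T y z + r"
    using a(2) b(2) by simp
qed

lemma skorohod_dist_zero:
  assumes x: "x \<in> cadlag_paths T" and y: "y \<in> cadlag_paths T" and 0: "skorohod_dist T x y = 0"
  shows "x = y"
proof (rule extensionalityI[of _ "{0..T}"])
  fix t assume t: "t \<in> {0..T}"
  have "dist (x t) (y t) \<le> 0 + \<epsilon>" if eps: "0 < \<epsilon>" for \<epsilon> :: real
  proof (cases "t < T")
    case True
    have "(x \<longlongrightarrow> x t) (at_right t)" "(y \<longlongrightarrow> y t) (at_right t)"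
      using x y t True by (auto simp: cadlag_paths_def)
    then have "\<forall>\<^sub>F s in at_right t. dist (x s) (x t) < \<epsilon> / 3 \<and> dist (y s) (y t) < \<epsilon> / 3"
      using eps by (intro eventually_conj tendstoD) auto
    then obtain b where b: "t < b"
      "\<And>s. t < s \<Longrightarrow> s < b \<Longrightarrow> dist (x s) (x t) < \<epsilon> / 3 \<and> dist (y s) (y t) < \<epsilon> / 3"
      by (auto simp: eventually_at_right_field)
    define h where "h = (min b T - t) / 2"
    have h: "0 < h" "t + 2 * h \<le> b" "t + 2 * h \<le> T"
      using b(1) True unfolding h_def by (auto simp: min_def field_simps)
    have "skorohod_dist T x y < min h (\<epsilon> / 3)" using 0 h eps by simp
    from skorohod_dist_lessE[OF x y this] obtain e \<theta> where e: "0 < e" "e < min h (\<epsilon> / 3)"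
      "\<And>t. t \<in> {0..T} \<Longrightarrow> \<bar>\<theta> t - t\<bar> \<le> e" "\<And>t. t \<in> {0..T} \<Longrightarrow> dist (x t) (y (\<theta> t)) \<le> e" by metis
    have s: "t + h \<in> {0..T}" using t h by auto
    have "t < \<theta> (t + h)" "\<theta> (t + h) < b" using e(2) e(3)[OF s] h by auto
    then have "dist (y (\<theta> (t + h))) (y t) < \<epsilon> / 3" using b by blast
    moreover have "dist (x (t + h)) (x t) < \<epsilon> / 3" using b(2)[of "t + h"] h by auto
    moreover have "dist (x (t + h)) (y (\<theta> (t + h))) < \<epsilon> / 3" using e(2) e(4)[OF s] by simp
    ultimately show ?thesis
      using dist_triangle[of "x t" "y t" "x (t + h)"]
        dist_triangle[of "x (t + h)" "y t" "y (\<theta> (t + h))"]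
      by (simp add: dist_commute)
  next
    case False
    then have tT: "t = T" using t by simp
    have "skorohod_dist T x y < \<epsilon>" using 0 eps by simp
    from skorohod_dist_lessE[OF x y this] obtain e \<theta> where e: "e < \<epsilon>" "\<theta> \<in> time_changes T"
      "\<And>t. t \<in> {0..T} \<Longrightarrow> dist (x t) (y (\<theta> t)) \<le> e" by metis
    have "\<theta> t = t"
    proof -
      have m: "strict_mono_on {0..T} \<theta>" and "\<theta> ` {0..T} = {0..T}"
        using e(2) by (simp_all add: time_changes_def)
      then have "T \<in> \<theta> ` {0..T}" using t tT by simp
      then obtain s where s: "s \<in> {0..T}" "\<theta> s = T" by blast
      have "T \<le> \<theta> t"
      proof (cases "s = t")
        case False
        then have "s < t" using s(1) tT by simp
        from strict_mono_onD[OF m s(1) t this] show ?thesis using s(2) by simp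
      qed (use s(2) in simp)
      moreover have "\<theta> t \<le> T" using time_changes_in[OF e(2) t] by simp
      ultimately show ?thesis using tT by simp
    qed
    then have "dist (x t) (y t) \<le> e" using e(3)[OF t] by simp
    then show ?thesis using e(1) by linarith
  qed
  then have "dist (x t) (y t) \<le> 0" by (rule field_le_epsilon)
  then show "x t = y t" by simp
qed (use x y in \<open>auto simp: cadlag_paths_def\<close>)

lemma Metric_space_skorohod:
  "Metric_space (cadlag_paths T) (skorohod_dist T :: (real \<Rightarrow> 'a::metric_space) \<Rightarrow> _)"
proof
  fix x y z :: "real \<Rightarrow> 'a"
  assume x: "x \<in> cadlag_paths T" and y: "y \<in> cadlag_paths T"
  have "skorohod_dist T x x \<le> e" if "0 < e" for e
    using that by (intro skorohod_dist_le[OF _ time_changes_id]) auto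
  then have "skorohod_dist T x x = 0"
    using skorohod_dist_nonneg[of T x x] by (meson dense_ge order_antisym)
  then show "skorohod_dist T x y = 0 \<longleftrightarrow> x = y" using skorohod_dist_zero[OF x y] by auto
  show "skorohod_dist T x z \<le> skorohod_dist T x y + skorohod_dist T y z"
    if "z \<in> cadlag_paths T" using skorohod_dist_triangle[OF x y that] .
next
  fix x y :: "real \<Rightarrow> 'a"
  show "0 \<le> skorohod_dist T x y" by (rule skorohod_dist_nonneg)
  show "skorohod_dist T x y = skorohod_dist T y x"
    using skorohod_dist_commute_le[of x T y] skorohod_dist_commute_le[of y T x]
    by (cases "x \<in> cadlag_paths T \<and> y \<in> cadlag_paths T")
       (auto simp: skorohod_dist_def intro: order_antisym)
qed

definition skorohod_topology :: "real \<Rightarrow> (real \<Rightarrow> 'a::metric_space) topology" where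
  "skorohod_topology T = Metric_space.mtopology (cadlag_paths T) (skorohod_dist T)"

text \<open>
  Convergence in distribution of random elements \<open>Z n\<close>, defined on possibly different probability
  spaces \<open>M n\<close>, to a random element \<open>Z'\<close>.
\<close>

definition borel_of :: "'a topology \<Rightarrow> 'a measure" where
  "borel_of X = sigma (topspace X) {U. openin X U}"

definition random_element :: "'w measure \<Rightarrow> 'a topology \<Rightarrow> ('w \<Rightarrow> 'a) \<Rightarrow> bool" where
  "random_element M X Z \<longleftrightarrow> prob_space M \<and> Z \<in> M \<rightarrow>\<^sub>M borel_of X"

definition converges_in_distribution ::
  "'a topology \<Rightarrow> (nat \<Rightarrow> 'w measure) \<Rightarrow> (nat \<Rightarrow> 'w \<Rightarrow> 'a) \<Rightarrow> 'v measure \<Rightarrow> ('v \<Rightarrow> 'a) \<Rightarrow> bool" where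
  "converges_in_distribution X M Z M' Z' \<longleftrightarrow>
     (\<forall>\<^sub>F n in sequentially. random_element (M n) X (Z n)) \<and> random_element M' X Z' \<and>
     (\<forall>F. continuous_map X euclideanreal F \<and> bounded (F ` topspace X) \<longrightarrow>
        (\<lambda>n. \<integral>\<omega>. F (Z n \<omega>) \<partial>M n) \<longlonglongrightarrow> (\<integral>\<omega>. F (Z' \<omega>) \<partial>M'))"

definition path_on :: "real \<Rightarrow> (real \<Rightarrow> 'w \<Rightarrow> 'a) \<Rightarrow> 'w \<Rightarrow> real \<Rightarrow> 'a" where
  "path_on T X \<omega> = (\<lambda>t\<in>{0..T}. X t \<omega>)"

end

theory Submission imports Defs begin

text \<open>
 Both processes jump at total rate 1, so each is a discrete chain run with independent exponential
 holding times. The holding times have the same law for all N; paths with equal holding times are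
 compared state by state, and only finitely many jumps matter before T. Hence it suffices that
 the chains of cycle partitions converge, tested by bounded Lipschitz functions of finitely many
 states.

 One step: the uniform law on permutations is conjugation invariant, hence averaging over the next
 edge is, up to O(1/N), averaging over all ordered pairs of vertices. The latter is the generator
 of split-and-merge up to a Riemann sum error, and this generator preserves Lipschitz functions.

 Initial law: cycle types satisfy a discrete Mecke equation, so with a geometric number of elements
 the cycle counts are independent Poisson variables, which converge to the points of the PD(1)
 process. The mean over a uniform permutation changes by O(1/N) from N to N + 1, which allows
 passing from the geometric number of elements back to a fixed one.
\<close>

text \<open>For a given permutation, the average over the edges may be far from the average over all
  pairs of vertices, and the cycle partition of the stirring process is not a Markov chain. Only
  means over a uniform initial permutation can be compared, and jointly with the past; hence test
  functions depend on all states up to step \<open>k\<close>. A relabelling that fixes the vertices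
  touched so far leaves the past walk alone, and since degrees are bounded, only a fraction of order
  \<open>k / N\<close> of the edges meets these vertices. Integrating out the last state leaves a
  test function of one state fewer, bounded Lipschitz again because merging and splitting at fixed
  indices do not increase distances.

  In the initial law, normalising the Poisson points is discontinuous at total mass 0; this is why
  all functionals carry a cutoff \<open>g\<close> of the total mass. Narrow windows \<open>g\<close>
  yield convergence of the means for a fixed number of elements; cutoffs tending to 1 identify the
  limit. As \<open>is_PD1\<close> takes an image under a map not stated to be measurable,
  measurability is recovered from the image being a probability.\<close>

abbreviation swp :: "'v => 'v => 'v => 'v" where
 "swp == Transposition.transpose"

section \<open>Decreasing rearrangements\<close>

text \<open>The sum is an integral over the counting measure because the index sets vary (cycles,
  pairs, numbers) and because sums over \<open>I\<close> are interchanged with Lebesgue integrals,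
  for which \<open>I\<close> has to be countable.\<close>

definition mass_family :: "'i set => ('i => real) => bool" where
 "mass_family I a \<longleftrightarrow> countable I & (\<forall>i\<in>I. 0 <= a i) & (\<integral>\<^sup>+i. ennreal (a i) \<partial>count_space I) = 1"

text \<open>This is the predicate under the definite description in \<open>rearranged\<close>; named
  separately, its existence and uniqueness can be proved first and then transferred.\<close>

definition rearranges :: "mass_partition => 'i set => ('i => real) => bool" where
 "rearranges p I a \<longleftrightarrow> (\<exists>\<pi>. bij_betw \<pi> {k. 0 < mass p k} {i \<in> I. 0 < a i} &
   (\<forall>k. 0 < mass p k --> mass p k = a (\<pi> k)))"

lemma mass_family_finite_tail:
 assumes "mass_family I a" "0 < t"
 shows "finite {i\<in>I. t < a i}"
proof -
 have "emeasure (count_space I) {i\<in>I. 1 <= ennreal (1/t) * ennreal (a i)}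
   <= ennreal (1/t) * (\<integral>\<^sup>+i. ennreal (a i) * indicator I i \<partial>count_space I)"
  by (rule nn_integral_Markov_inequality) auto
 also have "(\<integral>\<^sup>+i. ennreal (a i) * indicator I i \<partial>count_space I) = 1"
  using assms(1) by (subst nn_integral_cong[of _ _ "%i. ennreal (a i)"]) (auto simp: mass_family_def)
 finally have "emeasure (count_space I) {i\<in>I. 1 <= ennreal (1/t) * ennreal (a i)} < \<infinity>"
  using ennreal_less_top[of "1/t"] by (simp add: order_le_less_trans)
 then have "finite {i\<in>I. 1 <= ennreal (1/t) * ennreal (a i)}"
  by (auto simp: emeasure_count_space split: if_splits)
 moreover have "{i\<in>I. t < a i} \<subseteq> {i\<in>I. 1 <= ennreal (1/t) * ennreal (a i)}"
  using assms(2) by (auto simp flip: ennreal_mult' simp: field_simps)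
 ultimately show ?thesis by (rule rev_finite_subset)
qed

lemma nn_integral_mass: "(\<integral>\<^sup>+k. ennreal (mass p k) \<partial>count_space UNIV) = 1"
 using mass_sums[of p] mass_nonneg[of p]
 by (simp add: nn_integral_count_space_nat suminf_ennreal2 sums_iff)

lemma mass_family_mass: "mass_family UNIV (mass p)"
 by (simp add: mass_family_def mass_nonneg nn_integral_mass)

lemma mass_family_le_1:
 assumes "mass_family I a" "i \<in> I"
 shows "a i <= 1"
proof -
 have "ennreal (a i) = (\<integral>\<^sup>+j. ennreal (a i) * indicator {i} j \<partial>count_space I)"
  using assms(2) by (subst nn_integral_cmult_indicator) auto
 also have "... <= (\<integral>\<^sup>+j. ennreal (a j) \<partial>count_space I)"
  by (intro nn_integral_mono) (auto simp: indicator_def)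
 also have "... = 1" using assms(1) by (simp add: mass_family_def)
 finally show ?thesis by simp
qed

text \<open>The positive indices are ordered by decreasing value, ties broken by an enumeration of
  \<open>I\<close>. Each has only finitely many predecessors, and their number is its position in
  the rearrangement.\<close>

lemma rearranges_exists:
 assumes "mass_family I a"
 shows "\<exists>p. rearranges p I a"
proof -
 have cI: "countable I" and a0: "!!i. i \<in> I ==> 0 <= a i"
  and a1: "(\<integral>\<^sup>+i. ennreal (a i) \<partial>count_space I) = 1"
  using assms by (auto simp: mass_family_def)
 define A where "A = {i\<in>I. 0 < a i}"
 define e where "e = to_nat_on I"
 have e: "inj_on e A"
  unfolding e_def A_def by (rule inj_on_subset[OF inj_on_to_nat_on[OF cI]]) auto
 define lt where "lt j i \<longleftrightarrow> a i < a j | (a j = a i & e j < e i)" for j i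
 define B where "B i = {j\<in>A. lt j i}" for i
 define r where "r i = card (B i)" for i
 have finB: "finite (B i)" if "i \<in> A" for i
 proof (rule finite_subset)
  \<comment> \<open>Predecessors may have the same value as \<open>i\<close>; half of it is a level
    that they exceed strictly.\<close>
  show "B i \<subseteq> {j\<in>I. a i / 2 < a j}" using that by (auto simp: B_def lt_def A_def)
  show "finite {j\<in>I. a i / 2 < a j}"
   using that by (intro mass_family_finite_tail[OF assms]) (auto simp: A_def)
 qed
 have mono: "r j < r i" if "i \<in> A" "j \<in> A" "lt j i" for i j
  unfolding r_def
 proof (rule psubset_card_mono[OF finB[OF that(1)]])
  show "B j \<subset> B i" using that by (auto simp: B_def lt_def)
 qed
 have total: "lt j i | lt i j" if "i \<in> A" "j \<in> A" "i ~= j" for i j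
  using that inj_onD[OF e, of i j] unfolding lt_def by (metis linorder_less_linear)
 have inj: "inj_on r A"
  by (rule inj_onI) (use mono total in \<open>metis less_irrefl\<close>)
 \<comment> \<open>Ranks leave no gap: every position below an occupied one is occupied. Hence
   \<open>f\<close> is decreasing and its zeros come last.\<close>
 have down: "r ` B i = {..<r i}" if "i \<in> A" for i
 proof (rule card_subset_eq)
  show "r ` B i \<subseteq> {..<r i}" using mono that by (auto simp: B_def)
  have "inj_on r (B i)" by (rule inj_on_subset[OF inj]) (auto simp: B_def)
  then have "card (r ` B i) = card (B i)" by (rule card_image)
  then show "card (r ` B i) = card {..<r i}" by (simp only: r_def card_lessThan)
 qed simp
 define f where "f k = (if k \<in> r ` A then a (inv_into A r k) else 0)" for k
 have fr: "f (r i) = a i" if "i \<in> A" for i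
  using that inj by (simp add: f_def)
 have f0: "0 <= f k" for k
  using inv_into_into[of k r A] a0 by (auto simp: f_def A_def)
 have fpos: "0 < f k \<longleftrightarrow> k \<in> r ` A" for k
  using inv_into_into[of k r A] by (auto simp: f_def A_def)
 have f1: "f k <= 1" for k
  using inv_into_into[of k r A] mass_family_le_1[OF assms] by (auto simp: f_def A_def)
 have "decseq f"
 unfolding decseq_def
 proof (intro allI impI)
  fix m n :: nat assume mn: "m <= n"
  show "f n <= f m"
  proof (cases "n \<in> r ` A")
   case True
   then obtain i where i: "i \<in> A" "n = r i" by auto
   show ?thesis
   proof (cases "m = n")
    case False
    then have "m \<in> r ` B i" using down[OF i(1)] i(2) mn by auto
    then obtain j where "j \<in> B i" "m = r j" by auto
    then have "j \<in> A" "lt j i" "m = r j" by (auto simp: B_def)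
    then show ?thesis using i fr by (auto simp: lt_def)
   qed simp
  qed (use f0 in \<open>auto simp: f_def\<close>)
 qed
 moreover have "f sums 1"
 proof -
  have "(\<integral>\<^sup>+k. ennreal (f k) \<partial>count_space UNIV) = (\<integral>\<^sup>+k. ennreal (f k) \<partial>count_space (r ` A))"
   by (rule nn_integral_count_space_eq) (auto simp: f_def)
  also have "... = (\<integral>\<^sup>+i. ennreal (f (r i)) \<partial>count_space A)"
   by (rule nn_integral_bij_count_space[symmetric]) (simp add: inj inj_on_imp_bij_betw)
  also have "... = (\<integral>\<^sup>+i. ennreal (a i) \<partial>count_space A)"
   by (rule nn_integral_cong) (simp add: fr)
  also have "... = (\<integral>\<^sup>+i. ennreal (a i) \<partial>count_space I)"
   by (rule nn_integral_count_space_eq) (auto simp: A_def ennreal_neg)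
  finally have s: "(\<Sum>k. ennreal (f k)) = 1" using a1 by (simp add: nn_integral_count_space_nat)
  then have "summable f" using f0 by (intro summable_suminf_not_top) auto
  moreover from this have "ennreal (suminf f) = 1" using s f0 by (simp add: suminf_ennreal2)
  then have "suminf f = 1" by simp
  ultimately show ?thesis by (simp add: sums_iff)
 qed
 ultimately have f: "mass (Abs_mass_partition f) = f"
  using f0 f1 by (intro Abs_mass_partition_inverse) auto
 have "{k. 0 < f k} = r ` A" using fpos by auto
 moreover have "bij_betw (inv_into A r) (r ` A) A"
  using inj by (intro bij_betw_inv_into inj_on_imp_bij_betw)
 moreover have "f k = a (inv_into A r k)" if "0 < f k" for k
  using that by (simp add: f_def split: if_splits)
 ultimately show ?thesis
  unfolding rearranges_def A_def[symmetric] by (metis f)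
qed

text \<open>Counting entries above a level forgets the order and all zeros, so the counts are those
  of the original family. They also determine a decreasing sequence, which makes them the handle on
  uniqueness and on distances.\<close>

lemma rearranges_card_tail:
 assumes "rearranges p I a" "0 <= t"
 shows "card {k. t < mass p k} = card {i\<in>I. t < a i}"
proof -
 obtain \<pi> where \<pi>: "bij_betw \<pi> {k. 0 < mass p k} {i \<in> I. 0 < a i}"
  "!!k. 0 < mass p k ==> mass p k = a (\<pi> k)"
  using assms(1) by (auto simp: rearranges_def)
 have "\<pi> ` {k. t < mass p k} = {i\<in>I. t < a i}"
 proof (intro equalityI subsetI)
  fix i assume "i \<in> {i\<in>I. t < a i}"
  moreover from this have "i \<in> \<pi> ` {k. 0 < mass p k}"
   using assms(2) bij_betw_imp_surj_on[OF \<pi>(1)] by auto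
  ultimately show "i \<in> \<pi> ` {k. t < mass p k}" using \<pi>(2) by auto
 next
  fix i assume "i \<in> \<pi> ` {k. t < mass p k}"
  then obtain k where k: "i = \<pi> k" "t < mass p k" by auto
  then have "0 < mass p k" using assms(2) by simp
  then show "i \<in> {i\<in>I. t < a i}"
   using k \<pi>(2) bij_betwE[OF \<pi>(1)] by auto
 qed
 moreover have "inj_on \<pi> {k. t < mass p k}"
  using \<pi>(1) assms(2) by (auto simp: bij_betw_def elim!: inj_on_subset)
 ultimately show ?thesis by (metis card_image)
qed

lemma mass_tail_eq:
 assumes "0 < t"
 shows "{k. t < mass p k} = {..<card {k. t < mass p k}}"
proof -
 have fin: "finite {k. t < mass p k}"
  using mass_family_finite_tail[OF mass_family_mass assms, of p] by simp
 have "k \<in> {k. t < mass p k} ==> {..k} \<subseteq> {k. t < mass p k}" for k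
  using mass_decseq[of p] by (auto simp: decseq_def intro: less_le_trans)
 moreover define n where "n = (LEAST n. n \<notin> {k. t < mass p k})"
 have "\<exists>n. n \<notin> {k. t < mass p k}" using fin ex_new_if_finite by blast
 then have "n \<notin> {k. t < mass p k}" and "!!m. m < n ==> m \<in> {k. t < mass p k}"
  unfolding n_def by (rule LeastI_ex) (rule ccontr, use not_less_Least in blast)
 ultimately have "{k. t < mass p k} = {..<n}"
  by (metis (no_types, lifting) atMost_iff lessThan_iff linorder_not_less subsetD subsetI subset_antisym)
 then show ?thesis by simp
qed

lemma mass_partition_eqI:
 assumes "!!t. 0 < t ==> card {k. t < mass p k} = card {k. t < mass q k}"
 shows "p = q"
proof -
 have "t < mass p k \<longleftrightarrow> t < mass q k" if "0 < t" for t k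
  using mass_tail_eq[OF that, of p] mass_tail_eq[OF that, of q] assms[OF that] by auto
 moreover have "mass p k <= mass q k" if "!!t. 0 < t ==> t < mass p k ==> t < mass q k" for p q k
 proof (rule ccontr)
  assume "\<not> mass p k <= mass q k"
  then obtain t where t: "mass q k < t" "t < mass p k" using dense[of "mass q k" "mass p k"] by auto
  then have "0 < t" using mass_nonneg[of q k] by linarith
  then show False using that t by force
 qed
 ultimately have "mass p k = mass q k" for k by (meson order_antisym)
 then show ?thesis by (auto simp: mass_inject[symmetric])
qed

lemma rearranges_unique: "rearranges p I a ==> rearranges q I a ==> p = q"
 by (intro mass_partition_eqI) (simp add: rearranges_card_tail)

lemma rearranges_rearranged:
 assumes "mass_family I a"
 shows "rearranges (rearranged I a) I a"
proof -
 obtain p where "rearranges p I a" using rearranges_exists[OF assms] ..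
 then show ?thesis
  unfolding rearranged_def rearranges_def[symmetric]
  by (rule theI) (rule rearranges_unique[OF _ \<open>rearranges p I a\<close>])
qed

lemma rearranged_eqI:
 assumes "rearranges p I a"
 shows "rearranged I a = p"
 unfolding rearranged_def rearranges_def[symmetric]
 using assms by (rule the_equality) (rule rearranges_unique[OF _ assms])

lemma card_tail_rearranged:
 assumes "mass_family I a" "0 <= t"
 shows "card {k. t < mass (rearranged I a) k} = card {i\<in>I. t < a i}"
 using rearranges_card_tail[OF rearranges_rearranged[OF assms(1)] assms(2)] .

lemma rearranged_mass: "rearranged UNIV (mass p) = p"
 by (rule rearranged_eqI, unfold rearranges_def, rule exI[of _ id]) auto

text \<open>Only positive entries are matched. Families with different numbers of zeros, or over
  index sets of different types, thus have the same rearrangement.\<close>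

lemma rearranged_reindex:
 assumes "mass_family J b" "bij_betw \<pi> {i\<in>I. 0 < a i} {j\<in>J. 0 < b j}"
  "!!i. i \<in> I ==> 0 < a i ==> a i = b (\<pi> i)"
 shows "rearranged I a = rearranged J b"
proof (rule rearranged_eqI)
 obtain r where r: "bij_betw r {k. 0 < mass (rearranged J b) k} {j\<in>J. 0 < b j}"
  "!!k. 0 < mass (rearranged J b) k ==> mass (rearranged J b) k = b (r k)"
  using rearranges_rearranged[OF assms(1)] by (auto simp: rearranges_def)
 let ?\<sigma> = "inv_into {i\<in>I. 0 < a i} \<pi>"
 have s: "bij_betw ?\<sigma> {j\<in>J. 0 < b j} {i\<in>I. 0 < a i}" by (rule bij_betw_inv_into[OF assms(2)])
 have b: "bij_betw (?\<sigma> \<circ> r) {k. 0 < mass (rearranged J b) k} {i\<in>I. 0 < a i}"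
  by (rule bij_betw_trans[OF r(1) s])
 have "mass (rearranged J b) k = a ((?\<sigma> \<circ> r) k)" if k: "0 < mass (rearranged J b) k" for k
 proof -
  have j: "r k \<in> {j\<in>J. 0 < b j}" using bij_betwE[OF r(1)] k by auto
  then have "?\<sigma> (r k) \<in> {i\<in>I. 0 < a i}" using bij_betwE[OF s] by blast
  moreover have "\<pi> (?\<sigma> (r k)) = r k" using j assms(2) by (auto simp: bij_betw_inv_into_right)
  ultimately show ?thesis using assms(3)[of "?\<sigma> (r k)"] r(2)[OF k] by auto
 qed
 then show "rearranges (rearranged J b) I a" unfolding rearranges_def using b by blast
qed

section \<open>The distance of two partitions as an integral over levels\<close>

lemma ennreal_dist_mass_partition:
 "ennreal (dist p q) = (\<integral>\<^sup>+k. ennreal \<bar>mass p k - mass q k\<bar> \<partial>count_space UNIV)"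
 by (simp add: dist_mass_partition_def nn_integral_count_space_nat suminf_ennreal2 summable_mass_diff)

text \<open>The layer-cake form of |x - y|: the length of the set of levels that separate
  \<open>x\<close> from \<open>y\<close>.\<close>

lemma nn_integral_between:
 fixes x y :: real
 assumes "0 <= x" "0 <= y"
 shows "(\<integral>\<^sup>+t. indicator {t. 0 < t & (t < x) ~= (t < y)} t \<partial>lborel) = ennreal \<bar>x - y\<bar>"
proof -
 have "emeasure lborel {t. 0 < t & (t < x) ~= (t < y)} = ennreal \<bar>x - y\<bar>"
 proof -
  have *: "AE t in lborel. (t \<in> {t. 0 < t & (t < x) ~= (t < y)} \<longleftrightarrow> t \<in> {min x y<..<max x y})"
   using AE_lborel_singleton[of "min x y"] AE_lborel_singleton[of 0]
   by eventually_elim (use assms in \<open>auto simp: min_def max_def\<close>)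
  have "emeasure lborel {t. 0 < t & (t < x) ~= (t < y)} = emeasure lborel {min x y<..<max x y}"
   by (rule emeasure_eq_AE[OF *]) auto
  also have "... = ennreal (max x y - min x y)" by simp
  finally show ?thesis by (simp add: max_def min_def abs_if split: if_splits)
 qed
 then show ?thesis by simp
qed

text \<open>
 Both sides are integrals over levels \<open>t > 0\<close>: the left-hand one of the difference of the numbers
 of entries above \<open>t\<close>, the right-hand one of the number of indices at which exactly one of the two
 families exceeds \<open>t\<close>.
\<close>

lemma dist_rearranged_le_nn:
 assumes a: "mass_family I a" and b: "mass_family I b"
 shows "ennreal (dist (rearranged I a) (rearranged I b)) <= (\<integral>\<^sup>+i. ennreal \<bar>a i - b i\<bar> \<partial>count_space I)"
proof -
 let ?p = "rearranged I a" and ?q = "rearranged I b"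
 have cI: "countable I" and nn: "!!i. i \<in> I ==> 0 <= a i" "!!i. i \<in> I ==> 0 <= b i"
  using a b by (auto simp: mass_family_def)
 let ?D = "%f g t k. indicator {t. 0 < t & (t < f k) ~= (t < g k)} (t::real) :: ennreal"
 have "ennreal (dist ?p ?q) = (\<integral>\<^sup>+k. (\<integral>\<^sup>+t. ?D (mass ?p) (mass ?q) t k \<partial>lborel) \<partial>count_space UNIV)"
  unfolding ennreal_dist_mass_partition by (simp only: nn_integral_between mass_nonneg)
 also have "... = (\<integral>\<^sup>+t. (\<integral>\<^sup>+k. ?D (mass ?p) (mass ?q) t k \<partial>count_space UNIV) \<partial>lborel)"
  by (rule nn_integral_count_space_nn_integral[symmetric]) auto
 also have "... <= (\<integral>\<^sup>+t. (\<integral>\<^sup>+i. ?D a b t i \<partial>count_space I) \<partial>lborel)"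
 proof (rule nn_integral_mono)
  fix t :: real
  show "(\<integral>\<^sup>+k. ?D (mass ?p) (mass ?q) t k \<partial>count_space UNIV) <= (\<integral>\<^sup>+i. ?D a b t i \<partial>count_space I)"
  proof (cases "0 < t")
   case True
   define A B where "A = {i\<in>I. t < a i}" and "B = {i\<in>I. t < b i}"
   have fin: "finite A" "finite B"
    unfolding A_def B_def using mass_family_finite_tail[OF a True] mass_family_finite_tail[OF b True] by auto
   have pq: "{k. t < mass ?p k} = {..<card A}" "{k. t < mass ?q k} = {..<card B}"
    using mass_tail_eq[OF True, of ?p] mass_tail_eq[OF True, of ?q] True
     card_tail_rearranged[OF a, of t] card_tail_rearranged[OF b, of t]
    unfolding A_def B_def by simp_all
   have pqk: "t < mass ?p k \<longleftrightarrow> k < card A" "t < mass ?q k \<longleftrightarrow> k < card B" for k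
    using pq by blast+
   have 1: "(\<integral>\<^sup>+k. ?D (mass ?p) (mass ?q) t k \<partial>count_space UNIV)
     = (\<integral>\<^sup>+k. indicator (({..<card A} - {..<card B}) \<union> ({..<card B} - {..<card A})) k \<partial>count_space UNIV)"
    by (intro nn_integral_cong) (auto simp: indicator_def pqk True)
   have 2: "(\<integral>\<^sup>+i. ?D a b t i \<partial>count_space I) = (\<integral>\<^sup>+i. indicator ((A - B) \<union> (B - A)) i \<partial>count_space I)"
    using True by (intro nn_integral_cong) (auto simp: indicator_def A_def B_def)
   have "({..<card A} - {..<card B}) \<union> ({..<card B} - {..<card A})
     = {min (card A) (card B)..<max (card A) (card B)}" by auto
   then have "card (({..<card A} - {..<card B}) \<union> ({..<card B} - {..<card A}))
     = max (card A) (card B) - min (card A) (card B)" by simp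
   also have "... <= card (A - B) + card (B - A)"
    using fin card_Diff_subset_Int[of A B] card_Diff_subset_Int[of B A]
     card_mono[of A "A \<inter> B"] card_mono[of B "A \<inter> B"]
    by (auto simp: Int_commute max_def min_def)
   also have "... = card ((A - B) \<union> (B - A))"
    using fin by (intro card_Un_disjoint[symmetric]) auto
   finally have le: "card (({..<card A} - {..<card B}) \<union> ({..<card B} - {..<card A}))
     <= card ((A - B) \<union> (B - A))" .
   have AB: "(A - B) \<union> (B - A) \<subseteq> I" by (auto simp: A_def B_def)
   show ?thesis
    unfolding 1 2 using le fin AB
    by (subst (1 2) nn_integral_indicator) (auto simp: emeasure_count_space)
  qed auto
 qed
 also have "... = (\<integral>\<^sup>+i. (\<integral>\<^sup>+t. ?D a b t i \<partial>lborel) \<partial>count_space I)"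
  by (rule nn_integral_count_space_nn_integral[OF cI]) auto
 also have "... = (\<integral>\<^sup>+i. ennreal \<bar>a i - b i\<bar> \<partial>count_space I)"
  by (rule nn_integral_cong, rule nn_integral_between) (auto intro: nn)
 finally show ?thesis .
qed

lemma dist_rearranged_le_suminf:
 assumes "mass_family UNIV a" "mass_family UNIV b" "summable (\<lambda>k::nat. \<bar>a k - b k\<bar>)"
 shows "dist (rearranged UNIV a) (rearranged UNIV b) <= (\<Sum>k. \<bar>a k - b k\<bar>)"
 using dist_rearranged_le_nn[OF assms(1,2)] suminf_nonneg[OF assms(3)]
 by (simp add: nn_integral_count_space_nat suminf_ennreal2[OF _ assms(3)] ennreal_le_iff)

lemma dist_rearranged_le_sum:
 assumes "mass_family I a" "mass_family I b" "finite I"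
 shows "dist (rearranged I a) (rearranged I b) <= (\<Sum>k\<in>I. \<bar>a k - b k\<bar>)"
 using dist_rearranged_le_nn[OF assms(1,2)] assms(3)
 by (simp add: nn_integral_count_space_finite sum_nonneg ennreal_le_iff)

lemma mass_family_finite:
 assumes "finite I" "!!i. i \<in> I ==> 0 <= a i" "sum a I = 1"
 shows "mass_family I a"
 using assms by (simp add: mass_family_def countable_finite nn_integral_count_space_finite)

lemma mass_family_sums:
 assumes "!!i::nat. 0 <= a i" "a sums 1"
 shows "mass_family UNIV a"
 using assms by (simp add: mass_family_def nn_integral_count_space_nat suminf_ennreal2 sums_iff)

section \<open>Cycles of a permutation composed with a transposition\<close>

definition orbits :: "('v => 'v) => 'v set => 'v set set" where
 "orbits \<sigma> V = orbit \<sigma> ` V"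

lemma orbit_eq_funpow_image:
 assumes "(f ^^ n) x = x" "0 < n"
 shows "orbit f x = (%i. (f ^^ i) x) ` {..<n}"
 using orbit_altdef_bounded[OF assms] by auto

locale finite_perm =
 fixes V :: "'v set" and \<sigma> :: "'v => 'v"
 assumes fin: "finite V" and perm: "\<sigma> permutes V"
begin

lemma permutation: "permutation \<sigma>"
 using fin perm by (auto simp: permutation_permutes)

lemma self_in_orbit: "x \<in> orbit \<sigma> x"
 by (rule permutation_self_in_orbit[OF permutation])

lemma orbit_subset_V: "x \<in> V ==> orbit \<sigma> x \<subseteq> V"
 by (rule permutes_orbit_subset[OF perm])

lemma orbit_eqI2: "y \<in> orbit \<sigma> x ==> orbit \<sigma> y = orbit \<sigma> x"
 using orbit_swap[OF self_in_orbit] orbit_trans by (metis subsetI subset_antisym)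

lemma finite_orbits: "finite (orbits \<sigma> V)"
 using fin by (simp add: orbits_def)

lemma Union_orbits: "\<Union> (orbits \<sigma> V) = V"
 using orbit_subset_V self_in_orbit by (fastforce simp: orbits_def)

lemma finite_in_orbits: "C \<in> orbits \<sigma> V ==> finite C"
 using Union_orbits fin by (metis Sup_upper finite_subset)

lemma orbits_nonempty: "C \<in> orbits \<sigma> V ==> C ~= {}"
 using self_in_orbit by (auto simp: orbits_def)

lemma card_in_orbits_pos: "C \<in> orbits \<sigma> V ==> 0 < card C"
 using finite_in_orbits orbits_nonempty by (simp add: card_gt_0_iff)

lemma orbits_eq_orbit: "C \<in> orbits \<sigma> V ==> x \<in> C ==> C = orbit \<sigma> x"
 using orbit_eqI2 by (auto simp: orbits_def)

lemma disjoint_orbits: "C \<in> orbits \<sigma> V ==> D \<in> orbits \<sigma> V ==> C ~= D ==> C \<inter> D = {}"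
 using orbits_eq_orbit by (metis disjoint_iff)

lemma sum_orbits: "sum g V = (\<Sum>C\<in>orbits \<sigma> V. sum g C)"
proof -
 have "sum g (\<Union> (orbits \<sigma> V)) = (\<Sum>C\<in>orbits \<sigma> V. sum g C)"
  using sum.Union_disjoint[of "orbits \<sigma> V" g] finite_in_orbits disjoint_orbits by simp
 then show ?thesis by (simp add: Union_orbits)
qed

lemma sum_card_orbits: "(\<Sum>C\<in>orbits \<sigma> V. card C) = card V"
 using sum_orbits[of "%_. 1 :: nat"] by simp

lemma funpow_orbit:
 "orbit \<sigma> x = (%i. (\<sigma> ^^ i) x) ` {..<card (orbit \<sigma> x)}"
 "inj_on (%i. (\<sigma> ^^ i) x) {..<card (orbit \<sigma> x)}"
 "(\<sigma> ^^ card (orbit \<sigma> x)) x = x"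
proof -
 let ?u = "(%i. (\<sigma> ^^ i) x)"
 let ?n = "funpow_dist1 \<sigma> x x"
 have o: "orbit \<sigma> x = ?u ` {..<?n}"
  using orbit_conv_funpow_dist1[OF self_in_orbit] by (simp add: atLeast0LessThan)
 have i: "inj_on ?u {..<?n}"
  using inj_on_funpow_dist1[OF self_in_orbit] by (simp add: atLeast0LessThan)
 have "card (orbit \<sigma> x) = ?n" by (subst o) (simp add: card_image[OF i])
 then show "orbit \<sigma> x = ?u ` {..<card (orbit \<sigma> x)}"
  "inj_on ?u {..<card (orbit \<sigma> x)}"
  "(\<sigma> ^^ card (orbit \<sigma> x)) x = x"
  using o i funpow_dist1_prop[OF self_in_orbit] by simp_all
qed

lemma orbit_compose_transpose_other:
 assumes "x \<notin> orbit \<sigma> z" "y \<notin> orbit \<sigma> z"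
 shows "orbit (swp x y \<circ> \<sigma>) z = orbit \<sigma> z"
proof (rule orbit_cong0[of z "orbit \<sigma> z", symmetric])
 show "z \<in> orbit \<sigma> z" by (rule self_in_orbit)
 show "\<sigma> \<in> orbit \<sigma> z \<rightarrow> orbit \<sigma> z" by (auto intro: orbit.step)
 fix w assume "w \<in> orbit \<sigma> z"
 then have "\<sigma> w \<in> orbit \<sigma> z" by (rule orbit.step)
 then have "\<sigma> w ~= x" "\<sigma> w ~= y" using assms by auto
 then show "\<sigma> w = (swp x y \<circ> \<sigma>) w" by simp
qed

text \<open>The new orbit follows the cycle of \<open>x\<close>; at the step where
  \<open>\<sigma>\<close> would return to \<open>x\<close> the transposition sends it to
  \<open>y\<close> instead, and after the cycle of \<open>y\<close> it sends it back to
  \<open>x\<close>.\<close>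

lemma orbit_merge:
 assumes "y \<notin> orbit \<sigma> x"
 shows "orbit (swp x y \<circ> \<sigma>) x = orbit \<sigma> x \<union> orbit \<sigma> y"
proof -
 let ?t = "swp x y \<circ> \<sigma>"
 define l m where "l = card (orbit \<sigma> x)" and "m = card (orbit \<sigma> y)"
 have lm: "0 < l" "0 < m"
  unfolding l_def m_def using self_in_orbit finite_orbit[OF self_in_orbit] by (auto simp: card_gt_0_iff)
 note fx = funpow_orbit[of x, folded l_def] and fy = funpow_orbit[of y, folded m_def]
 have nx: "(\<sigma> ^^ i) y ~= x" for i
  using assms orbit_swap[OF self_in_orbit, of x y] funpow_in_orbit[OF self_in_orbit, of i y] by metis
 have ny: "(\<sigma> ^^ i) x ~= y" for i
  using assms funpow_in_orbit[OF self_in_orbit, of i x] by metis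
 have a: "(?t ^^ i) x = (\<sigma> ^^ i) x" if "i < l" for i
  using that
 proof (induction i)
  case (Suc i)
  then have "(\<sigma> ^^ Suc i) x ~= x"
   using inj_onD[OF fx(2), of "Suc i" 0] by auto
  moreover have "(\<sigma> ^^ Suc i) x ~= y" by (rule ny)
  ultimately show ?case using Suc by simp
 qed simp
 obtain l' where l': "l = Suc l'" using lm by (cases l) auto
 have tl: "(?t ^^ l) x = y"
  using a[of l'] fx(3) by (simp add: l')
 have b: "(?t ^^ i) y = (\<sigma> ^^ i) y" if "i < m" for i
  using that
 proof (induction i)
  case (Suc i)
  then have "(\<sigma> ^^ Suc i) y ~= y"
   using inj_onD[OF fy(2), of "Suc i" 0] by auto
  moreover have "(\<sigma> ^^ Suc i) y ~= x" by (rule nx)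
  ultimately show ?case using Suc by simp
 qed simp
 obtain m' where m': "m = Suc m'" using lm by (cases m) auto
 have c: "(?t ^^ m) y = x"
  using b[of m'] fy(3) by (simp add: m')
 have d: "(?t ^^ (i + l)) x = (?t ^^ i) y" for i
  using tl by (simp add: funpow_add)
 have "orbit ?t x = (%i. (?t ^^ i) x) ` {..<m + l}"
  by (rule orbit_eq_funpow_image) (use d c lm in auto)
 also have "{..<m + l} = {..<l} \<union> (%i. i + l) ` {..<m}"
 proof (intro equalityI subsetI)
  fix i assume "i \<in> {..<m + l}"
  then show "i \<in> {..<l} \<union> (%i. i + l) ` {..<m}"
   by (cases "i < l") (auto simp: image_iff intro!: bexI[of _ "i - l"])
 qed auto
 also have "(%i. (?t ^^ i) x) ` ... = (%i. (\<sigma> ^^ i) x) ` {..<l} \<union> (%i. (\<sigma> ^^ i) y) ` {..<m}"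
  unfolding image_Un image_image d using a b by (auto cong: image_cong_simp)
 finally show ?thesis using fx(1) fy(1) by metis
qed

lemma orbits_merge:
 assumes "x \<in> V" "y \<in> V" "y \<notin> orbit \<sigma> x"
 shows "orbits (swp x y \<circ> \<sigma>) V
  = insert (orbit \<sigma> x \<union> orbit \<sigma> y) (orbits \<sigma> V - {orbit \<sigma> x, orbit \<sigma> y})"
proof -
 let ?t = "swp x y \<circ> \<sigma>"
 interpret t: finite_perm V ?t
  by unfold_locales (auto intro!: fin permutes_compose perm permutes_swap_id assms)
 have o: "orbit ?t z = (if z \<in> orbit \<sigma> x \<union> orbit \<sigma> y then orbit \<sigma> x \<union> orbit \<sigma> y else orbit \<sigma> z)" for z
 proof (cases "z \<in> orbit \<sigma> x \<union> orbit \<sigma> y")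
  case True
  then have "z \<in> orbit ?t x" using orbit_merge[OF assms(3)] by simp
  from t.orbit_eqI2[OF this] show ?thesis using orbit_merge[OF assms(3)] True by simp
 next
  case False
  then have "x \<notin> orbit \<sigma> z" "y \<notin> orbit \<sigma> z" using orbit_swap[OF self_in_orbit] by blast+
  then show ?thesis using orbit_compose_transpose_other False by simp
 qed
 show ?thesis
 proof (intro equalityI subsetI)
  fix C assume "C \<in> orbits ?t V"
  then obtain z where z: "z \<in> V" "C = orbit ?t z" by (auto simp: orbits_def)
  show "C \<in> insert (orbit \<sigma> x \<union> orbit \<sigma> y) (orbits \<sigma> V - {orbit \<sigma> x, orbit \<sigma> y})"
  proof (cases "z \<in> orbit \<sigma> x \<union> orbit \<sigma> y")
   case False
   then show ?thesis using z o[of z] self_in_orbit[of z] by (auto simp: orbits_def)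
  qed (use z o in auto)
 next
  fix C assume "C \<in> insert (orbit \<sigma> x \<union> orbit \<sigma> y) (orbits \<sigma> V - {orbit \<sigma> x, orbit \<sigma> y})"
  then consider "C = orbit \<sigma> x \<union> orbit \<sigma> y" | z where "z \<in> V" "C = orbit \<sigma> z" "C ~= orbit \<sigma> x" "C ~= orbit \<sigma> y"
   by (auto simp: orbits_def)
  then show "C \<in> orbits ?t V"
  proof cases
   case 1
   then have "C = orbit ?t x" using o[of x] self_in_orbit[of x] by auto
   then show ?thesis using assms(1) by (auto simp: orbits_def)
  next
   case 2
   then have "z \<notin> orbit \<sigma> x \<union> orbit \<sigma> y" using orbit_eqI2 by auto
   then have "C = orbit ?t z" using o[of z] 2 by auto
   then show ?thesis using 2 by (auto simp: orbits_def)
  qed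
 qed
qed

text \<open>Where \<open>\<sigma>\<close> would arrive at \<open>y\<close> after \<open>a\<close>
  steps, the transposition returns to \<open>x\<close>, and where it would return to
  \<open>x\<close>, it goes to \<open>y\<close>: the cycle falls into an arc of \<open>a\<close>
  vertices and the arc of the remaining ones.\<close>

lemma orbit_split:
 assumes "0 < a" "a < card (orbit \<sigma> x)"
 defines "y \<equiv> (\<sigma> ^^ a) x"
 shows "orbit (swp x y \<circ> \<sigma>) x = (%i. (\<sigma> ^^ i) x) ` {..<a}"
  and "orbit (swp x y \<circ> \<sigma>) y = (%i. (\<sigma> ^^ i) x) ` {a..<card (orbit \<sigma> x)}"
proof -
 let ?t = "swp x y \<circ> \<sigma>"
 define l where "l = card (orbit \<sigma> x)"
 note fx = funpow_orbit[of x, folded l_def]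
 have al: "a < l" using assms by (simp add: l_def)
 have ne: "(\<sigma> ^^ i) x ~= x" if "0 < i" "i < l" for i
  using inj_onD[OF fx(2), of i 0] that by auto
 have ne2: "(\<sigma> ^^ i) x ~= y" if "i < l" "i ~= a" for i
  using inj_onD[OF fx(2), of i a] that al by (auto simp: y_def)
 have b: "(?t ^^ i) x = (\<sigma> ^^ i) x" if "i < a" for i
  using that
 proof (induction i)
  case (Suc i)
  then show ?case using ne[of "Suc i"] ne2[of "Suc i"] al by simp
 qed simp
 obtain a' where a': "a = Suc a'" using assms(1) by (cases a) auto
 have c: "(?t ^^ a) x = x"
  using b[of a'] by (simp add: a' y_def)
 show "orbit ?t x = (%i. (\<sigma> ^^ i) x) ` {..<a}"
  unfolding orbit_eq_funpow_image[OF c assms(1)] using b by (auto cong: image_cong_simp)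
 have d: "(?t ^^ i) y = (\<sigma> ^^ (i + a)) x" if "i < l - a" for i
  using that
 proof (induction i)
  case (Suc i)
  then show ?case using ne[of "Suc i + a"] ne2[of "Suc i + a"] al by simp
 qed (simp add: y_def)
 obtain m where m: "l - a = Suc m" using al by (cases "l - a") auto
 then have l: "l = Suc (m + a)" using al by simp
 have "(?t ^^ (l - a)) y = y"
  using d[of m] m fx(3) by (simp add: l)
 then have "orbit ?t y = (%i. (?t ^^ i) y) ` {..<l - a}"
  by (rule orbit_eq_funpow_image) (use al in simp)
 also have "... = (%i. (\<sigma> ^^ (i + a)) x) ` {..<l - a}"
  using d by (auto cong: image_cong_simp)
 also have "... = (%i. (\<sigma> ^^ i) x) ` ((%i. i + a) ` {..<l - a})"
  by (simp add: image_image)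
 also have "(%i. i + a) ` {..<l - a} = {a..<l}"
 proof (intro equalityI subsetI)
  fix i assume "i \<in> {a..<l}"
  then show "i \<in> (%i. i + a) ` {..<l - a}"
   by (auto simp: image_iff intro!: bexI[of _ "i - a"])
 qed auto
 finally show "orbit ?t y = (%i. (\<sigma> ^^ i) x) ` {a..<card (orbit \<sigma> x)}" by (simp only: l_def)
qed

lemma orbits_split:
 assumes "x \<in> V" "0 < a" "a < card (orbit \<sigma> x)"
 defines "y \<equiv> (\<sigma> ^^ a) x"
 defines "t \<equiv> swp x y \<circ> \<sigma>"
 shows "orbits t V = insert (orbit t x) (insert (orbit t y) (orbits \<sigma> V - {orbit \<sigma> x}))"
  and "card (orbit t x) = a" and "card (orbit t y) = card (orbit \<sigma> x) - a"
  and "orbit t x \<union> orbit t y = orbit \<sigma> x" and "orbit t x \<inter> orbit t y = {}"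
proof -
 let ?u = "(insert (orbit t y) (orbits \<sigma> V - {orbit \<sigma> x}))"
 let ?l = "card (orbit \<sigma> x)"
 note s = orbit_split[OF assms(2,3), folded y_def, folded t_def]
 note fx = funpow_orbit[of x]
 show "card (orbit t x) = a"
  unfolding s using card_image[OF inj_on_subset[OF fx(2)], of "{..<a}"] assms(3) by auto
 show "card (orbit t y) = ?l - a"
  unfolding s by (subst card_image[OF inj_on_subset[OF fx(2)]]) auto
 have "{..<?l} = {..<a} \<union> {a..<?l}" using assms(3) by auto
 then show U: "orbit t x \<union> orbit t y = orbit \<sigma> x"
  using fx(1) unfolding s by (metis image_Un)
 show "orbit t x \<inter> orbit t y = {}"
  unfolding s using assms(3) by (auto dest!: inj_onD[OF fx(2)])
 have yo: "y \<in> orbit \<sigma> x" unfolding y_def by (rule funpow_in_orbit[OF self_in_orbit])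
 then have yV: "y \<in> V" using orbit_subset_V[OF assms(1)] by auto
 interpret t: finite_perm V t
  unfolding t_def by unfold_locales (auto intro!: fin permutes_compose perm permutes_swap_id assms(1) yV)
 have other: "orbit t z = orbit \<sigma> z" if "z \<notin> orbit \<sigma> x" for z
  unfolding t_def
 proof (rule orbit_compose_transpose_other)
  show "x \<notin> orbit \<sigma> z" using that orbit_swap[OF self_in_orbit] by blast
  show "y \<notin> orbit \<sigma> z" using that yo orbit_eqI2[OF yo] orbit_swap[OF self_in_orbit, of y z] by auto
 qed
 have inner: "orbit t z = orbit t x | orbit t z = orbit t y" if "z \<in> orbit \<sigma> x" for z
  using that U t.orbit_eqI2 by auto
 show "orbits t V = insert (orbit t x) ?u"
 proof (intro equalityI subsetI)
  fix C assume "C \<in> orbits t V"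
  then obtain z where z: "z \<in> V" "C = orbit t z" by (auto simp: orbits_def)
  show "C \<in> insert (orbit t x) ?u"
  proof (cases "z \<in> orbit \<sigma> x")
   case False
   then show ?thesis using z other[of z] self_in_orbit[of z] by (auto simp: orbits_def)
  qed (use z inner in auto)
 next
  fix C assume "C \<in> insert (orbit t x) ?u"
  then consider "C = orbit t x" | "C = orbit t y" | z where "z \<in> V" "C = orbit \<sigma> z" "C ~= orbit \<sigma> x"
   by (auto simp: orbits_def)
  then show "C \<in> orbits t V"
  proof cases
   case 3
   then have "z \<notin> orbit \<sigma> x" using orbit_eqI2 by auto
   then show ?thesis using other[of z] 3 by (auto simp: orbits_def)
  qed (use assms(1) yV in \<open>auto simp: orbits_def\<close>)
 qed
qed

end

section \<open>Topology of the space of partitions\<close>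

lemma abs_mass_diff_le_dist: "\<bar>mass p i - mass q i\<bar> <= dist p q"
 unfolding dist_mass_partition_def
 using sum_le_suminf[OF summable_mass_diff, of "{i}" p q] by simp

text \<open>Both sequences sum to 1, so the distance is twice the sum of the positive parts of
  \<open>mass p i - mass q i\<close>, and beyond \<open>n\<close> these are at most
  \<open>mass p i\<close>. Closeness of finitely many entries therefore gives closeness in the
  metric, as in Scheffe's lemma.\<close>

lemma dist_mass_partition_le_partial:
 "dist p q <= 2 * (\<Sum>i<n. \<bar>mass p i - mass q i\<bar>) + 2 * (1 - (\<Sum>i<n. mass p i))"
proof -
 let ?f = "%i. 2 * max 0 (mass p i - mass q i)"
 have sp: "mass p sums 1" "mass q sums 1" by (rule mass_sums)+
 have sf: "summable ?f"
  by (rule summable_comparison_test'[of "%i. 2 * \<bar>mass p i - mass q i\<bar>" 0])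
   (auto intro: summable_mult summable_mass_diff)
 have "(%i. \<bar>mass p i - mass q i\<bar>) = (%i. ?f i - (mass p i - mass q i))"
  by (auto simp: fun_eq_iff max_def)
 moreover have "(%i. ?f i - (mass p i - mass q i)) sums (suminf ?f - (1 - 1))"
  by (intro sums_diff summable_sums sf sp)
 ultimately have "dist p q = suminf ?f"
  by (simp add: dist_mass_partition_def sums_iff)
 also have "... = (\<Sum>i. ?f (i + n)) + sum ?f {..<n}" by (rule suminf_split_initial_segment[OF sf])
 also have "(\<Sum>i. ?f (i + n)) <= (\<Sum>i. 2 * mass p (i + n))"
  using sums_summable[OF sp(1)] mass_nonneg[of p] mass_nonneg[of q]
  by (intro suminf_le summable_mult summable_ignore_initial_segment[OF sf])
   (auto simp: summable_iff_shift max_def)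
 also have "(\<Sum>i. 2 * mass p (i + n)) = 2 * (1 - (\<Sum>i<n. mass p i))"
  using suminf_minus_initial_segment[OF sums_summable[OF sp(1)], of n] sp(1)
   sums_summable[OF sp(1)]
  by (subst suminf_mult) (auto simp: summable_iff_shift sums_iff)
 also have "sum ?f {..<n} <= 2 * (\<Sum>i<n. \<bar>mass p i - mass q i\<bar>)"
  unfolding sum_distrib_left by (intro sum_mono) auto
 finally show ?thesis by simp
qed

text \<open>On sequences of total mass 1 the metric topology is that of coordinatewise convergence,
  so boxes with rational sides in finitely many coordinates form a base. The class is what
  identifies the Borel sets of sequences of partitions with the product sigma-algebra.\<close>

instance mass_partition :: second_countable_topology
proof
 define U where "U l = {q. \<forall>i<length l. of_rat (fst (l ! i)) < mass q i & mass q i < of_rat (snd (l ! i))}"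
  for l :: "(rat \<times> rat) list"
 have cont: "continuous_on UNIV (%q. mass q i)" for i
  unfolding continuous_on_iff dist_real_def
  using abs_mass_diff_le_dist[of _ i] by (metis order_le_less_trans)
 have "topological_basis (range U)"
 proof (rule topological_basisI)
  fix B assume "B \<in> range U"
  then obtain l where l: "B = U l" by auto
  have "U l = (\<Inter>i<length l. {q. of_rat (fst (l ! i)) < mass q i} \<inter> {q. mass q i < of_rat (snd (l ! i))})"
   by (auto simp: U_def)
  also have "open ..."
   by (intro open_INT finite_lessThan ballI open_Int open_Collect_less cont continuous_on_const)
  finally show "open B" by (simp add: l)
 next
  fix O' :: "mass_partition set" and p assume "open O'" "p \<in> O'"
  then obtain e where e: "0 < e" "ball p e \<subseteq> O'" by (meson open_contains_ball)
  have "(%n. \<Sum>i<n. mass p i) \<longlonglongrightarrow> 1" using mass_sums[of p] by (simp add: sums_def)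
  then have "\<forall>\<^sub>F n in sequentially. 1 - e / 4 < (\<Sum>i<n. mass p i)"
   using e(1) by (intro order_tendstoD) auto
  then obtain n where n: "1 - e / 4 < (\<Sum>i<n. mass p i)" by (auto simp: eventually_sequentially)
  \<comment> \<open>Less than \<open>e / 4\<close> in the sum of the first \<open>n\<close>
    differences and less than \<open>e / 4\<close> in the tail, both doubled by
    \<open>dist_mass_partition_le_partial\<close>, give \<open>e\<close>.\<close>
  define \<delta> where "\<delta> = e / (4 * (real n + 1))"
  have \<delta>: "0 < \<delta>" using e(1) by (simp add: \<delta>_def)
  have "\<exists>r s. mass p i - \<delta> < of_rat r & of_rat r < mass p i & mass p i < of_rat s & of_rat s < mass p i + \<delta>" for i
   using of_rat_dense[of "mass p i - \<delta>" "mass p i"] of_rat_dense[of "mass p i" "mass p i + \<delta>"] \<delta> by auto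
  then obtain r s where rs: "!!i. mass p i - \<delta> < of_rat (r i)" "!!i. of_rat (r i) < mass p i"
   "!!i. mass p i < of_rat (s i)" "!!i. of_rat (s i) < mass p i + \<delta>" by metis
  define l where "l = map (%i. (r i, s i)) [0..<n]"
  have "p \<in> U l" using rs by (auto simp: U_def l_def)
  moreover have "U l \<subseteq> ball p e"
  proof
   fix q assume q: "q \<in> U l"
   have "\<bar>mass p i - mass q i\<bar> <= \<delta>" if "i < n" for i
   proof -
    have "of_rat (r i) < mass q i" "mass q i < of_rat (s i)" using q that by (auto simp: U_def l_def)
    then show ?thesis using rs[of i] by linarith
   qed
   then have "(\<Sum>i<n. \<bar>mass p i - mass q i\<bar>) <= (\<Sum>i<n. \<delta>)" by (intro sum_mono) auto
   also have "... = real n * \<delta>" by simp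
   also have "... < e / 4" using e(1) by (simp add: \<delta>_def field_simps)
   finally show "q \<in> ball p e" using n dist_mass_partition_le_partial[of p q n] by simp
  qed
  ultimately show "\<exists>B'\<in>range U. p \<in> B' & B' \<subseteq> O'" using e(2) by blast
 qed
 moreover have "countable (range U)" by simp
 ultimately show "\<exists>B::mass_partition set set. countable B & open = generate_topology B"
  using topological_basis_imp_subbasis by blast
qed

section \<open>The split-and-merge generator\<close>

lemma sums_fun_upd:
 fixes f :: "nat => real"
 assumes "f sums s"
 shows "f(i := x) sums (s - f i + x)"
proof -
 let ?u = "(%k. f k + (if k = i then (%_. x - f i) k else 0))"
 have "?u sums (s + (x - f i))"
  by (intro sums_add assms sums_single)
 moreover have "?u = f(i := x)" by auto
 ultimately show ?thesis by (simp add: algebra_simps)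
qed

lemma sums_merge:
 fixes f :: "nat => real"
 assumes "f sums s" "i ~= j"
 shows "f(i := f i + f j, j := 0) sums s"
 using sums_fun_upd[OF sums_fun_upd[OF assms(1), of i "f i + f j"], of j 0] assms(2) by simp

lemma sums_split:
 fixes f :: "nat => real"
 assumes "f sums s"
 shows "case_nat ((1 - u) * f i) (f(i := u * f i)) sums s"
proof -
 define g where "g = f(i := u * f i)"
 have "g sums (s - f i + u * f i)" unfolding g_def by (rule sums_fun_upd[OF assms])
 then have "(%n. case_nat ((1 - u) * f i) g (Suc n)) sums (s - f i + u * f i)" by simp
 from sums_Suc[OF this] have "case_nat ((1 - u) * f i) g sums (s - f i + u * f i + (1 - u) * f i)" by simp
 then show ?thesis unfolding g_def by (simp add: algebra_simps del: fun_upd_apply)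
qed

lemma mass_family_merge: "i ~= j ==> mass_family UNIV ((mass p)(i := mass p i + mass p j, j := 0))"
 by (intro mass_family_sums sums_merge mass_sums) (auto simp: mass_nonneg add_nonneg_nonneg)

lemma mass_family_split:
 "0 <= u ==> u <= 1 ==> mass_family UNIV (case_nat ((1 - u) * mass p i) ((mass p)(i := u * mass p i)))"
 by (intro mass_family_sums sums_split mass_sums) (auto simp: mass_nonneg split: nat.split)

lemma dist_mass_sums: "(%k. \<bar>mass p k - mass q k\<bar>) sums dist p q"
 unfolding dist_mass_partition_def by (rule summable_sums[OF summable_mass_diff])

lemma dist_rearranged_le_sums:
 assumes "mass_family UNIV a" "mass_family UNIV b" "!!k::nat. \<bar>a k - b k\<bar> <= c k" "c sums s"
 shows "dist (rearranged UNIV a) (rearranged UNIV b) <= s"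
proof -
 have sm: "summable (%k. \<bar>a k - b k\<bar>)"
  by (rule summable_comparison_test'[of c 0]) (use assms in \<open>auto simp: sums_iff\<close>)
 have "(\<Sum>k. \<bar>a k - b k\<bar>) <= suminf c"
  using assms(3,4) sm by (intro suminf_le) (auto simp: sums_iff)
 then show ?thesis using dist_rearranged_le_suminf[OF assms(1,2) sm] assms(4) by (simp add: sums_iff)
qed

text \<open>The differences of the merged sequences are dominated by the sequence |p - q| with its
  own entries \<open>i\<close> and \<open>j\<close> merged, which keeps its sum; rearranging does
  not increase distances. Splitting is treated in the same way.\<close>

lemma dist_merge_masses_le:
 assumes "i ~= j"
 shows "dist (merge_masses i j p) (merge_masses i j q) <= dist p q"
 unfolding merge_masses_def
proof (rule dist_rearranged_le_sums[OF mass_family_merge[OF assms] mass_family_merge[OF assms] _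
    sums_merge[OF dist_mass_sums assms]])
 fix k
 have "\<bar>x + y - (v + w)\<bar> <= \<bar>x - v\<bar> + \<bar>y - w\<bar>" for x y v w :: real by arith
 then show "\<bar>((mass p)(i := mass p i + mass p j, j := 0)) k - ((mass q)(i := mass q i + mass q j, j := 0)) k\<bar>
   <= ((%k. \<bar>mass p k - mass q k\<bar>)(i := \<bar>mass p i - mass q i\<bar> + \<bar>mass p j - mass q j\<bar>, j := 0)) k"
  by simp
qed

lemma dist_split_mass_le:
 assumes "0 <= u" "u <= 1"
 shows "dist (split_mass i u p) (split_mass i u q) <= dist p q"
 unfolding split_mass_def
proof (rule dist_rearranged_le_sums[OF mass_family_split[OF assms] mass_family_split[OF assms] _
    sums_split[OF dist_mass_sums, where i=i and u=u]])
 fix k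
 have "\<bar>u * x - u * y\<bar> = u * \<bar>x - y\<bar>" "\<bar>(1 - u) * x - (1 - u) * y\<bar> = (1 - u) * \<bar>x - y\<bar>" for x y
  using assms by (simp_all add: abs_mult flip: right_diff_distrib)
 then show "\<bar>case_nat ((1 - u) * mass p i) ((mass p)(i := u * mass p i)) k
    - case_nat ((1 - u) * mass q i) ((mass q)(i := u * mass q i)) k\<bar>
   <= case_nat ((1 - u) * \<bar>mass p i - mass q i\<bar>)
     ((%k. \<bar>mass p k - mass q k\<bar>)(i := u * \<bar>mass p i - mass q i\<bar>)) k"
  by (cases k) simp_all
qed

text \<open>Both fragments change by |u - v| times \<open>mass p i\<close>, hence the factor
  2.\<close>

lemma dist_split_mass_arg_le:
 assumes "0 <= u" "u <= 1" "0 <= v" "v <= 1"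
 shows "dist (split_mass i u p) (split_mass i v p) <= 2 * \<bar>u - v\<bar> * mass p i"
proof -
 let ?u = "((\<lambda>_::nat. 0::real)(i := \<bar>u - v\<bar> * mass p i))"
 let ?v = "(\<bar>u - v\<bar> * mass p i)"
 have "(\<lambda>_::nat. 0::real)(i := \<bar>u - v\<bar> * mass p i) sums ?v"
  using sums_fun_upd[OF sums_zero, of i "\<bar>u - v\<bar> * mass p i"] by simp
 then have s: "case_nat ?v ?u
   sums (2 * \<bar>u - v\<bar> * mass p i)"
  using sums_Suc[of "case_nat ?v ?u"
   "\<bar>u - v\<bar> * mass p i"] by (simp del: fun_upd_apply add: mult_ac)
 show ?thesis
  unfolding split_mass_def
 proof (rule dist_rearranged_le_sums[OF mass_family_split[OF assms(1,2)] mass_family_split[OF assms(3,4)] _ s])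
  fix k
  have "\<bar>u * x - v * x\<bar> = \<bar>u - v\<bar> * \<bar>x\<bar>" "\<bar>(1 - u) * x - (1 - v) * x\<bar> = \<bar>u - v\<bar> * \<bar>x\<bar>" for x
   by (simp_all add: abs_mult abs_minus_commute flip: left_diff_distrib)
  then show "\<bar>case_nat ((1 - u) * mass p i) ((mass p)(i := u * mass p i)) k
     - case_nat ((1 - v) * mass p i) ((mass p)(i := v * mass p i)) k\<bar>
    <= case_nat ?v ?u k"
   by (cases k) (simp_all add: mass_nonneg)
 qed
qed

lemma summable_on_bounded_real:
 fixes f :: "'a => real"
 assumes "!!F. finite F ==> F \<subseteq> A ==> (\<Sum>x\<in>F. \<bar>f x\<bar>) <= C"
 shows "f summable_on A" "\<bar>infsum f A\<bar> <= C"
proof -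
 have s: "(%x. \<bar>f x\<bar>) summable_on A"
 proof (rule nonneg_bdd_above_summable_on)
  show "bdd_above (sum (%x. \<bar>f x\<bar>) ` {F. F \<subseteq> A & finite F})"
   by (rule bdd_aboveI2[where M = C]) (use assms in blast)
 qed simp
 then show "f summable_on A" using summable_on_iff_abs_summable_on_real[of f A] by simp
 have "\<bar>infsum f A\<bar> <= infsum (%x. \<bar>f x\<bar>) A"
  using norm_infsum_bound[of f A] s by simp
 also have "... <= C" by (rule infsum_le_finite_sums[OF s]) (rule assms)
 finally show "\<bar>infsum f A\<bar> <= C" .
qed

lemma sum_mass_le_1: "finite F ==> (\<Sum>i\<in>F. mass p i) <= 1"
 using sum_le_suminf[OF sums_summable[OF mass_sums], of F p] mass_nonneg[of p] mass_sums[of p]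
 by (auto simp: sums_iff)

lemma sum_mass_diff_le_dist: "finite F ==> (\<Sum>i\<in>F. \<bar>mass p i - mass q i\<bar>) <= dist p q"
 unfolding dist_mass_partition_def by (rule sum_le_suminf[OF summable_mass_diff]) auto

lemma finite_pairs_subset:
 assumes "finite (F :: (nat \<times> nat) set)"
 obtains n where "F \<subseteq> {..<n} \<times> {..<n}"
proof -
 obtain n where n: "\<forall>k\<in>fst ` F \<union> snd ` F. k < n"
  using finite_nat_set_iff_bounded[of "fst ` F \<union> snd ` F"] assms by auto
 then have "fst x < n & snd x < n" if "x \<in> F" for x using that by blast
 then have "F \<subseteq> {..<n} \<times> {..<n}" by auto
 then show ?thesis using that by blast
qed

lemma sum_mass_pairs_le_1:
 assumes "finite F"
 shows "(\<Sum>(i, j)\<in>F. mass p i * mass p j) <= 1"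
proof -
 obtain n where n: "F \<subseteq> {..<n} \<times> {..<n}" using finite_pairs_subset[OF assms] .
 have "(\<Sum>(i, j)\<in>F. mass p i * mass p j) <= (\<Sum>(i, j)\<in>{..<n} \<times> {..<n}. mass p i * mass p j)"
  by (rule sum_mono2[OF _ n]) (auto simp: mass_nonneg)
 also have "... = (\<Sum>i<n. mass p i) * (\<Sum>j<n. mass p j)"
  by (simp add: sum.cartesian_product[symmetric] sum_product)
 also have "... <= 1 * 1"
  by (intro mult_mono sum_mass_le_1 sum_nonneg) (auto simp: mass_nonneg)
 finally show ?thesis by simp
qed

lemma sum_mass_pairs_diff_le:
 assumes "finite F"
 shows "(\<Sum>(i, j)\<in>F. \<bar>mass p i * mass p j - mass q i * mass q j\<bar>) <= 2 * dist p q"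
proof -
 obtain n where n: "F \<subseteq> {..<n} \<times> {..<n}" using finite_pairs_subset[OF assms] .
 have "(\<Sum>(i, j)\<in>F. \<bar>mass p i * mass p j - mass q i * mass q j\<bar>)
   <= (\<Sum>(i, j)\<in>{..<n} \<times> {..<n}. \<bar>mass p i * mass p j - mass q i * mass q j\<bar>)"
  by (rule sum_mono2[OF _ n]) auto
 also have "... = (\<Sum>i<n. \<Sum>j<n. \<bar>mass p i * mass p j - mass q i * mass q j\<bar>)"
  by (simp add: sum.cartesian_product)
 also have "... <= (\<Sum>i<n. \<Sum>j<n. mass p i * \<bar>mass p j - mass q j\<bar> + \<bar>mass p i - mass q i\<bar> * mass q j)"
 proof (intro sum_mono)
  fix i j
  have "mass p i * mass p j - mass q i * mass q j
    = mass p i * (mass p j - mass q j) + (mass p i - mass q i) * mass q j" by (simp add: algebra_simps)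
  then show "\<bar>mass p i * mass p j - mass q i * mass q j\<bar>
    <= mass p i * \<bar>mass p j - mass q j\<bar> + \<bar>mass p i - mass q i\<bar> * mass q j"
   using abs_triangle_ineq[of "mass p i * (mass p j - mass q j)" "(mass p i - mass q i) * mass q j"]
   by (simp add: abs_mult mass_nonneg)
 qed
 also have "... = (\<Sum>i<n. mass p i) * (\<Sum>j<n. \<bar>mass p j - mass q j\<bar>)
   + (\<Sum>i<n. \<bar>mass p i - mass q i\<bar>) * (\<Sum>j<n. mass q j)"
  by (simp add: sum.distrib sum_product)
 also have "... <= 1 * dist p q + dist p q * 1"
  by (intro add_mono mult_mono sum_mass_le_1 sum_mass_diff_le_dist sum_nonneg) (auto simp: mass_nonneg)
 finally show ?thesis by simp
qed

section \<open>Bounded Lipschitz functions under the generator\<close>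

lemma set_integral_unit_bound:
 fixes g :: "real => real"
 assumes "set_integrable lborel {0..<1} g" "!!u. 0 <= u ==> u < 1 ==> \<bar>g u\<bar> <= c"
 shows "\<bar>LINT u:{0..<1}|lborel. g u\<bar> <= c"
proof -
 have "norm (\<integral>u. indicator {0..<1} u *\<^sub>R g u \<partial>lborel) <= (\<integral>u. indicator {0..<1::real} u *\<^sub>R c \<partial>lborel)"
 proof (rule Bochner_Integration.integral_norm_bound_integral)
  show "integrable lborel (%u. indicator {0..<1} u *\<^sub>R g u)" using assms(1) by (simp add: set_integrable_def)
  show "integrable lborel (%u. indicator {0..<1::real} u *\<^sub>R c)" by (rule integrable_indicator) auto
 qed (use assms(2) in \<open>auto simp: indicator_def\<close>)
 also have "... = c" by simp
 finally show ?thesis by (simp add: set_lebesgue_integral_def)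
qed

text \<open>Bounded Lipschitz functions suffice to test weak convergence, and the generator maps
  them to Lipschitz functions with explicit constants. \<open>B\<close> and \<open>L\<close> are
  kept as parameters since errors must be uniform in the volume.\<close>

locale lipschitz_test =
 fixes f :: "mass_partition => real" and B L :: real
 assumes bound: "\<bar>f p\<bar> <= B" and lip: "\<bar>f p - f q\<bar> <= L * dist p q"
  and L_nonneg: "0 <= L"
begin

lemma B_nonneg: "0 <= B"
 using bound[of undefined] by linarith

lemma diff_bound: "\<bar>f p - f q\<bar> <= 2 * B"
 using bound[of p] bound[of q] by linarith

lemma continuous: "continuous_on A f"
proof -
 have "L-lipschitz_on UNIV f"
  by (rule lipschitz_onI) (use lip L_nonneg in \<open>auto simp: dist_real_def\<close>)
 then show ?thesis using lipschitz_on_continuous_on continuous_on_subset by blast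
qed

lemma lip_le: "dist p q <= c ==> \<bar>f p - f q\<bar> <= L * c"
 using lip[of p q] L_nonneg by (meson mult_left_mono order_trans)

lemma split_continuous: "continuous_on {0..1} (%u. f (split_mass i u p))"
proof -
 have "(L * (2 * mass p i))-lipschitz_on {0..1} (%u. f (split_mass i u p))"
 proof (rule lipschitz_onI)
  fix u v :: real assume "u \<in> {0..1}" "v \<in> {0..1}"
  then show "dist (f (split_mass i u p)) (f (split_mass i v p)) <= L * (2 * mass p i) * dist u v"
   using lip_le[OF dist_split_mass_arg_le, of u v i p] by (simp add: dist_real_def mult_ac)
 qed (simp add: L_nonneg mass_nonneg)
 then show ?thesis by (rule lipschitz_on_continuous_on)
qed

lemma split_integrable: "set_integrable lborel {0..<1} (%u. f (split_mass i u p) - f p)"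
proof -
 have "set_integrable lborel {0..1} (%u. f (split_mass i u p) - f p)"
  by (intro borel_integrable_atLeastAtMost' continuous_intros split_continuous)
 then show ?thesis by (rule set_integrable_subset) auto
qed

abbreviation "split_term p i \<equiv> LINT u:{0..<1}|lborel. f (split_mass i u p) - f p"

lemma split_term_bound: "\<bar>split_term p i\<bar> <= 2 * B"
 by (rule set_integral_unit_bound[OF split_integrable]) (rule diff_bound)

lemma split_term_lip: "\<bar>split_term p i - split_term q i\<bar> <= 2 * L * dist p q"
proof -
 have "\<bar>(f (split_mass i u p) - f p) - (f (split_mass i u q) - f q)\<bar> <= 2 * L * dist p q"
  if "0 <= u" "u < 1" for u
  using lip_le[OF dist_split_mass_le[of u i p q]] lip[of p q] that by simp
 then show ?thesis
  unfolding set_integral_diff(2)[OF split_integrable split_integrable, symmetric]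
  by (intro set_integral_unit_bound set_integral_diff split_integrable)
qed

abbreviation "merge_term p i j \<equiv> f (merge_masses i j p) - f p"

lemma merge_term_lip: "i ~= j ==> \<bar>merge_term p i j - merge_term q i j\<bar> <= 2 * L * dist p q"
 using lip_le[OF dist_merge_masses_le[of i j p q]] lip[of p q] by simp

lemma summable_merge:
 "(%(i, j). mass p i * mass p j * merge_term p i j) summable_on {(i, j). i < j}"
proof (rule summable_on_bounded_real(1)[of _ _ "2 * B"])
 fix F :: "(nat \<times> nat) set" assume F: "finite F"
 have "(\<Sum>x\<in>F. \<bar>case x of (i, j) => mass p i * mass p j * merge_term p i j\<bar>)
   <= (\<Sum>x\<in>F. 2 * B * (case x of (i, j) => mass p i * mass p j))"
  using diff_bound by (intro sum_mono) (auto simp: abs_mult mass_nonneg mult.commute[of "2 * B"] intro!: mult_left_mono)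
 also have "... <= 2 * B * 1"
  unfolding sum_distrib_left[symmetric] using sum_mass_pairs_le_1[OF F] B_nonneg by (intro mult_left_mono) auto
 finally show "(\<Sum>x\<in>F. \<bar>case x of (i, j) => mass p i * mass p j * merge_term p i j\<bar>) <= 2 * B" by simp
qed

lemma mass_sq_diff_le: "\<bar>(mass p i)\<^sup>2 - (mass q i)\<^sup>2\<bar> <= 2 * \<bar>mass p i - mass q i\<bar>"
proof -
 have "(mass p i)\<^sup>2 - (mass q i)\<^sup>2 = (mass p i + mass q i) * (mass p i - mass q i)"
  by (simp add: power2_eq_square algebra_simps)
 then have "\<bar>(mass p i)\<^sup>2 - (mass q i)\<^sup>2\<bar> = (mass p i + mass q i) * \<bar>mass p i - mass q i\<bar>"
  by (simp add: abs_mult mass_nonneg)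
 also have "... <= 2 * \<bar>mass p i - mass q i\<bar>"
  using mass_le_1[of p i] mass_le_1[of q i] by (intro mult_right_mono) auto
 finally show ?thesis .
qed

lemma mass_sq_le: "(mass p i)\<^sup>2 <= mass p i"
 using mass_le_1[of p i] mass_nonneg[of p i] by (simp add: power2_eq_square mult_left_le)

lemma summable_split: "summable (%i. (mass p i)\<^sup>2 * split_term p i)"
proof (rule summable_comparison_test'[of "%i. mass p i * (2 * B)" 0])
 show "summable (%i. mass p i * (2 * B))"
  by (intro summable_mult2 sums_summable[OF mass_sums])
 show "norm ((mass p n)\<^sup>2 * split_term p n) <= mass p n * (2 * B)" for n
  using mass_sq_le[of p n] split_term_bound[of n p] by (auto simp: abs_mult intro!: mult_mono mass_nonneg)
qed

text \<open>Between \<open>p\<close> and \<open>q\<close> the weights of all merges, and likewise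
  those of all splits, change by at most \<open>2 * dist p q\<close> in total, each change
  multiplied by at most \<open>2 * B\<close>, while the increments of \<open>f\<close> change by at
  most \<open>2 * L * dist p q\<close>. With the factor 2 of the merge part this gives
  \<open>12 * B + 6 * L\<close>, which is rounded up.\<close>

lemma split_merge_generator_lip:
 "\<bar>split_merge_generator f p - split_merge_generator f q\<bar> <= (16 * B + 8 * L) * dist p q"
proof -
 let ?a = "%p (i, j). mass p i * mass p j * merge_term p i j"
 let ?b = "%p i. (mass p i)\<^sup>2 * split_term p i"
 let ?d = "dist p q"
 have bd: "\<bar>x * s - y * t\<bar> <= \<bar>x - y\<bar> * (2 * B) + y * (2 * L * ?d)"
  if "\<bar>s\<bar> <= 2 * B" "\<bar>s - t\<bar> <= 2 * L * ?d" "0 <= y" for x y s t :: real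
 proof -
  have "x * s - y * t = (x - y) * s + y * (s - t)" by (simp add: algebra_simps)
  then have "\<bar>x * s - y * t\<bar> <= \<bar>x - y\<bar> * \<bar>s\<bar> + y * \<bar>s - t\<bar>"
   using abs_triangle_ineq[of "(x - y) * s" "y * (s - t)"] that(3) by (simp add: abs_mult)
  also have "... <= \<bar>x - y\<bar> * (2 * B) + y * (2 * L * ?d)"
   using that by (intro add_mono mult_left_mono) auto
  finally show ?thesis .
 qed
 have "\<bar>infsum (%x. ?a p x - ?a q x) {(i, j). i < j}\<bar> <= 2 * ?d * (2 * B) + 1 * (2 * L * ?d)"
 proof (rule summable_on_bounded_real(2))
  fix F :: "(nat \<times> nat) set" assume F: "finite F" "F \<subseteq> {(i, j). i < j}"
  have "(\<Sum>x\<in>F. \<bar>?a p x - ?a q x\<bar>)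
   <= (\<Sum>(i, j)\<in>F. \<bar>mass p i * mass p j - mass q i * mass q j\<bar> * (2 * B) + (mass q i * mass q j) * (2 * L * ?d))"
  proof (intro sum_mono)
   fix x assume "x \<in> F"
   then obtain i j where "x = (i, j)" "i ~= j" using F(2) by auto
   moreover have "\<bar>mass p i * mass p j * merge_term p i j - mass q i * mass q j * merge_term q i j\<bar>
     <= \<bar>mass p i * mass p j - mass q i * mass q j\<bar> * (2 * B) + (mass q i * mass q j) * (2 * L * ?d)"
    by (rule bd[OF diff_bound merge_term_lip[OF \<open>i ~= j\<close>]]) (simp add: mass_nonneg)
   ultimately show "\<bar>?a p x - ?a q x\<bar> <= (case x of (i, j) =>
     \<bar>mass p i * mass p j - mass q i * mass q j\<bar> * (2 * B) + (mass q i * mass q j) * (2 * L * ?d))"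
    by simp
  qed
  also have "... = (\<Sum>(i, j)\<in>F. \<bar>mass p i * mass p j - mass q i * mass q j\<bar>) * (2 * B)
    + (\<Sum>(i, j)\<in>F. mass q i * mass q j) * (2 * L * ?d)"
   by (simp add: sum_distrib_right sum.distrib split_beta)
  also have "... <= 2 * ?d * (2 * B) + 1 * (2 * L * ?d)"
   using B_nonneg L_nonneg F(1)
   by (intro add_mono mult_right_mono sum_mass_pairs_diff_le sum_mass_pairs_le_1) auto
  finally show "(\<Sum>x\<in>F. \<bar>?a p x - ?a q x\<bar>) <= 2 * ?d * (2 * B) + 1 * (2 * L * ?d)" .
 qed
 moreover have "infsum (%x. ?a p x - ?a q x) {(i, j). i < j} = infsum (?a p) {(i, j). i < j} - infsum (?a q) {(i, j). i < j}"
  using has_sum_add[OF has_sum_infsum[OF summable_merge[of p]]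
    has_sum_uminusI[OF has_sum_infsum[OF summable_merge[of q]]]]
  by (intro infsumI) (simp add: split_beta)
 moreover have "\<bar>(\<Sum>i. ?b p i - ?b q i)\<bar> <= 2 * ?d * (2 * B) + 1 * (2 * L * ?d)"
 proof -
  have c: "(%i. 2 * \<bar>mass p i - mass q i\<bar> * (2 * B) + mass q i * (2 * L * ?d)) sums (2 * ?d * (2 * B) + 1 * (2 * L * ?d))"
   by (intro sums_add sums_mult2 sums_mult dist_mass_sums mass_sums)
  have le: "\<bar>?b p i - ?b q i\<bar> <= 2 * \<bar>mass p i - mass q i\<bar> * (2 * B) + mass q i * (2 * L * ?d)" for i
  proof -
   have "\<bar>?b p i - ?b q i\<bar> <= \<bar>(mass p i)\<^sup>2 - (mass q i)\<^sup>2\<bar> * (2 * B) + (mass q i)\<^sup>2 * (2 * L * ?d)"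
    by (rule bd[OF split_term_bound split_term_lip]) simp
   also have "... <= 2 * \<bar>mass p i - mass q i\<bar> * (2 * B) + mass q i * (2 * L * ?d)"
    using B_nonneg L_nonneg by (intro add_mono mult_right_mono mass_sq_diff_le mass_sq_le) auto
   finally show ?thesis .
  qed
  have s: "summable (%i. \<bar>?b p i - ?b q i\<bar>)"
   by (rule summable_rabs_comparison_test[OF _ sums_summable[OF c]]) (use le in auto)
  have "\<bar>(\<Sum>i. ?b p i - ?b q i)\<bar> <= (\<Sum>i. \<bar>?b p i - ?b q i\<bar>)" by (rule summable_rabs[OF s])
  also have "... <= (\<Sum>i. 2 * \<bar>mass p i - mass q i\<bar> * (2 * B) + mass q i * (2 * L * ?d))"
   by (rule suminf_le[OF le s sums_summable[OF c]])
  finally show ?thesis using c by (simp add: sums_iff)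
 qed
 moreover have "(\<Sum>i. ?b p i - ?b q i) = suminf (?b p) - suminf (?b q)"
  by (rule suminf_diff[OF summable_split summable_split, symmetric])
 moreover have "\<bar>2 * x + y\<bar> <= 3 * c" if "\<bar>x\<bar> <= c" "\<bar>y\<bar> <= c" for x y c :: real
  using that by linarith
 ultimately have "\<bar>2 * (infsum (?a p) {(i, j). i < j} - infsum (?a q) {(i, j). i < j}) + (suminf (?b p) - suminf (?b q))\<bar>
   <= 3 * (2 * ?d * (2 * B) + 1 * (2 * L * ?d))" by (metis (no_types, lifting))
 also have "... <= (16 * B + 8 * L) * ?d"
 proof -
  have "0 <= B * ?d" "0 <= L * ?d" using B_nonneg L_nonneg by simp_all
  then show ?thesis by (simp add: algebra_simps)
 qed
 finally show ?thesis unfolding split_merge_generator_def by (simp add: algebra_simps)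
qed

end

section \<open>Cycle lengths after the transposition of two arbitrary vertices\<close>

definition cycle_masses :: "'v set => ('v => 'v) => mass_partition" where
 "cycle_masses V \<sigma> = rearranged (orbits \<sigma> V) (%C. real (card C) / real (card V))"

text \<open>On each of the \<open>n\<close> intervals the integrand differs from its value at the
  left end point by at most \<open>M / n\<close>, so each interval contributes an error of at most
  \<open>M / n^2\<close>.\<close>

lemma riemann_sum_unit:
 fixes h :: "real => real"
 assumes M: "!!u v. 0 <= u ==> u <= 1 ==> 0 <= v ==> v <= 1 ==> \<bar>h u - h v\<bar> <= M * \<bar>u - v\<bar>"
  and int: "set_integrable lborel {0..<1} h" and n: "0 < n"
 shows "\<bar>(\<Sum>i<n. h (real i / real n)) / real n - (LINT u:{0..<1}|lborel. h u)\<bar> <= M / real n"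
proof -
 have M0: "0 <= M" using M[of 0 1] by simp
 have piece: "\<bar>h a * (b - a) - (LINT u:{a..<b}|lborel. h u)\<bar> <= M * (b - a) * (b - a)"
  if ab: "0 <= a" "a < b" "b <= 1" for a b
 proof -
  have i1: "set_integrable lborel {a..<b} h"
   by (rule set_integrable_subset[OF int]) (use ab in auto)
  have i0: "set_integrable lborel {a..<b} (%_. c)" for c :: real
   unfolding set_integrable_def by (rule integrable_indicator) (use ab in auto)
  have "h a * (b - a) - (LINT u:{a..<b}|lborel. h u) = (LINT u:{a..<b}|lborel. h a - h u)"
   using ab by (subst set_integral_diff(2)[OF i0 i1]) (simp add: set_lebesgue_integral_def)
  also have "norm ... <= (\<integral>u. indicator {a..<b} u *\<^sub>R (M * (b - a)) \<partial>lborel)"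
   unfolding set_lebesgue_integral_def
  proof (rule Bochner_Integration.integral_norm_bound_integral)
   show "integrable lborel (%u. indicat_real {a..<b} u *\<^sub>R (h a - h u))"
    using set_integral_diff(1)[OF i0[of "h a"] i1] by (simp add: set_integrable_def)
   show "integrable lborel (%u. indicat_real {a..<b} u *\<^sub>R (M * (b - a)))"
    using i0[of "M * (b - a)"] by (simp add: set_integrable_def)
   fix u
   have "\<bar>h a - h u\<bar> <= M * (b - a)" if "a <= u" "u < b"
   proof -
    have "\<bar>h a - h u\<bar> <= M * \<bar>a - u\<bar>" using that ab by (intro M) auto
    also have "... <= M * (b - a)" using that M0 by (intro mult_left_mono) auto
    finally show ?thesis .
   qed
   then show "norm (indicat_real {a..<b} u *\<^sub>R (h a - h u)) <= indicat_real {a..<b} u *\<^sub>R (M * (b - a))"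
    by (auto simp: indicator_def)
  qed
  also have "... = M * (b - a) * (b - a)" using ab by simp
  finally show ?thesis by simp
 qed
 have "\<bar>(\<Sum>i<m. h (real i / real n)) / real n - (LINT u:{0..<real m / real n}|lborel. h u)\<bar>
   <= real m * (M / (real n * real n))" if "m <= n" for m
  using that
 proof (induction m)
  case (Suc m)
  let ?a = "real m / real n" and ?b = "real (Suc m) / real n"
  have ab: "0 <= ?a" "?a < ?b" "?b <= 1" "?b - ?a = 1 / real n"
   using Suc.prems n by (auto simp: field_simps)
  have "{0..<?b} = {0..<?a} \<union> {?a..<?b}" using ab by (intro ivl_disj_un_two(3)[symmetric]) auto
  then have "(LINT u:{0..<?b}|lborel. h u) = (LINT u:{0..<?a} \<union> {?a..<?b}|lborel. h u)" by simp
  also have "... = (LINT u:{0..<?a}|lborel. h u) + (LINT u:{?a..<?b}|lborel. h u)"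
  proof (rule set_integral_Un)
   have "{0..<?a} \<subseteq> {0..<1}" using ab by (intro ivl_subset[THEN iffD2]) auto
   then show "set_integrable lborel {0..<?a} h" by (rule set_integrable_subset[OF int, rotated]) auto
   have "{?a..<?b} \<subseteq> {0..<1}" using ab by (intro ivl_subset[THEN iffD2]) auto
   then show "set_integrable lborel {?a..<?b} h" by (rule set_integrable_subset[OF int, rotated]) auto
  qed auto
  finally have "\<bar>(\<Sum>i<Suc m. h (real i / real n)) / real n - (LINT u:{0..<?b}|lborel. h u)\<bar>
   <= \<bar>(\<Sum>i<m. h (real i / real n)) / real n - (LINT u:{0..<?a}|lborel. h u)\<bar>
    + \<bar>h ?a * (?b - ?a) - (LINT u:{?a..<?b}|lborel. h u)\<bar>"
   unfolding ab(4) by (simp add: add_divide_distrib)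
  also have "... <= real m * (M / (real n * real n)) + M * (?b - ?a) * (?b - ?a)"
   using Suc ab by (intro add_mono piece) auto
  also have "... = real (Suc m) * (M / (real n * real n))"
   unfolding ab(4) by (simp add: distrib_right add_divide_distrib)
  finally show ?case .
 qed (simp add: set_lebesgue_integral_def)
 from this[of n] n show ?thesis by simp
qed

context finite_perm
begin

lemma mass_family_orbits:
 assumes "V ~= {}"
 shows "mass_family (orbits \<sigma> V) (%C. real (card C) / real (card V))"
proof (rule mass_family_finite[OF finite_orbits])
 have "(\<Sum>C\<in>orbits \<sigma> V. real (card C)) = real (card V)"
  using sum_card_orbits by (metis of_nat_sum)
 then show "(\<Sum>C\<in>orbits \<sigma> V. real (card C) / real (card V)) = 1"
  using assms fin by (simp flip: sum_divide_distrib)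
qed simp

lemma compose_transpose: "x \<in> V ==> y \<in> V ==> finite_perm V (swp x y \<circ> \<sigma>)"
 by unfold_locales (auto intro!: fin permutes_compose perm permutes_swap_id)

text \<open>The bijection in the definition of \<open>rearranged\<close> labels the cycles by the
  positive entries of \<open>p\<close>. It turns \<open>merge_masses\<close> and
  \<open>split_mass\<close>, which act on indices, into operations on cycles.\<close>

context
 fixes p \<pi>
 assumes V: "V ~= {}"
  and \<pi>: "bij_betw \<pi> {k. 0 < mass p k} (orbits \<sigma> V)"
  and mass_\<pi>: "!!k. 0 < mass p k ==> mass p k = real (card (\<pi> k)) / real (card V)"
begin

lemma card_V_pos: "0 < card V"
 using V fin by (simp add: card_gt_0_iff)

lemma \<pi>_in: "0 < mass p k ==> \<pi> k \<in> orbits \<sigma> V"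
 using bij_betwE[OF \<pi>] by simp

lemma \<pi>_eq_iff: "0 < mass p k ==> 0 < mass p l ==> \<pi> k = \<pi> l \<longleftrightarrow> k = l"
 using \<pi> by (auto simp: bij_betw_def inj_on_def)

lemma \<pi>_surj: "C \<in> orbits \<sigma> V ==> \<exists>k. 0 < mass p k & C = \<pi> k"
 using bij_betw_imp_surj_on[OF \<pi>] by auto

lemma cycle_masses_eq: "cycle_masses V \<sigma> = p"
 unfolding cycle_masses_def
proof (rule rearranged_eqI, unfold rearranges_def, intro exI conjI allI impI)
 have "{C \<in> orbits \<sigma> V. 0 < real (card C) / real (card V)} = orbits \<sigma> V"
  using card_in_orbits_pos card_V_pos by auto
 then show "bij_betw \<pi> {k. 0 < mass p k} {C \<in> orbits \<sigma> V. 0 < real (card C) / real (card V)}"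
  using \<pi> by simp
qed (rule mass_\<pi>)

text \<open>In the new permutation the joint cycle takes over the label \<open>k\<close>, while
  \<open>l\<close> becomes an entry 0 and drops out of the rearrangement.\<close>

lemma cycle_masses_merge:
 assumes k: "0 < mass p k" and l: "0 < mass p l" and kl: "k ~= l" and x: "x \<in> \<pi> k" and y: "y \<in> \<pi> l"
 shows "cycle_masses V (swp x y \<circ> \<sigma>) = merge_masses k l p"
proof -
 let ?u = "({i. 0 < mass p i} - {l})"
 let ?t = "swp x y \<circ> \<sigma>"
 have o: "\<pi> k = orbit \<sigma> x" "\<pi> l = orbit \<sigma> y"
  using orbits_eq_orbit \<pi>_in k l x y by blast+
 have dis: "\<pi> k \<inter> \<pi> l = {}" using disjoint_orbits \<pi>_in \<pi>_eq_iff k l kl by metis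
 have xy: "x \<in> V" "y \<in> V" using Union_orbits \<pi>_in[OF k] \<pi>_in[OF l] x y by blast+
 have "y \<notin> orbit \<sigma> x" using dis y o by auto
 note ot = orbits_merge[OF xy this, folded o]
 interpret t: finite_perm V ?t by (rule compose_transpose[OF xy])
 let ?a = "(mass p)(k := mass p k + mass p l, l := 0)"
 let ?r = "\<pi>(k := \<pi> k \<union> \<pi> l)"
 have S: "{i \<in> UNIV. 0 < ?a i} = {i. 0 < mass p i} - {l}" using k l kl by auto
 have S': "{C \<in> orbits ?t V. 0 < real (card C) / real (card V)} = orbits ?t V"
  using t.card_in_orbits_pos card_V_pos by auto
 have ne: "\<pi> i ~= \<pi> k \<union> \<pi> l" if "0 < mass p i" for i
 proof
  assume eq: "\<pi> i = \<pi> k \<union> \<pi> l"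
  then have "\<pi> i \<inter> \<pi> k ~= {}" "\<pi> i \<inter> \<pi> l ~= {}" using x y by auto
  then have "\<pi> i = \<pi> k" "\<pi> i = \<pi> l" using disjoint_orbits \<pi>_in that k l by metis+
  then show False using kl \<pi>_eq_iff k l by metis
 qed
 have "bij_betw ?r ?u (orbits ?t V)"
  unfolding bij_betw_def
 proof
  show "inj_on ?r ?u"
   using ne \<pi>_eq_iff by (auto simp: inj_on_def dest: sym)
  have "orbits \<sigma> V - {\<pi> k, \<pi> l} = \<pi> ` ({i. 0 < mass p i} - {k, l})"
   using \<pi>_surj \<pi>_in \<pi>_eq_iff k l by auto
  moreover have "?r ` ?u = insert (\<pi> k \<union> \<pi> l) (\<pi> ` ({i. 0 < mass p i} - {k, l}))"
   using k kl by (auto simp: image_iff)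
  ultimately show "?r ` ?u = orbits ?t V"
   unfolding ot by simp
 qed
 moreover have "?a i = real (card (?r i)) / real (card V)" if "0 < ?a i" for i
 proof (cases "i = k")
  case True
  have "card (\<pi> k \<union> \<pi> l) = card (\<pi> k) + card (\<pi> l)"
   by (rule card_Un_disjoint) (use finite_in_orbits \<pi>_in k l dis in auto)
  then show ?thesis using True kl mass_\<pi> k l by (simp add: add_divide_distrib)
 next
  case False
  then show ?thesis using that mass_\<pi>[of i] by (auto split: if_splits)
 qed
 ultimately have "rearranged UNIV ?a = rearranged (orbits ?t V) (%C. real (card C) / real (card V))"
  by (intro rearranged_reindex[OF t.mass_family_orbits[OF V], where \<pi> = ?r]) (simp_all only: S S')
 then show ?thesis by (simp add: merge_masses_def cycle_masses_def)
qed

text \<open>As \<open>i\<close> runs through the positions of the cycle,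
  \<open>(\<sigma> ^^ i) x\<close> runs through its vertices and the cut falls at a fraction of the
  length that is a grid point of the unit interval: the uniform variable \<open>u\<close> of the
  generator, discretised.\<close>

lemma cycle_masses_split:
 assumes k: "0 < mass p k" and x: "x \<in> \<pi> k" and i: "i < card (\<pi> k)"
 shows "cycle_masses V (swp x ((\<sigma> ^^ i) x) \<circ> \<sigma>) = split_mass k (real i / real (card (\<pi> k))) p"
proof (cases "i = 0")
 \<comment> \<open>For \<open>i = 0\<close> the transposition is the identity. On the other side the
   fragment at \<open>k\<close> is empty and the whole mass moves to position 0, so both sides are
   \<open>p\<close>.\<close>
 case True
 have "rearranged UNIV (case_nat (mass p k) ((mass p)(k := 0))) = rearranged UNIV (mass p)"
 proof (rule rearranged_reindex[OF mass_family_mass, where \<pi> = "case_nat k (%j. j)"])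
  show "bij_betw (case_nat k (%j. j)) {i \<in> UNIV. 0 < case_nat (mass p k) ((mass p)(k := 0)) i}
    {j \<in> UNIV. 0 < mass p j}"
   unfolding bij_betw_def
  proof
   show "inj_on (case_nat k (%j. j)) {i \<in> UNIV. 0 < case_nat (mass p k) ((mass p)(k := 0)) i}"
    by (auto simp: inj_on_def split: nat.splits if_splits)
   show "case_nat k (%j. j) ` {i \<in> UNIV. 0 < case_nat (mass p k) ((mass p)(k := 0)) i} = {j \<in> UNIV. 0 < mass p j}"
   proof (intro equalityI subsetI)
    fix j assume "j \<in> {j \<in> UNIV. 0 < mass p j}"
    then show "j \<in> case_nat k (%j. j) ` {i \<in> UNIV. 0 < case_nat (mass p k) ((mass p)(k := 0)) i}"
     by (intro image_eqI[of _ _ "if j = k then 0 else Suc j"]) auto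
   qed (use k in \<open>auto split: nat.splits if_splits\<close>)
  qed
 qed (auto split: nat.splits if_splits)
 then show ?thesis using True cycle_masses_eq by (simp add: split_mass_def rearranged_mass del: fun_upd_apply)
next
 case False
 have o: "\<pi> k = orbit \<sigma> x" using orbits_eq_orbit \<pi>_in[OF k] x by blast
 have xV: "x \<in> V" using Union_orbits \<pi>_in[OF k] x by blast
 define y t where "y = (\<sigma> ^^ i) x" and "t = swp x y \<circ> \<sigma>"
 note sp = orbits_split[OF xV _ i[unfolded o], folded y_def, folded t_def, folded o]
 have i0: "0 < i" using False by simp
 have "y \<in> orbit \<sigma> x" unfolding y_def by (rule funpow_in_orbit[OF self_in_orbit])
 then have yV: "y \<in> V" using orbit_subset_V[OF xV] by auto
 interpret t: finite_perm V t unfolding t_def by (rule compose_transpose[OF xV yV])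
 define l where "l = card (\<pi> k)"
 define u where "u = real i / real l"
 have u: "0 < u" "u < 1" using i i0 by (simp_all add: u_def l_def)
 let ?a = "case_nat ((1 - u) * mass p k) ((mass p)(k := u * mass p k))"
 \<comment> \<open>\<open>split_mass\<close> shifts all entries by one and puts the mass
   \<open>(1 - u) * mass p k\<close> in front: that is the arc of \<open>y\<close>, while the arc of
   \<open>x\<close> keeps the label \<open>k\<close>.\<close>
 let ?r = "case_nat (orbit t y) (\<pi>(k := orbit t x))"
 have S: "{n \<in> UNIV. 0 < ?a n} = insert 0 (Suc ` {n. 0 < mass p n})"
 proof (intro set_eqI)
  fix n show "n \<in> {n \<in> UNIV. 0 < ?a n} \<longleftrightarrow> n \<in> insert 0 (Suc ` {n. 0 < mass p n})"
   using k u by (cases n) (auto simp: zero_less_mult_iff)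
 qed
 have S': "{C \<in> orbits t V. 0 < real (card C) / real (card V)} = orbits t V"
  using t.card_in_orbits_pos card_V_pos by auto
 have xy: "x \<in> orbit t x" "y \<in> orbit t y" by (rule t.self_in_orbit)+
 have ne: "\<pi> j ~= orbit t x" "\<pi> j ~= orbit t y" if j: "0 < mass p j" "j ~= k" for j
 proof -
  have "\<pi> j \<inter> \<pi> k = {}" using disjoint_orbits \<pi>_in \<pi>_eq_iff j k by metis
  then show "\<pi> j ~= orbit t x" "\<pi> j ~= orbit t y" using xy sp(4)[OF i0] by blast+
 qed
 have ne2: "orbit t x ~= orbit t y" using sp(5)[OF i0] xy by blast
 have "bij_betw ?r (insert 0 (Suc ` {n. 0 < mass p n})) (orbits t V)"
  unfolding bij_betw_def
 proof
  show "inj_on ?r (insert 0 (Suc ` {n. 0 < mass p n}))"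
   using ne ne2 \<pi>_eq_iff by (auto simp: inj_on_def dest: sym)
  have 1: "orbits \<sigma> V - {\<pi> k} = \<pi> ` ({i. 0 < mass p i} - {k})"
   using \<pi>_surj \<pi>_in \<pi>_eq_iff k by auto
  have "?r ` (insert 0 (Suc ` {n. 0 < mass p n})) = insert (orbit t y) ((\<pi>(k := orbit t x)) ` {n. 0 < mass p n})"
   by (simp add: image_image del: fun_upd_apply)
  also have "(\<pi>(k := orbit t x)) ` {n. 0 < mass p n} = insert (orbit t x) (\<pi> ` ({i. 0 < mass p i} - {k}))"
   using k by (auto simp: image_iff)
  finally show "?r ` (insert 0 (Suc ` {n. 0 < mass p n})) = orbits t V"
   unfolding sp(1)[OF i0] 1 by (simp only: insert_commute)
 qed
 moreover have "?a n = real (card (?r n)) / real (card V)" if "0 < ?a n" for n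
 proof (cases n)
  case 0
  have "(1 - u) * mass p k = (real l - real i) / real (card V)"
   unfolding mass_\<pi>[OF k] u_def l_def[symmetric] using i by (simp add: l_def left_diff_distrib diff_divide_distrib)
  then show ?thesis using 0 sp(3)[OF i0] i by (simp add: l_def of_nat_diff)
 next
  case (Suc j)
  show ?thesis
  proof (cases "j = k")
   case True
   have "u * mass p k = real i / real (card V)"
    using i mass_\<pi>[OF k] unfolding u_def l_def by simp
   then show ?thesis using Suc True sp(2)[OF i0] by simp
  next
   case False
   then show ?thesis using Suc that mass_\<pi>[of j] by simp
  qed
 qed
 ultimately have "rearranged UNIV ?a = rearranged (orbits t V) (%C. real (card C) / real (card V))"
  by (intro rearranged_reindex[OF t.mass_family_orbits[OF V], where \<pi> = ?r]) (simp_all only: S S')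
 then show ?thesis by (simp add: split_mass_def cycle_masses_def t_def y_def u_def l_def)
qed

lemma finite_support: "finite {k. 0 < mass p k}"
 using \<pi> finite_orbits bij_betw_finite by metis

lemma sum_V_\<pi>: "sum g V = (\<Sum>k | 0 < mass p k. sum g (\<pi> k))"
 unfolding sum_orbits by (rule sum.reindex_bij_betw[OF \<pi>, symmetric])

lemma merge_masses_commute:
 assumes "0 < mass p k" "0 < mass p l" "k ~= l"
 shows "merge_masses k l p = merge_masses l k p"
proof -
 obtain x y where xy: "x \<in> \<pi> k" "y \<in> \<pi> l"
  using orbits_nonempty[OF \<pi>_in[OF assms(1)]] orbits_nonempty[OF \<pi>_in[OF assms(2)]] by auto
 then show ?thesis
  using cycle_masses_merge[OF assms xy] cycle_masses_merge[OF assms(2,1) _ xy(2,1)] assms(3)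
  by (simp add: transpose_commute)
qed

text \<open>For a uniform ordered pair, the first vertex lies in cycle \<open>k\<close> and the
  second in another cycle \<open>m\<close> with probability \<open>mass p k * mass p m\<close>; both
  orders together give the factor 2 of the merge part. If both lie in cycle \<open>k\<close>, the
  second is reached from the first after a uniform number of steps, and the mean is a Riemann sum
  for the split integral.\<close>

lemma split_merge_generator_approx:
 assumes "lipschitz_test f B L"
 shows "\<bar>(\<Sum>x\<in>V. \<Sum>y\<in>V. f (cycle_masses V (swp x y \<circ> \<sigma>)) - f p) / (real (card V))\<^sup>2
  - split_merge_generator f p\<bar> <= 2 * L / real (card V)"
proof -
 interpret lipschitz_test f B L by fact
 let ?K = "{k. 0 < mass p k}" and ?N = "real (card V)"
 let ?g = "%x y. f (cycle_masses V (swp x y \<circ> \<sigma>)) - f p"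
 define l where "l k = card (\<pi> k)" for k
 have N: "0 < ?N" using card_V_pos by simp
 have p: "mass p k = real (l k) / ?N" if "k \<in> ?K" for k using mass_\<pi> that by (simp add: l_def)
 have l0: "0 < l k" if "k \<in> ?K" for k using card_in_orbits_pos \<pi>_in that by (simp add: l_def)
 define R where "R k = (\<Sum>i<l k. f (split_mass k (real i / real (l k)) p) - f p) / real (l k)" for k
 have "(\<Sum>x\<in>V. \<Sum>y\<in>V. ?g x y) = (\<Sum>k\<in>?K. \<Sum>m\<in>?K. \<Sum>x\<in>\<pi> k. \<Sum>y\<in>\<pi> m. ?g x y)"
  unfolding sum_V_\<pi> by (intro sum.cong refl sum.swap)
 also have "... = (\<Sum>k\<in>?K. \<Sum>m\<in>?K. if k = m then real (l k) * (real (l k) * R k)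
   else real (l k) * (real (l m) * merge_term p k m))"
 proof (intro sum.cong refl)
  fix k m assume km: "k \<in> ?K" "m \<in> ?K"
  show "(\<Sum>x\<in>\<pi> k. \<Sum>y\<in>\<pi> m. ?g x y) = (if k = m then real (l k) * (real (l k) * R k)
   else real (l k) * (real (l m) * merge_term p k m))"
  proof (cases "k = m")
   case False
   have "(\<Sum>x\<in>\<pi> k. \<Sum>y\<in>\<pi> m. ?g x y) = (\<Sum>x\<in>\<pi> k. \<Sum>y\<in>\<pi> m. merge_term p k m)"
    by (intro sum.cong refl) (use cycle_masses_merge[of k m] km False in simp)
   then show ?thesis using False by (simp add: l_def)
  next
   case True
   have "(\<Sum>x\<in>\<pi> k. \<Sum>y\<in>\<pi> k. ?g x y) = (\<Sum>x\<in>\<pi> k. \<Sum>i<l k. f (split_mass k (real i / real (l k)) p) - f p)"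
   proof (intro sum.cong refl)
    fix x assume x: "x \<in> \<pi> k"
    have o: "\<pi> k = orbit \<sigma> x" using orbits_eq_orbit \<pi>_in km(1) x by blast
    have "(\<Sum>y\<in>\<pi> k. ?g x y) = (\<Sum>y\<in>(%i. (\<sigma> ^^ i) x) ` {..<l k}. ?g x y)"
     using funpow_orbit(1)[of x] by (simp add: o l_def)
    also have "... = (\<Sum>i<l k. ?g x ((\<sigma> ^^ i) x))"
     using funpow_orbit(2)[of x] by (subst sum.reindex) (auto simp: o l_def)
    also have "... = (\<Sum>i<l k. f (split_mass k (real i / real (l k)) p) - f p)"
     using cycle_masses_split[of k x] km x by (intro sum.cong refl) (simp add: l_def)
    finally show "(\<Sum>y\<in>\<pi> k. ?g x y) = (\<Sum>i<l k. f (split_mass k (real i / real (l k)) p) - f p)" .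
   qed
   also have "... = real (l k) * (real (l k) * R k)"
    using l0[OF km(1)] by (simp add: R_def l_def)
   finally show ?thesis using True by simp
  qed
 qed
 also have "... = (\<Sum>k\<in>?K. real (l k) * (real (l k) * R k)) + (\<Sum>k\<in>?K. \<Sum>m\<in>?K - {k}. real (l k) * (real (l m) * merge_term p k m))"
  unfolding sum.distrib[symmetric]
 proof (intro sum.cong refl)
  fix k assume k: "k \<in> ?K"
  show "(\<Sum>m\<in>?K. if k = m then real (l k) * (real (l k) * R k) else real (l k) * (real (l m) * merge_term p k m))
   = real (l k) * (real (l k) * R k) + (\<Sum>m\<in>?K - {k}. real (l k) * (real (l m) * merge_term p k m))"
   by (subst sum.remove[OF finite_support k]) (auto intro!: sum.cong)
 qed
 finally have "(\<Sum>x\<in>V. \<Sum>y\<in>V. ?g x y) / ?N\<^sup>2 = (\<Sum>k\<in>?K. real (l k) * (real (l k) * R k)) / ?N\<^sup>2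
   + (\<Sum>k\<in>?K. \<Sum>m\<in>?K - {k}. real (l k) * (real (l m) * merge_term p k m)) / ?N\<^sup>2"
  by (simp add: add_divide_distrib)
 also have "(\<Sum>k\<in>?K. real (l k) * (real (l k) * R k)) / ?N\<^sup>2 = (\<Sum>k\<in>?K. (mass p k)\<^sup>2 * R k)"
  unfolding sum_divide_distrib
 proof (intro sum.cong refl)
  fix k assume k: "k \<in> ?K"
  show "real (l k) * (real (l k) * R k) / ?N\<^sup>2 = (mass p k)\<^sup>2 * R k"
   unfolding p[OF k] by (simp add: power2_eq_square)
 qed
 also have "(\<Sum>k\<in>?K. \<Sum>m\<in>?K - {k}. real (l k) * (real (l m) * merge_term p k m)) / ?N\<^sup>2
   = (\<Sum>k\<in>?K. \<Sum>m\<in>?K - {k}. mass p k * mass p m * merge_term p k m)"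
  unfolding sum_divide_distrib
 proof (intro sum.cong refl)
  fix k m assume k: "k \<in> ?K" and "m \<in> ?K - {k}"
  then have m: "m \<in> ?K" by simp
  show "real (l k) * (real (l m) * merge_term p k m) / ?N\<^sup>2 = mass p k * mass p m * merge_term p k m"
   unfolding p[OF k] p[OF m] by (simp add: power2_eq_square)
 qed
 also have "... = 2 * (\<Sum>(k, m)\<in>{(k, m) \<in> ?K \<times> ?K. k < m}. mass p k * mass p m * merge_term p k m)" (is "_ = 2 * ?S")
 proof -
  let ?h = "%(k, m). mass p k * mass p m * merge_term p k m"
  have f1: "finite {(k, m) \<in> ?K \<times> ?K. k < m}" "finite {(k, m) \<in> ?K \<times> ?K. m < k}"
   by (rule finite_subset[OF _ finite_cartesian_product[OF finite_support finite_support]], auto)+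
  have "(\<Sum>k\<in>?K. \<Sum>m\<in>?K - {k}. mass p k * mass p m * merge_term p k m) = sum ?h (SIGMA k:?K. ?K - {k})"
   by (rule sum.Sigma) (use finite_support in auto)
  also have "(SIGMA k:?K. ?K - {k}) = {(k, m) \<in> ?K \<times> ?K. k < m} \<union> {(k, m) \<in> ?K \<times> ?K. m < k}" by auto
  also have "sum ?h ... = sum ?h {(k, m) \<in> ?K \<times> ?K. k < m} + sum ?h {(k, m) \<in> ?K \<times> ?K. m < k}"
   using f1 by (intro sum.union_disjoint) auto
  also have "sum ?h {(k, m) \<in> ?K \<times> ?K. m < k} = sum ?h {(k, m) \<in> ?K \<times> ?K. k < m}"
   by (rule sum.reindex_bij_witness[of _ "%(k, m). (m, k)" "%(k, m). (m, k)"])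
    (auto simp: merge_masses_commute)
  finally show ?thesis by simp
 qed
 finally have A: "(\<Sum>x\<in>V. \<Sum>y\<in>V. ?g x y) / ?N\<^sup>2 = (\<Sum>k\<in>?K. (mass p k)\<^sup>2 * R k) + 2 * ?S" .
 have "infsum (%(k, m). mass p k * mass p m * merge_term p k m) {(i, j). i < j}
   = infsum (%(k, m). mass p k * mass p m * merge_term p k m) {(k, m) \<in> ?K \<times> ?K. k < m}"
  by (rule infsum_cong_neutral) (use mass_nonneg[of p] in \<open>auto simp: order_less_le\<close>)
 also have "... = ?S"
  by (rule infsum_finite, rule finite_subset[OF _ finite_cartesian_product[OF finite_support finite_support]]) auto
 finally have 1: "infsum (%(k, m). mass p k * mass p m * merge_term p k m) {(i, j). i < j} = ?S" .
 have 2: "(\<Sum>i. (mass p i)\<^sup>2 * split_term p i) = (\<Sum>k\<in>?K. (mass p k)\<^sup>2 * split_term p k)"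
  by (rule suminf_finite[OF finite_support]) (use mass_nonneg[of p] in \<open>auto simp: order_less_le\<close>)
 have "\<bar>(\<Sum>k\<in>?K. (mass p k)\<^sup>2 * R k) - (\<Sum>k\<in>?K. (mass p k)\<^sup>2 * split_term p k)\<bar>
   = \<bar>\<Sum>k\<in>?K. (mass p k)\<^sup>2 * (R k - split_term p k)\<bar>"
  by (simp add: sum_subtractf right_diff_distrib)
 also have "... <= (\<Sum>k\<in>?K. \<bar>(mass p k)\<^sup>2 * (R k - split_term p k)\<bar>)" by (rule sum_abs)
 also have "... <= (\<Sum>k\<in>?K. mass p k * (2 * L / ?N))"
 proof (intro sum_mono)
  fix k assume k: "k \<in> ?K"
  \<comment> \<open>The Lipschitz constant in \<open>u\<close> is proportional to the length of the
    cycle and the mesh is inversely proportional to it, so the error is the same for all cycles; the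
    squared masses that weigh it sum to at most 1.\<close>
  have "\<bar>R k - split_term p k\<bar> <= (L * (2 * mass p k)) / real (l k)"
   unfolding R_def
  proof (rule riemann_sum_unit[OF _ split_integrable l0[OF k]])
   fix u v :: real assume "0 <= u" "u <= 1" "0 <= v" "v <= 1"
   then show "\<bar>f (split_mass k u p) - f p - (f (split_mass k v p) - f p)\<bar> <= L * (2 * mass p k) * \<bar>u - v\<bar>"
    using lip_le[OF dist_split_mass_arg_le, of u v k p] by (simp add: mult_ac)
  qed
  also have "... = 2 * L / ?N" using p[OF k] l0[OF k] by simp
  finally have "\<bar>R k - split_term p k\<bar> <= 2 * L / ?N" .
  then have "(mass p k)\<^sup>2 * \<bar>R k - split_term p k\<bar> <= mass p k * (2 * L / ?N)"
   by (intro mult_mono mass_sq_le mass_nonneg) auto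
  then show "\<bar>(mass p k)\<^sup>2 * (R k - split_term p k)\<bar> <= mass p k * (2 * L / ?N)"
   by (simp only: abs_mult abs_power2)
 qed
 also have "... = (\<Sum>k\<in>?K. mass p k) * (2 * L / ?N)" by (rule sum_distrib_right[symmetric])
 also have "... <= 1 * (2 * L / ?N)"
  using L_nonneg by (intro mult_right_mono sum_mass_le_1 finite_support) auto
 finally show ?thesis unfolding A split_merge_generator_def 1 2 by simp
qed

end

lemma split_merge_generator_cycle_masses:
 assumes "V ~= {}" "lipschitz_test f B L"
 shows "\<bar>(\<Sum>x\<in>V. \<Sum>y\<in>V. f (cycle_masses V (swp x y \<circ> \<sigma>))) / (real (card V))\<^sup>2
  - (f (cycle_masses V \<sigma>) + split_merge_generator f (cycle_masses V \<sigma>))\<bar> <= 2 * L / real (card V)"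
proof -
 have cV: "0 < real (card V)" using assms(1) fin by (simp add: card_gt_0_iff)
 have "{C \<in> orbits \<sigma> V. 0 < real (card C) / real (card V)} = orbits \<sigma> V"
  using card_in_orbits_pos cV by auto
 then obtain \<pi> where \<pi>: "bij_betw \<pi> {k. 0 < mass (cycle_masses V \<sigma>) k} (orbits \<sigma> V)"
  "!!k. 0 < mass (cycle_masses V \<sigma>) k ==> mass (cycle_masses V \<sigma>) k = real (card (\<pi> k)) / real (card V)"
  using rearranges_rearranged[OF mass_family_orbits[OF assms(1)]]
  unfolding rearranges_def cycle_masses_def by auto
 have "(\<Sum>x\<in>V. \<Sum>y\<in>V. f (cycle_masses V (swp x y \<circ> \<sigma>)) - f (cycle_masses V \<sigma>)) / (real (card V))\<^sup>2
  = (\<Sum>x\<in>V. \<Sum>y\<in>V. f (cycle_masses V (swp x y \<circ> \<sigma>))) / (real (card V))\<^sup>2 - f (cycle_masses V \<sigma>)"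
  using cV by (simp add: sum_subtractf power2_eq_square diff_divide_distrib)
 then show ?thesis
  using split_merge_generator_approx[OF assms(1) \<pi> assms(2)] by simp
qed

end

section \<open>Cycle types of uniform permutations\<close>

definition cycle_type :: "('v => 'v) => 'v set => nat multiset" where
 "cycle_type \<sigma> V = image_mset card (mset_set (orbits \<sigma> V))"

text \<open>
 The Chinese restaurant transition: a new element starts its own cycle or is inserted next to one
 of the old elements.
\<close>

definition crp_step :: "(nat multiset => ennreal) => nat multiset => ennreal" where
 "crp_step F \<pi> = F (add_mset 1 \<pi>) + (\<Sum>c\<in>#\<pi>. of_nat c * F (add_mset (Suc c) (\<pi> - {#c#})))"

text \<open>Recursion on the last arrival, with \<open>F\<close> transported backwards. Values in
  \<open>ennreal\<close> make all sums and interchanges unconditional;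
  \<open>sum_cycle_type_permutes\<close> identifies the result as a mean over uniform
  permutations.\<close>

fun crp_mean :: "nat => (nat multiset => ennreal) => ennreal" where
 "crp_mean 0 F = F {#}"
| "crp_mean (Suc n) F = crp_mean n (crp_step F) / of_nat (Suc n)"

context finite_perm
begin

lemma orbits_insert:
 assumes "v \<notin> V"
 shows "orbits \<sigma> (insert v V) = insert {v} (orbits \<sigma> V)" "{v} \<notin> orbits \<sigma> V" "orbit \<sigma> v = {v}"
proof -
 show o: "orbit \<sigma> v = {v}"
  using perm assms by (simp add: orbit_eq_singleton_iff permutes_not_in)
 then show "orbits \<sigma> (insert v V) = insert {v} (orbits \<sigma> V)" by (simp add: orbits_def)
 show "{v} \<notin> orbits \<sigma> V" using Union_orbits assms by blast
qed

lemma cycle_type_insert_fixed: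
 assumes "v \<notin> V"
 shows "cycle_type \<sigma> (insert v V) = add_mset 1 (cycle_type \<sigma> V)"
 unfolding cycle_type_def orbits_insert(1)[OF assms] using orbits_insert(2)[OF assms] finite_orbits by simp

text \<open>\<open>\<sigma>\<close> fixes \<open>v\<close>, so this is the merging of the cycle
  \<open>{v}\<close> with the cycle of \<open>u\<close>.\<close>

lemma cycle_type_insert:
 assumes "v \<notin> V" "u \<in> V"
 shows "cycle_type (swp v u \<circ> \<sigma>) (insert v V)
  = add_mset (Suc (card (orbit \<sigma> u))) (cycle_type \<sigma> V - {#card (orbit \<sigma> u)#})"
proof -
 let ?D = "orbit \<sigma> u" and ?O = "orbits \<sigma> V"
 interpret i: finite_perm "insert v V" \<sigma>
  using fin perm by unfold_locales (auto intro: permutes_imp_permutes_insert)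
 have D: "?D \<in> ?O" using assms(2) by (auto simp: orbits_def)
 have vD: "v \<notin> ?D" using orbit_subset_V[OF assms(2)] assms(1) by auto
 have ov: "orbit \<sigma> v = {v}" by (rule orbits_insert(3)[OF assms(1)])
 have "u \<notin> orbit \<sigma> v" using ov assms by auto
 then have "orbits (swp v u \<circ> \<sigma>) (insert v V)
   = insert (orbit \<sigma> v \<union> ?D) (orbits \<sigma> (insert v V) - {orbit \<sigma> v, ?D})"
  using assms(2) by (intro i.orbits_merge) auto
 also have "... = insert (insert v ?D) (?O - {?D})"
  unfolding ov orbits_insert(1)[OF assms(1)] using orbits_insert(2)[OF assms(1)] by auto
 finally have "cycle_type (swp v u \<circ> \<sigma>) (insert v V)
   = image_mset card (mset_set (insert (insert v ?D) (?O - {?D})))" by (simp add: cycle_type_def)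
 also have "insert v ?D \<notin> ?O - {?D}" using Union_orbits assms(1) by blast
 then have "mset_set (insert (insert v ?D) (?O - {?D})) = add_mset (insert v ?D) (mset_set ?O - {#?D#})"
  using finite_orbits D by (simp add: mset_set_Diff)
 also have "image_mset card ... = add_mset (Suc (card ?D)) (cycle_type \<sigma> V - {#card ?D#})"
  using vD finite_in_orbits[OF D] finite_orbits D
  by (simp add: cycle_type_def image_mset_Diff)
 finally show ?thesis .
qed

lemma sum_cycle_type:
 fixes G :: "nat => ennreal"
 shows "(\<Sum>u\<in>V. G (card (orbit \<sigma> u))) = (\<Sum>c\<in>#cycle_type \<sigma> V. of_nat c * G c)"
proof -
 have "(\<Sum>u\<in>V. G (card (orbit \<sigma> u))) = (\<Sum>C\<in>orbits \<sigma> V. \<Sum>u\<in>C. G (card (orbit \<sigma> u)))"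
  by (rule sum_orbits)
 also have "... = (\<Sum>C\<in>orbits \<sigma> V. of_nat (card C) * G (card C))"
 proof (intro sum.cong refl)
  fix C assume C: "C \<in> orbits \<sigma> V"
  have "(\<Sum>u\<in>C. G (card (orbit \<sigma> u))) = (\<Sum>u\<in>C. G (card C))"
   using orbits_eq_orbit[OF C] by (intro sum.cong) auto
  then show "(\<Sum>u\<in>C. G (card (orbit \<sigma> u))) = of_nat (card C) * G (card C)" by simp
 qed
 finally show ?thesis by (simp add: cycle_type_def sum_unfold_sum_mset image_mset.compositionality o_def)
qed

end

text \<open>A permutation of the larger set is determined by the image \<open>u\<close> of
  \<open>v\<close> and by the permutation of \<open>V\<close> that remains after composing with the
  transposition of \<open>v\<close> and \<open>u\<close>.\<close>

lemma sum_permutes_insert: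
 fixes F :: "('v => 'v) => 'b :: comm_monoid_add"
 assumes "finite V" "v \<notin> V"
 shows "(\<Sum>\<sigma> | \<sigma> permutes insert v V. F \<sigma>)
  = (\<Sum>\<sigma> | \<sigma> permutes V. \<Sum>u\<in>insert v V. F (swp v u \<circ> \<sigma>))"
proof -
 let ?A = "insert v V \<times> {\<sigma>. \<sigma> permutes V}"
 have inj: "inj_on (%(u, \<sigma>). swp v u \<circ> \<sigma>) ?A"
 proof (rule inj_onI, clarify)
  fix u w \<sigma> t assume a: "\<sigma> permutes V" "t permutes V"
   and eq: "swp v u \<circ> \<sigma> = swp v w \<circ> t"
  have "\<sigma> v = v" "t v = v" using a assms(2) by (auto simp: permutes_not_in)
  then have uw: "u = w" using fun_cong[OF eq, of v] by simp
  have "swp v u \<circ> (swp v u \<circ> \<sigma>)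
    = swp v u \<circ> (swp v u \<circ> t)" using eq uw by simp
  then show "u = w & \<sigma> = t" using uw by (simp add: fun_eq_iff)
 qed
 have "{\<sigma>. \<sigma> permutes insert v V} = (%(u, \<sigma>). swp v u \<circ> \<sigma>) ` ?A"
  unfolding permutes_insert by (rule arg_cong[where f = "(`) _"]) auto
 then have "(\<Sum>\<sigma> | \<sigma> permutes insert v V. F \<sigma>)
   = (\<Sum>(u, \<sigma>)\<in>?A. F (swp v u \<circ> \<sigma>))"
  using sum.reindex[OF inj, of F] by (simp add: split_beta o_def)
 also have "... = (\<Sum>u\<in>insert v V. \<Sum>\<sigma> | \<sigma> permutes V. F (swp v u \<circ> \<sigma>))"
  by (simp add: sum.cartesian_product)
 finally show ?thesis by (simp add: sum.swap[of _ "{\<sigma>. \<sigma> permutes V}"])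
qed

lemma sum_cycle_type_permutes:
 assumes "finite V"
 shows "(\<Sum>\<sigma> | \<sigma> permutes V. F (cycle_type \<sigma> V)) = fact (card V) * crp_mean (card V) F"
 using assms
proof (induction V arbitrary: F rule: finite_induct)
 case empty
 have "{\<sigma>. \<sigma> permutes ({} :: 'a set)} = {id}" by auto
 then show ?case by (simp add: cycle_type_def orbits_def)
next
 case (insert v V)
 have "(\<Sum>\<sigma> | \<sigma> permutes insert v V. F (cycle_type \<sigma> (insert v V)))
   = (\<Sum>\<sigma> | \<sigma> permutes V. \<Sum>u\<in>insert v V. F (cycle_type (swp v u \<circ> \<sigma>) (insert v V)))"
  by (rule sum_permutes_insert[OF insert.hyps])
 also have "... = (\<Sum>\<sigma> | \<sigma> permutes V. crp_step F (cycle_type \<sigma> V))"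
 proof (intro sum.cong refl)
  fix \<sigma> :: "'a => 'a" assume "\<sigma> \<in> {\<sigma>. \<sigma> permutes V}"
  then interpret finite_perm V \<sigma> using insert.hyps by unfold_locales auto
  have "(\<Sum>u\<in>insert v V. F (cycle_type (swp v u \<circ> \<sigma>) (insert v V)))
    = F (add_mset 1 (cycle_type \<sigma> V))
     + (\<Sum>u\<in>V. F (cycle_type (swp v u \<circ> \<sigma>) (insert v V)))"
   using insert.hyps by (simp add: cycle_type_insert_fixed)
  also have "(\<Sum>u\<in>V. F (cycle_type (swp v u \<circ> \<sigma>) (insert v V)))
    = (\<Sum>u\<in>V. F (add_mset (Suc (card (orbit \<sigma> u))) (cycle_type \<sigma> V - {#card (orbit \<sigma> u)#})))"
   using insert.hyps by (intro sum.cong refl) (simp add: cycle_type_insert)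
  also have "... = (\<Sum>c\<in>#cycle_type \<sigma> V. of_nat c * F (add_mset (Suc c) (cycle_type \<sigma> V - {#c#})))"
   by (rule sum_cycle_type)
  finally show "(\<Sum>u\<in>insert v V. F (cycle_type (swp v u \<circ> \<sigma>) (insert v V)))
    = crp_step F (cycle_type \<sigma> V)" unfolding crp_step_def .
 qed
 also have "... = fact (card V) * crp_mean (card V) (crp_step F)" by (rule insert.IH)
 also have "... = fact (card (insert v V)) * crp_mean (card (insert v V)) F"
 proof -
  have "fact (Suc m) * (x / of_nat (Suc m)) = fact m * x" for x :: ennreal and m
  proof -
   have "fact (Suc m) * (x / of_nat (Suc m)) = fact m * (of_nat (Suc m) * (x / of_nat (Suc m)))"
    by (simp add: mult_ac)
   also have "of_nat (Suc m) * (x / of_nat (Suc m)) = x"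
    by (metis ennreal_mult_divide_eq ennreal_of_nat_neq_top ennreal_times_divide mult.commute of_nat_eq_0_iff nat.distinct(2))
   finally show ?thesis .
  qed
  then show ?thesis using insert.hyps by simp
 qed
 finally show ?case .
qed

subsection \<open>The discrete Mecke equation\<close>

lemma crp_step_add: "crp_step (%\<pi>. F \<pi> + G \<pi>) = (%\<pi>. crp_step F \<pi> + crp_step G \<pi>)"
 by (rule ext) (simp add: crp_step_def distrib_left sum_mset.distrib add_ac)

lemma crp_step_cmult: "crp_step (%\<pi>. k * F \<pi>) = (%\<pi>. k * crp_step F \<pi>)"
 by (rule ext) (simp add: crp_step_def distrib_left sum_mset_distrib_left mult.left_commute)

lemma crp_mean_add: "crp_mean n (%\<pi>. F \<pi> + G \<pi>) = crp_mean n F + crp_mean n G"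
 by (induction n arbitrary: F G) (simp_all add: crp_step_add add_divide_distrib_ennreal)

lemma crp_mean_cmult: "crp_mean n (%\<pi>. k * F \<pi>) = k * crp_mean n F"
 by (induction n arbitrary: F) (simp_all add: crp_step_cmult ennreal_times_divide)

text \<open>
 Size biasing: a cycle chosen with probability proportional to its length leaves behind a uniform
 permutation of the remaining elements.
\<close>

lemma crp_mean_size_biased:
 "crp_mean n (%\<pi>. \<Sum>c\<in>#\<pi>. of_nat c * \<Phi> c (\<pi> - {#c#})) = (\<Sum>j=1..n. crp_mean (n - j) (\<Phi> j))"
proof (induction n arbitrary: \<Phi>)
 case (Suc n)
 let ?F = "%\<Phi> \<pi>. \<Sum>c\<in>#\<pi>. of_nat c * \<Phi> c (\<pi> - {#c#}) :: ennreal"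
 \<comment> \<open>The arrival is itself the marked cycle, or it leaves the marked cycle alone and
   acts on the rest, or it enlarges the marked cycle; these are the three terms.\<close>
 have step: "crp_step (?F \<Phi>) \<pi> = \<Phi> 1 \<pi> + (?F (%c. crp_step (\<Phi> c)) \<pi> + ?F (%c \<pi>. of_nat (Suc c) * \<Phi> (Suc c) \<pi>) \<pi>)" for \<pi>
 proof -
  have A: "?F \<Phi> (add_mset 1 \<pi>) = \<Phi> 1 \<pi> + (\<Sum>c\<in>#\<pi>. of_nat c * \<Phi> c (add_mset 1 (\<pi> - {#c#})))"
   by (auto intro!: arg_cong[where f = sum_mset] image_mset_cong simp: multi_member_split)
  have B: "?F \<Phi> (add_mset (Suc c) (\<pi> - {#c#})) = of_nat (Suc c) * \<Phi> (Suc c) (\<pi> - {#c#})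
    + (\<Sum>b\<in>#\<pi> - {#c#}. of_nat b * \<Phi> b (add_mset (Suc c) (\<pi> - {#c#} - {#b#})))" for c
   by (auto intro!: arg_cong[where f = sum_mset] image_mset_cong simp: multi_member_split)
  \<comment> \<open>The marked cycle and the one that grows exchange their roles, which is a
    symmetry of sums over ordered pairs of distinct occurrences.\<close>
  have C: "(\<Sum>c\<in>#\<pi>. \<Sum>b\<in>#\<pi> - {#c#}. H c b) = (\<Sum>c\<in>#\<pi>. \<Sum>b\<in>#\<pi> - {#c#}. H b c)" for H :: "nat => nat => ennreal"
  proof (induction \<pi>)
   case (add x \<pi>)
   have 1: "(\<Sum>c\<in>#add_mset x \<pi>. \<Sum>b\<in>#add_mset x \<pi> - {#c#}. H c b)
     = (\<Sum>b\<in>#\<pi>. H x b) + ((\<Sum>c\<in>#\<pi>. H c x) + (\<Sum>c\<in>#\<pi>. \<Sum>b\<in>#\<pi> - {#c#}. H c b))" for H :: "nat => nat => ennreal"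
   proof -
    have "(\<Sum>c\<in>#\<pi>. \<Sum>b\<in>#add_mset x \<pi> - {#c#}. H c b) = (\<Sum>c\<in>#\<pi>. H c x + (\<Sum>b\<in>#\<pi> - {#c#}. H c b))"
     by (rule arg_cong[where f = sum_mset], rule image_mset_cong) (auto simp: multi_member_split)
    then show ?thesis by (simp add: sum_mset.distrib)
   qed
   show ?case unfolding 1 add by (simp add: add_ac)
  qed simp
  have "crp_step (?F \<Phi>) \<pi> = \<Phi> 1 \<pi> + (\<Sum>c\<in>#\<pi>. of_nat c * \<Phi> c (add_mset 1 (\<pi> - {#c#})))
    + (\<Sum>c\<in>#\<pi>. of_nat c * (of_nat (Suc c) * \<Phi> (Suc c) (\<pi> - {#c#})))
    + (\<Sum>c\<in>#\<pi>. \<Sum>b\<in>#\<pi> - {#c#}. of_nat c * (of_nat b * \<Phi> b (add_mset (Suc c) (\<pi> - {#c#} - {#b#}))))"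
   unfolding crp_step_def A B by (simp only: distrib_left sum_mset.distrib sum_mset_distrib_left add.assoc)
  also have "(\<Sum>c\<in>#\<pi>. \<Sum>b\<in>#\<pi> - {#c#}. of_nat c * (of_nat b * \<Phi> b (add_mset (Suc c) (\<pi> - {#c#} - {#b#}))))
    = (\<Sum>c\<in>#\<pi>. \<Sum>b\<in>#\<pi> - {#c#}. of_nat c * (of_nat b * \<Phi> c (add_mset (Suc b) (\<pi> - {#c#} - {#b#}))))"
   by (subst C) (simp add: mult.left_commute diff_diff_add_mset add_mset_commute)
  also have "\<Phi> 1 \<pi> + (\<Sum>c\<in>#\<pi>. of_nat c * \<Phi> c (add_mset 1 (\<pi> - {#c#})))
    + (\<Sum>c\<in>#\<pi>. of_nat c * (of_nat (Suc c) * \<Phi> (Suc c) (\<pi> - {#c#}))) + ...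
   = \<Phi> 1 \<pi> + (?F (%c. crp_step (\<Phi> c)) \<pi> + ?F (%c \<pi>. of_nat (Suc c) * \<Phi> (Suc c) \<pi>) \<pi>)"
   unfolding crp_step_def by (simp only: distrib_left sum_mset.distrib sum_mset_distrib_left add_ac)
  finally show ?thesis .
 qed
 have n: "of_nat (Suc n) ~= (0::ennreal)" "of_nat (Suc n) ~= (\<top>::ennreal)"
  by (simp_all del: of_nat_Suc)
 \<comment> \<open>The denominator in the definition of \<open>crp_mean\<close> comes out as the
   weight \<open>Suc n - j\<close>. The enlarged marked cycles contribute the weight
   \<open>j\<close>, so that every \<open>j\<close> ends up with the total weight
   \<open>Suc n\<close>.\<close>
 have S: "crp_mean (n - j) (crp_step (\<Phi> j)) = of_nat (Suc n - j) * crp_mean (Suc n - j) (\<Phi> j)" if "j <= n" for j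
 proof -
  have "Suc n - j = Suc (n - j)" using that by simp
  then show ?thesis
   by (simp del: of_nat_Suc add: ennreal_times_divide[symmetric])
     (metis ennreal_mult_divide_eq ennreal_of_nat_neq_top ennreal_times_divide mult.commute of_nat_eq_0_iff nat.distinct(2))
 qed
 have "crp_mean n (crp_step (?F \<Phi>)) = crp_mean n (\<Phi> 1)
   + ((\<Sum>j=1..n. crp_mean (n - j) (crp_step (\<Phi> j))) + (\<Sum>j=1..n. crp_mean (n - j) (%\<pi>. of_nat (Suc j) * \<Phi> (Suc j) \<pi>)))"
  using Suc.IH[of "%c. crp_step (\<Phi> c)"] Suc.IH[of "%c \<pi>. of_nat (Suc c) * \<Phi> (Suc c) \<pi>"]
  by (simp only: ext[OF step, of "%\<pi>. \<pi>"] crp_mean_add)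
 also have "(\<Sum>j=1..n. crp_mean (n - j) (crp_step (\<Phi> j))) = (\<Sum>j=1..Suc n. of_nat (Suc n - j) * crp_mean (Suc n - j) (\<Phi> j))"
  using S by simp
 also have "crp_mean n (\<Phi> 1) + (... + (\<Sum>j=1..n. crp_mean (n - j) (%\<pi>. of_nat (Suc j) * \<Phi> (Suc j) \<pi>)))
   = (\<Sum>j=1..Suc n. of_nat (Suc n - j) * crp_mean (Suc n - j) (\<Phi> j)) + (\<Sum>j=1..Suc n. of_nat j * crp_mean (Suc n - j) (\<Phi> j))"
 proof -
  have "(\<Sum>j=1..Suc n. of_nat j * crp_mean (Suc n - j) (\<Phi> j)) = (\<Sum>j=0..n. of_nat (Suc j) * crp_mean (n - j) (\<Phi> (Suc j)))"
   using sum.shift_bounds_cl_Suc_ivl[of "%j. of_nat j * crp_mean (Suc n - j) (\<Phi> j)" 0 n] by (simp del: of_nat_Suc)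
  also have "... = crp_mean n (\<Phi> 1) + (\<Sum>j=1..n. crp_mean (n - j) (%\<pi>. of_nat (Suc j) * \<Phi> (Suc j) \<pi>))"
   unfolding crp_mean_cmult by (subst sum.atLeast_Suc_atMost) simp_all
  finally show ?thesis by (simp only: add_ac)
 qed
 also have "... = (\<Sum>j=1..Suc n. of_nat (Suc n) * crp_mean (Suc n - j) (\<Phi> j))"
  unfolding sum.distrib[symmetric] distrib_right[symmetric]
  by (intro sum.cong refl) (auto simp flip: of_nat_add)
 also have "... = of_nat (Suc n) * (\<Sum>j=1..Suc n. crp_mean (Suc n - j) (\<Phi> j))"
  by (simp only: sum_distrib_left)
 finally show ?case
  unfolding crp_mean.simps by (simp only: mult.commute[of "of_nat (Suc n)"] ennreal_mult_divide_eq[OF n])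
qed simp

section \<open>A uniform permutation of a geometric number of elements\<close>

definition cycle_type_pmf :: "nat => nat multiset pmf" where
 "cycle_type_pmf n = map_pmf (%\<sigma>. cycle_type \<sigma> {..<n}) (pmf_of_set {\<sigma>. \<sigma> permutes {..<n}})"

text \<open>The Shepp--Lloyd randomisation: when the number of elements is \<open>n\<close> with
  probability \<open>z ^ n * (1 - z)\<close>, the numbers of cycles of the various lengths become
  independent.\<close>

definition geo_cycle_type_pmf :: "real => nat multiset pmf" where
 "geo_cycle_type_pmf z = bind_pmf (geometric_pmf (1 - z)) cycle_type_pmf"

lemma nn_integral_uniform_cycle_type:
 assumes "finite V"
 shows "(\<integral>\<^sup>+s. F (cycle_type s V) \<partial>(pmf_of_set {s. s permutes V})) = crp_mean (card V) F"
proof -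
 have ne: "{s. s permutes V} ~= {}" using permutes_id by blast
 have f: "(fact (card V) :: ennreal) = of_nat (fact (card V))" by (simp only: of_nat_fact)
 have "(\<integral>\<^sup>+s. F (cycle_type s V) \<partial>(pmf_of_set {s. s permutes V}))
   = (\<Sum>s | s permutes V. F (cycle_type s V)) / of_nat (card {s. s permutes V})"
  by (simp only: nn_integral_pmf_of_set[OF ne finite_permutations[OF assms]] ennreal_of_nat_eq_real_of_nat)
 also have "... = crp_mean (card V) F * fact (card V) / fact (card V)"
  unfolding sum_cycle_type_permutes[OF assms] card_permutations[OF refl assms] f
  by (simp only: mult.commute)
 also have "... = crp_mean (card V) F"
 proof (rule ennreal_mult_divide_eq)
  show "fact (card V) ~= (0::ennreal)" unfolding f of_nat_eq_0_iff by (rule fact_nonzero)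
  show "fact (card V) ~= (\<top>::ennreal)" unfolding f by (rule ennreal_of_nat_neq_top)
 qed
 finally show ?thesis .
qed

lemma nn_integral_cycle_type_pmf: "(\<integral>\<^sup>+r. F r \<partial>(cycle_type_pmf n)) = crp_mean n F"
 using nn_integral_uniform_cycle_type[of "{..<n}" F] by (simp add: cycle_type_pmf_def)

lemma map_cycle_type_uniform:
 assumes "finite V"
 shows "map_pmf (%s. cycle_type s V) (pmf_of_set {s. s permutes V}) = cycle_type_pmf (card V)"
proof (rule pmf_eqI)
 let ?u = "(map_pmf (%s. cycle_type s V) (pmf_of_set {s. s permutes V}))"
 fix r
 have "ennreal (pmf p r) = (\<integral>\<^sup>+x. indicator {r} x \<partial>p)" for p :: "nat multiset pmf"
  by (simp add: emeasure_pmf_single)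
 then have "ennreal (pmf ?u r)
   = ennreal (pmf (cycle_type_pmf (card V)) r)"
  using nn_integral_uniform_cycle_type[OF assms, where F = "indicator {r}"]
   nn_integral_cycle_type_pmf[where F = "indicator {r}" and n = "card V"]
  by (simp only: nn_integral_map_pmf)
 then show "pmf ?u r = pmf (cycle_type_pmf (card V)) r"
  by simp
qed

lemma sum_mset_cycle_type_pmf:
 assumes "r \<in> set_pmf (cycle_type_pmf n)"
 shows "sum_mset r = n"
proof -
 have ne: "{s. s permutes {..<n}} ~= {}" using permutes_id by blast
 obtain s where s: "s permutes {..<n}" "r = cycle_type s {..<n}"
  using assms set_pmf_of_set[OF ne finite_permutations] by (auto simp: cycle_type_pmf_def)
 interpret finite_perm "{..<n}" s using s by unfold_locales auto
 show ?thesis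
  using sum_card_orbits by (simp add: s(2) cycle_type_def sum_unfold_sum_mset)
qed

context
 fixes z :: real
 assumes z: "0 < z" "z < 1"
begin

lemma nn_integral_geo_cycle_type:
 "(\<integral>\<^sup>+r. F r \<partial>(geo_cycle_type_pmf z))
  = (\<integral>\<^sup>+n. ennreal (z ^ n * (1 - z)) * crp_mean n F \<partial>count_space UNIV)"
proof -
 have "0 < 1 - z" "1 - z <= 1" using z by auto
 then show ?thesis
  unfolding geo_cycle_type_pmf_def nn_integral_bind_pmf nn_integral_cycle_type_pmf
  by (subst nn_integral_measure_pmf) simp
qed

text \<open>Removing a cycle of length \<open>j\<close> shifts the number of elements from
  \<open>n\<close> to \<open>n - j\<close>, and geometric weights reproduce themselves under this
  shift up to the factor \<open>z ^ j\<close>. After division by the size bias this is the Mecke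
  equation with intensity \<open>z ^ j / j\<close>.\<close>

lemma mecke_geo_cycle_type:
 "(\<integral>\<^sup>+r. (\<Sum>c\<in>#r. of_nat c * \<Phi> c (r - {#c#})) \<partial>(geo_cycle_type_pmf z))
  = (\<integral>\<^sup>+j. ennreal (z ^ j) * (\<integral>\<^sup>+r. \<Phi> j r \<partial>(geo_cycle_type_pmf z)) \<partial>count_space {1..})"
proof -
 let ?w = "%n. ennreal (z ^ n * (1 - z))"
 have "(\<integral>\<^sup>+r. (\<Sum>c\<in>#r. of_nat c * \<Phi> c (r - {#c#})) \<partial>(geo_cycle_type_pmf z))
   = (\<integral>\<^sup>+n. ?w n * (\<Sum>j=1..n. crp_mean (n - j) (\<Phi> j)) \<partial>count_space UNIV)"
  unfolding nn_integral_geo_cycle_type crp_mean_size_biased ..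
 also have "... = (\<integral>\<^sup>+n. (\<integral>\<^sup>+j. (if j <= n then ?w n * crp_mean (n - j) (\<Phi> j) else 0) \<partial>count_space {1..}) \<partial>count_space UNIV)"
 proof (rule nn_integral_cong)
  fix n
  have "?w n * (\<Sum>j=1..n. crp_mean (n - j) (\<Phi> j)) = (\<integral>\<^sup>+j. ?w n * crp_mean (n - j) (\<Phi> j) \<partial>count_space {1..n})"
   by (simp add: nn_integral_count_space_finite sum_distrib_left)
  also have "... = (\<integral>\<^sup>+j. (if j <= n then ?w n * crp_mean (n - j) (\<Phi> j) else 0) \<partial>count_space {1..n})"
   by (rule nn_integral_cong) simp
  also have "... = (\<integral>\<^sup>+j. (if j <= n then ?w n * crp_mean (n - j) (\<Phi> j) else 0) \<partial>count_space {1..})"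
   by (rule nn_integral_count_space_eq) auto
  finally show "?w n * (\<Sum>j=1..n. crp_mean (n - j) (\<Phi> j))
   = (\<integral>\<^sup>+j. (if j <= n then ?w n * crp_mean (n - j) (\<Phi> j) else 0) \<partial>count_space {1..})" .
 qed
 also have "... = (\<integral>\<^sup>+j. (\<integral>\<^sup>+n. (if j <= n then ?w n * crp_mean (n - j) (\<Phi> j) else 0) \<partial>count_space UNIV) \<partial>count_space {1..})"
  by (rule nn_integral_count_space_nn_integral) auto
 also have "... = (\<integral>\<^sup>+j. ennreal (z ^ j) * (\<integral>\<^sup>+r. \<Phi> j r \<partial>(geo_cycle_type_pmf z)) \<partial>count_space {1..})"
 proof (rule nn_integral_cong)
  fix j :: nat
  have "(\<integral>\<^sup>+n. (if j <= n then ?w n * crp_mean (n - j) (\<Phi> j) else 0) \<partial>count_space UNIV)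
    = (\<integral>\<^sup>+n. (if j <= n then ?w n * crp_mean (n - j) (\<Phi> j) else 0) \<partial>count_space {j..})"
   by (rule nn_integral_count_space_eq) auto
  also have "... = (\<integral>\<^sup>+k. (if j <= k + j then ?w (k + j) * crp_mean (k + j - j) (\<Phi> j) else 0) \<partial>count_space UNIV)"
   by (rule nn_integral_bij_count_space[symmetric], rule bij_betwI[where g = "%n. n - j"]) auto
  also have "... = (\<integral>\<^sup>+k. ennreal (z ^ j) * (?w k * crp_mean k (\<Phi> j)) \<partial>count_space UNIV)"
   using z by (intro nn_integral_cong) (simp add: power_add ennreal_mult' mult_ac)
  also have "... = ennreal (z ^ j) * (\<integral>\<^sup>+r. \<Phi> j r \<partial>(geo_cycle_type_pmf z))"
   by (simp add: nn_integral_cmult nn_integral_geo_cycle_type)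
  finally show "(\<integral>\<^sup>+n. (if j <= n then ?w n * crp_mean (n - j) (\<Phi> j) else 0) \<partial>count_space UNIV)
   = ennreal (z ^ j) * (\<integral>\<^sup>+r. \<Phi> j r \<partial>(geo_cycle_type_pmf z))" .
 qed
 finally show ?thesis .
qed

end

text \<open>The value 0 outside \<open>{..<m}\<close> is the default value of the
  \<open>Pi_pmf\<close> with which the counts are compared.\<close>

definition class_counts :: "nat => (nat => nat set) => nat multiset => nat => nat" where
 "class_counts m A \<pi> l = (if l < m then size (filter_mset (%c. c \<in> A l) \<pi>) else 0)"

lemma class_counts_remove:
 assumes "c \<in># \<pi>" "c \<in> A l" "l < m" "disjoint_family_on A {..<m}"
 shows "class_counts m A (\<pi> - {#c#}) = (class_counts m A \<pi>)(l := class_counts m A \<pi> l - 1)"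
  and "0 < class_counts m A \<pi> l"
proof -
 obtain \<pi>' where \<pi>: "\<pi> = add_mset c \<pi>'" using assms(1) by (metis multi_member_split)
 have "c \<notin> A k" if "k < m" "k ~= l" for k
  using assms that by (auto simp: disjoint_family_on_def)
 then show "class_counts m A (\<pi> - {#c#}) = (class_counts m A \<pi>)(l := class_counts m A \<pi> l - 1)"
  using assms(2,3) by (auto simp: class_counts_def \<pi> fun_eq_iff)
 show "0 < class_counts m A \<pi> l" using assms(2,3) by (simp add: class_counts_def \<pi>)
qed

text \<open>This recursion characterises independent Poisson laws. It is the Mecke equation for the
  event that after the removal of a cycle with length in class \<open>l\<close> the counts are
  \<open>k\<close>: before the removal there is one more in class \<open>l\<close>, and
  \<open>Suc (k l)\<close> cycles are available for removal.\<close>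

lemma pmf_class_counts_step:
 assumes z: "0 < z" "z < (1::real)" and A: "!!l. l < m ==> finite (A l) & 0 \<notin> A l"
  and dis: "disjoint_family_on A {..<m}" and l: "l < m"
 defines "P \<equiv> map_pmf (class_counts m A) (geo_cycle_type_pmf z)"
 shows "real (Suc (k l)) * pmf P (k(l := Suc (k l))) = (\<Sum>j\<in>A l. z ^ j / real j) * pmf P k"
proof -
 let ?u = "(\<Sum>j\<in>A l. z ^ j / real j)"
 let ?G = "measure_pmf (geo_cycle_type_pmf z)" and ?cnt = "class_counts m A"
 let ?k = "k(l := Suc (k l))"
 have P: "ennreal (pmf P k) = (\<integral>\<^sup>+u. indicator {k} (?cnt u) \<partial>?G)" for k
 proof -
  have "ennreal (pmf P k) = emeasure ?G (?cnt -` {k})"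
   unfolding P_def by (simp add: emeasure_pmf_single[symmetric])
  also have "... = (\<integral>\<^sup>+u. indicator (?cnt -` {k}) u \<partial>?G)" by simp
  also have "... = (\<integral>\<^sup>+u. indicator {k} (?cnt u) \<partial>?G)"
   by (rule nn_integral_cong) (simp add: indicator_def)
  finally show ?thesis .
 qed
 \<comment> \<open>The factor \<open>1 / real c\<close> cancels the size bias; 0 belongs to no
   class, so the cancellation is legitimate.\<close>
 define \<Phi> where "\<Phi> c u = (if c \<in> A l then ennreal (1 / real c) * indicator {k} (?cnt u) else 0)" for c u
 have \<Phi>: "of_nat c * \<Phi> c u = (if c \<in> A l then indicator {k} (?cnt u) else 0)" for c u
 proof (cases "c \<in> A l")
  case True
  then have "c ~= 0" using A[OF l] by metis
  then have "of_nat c * ennreal (1 / real c) = 1"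
   by (simp add: ennreal_of_nat_eq_real_of_nat flip: ennreal_mult')
  then show ?thesis using True by (simp add: \<Phi>_def mult.assoc[symmetric])
 qed (simp add: \<Phi>_def)
 have "(\<Sum>c\<in>#u. of_nat c * \<Phi> c (u - {#c#})) = of_nat (Suc (k l)) * indicator {?k} (?cnt u)" for u
 proof -
  have "(\<Sum>c\<in>#u. of_nat c * \<Phi> c (u - {#c#})) = (\<Sum>c\<in>#u. if c \<in> A l then indicator {?k} (?cnt u) else 0)"
  proof (rule arg_cong[where f = sum_mset], rule image_mset_cong)
   fix c assume c: "c \<in># u"
   show "of_nat c * \<Phi> c (u - {#c#}) = (if c \<in> A l then indicator {?k} (?cnt u) else 0)"
   proof (cases "c \<in> A l")
    case True
    note r = class_counts_remove[OF c True l dis]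
    have "?cnt (u - {#c#}) = k \<longleftrightarrow> ?cnt u = ?k"
     unfolding r(1) using r(2) by (simp add: fun_eq_iff) (metis Suc_pred diff_Suc_1)
    then show ?thesis unfolding \<Phi> by (simp add: indicator_def)
   qed (simp add: \<Phi>)
  qed
  also have "... = of_nat (?cnt u l) * indicator {?k} (?cnt u)"
  proof -
   have "(\<Sum>c\<in>#u. if c \<in> A l then x else 0) = of_nat (size (filter_mset (%c. c \<in> A l) u)) * x" for x :: ennreal
    by (induction u) (auto simp: distrib_right)
   then show ?thesis using l by (simp add: class_counts_def)
  qed
  also have "... = of_nat (Suc (k l)) * indicator {?k} (?cnt u)"
   by (cases "?cnt u = ?k") (simp_all add: indicator_def)
  finally show ?thesis .
 qed
 then have "of_nat (Suc (k l)) * ennreal (pmf P ?k)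
   = (\<integral>\<^sup>+u. (\<Sum>c\<in>#u. of_nat c * \<Phi> c (u - {#c#})) \<partial>?G)"
  unfolding P by (simp add: nn_integral_cmult)
 also have "... = (\<integral>\<^sup>+j. ennreal (z ^ j) * (\<integral>\<^sup>+u. \<Phi> j u \<partial>?G) \<partial>count_space {1..})"
  by (rule mecke_geo_cycle_type[OF z])
 also have "... = (\<integral>\<^sup>+j. ennreal (z ^ j) * (\<integral>\<^sup>+u. \<Phi> j u \<partial>?G) \<partial>count_space (A l))"
 proof (rule nn_integral_count_space_eq)
  fix j assume "j \<in> A l - {1..}"
  then have "j = 0" "j \<in> A l" by auto
  then show "ennreal (z ^ j) * (\<integral>\<^sup>+u. \<Phi> j u \<partial>?G) = 0" using A[OF l] by simp
 qed (simp add: \<Phi>_def)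
 also have "... = (\<Sum>j\<in>A l. ennreal (z ^ j / real j) * ennreal (pmf P k))"
 proof -
  have "ennreal (z ^ j) * (\<integral>\<^sup>+u. \<Phi> j u \<partial>?G) = ennreal (z ^ j / real j) * ennreal (pmf P k)" if "j \<in> A l" for j
  proof -
   have "(\<integral>\<^sup>+u. \<Phi> j u \<partial>?G) = ennreal (1 / real j) * ennreal (pmf P k)"
    unfolding P \<Phi>_def using that by (simp add: nn_integral_cmult)
   moreover have "ennreal (z ^ j) * ennreal (1 / real j) = ennreal (z ^ j / real j)"
    using z by (subst ennreal_mult'[symmetric]) auto
   ultimately show ?thesis by (metis mult.assoc)
  qed
  then show ?thesis using A[OF l] by (simp add: nn_integral_count_space_finite)
 qed
 also have "... = (\<Sum>j\<in>A l. ennreal (z ^ j / real j)) * ennreal (pmf P k)"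
  by (rule sum_distrib_right[symmetric])
 also have "(\<Sum>j\<in>A l. ennreal (z ^ j / real j)) = ennreal ?u"
  using z by (intro sum_ennreal) auto
 also have "... * ennreal (pmf P k) = ennreal (?u * pmf P k)"
  using z by (intro ennreal_mult'[symmetric] sum_nonneg) auto
 finally have "ennreal (real (Suc (k l)) * pmf P ?k) = ennreal (?u * pmf P k)"
  by (simp add: ennreal_mult' ennreal_of_nat_eq_real_of_nat del: of_nat_Suc fun_upd_apply)
 then show ?thesis
  using z by (subst (asm) ennreal_inj) (auto intro!: mult_nonneg_nonneg sum_nonneg simp del: fun_upd_apply)
qed

lemma pmf_Pi_poisson_step:
 fixes m :: nat
 assumes "!!l. l < m ==> 0 < r l" "l < m"
 defines "Q \<equiv> Pi_pmf {..<m} 0 (%l. poisson_pmf (r l))"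
 shows "real (Suc (c l)) * pmf Q (c(l := Suc (c l))) = r l * pmf Q c"
proof (cases "\<forall>k. k \<notin> {..<m} --> c k = 0")
 case True
 let ?p = "%c k. pmf (poisson_pmf (r k)) (c k)"
 have 0: "real (Suc (c l)) * (r l ^ Suc (c l) / fact (Suc (c l))) = r l * (r l ^ c l / fact (c l))"
  by (simp add: field_simps del: of_nat_Suc)
 then have 1: "real (Suc (c l)) * pmf (poisson_pmf (r l)) (Suc (c l)) = r l * pmf (poisson_pmf (r l)) (c l)"
  unfolding pmf_poisson[OF assms(1)[OF assms(2)]] by (simp only: mult.assoc[symmetric] 0)
 have "pmf Q (c(l := Suc (c l))) = (\<Prod>k<m. ?p (c(l := Suc (c l))) k)"
  unfolding Q_def using True assms(2) by (intro pmf_Pi') auto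
 also have "... = pmf (poisson_pmf (r l)) (Suc (c l)) * (\<Prod>k\<in>{..<m} - {l}. ?p c k)"
  using assms(2) by (subst prod.remove[of _ l]) (auto intro!: prod.cong)
 finally have 2: "pmf Q (c(l := Suc (c l))) = pmf (poisson_pmf (r l)) (Suc (c l)) * (\<Prod>k\<in>{..<m} - {l}. ?p c k)" .
 have "pmf Q c = (\<Prod>k<m. ?p c k)"
  unfolding Q_def using True by (intro pmf_Pi') auto
 also have "... = pmf (poisson_pmf (r l)) (c l) * (\<Prod>k\<in>{..<m} - {l}. ?p c k)"
  using assms(2) by (subst prod.remove[of _ l]) auto
 finally show ?thesis unfolding 2 by (simp only: mult.assoc[symmetric] 1)
next
 case False
 then obtain k where "k \<notin> {..<m}" "c k ~= 0" by auto
 moreover from this have "(c(l := Suc (c l))) k ~= 0" using assms(2) by auto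
 ultimately have "pmf Q (c(l := Suc (c l))) = 0" "pmf Q c = 0"
  unfolding Q_def by (intro pmf_Pi_outside, simp, blast)+
 then show ?thesis by simp
qed

text \<open>By induction on the total count the recursion fixes all probabilities relative to the
  one at 0. Two laws that satisfy it are therefore proportional, hence equal.\<close>

lemma pmf_Pi_poissonI:
 fixes m :: nat
 assumes lam: "!!l. l < m ==> 0 < r l"
  and step: "!!\<kappa> l. l < m ==> real (Suc (\<kappa> l)) * pmf P (\<kappa>(l := Suc (\<kappa> l))) = r l * pmf P \<kappa>"
  and supp: "!!\<kappa>. \<kappa> \<in> set_pmf P ==> \<forall>l. l \<notin> {..<m} --> \<kappa> l = 0"
 shows "P = Pi_pmf {..<m} 0 (%l. poisson_pmf (r l))" (is "_ = ?Q")
proof -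
 have Q0: "0 < pmf ?Q (%_. 0)"
  using lam by (subst pmf_Pi') (auto intro!: prod_pos)
 define c where "c = pmf P (%_. 0) / pmf ?Q (%_. 0)"
 have main: "pmf P \<kappa> = c * pmf ?Q \<kappa>" if "\<forall>l. l \<notin> {..<m} --> \<kappa> l = 0" for \<kappa>
  using that
 proof (induction "\<Sum>l<m. \<kappa> l" arbitrary: \<kappa>)
  case 0
  then have "\<kappa> = (%_. 0)" by (auto simp: fun_eq_iff)
  then show ?case using Q0 by (simp add: c_def)
 next
  case (Suc s)
  then obtain l where l: "l < m" "0 < \<kappa> l"
   by (metis lessThan_iff not_gr_zero sum.neutral zero_less_Suc less_irrefl)
  define \<kappa>' where "\<kappa>' = \<kappa>(l := \<kappa> l - 1)"
  have \<kappa>: "\<kappa> = \<kappa>'(l := Suc (\<kappa>' l))" using l by (auto simp: \<kappa>'_def)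
  have "(\<Sum>l<m. \<kappa> l) = \<kappa> l + (\<Sum>k\<in>{..<m} - {l}. \<kappa> k)" using l by (intro sum.remove) auto
  moreover have "(\<Sum>l<m. \<kappa>' l) = \<kappa>' l + (\<Sum>k\<in>{..<m} - {l}. \<kappa>' k)" using l by (intro sum.remove) auto
  moreover have "(\<Sum>k\<in>{..<m} - {l}. \<kappa>' k) = (\<Sum>k\<in>{..<m} - {l}. \<kappa> k)"
   by (intro sum.cong) (auto simp: \<kappa>'_def)
  ultimately have "s = (\<Sum>l<m. \<kappa>' l)" using Suc.hyps(2) l by (simp add: \<kappa>'_def)
  moreover have "\<forall>l. l \<notin> {..<m} --> \<kappa>' l = 0" using Suc.prems by (auto simp: \<kappa>'_def)
  ultimately have IH: "pmf P \<kappa>' = c * pmf ?Q \<kappa>'" by (rule Suc.hyps(1))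
  have "real (Suc (\<kappa>' l)) * pmf P \<kappa> = r l * pmf P \<kappa>'" using step[OF l(1), of \<kappa>'] \<kappa> by metis
  also have "... = c * (r l * pmf ?Q \<kappa>')" by (simp add: IH)
  also have "... = c * (real (Suc (\<kappa>' l)) * pmf ?Q \<kappa>)"
   using pmf_Pi_poisson_step[of m r l \<kappa>', OF lam l(1)] \<kappa> by metis
  finally have "real (Suc (\<kappa>' l)) * pmf P \<kappa> = real (Suc (\<kappa>' l)) * (c * pmf ?Q \<kappa>)"
   by (simp only: mult_ac)
  then show ?case by (simp del: of_nat_Suc)
 qed
 have main': "pmf P \<kappa> = c * pmf ?Q \<kappa>" for \<kappa>
 proof (cases "\<forall>l. l \<notin> {..<m} --> \<kappa> l = 0")
  case False
  then have "pmf P \<kappa> = 0" using supp set_pmf_iff by metis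
  moreover have "pmf ?Q \<kappa> = 0" using False by (subst pmf_Pi) auto
  ultimately show ?thesis by simp
 qed (rule main)
 have c0: "0 <= c" using Q0 by (simp add: c_def)
 have "1 = (\<integral>\<^sup>+\<kappa>. ennreal (pmf P \<kappa>) \<partial>count_space UNIV)" by (simp add: nn_integral_pmf)
 also have "... = ennreal c * (\<integral>\<^sup>+\<kappa>. ennreal (pmf ?Q \<kappa>) \<partial>count_space UNIV)"
  unfolding main' using c0 by (simp add: ennreal_mult' nn_integral_cmult)
 also have "... = ennreal c" by (simp add: nn_integral_pmf)
 finally have "c = 1" by simp
 then show ?thesis using main' by (intro pmf_eqI) simp
qed

lemma class_counts_geo_cycle_type:
 assumes z: "0 < z" "z < (1::real)" and A: "!!l. l < m ==> finite (A l) & 0 \<notin> A l & A l ~= {}"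
  and dis: "disjoint_family_on A {..<m}"
 shows "map_pmf (class_counts m A) (geo_cycle_type_pmf z)
  = Pi_pmf {..<m} 0 (%l. poisson_pmf (\<Sum>j\<in>A l. z ^ j / real j))"
proof (rule pmf_Pi_poissonI)
 fix l assume l: "l < m"
 show "0 < (\<Sum>j\<in>A l. z ^ j / real j)"
  using A[OF l] z by (intro sum_pos) (auto intro!: divide_pos_pos Nat.gr0I)
 show "real (Suc (k l)) * pmf (map_pmf (class_counts m A) (geo_cycle_type_pmf z)) (k(l := Suc (k l)))
   = (\<Sum>j\<in>A l. z ^ j / real j) * pmf (map_pmf (class_counts m A) (geo_cycle_type_pmf z)) k" for k
  by (rule pmf_class_counts_step[OF z _ dis l]) (use A in auto)
qed (auto simp: class_counts_def)

section \<open>Lipschitz functionals of summable families\<close>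

text \<open>A divergent sum gets the value 0 from \<open>enn2real\<close>. Cutoffs vanish at 0, so
  families that are not summable are cut off together with those of small mass.\<close>

definition total_mass :: "'i set => ('i => real) => real" where
 "total_mass I a = enn2real (\<integral>\<^sup>+i. ennreal (a i) \<partial>count_space I)"

definition summable_family :: "'i set => ('i => real) => bool" where
 "summable_family I a \<longleftrightarrow> countable I & (\<forall>i\<in>I. 0 <= a i) & (\<integral>\<^sup>+i. ennreal (a i) \<partial>count_space I) < \<infinity>"

lemma total_mass_nonneg: "0 <= total_mass I a"
 by (simp add: total_mass_def)

lemma ennreal_total_mass:
 "summable_family I a ==> (\<integral>\<^sup>+i. ennreal (a i) \<partial>count_space I) = ennreal (total_mass I a)"
 by (simp add: summable_family_def total_mass_def)

lemma mass_family_normalized: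
 assumes "summable_family I a" "0 < total_mass I a"
 shows "mass_family I (%i. a i / total_mass I a)"
proof -
 let ?S = "total_mass I a"
 have "(\<integral>\<^sup>+i. ennreal (a i / ?S) \<partial>count_space I) = (\<integral>\<^sup>+i. ennreal (1 / ?S) * ennreal (a i) \<partial>count_space I)"
  using assms by (intro nn_integral_cong) (simp add: summable_family_def ennreal_mult'[symmetric])
 also have "... = ennreal (1 / ?S) * ennreal ?S"
  using assms by (simp add: nn_integral_cmult ennreal_total_mass)
 also have "... = 1" using assms(2) by (simp add: ennreal_mult'[symmetric])
 finally show ?thesis using assms by (simp add: mass_family_def summable_family_def)
qed

lemma total_mass_diff_le:
 assumes a: "summable_family I a" and b: "summable_family I b"
 shows "(\<integral>\<^sup>+i. ennreal \<bar>a i - b i\<bar> \<partial>count_space I) < \<infinity>"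
  and "\<bar>total_mass I a - total_mass I b\<bar> <= enn2real (\<integral>\<^sup>+i. ennreal \<bar>a i - b i\<bar> \<partial>count_space I)"
proof -
 let ?D = "\<integral>\<^sup>+i. ennreal \<bar>a i - b i\<bar> \<partial>count_space I"
 have nn: "!!i. i \<in> I ==> 0 <= a i" "!!i. i \<in> I ==> 0 <= b i" using a b by (auto simp: summable_family_def)
 have "?D <= (\<integral>\<^sup>+i. ennreal (a i) + ennreal (b i) \<partial>count_space I)"
 proof (rule nn_integral_mono)
  fix i assume "i \<in> space (count_space I)"
  then have "0 <= a i" "0 <= b i" using nn by auto
  then show "ennreal \<bar>a i - b i\<bar> <= ennreal (a i) + ennreal (b i)"
   by (simp add: ennreal_plus[symmetric] ennreal_leI del: ennreal_plus)
 qed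
 also have "... = ennreal (total_mass I a) + ennreal (total_mass I b)"
  using a b by (simp add: nn_integral_add ennreal_total_mass)
 finally show fin: "?D < \<infinity>" using ennreal_less_top by (auto simp: ennreal_plus[symmetric] total_mass_nonneg le_less_trans simp del: ennreal_plus)
 then have D: "?D = ennreal (enn2real ?D)" by simp
 have le: "total_mass I a <= total_mass I b + enn2real ?D"
  if "summable_family I a" "summable_family I b" "?D = (\<integral>\<^sup>+i. ennreal \<bar>a i - b i\<bar> \<partial>count_space I)" for a b
 proof -
  have "!!i. i \<in> I ==> 0 <= a i" "!!i. i \<in> I ==> 0 <= b i" using that by (auto simp: summable_family_def)
  then have "(\<integral>\<^sup>+i. ennreal (a i) \<partial>count_space I) <= (\<integral>\<^sup>+i. ennreal (b i) + ennreal \<bar>a i - b i\<bar> \<partial>count_space I)"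
   by (intro nn_integral_mono) (auto simp: ennreal_plus[symmetric] simp del: ennreal_plus intro!: ennreal_leI)
  also have "... = ennreal (total_mass I b) + ?D"
   using that by (simp add: nn_integral_add ennreal_total_mass)
  also have "... = ennreal (total_mass I b + enn2real ?D)"
   by (subst D) (simp add: total_mass_nonneg)
  finally have "ennreal (total_mass I a) <= ennreal (total_mass I b + enn2real ?D)"
   using that by (simp only: ennreal_total_mass)
  then show ?thesis by (subst (asm) ennreal_le_iff) (auto simp: total_mass_nonneg)
 qed
 have sym: "?D = (\<integral>\<^sup>+i. ennreal \<bar>b i - a i\<bar> \<partial>count_space I)" by (simp add: abs_minus_commute)
 show "\<bar>total_mass I a - total_mass I b\<bar> <= enn2real ?D"
  using le[OF a b refl] le[OF b a sym] by linarith
qed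

text \<open>Each positive value is carried by equally many indices on both sides; bijections between
  these finite fibres are glued together.\<close>

lemma fibre_bijection:
 assumes "!!v. 0 < v ==> finite {i\<in>I. a i = v} & finite {j\<in>J. b j = v} & card {i\<in>I. a i = v} = card {j\<in>J. b j = (v::real)}"
 obtains \<pi> where "bij_betw \<pi> {i\<in>I. 0 < a i} {j\<in>J. 0 < b j}" "!!i. i \<in> I ==> 0 < a i ==> a i = b (\<pi> i)"
proof -
 have "\<exists>h. 0 < v --> bij_betw h {i\<in>I. a i = v} {j\<in>J. b j = v}" for v
  using assms[of v] finite_same_card_bij by blast
 then obtain h where h: "!!v. 0 < v ==> bij_betw (h v) {i\<in>I. a i = v} {j\<in>J. b j = v}" by metis
 define \<pi> where "\<pi> i = h (a i) i" for i
 have in_J: "\<pi> i \<in> J & b (\<pi> i) = a i" if "i \<in> I" "0 < a i" for i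
  using bij_betwE[OF h[OF that(2)]] that unfolding \<pi>_def by auto
 have "bij_betw \<pi> {i\<in>I. 0 < a i} {j\<in>J. 0 < b j}"
  unfolding bij_betw_def
 proof
  show "inj_on \<pi> {i\<in>I. 0 < a i}"
  proof (rule inj_onI)
   fix i k assume ik: "i \<in> {i\<in>I. 0 < a i}" "k \<in> {i\<in>I. 0 < a i}" "\<pi> i = \<pi> k"
   then have "a i = a k" using in_J by (metis mem_Collect_eq)
   then show "i = k" using ik h[of "a i"] by (auto simp: \<pi>_def bij_betw_def inj_on_def)
  qed
  show "\<pi> ` {i\<in>I. 0 < a i} = {j\<in>J. 0 < b j}"
  proof (intro equalityI subsetI)
   fix j assume j: "j \<in> {j\<in>J. 0 < b j}"
   then have "j \<in> h (b j) ` {i\<in>I. a i = b j}" using bij_betw_imp_surj_on[OF h[of "b j"]] by auto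
   then obtain i where "i \<in> I" "a i = b j" "j = h (b j) i" by auto
   then show "j \<in> \<pi> ` {i\<in>I. 0 < a i}" using j by (intro image_eqI[of _ _ i]) (auto simp: \<pi>_def)
  qed (use in_J in auto)
 qed
 then show ?thesis using in_J that by metis
qed

lemma total_mass_cong:
 assumes "bij_betw \<pi> {i\<in>I. 0 < a i} {j\<in>J. 0 < b j}" "!!i. i \<in> I ==> 0 < a i ==> a i = b (\<pi> i)"
 shows "total_mass I a = total_mass J b"
proof -
 have "(\<integral>\<^sup>+i. ennreal (a i) \<partial>count_space I) = (\<integral>\<^sup>+i. ennreal (a i) \<partial>count_space {i\<in>I. 0 < a i})"
  by (rule nn_integral_count_space_eq) (auto simp: ennreal_neg)
 also have "... = (\<integral>\<^sup>+i. ennreal (b (\<pi> i)) \<partial>count_space {i\<in>I. 0 < a i})"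
  using assms(2) by (intro nn_integral_cong) auto
 also have "... = (\<integral>\<^sup>+j. ennreal (b j) \<partial>count_space {j\<in>J. 0 < b j})"
  by (rule nn_integral_bij_count_space[OF assms(1)])
 also have "... = (\<integral>\<^sup>+j. ennreal (b j) \<partial>count_space J)"
  by (rule nn_integral_count_space_eq) (auto simp: ennreal_neg)
 finally show ?thesis by (simp add: total_mass_def)
qed

text \<open>Normalising a family is not continuous near total mass 0. The cutoff \<open>g\<close>
  removes that region and leaves a function that is Lipschitz on unnormalised families; later it
  also serves to localise the total mass.\<close>

locale cone_test = lipschitz_test f B L for f B L +
 fixes g :: "real => real" and \<alpha> G :: real
 assumes \<alpha>: "0 < \<alpha>" and g01: "0 <= g s" "g s <= 1" and g_small: "s <= \<alpha> ==> g s = 0"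
  and g_lip: "\<bar>g s - g t\<bar> <= G * \<bar>s - t\<bar>" and G_nonneg: "0 <= G"
begin

definition phi :: "'i set => ('i => real) => real" where
 "phi I a = g (total_mass I a) * f (rearranged I (%i. a i / total_mass I a))"

text \<open>\<open>B * G\<close> is the effect of a change of the total mass on the cutoff;
  \<open>2 * L / \<alpha>\<close> is the effect of changed entries and a changed denominator on the
  normalised family.\<close>

definition "C = B * G + 2 * L / \<alpha>"

lemma C_nonneg: "0 <= C"
 unfolding C_def using B_nonneg G_nonneg L_nonneg \<alpha> by simp

lemma phi_bound: "\<bar>phi I a\<bar> <= B"
proof -
 have "\<bar>phi I a\<bar> <= 1 * B"
  unfolding phi_def abs_mult using g01 bound by (intro mult_mono) auto
 then show ?thesis by simp
qed

lemma phi_lipschitz: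
 assumes a: "summable_family I a" and b: "summable_family I b"
 shows "\<bar>phi I a - phi I b\<bar> <= C * enn2real (\<integral>\<^sup>+i. ennreal \<bar>a i - b i\<bar> \<partial>count_space I)"
proof -
 \<comment> \<open>By symmetry one total mass may be assumed above \<open>\<alpha>\<close>; it
   serves as the denominator. If neither is above it, both values are 0.\<close>
 have main: "\<bar>phi I a - phi I b\<bar> <= C * enn2real (\<integral>\<^sup>+i. ennreal \<bar>a i - b i\<bar> \<partial>count_space I)"
  if a: "summable_family I a" and b: "summable_family I b" and S: "\<alpha> < total_mass I a" for a b
 proof -
  define S S' D where "S = total_mass I a" and "S' = total_mass I b"
   and "D = enn2real (\<integral>\<^sup>+i. ennreal \<bar>a i - b i\<bar> \<partial>count_space I)"
  let ?p = "rearranged I (%i. a i / S)" and ?q = "rearranged I (%i. b i / S')"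
  note td = total_mass_diff_le[OF a b]
  have SD: "\<bar>S - S'\<bar> <= D" using td(2) by (simp add: S_def S'_def D_def)
  have D: "(\<integral>\<^sup>+i. ennreal \<bar>a i - b i\<bar> \<partial>count_space I) = ennreal D" using td(1) by (simp add: D_def)
  have D0: "0 <= D" by (simp add: D_def)
  have S0: "\<alpha> < S" "0 < S" using S \<alpha> by (auto simp: S_def)
  have gS: "\<bar>g S - g S'\<bar> <= G * D" using g_lip[of S S'] SD G_nonneg by (meson mult_left_mono order_trans)
  have "\<bar>g S * f ?p - g S' * f ?q\<bar> <= C * D"
  proof (cases "0 < S'")
   case False
   then have "g S' = 0" using \<alpha> by (intro g_small) simp
   then have "\<bar>g S * f ?p - g S' * f ?q\<bar> = \<bar>g S - g S'\<bar> * \<bar>f ?p\<bar>" by (simp add: abs_mult)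
   also have "... <= (G * D) * B" using gS bound G_nonneg D0 by (intro mult_mono) auto
   also have "... <= (G * D) * B + 2 * L / \<alpha> * D" using L_nonneg D0 \<alpha> by simp
   also have "... = C * D" unfolding C_def by (simp add: algebra_simps)
   finally show ?thesis .
  next
   case True
   have "ennreal (dist ?p ?q) <= (\<integral>\<^sup>+i. ennreal \<bar>a i / S - b i / S'\<bar> \<partial>count_space I)"
    using mass_family_normalized[OF a] mass_family_normalized[OF b] S0 True
    by (intro dist_rearranged_le_nn) (auto simp: S_def S'_def)
   also have "... <= (\<integral>\<^sup>+i. ennreal (1 / S) * ennreal \<bar>a i - b i\<bar> + ennreal (D / (S * S')) * ennreal (b i) \<partial>count_space I)"
   proof (rule nn_integral_mono)
    fix i assume i: "i \<in> space (count_space I)"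
    then have bi: "0 <= b i" using b by (simp add: summable_family_def)
    \<comment> \<open>The change of the entry is separated from the change of the denominator;
      summed over \<open>i\<close>, each of the two contributes at most
      \<open>D / S\<close>.\<close>
    have "a i / S - b i / S' = (1 / S) * (a i - b i) + b i * (S' - S) / (S * S')"
     using S0 True by (simp add: field_simps)
    then have "\<bar>a i / S - b i / S'\<bar> <= \<bar>(1 / S) * (a i - b i)\<bar> + \<bar>b i * (S' - S) / (S * S')\<bar>"
     using abs_triangle_ineq[of "(1 / S) * (a i - b i)" "b i * (S' - S) / (S * S')"] by simp
    also have "\<bar>(1 / S) * (a i - b i)\<bar> = (1 / S) * \<bar>a i - b i\<bar>" using S0 by (simp add: abs_mult)
    also have "\<bar>b i * (S' - S) / (S * S')\<bar> = b i * \<bar>S' - S\<bar> / (S * S')" using S0 True bi by (simp add: abs_mult)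
    also have "... <= b i * D / (S * S')"
     using S0 True bi SD by (intro divide_right_mono mult_left_mono) (auto simp: abs_minus_commute)
    also have "... = D / (S * S') * b i" by simp
    finally have "\<bar>a i / S - b i / S'\<bar> <= (1 / S) * \<bar>a i - b i\<bar> + D / (S * S') * b i" by simp
    then have "ennreal \<bar>a i / S - b i / S'\<bar> <= ennreal ((1 / S) * \<bar>a i - b i\<bar> + D / (S * S') * b i)" by (rule ennreal_leI)
    also have "... = ennreal (1 / S) * ennreal \<bar>a i - b i\<bar> + ennreal (D / (S * S')) * ennreal (b i)"
     using S0 True bi D0 by (simp only: ennreal_plus ennreal_mult mult_nonneg_nonneg divide_nonneg_pos abs_ge_zero zero_le_one mult_pos_pos less_imp_le)
    finally show "ennreal \<bar>a i / S - b i / S'\<bar> <= ennreal (1 / S) * ennreal \<bar>a i - b i\<bar> + ennreal (D / (S * S')) * ennreal (b i)" .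
   qed
   also have "... = ennreal (1 / S) * ennreal D + ennreal (D / (S * S')) * ennreal S'"
    using ennreal_total_mass[OF b] by (simp add: nn_integral_add nn_integral_cmult D S'_def)
   also have "... = ennreal (1 / S * D + D / (S * S') * S')"
    using S0 True D0 by (simp only: ennreal_plus ennreal_mult mult_nonneg_nonneg divide_nonneg_pos zero_le_one mult_pos_pos less_imp_le)
   also have "1 / S * D + D / (S * S') * S' = 2 * D / S" using S0 True by (simp add: field_simps)
   finally have "dist ?p ?q <= 2 * D / S" using S0 D0 by (subst (asm) ennreal_le_iff) auto
   also have "... <= 2 * D / \<alpha>" using S0 \<alpha> D0 by (intro divide_left_mono) auto
   finally have "\<bar>f ?p - f ?q\<bar> <= L * (2 * D / \<alpha>)" by (rule lip_le)
   moreover have "g S * f ?p - g S' * f ?q = g S * (f ?p - f ?q) + (g S - g S') * f ?q" by (simp add: algebra_simps)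
   then have "\<bar>g S * f ?p - g S' * f ?q\<bar> <= g S * \<bar>f ?p - f ?q\<bar> + \<bar>g S - g S'\<bar> * \<bar>f ?q\<bar>"
    using abs_triangle_ineq[of "g S * (f ?p - f ?q)" "(g S - g S') * f ?q"] g01(1)[of S] by (simp add: abs_mult)
   moreover have "g S * \<bar>f ?p - f ?q\<bar> <= 1 * \<bar>f ?p - f ?q\<bar>" using g01(2) by (intro mult_right_mono) auto
   moreover have "\<bar>g S - g S'\<bar> * \<bar>f ?q\<bar> <= (G * D) * B" using gS bound G_nonneg D0 by (intro mult_mono) auto
   ultimately have "\<bar>g S * f ?p - g S' * f ?q\<bar> <= L * (2 * D / \<alpha>) + G * D * B" by linarith
   also have "... = C * D" unfolding C_def by (simp add: algebra_simps)
   finally show ?thesis .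
  qed
  then show ?thesis by (simp add: phi_def S_def S'_def D_def)
 qed
 show ?thesis
 proof (cases "\<alpha> < total_mass I a")
  case True
  then show ?thesis by (rule main[OF a b])
 next
  case False
  show ?thesis
  proof (cases "\<alpha> < total_mass I b")
   case True
   then show ?thesis using main[OF b a True] by (simp add: abs_minus_commute)
  next
   case F: False
   then show ?thesis using False g_small[of "total_mass I a"] g_small[of "total_mass I b"] C_nonneg by (simp add: phi_def)
  qed
 qed
qed

lemma phi_cong:
 assumes a: "summable_family I a" and b: "summable_family J b"
  and \<pi>: "bij_betw \<pi> {i\<in>I. 0 < a i} {j\<in>J. 0 < b j}" "!!i. i \<in> I ==> 0 < a i ==> a i = b (\<pi> i)"
 shows "phi I a = phi J b"
proof -
 note t = total_mass_cong[OF \<pi>]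
 show ?thesis
 proof (cases "0 < total_mass J b")
  case True
  then have S: "{i \<in> I. 0 < a i / total_mass I a} = {i\<in>I. 0 < a i}" "{j \<in> J. 0 < b j / total_mass J b} = {j\<in>J. 0 < b j}"
   using t by (auto simp: zero_less_divide_iff)
  have "rearranged I (%i. a i / total_mass I a) = rearranged J (%j. b j / total_mass J b)"
  proof (rule rearranged_reindex[OF mass_family_normalized[OF b True]])
   show "bij_betw \<pi> {i \<in> I. 0 < a i / total_mass I a} {j \<in> J. 0 < b j / total_mass J b}"
    unfolding S by (rule \<pi>(1))
   fix i assume "i \<in> I" "0 < a i / total_mass I a"
   then show "a i / total_mass I a = b (\<pi> i) / total_mass J b"
    using \<pi>(2)[of i] True t by (simp add: zero_less_divide_iff)
  qed
  then show ?thesis by (simp add: phi_def t)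
 next
  case False
  then show ?thesis using t \<alpha> g_small[of "total_mass J b"] by (simp add: phi_def)
 qed
qed

end

section \<open>Rounding to a grid\<close>

text \<open>Cells start at \<open>\<eta>\<close> and their width is the square of
  \<open>\<eta>\<close>, so rounding a point of a cell changes it by at most the fraction
  \<open>\<eta>\<close> of its size. The error is then controlled by the total mass, whatever the
  number of points, and the rounded family is described by \<open>m\<close> counts.\<close>

locale grid_rounding = cone_test +
 fixes \<eta> :: real and m :: nat
 assumes \<eta>: "0 < \<eta>"
begin

definition "cell l = {\<eta> + real l * \<eta>\<^sup>2 <.. \<eta> + real (Suc l) * \<eta>\<^sup>2}"

definition "rounded t = (if \<exists>l<m. t \<in> cell l then \<eta> + real (THE l. t \<in> cell l) * \<eta>\<^sup>2 else 0)"

text \<open>Points below the first cell or above the last one are rounded to 0 and lost entirely;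
  the last term covers the error within a cell.\<close>

definition "rounding_error t = (if t <= \<eta> then t else 0) + (if \<eta> + real m * \<eta>\<^sup>2 < t then t else 0) + \<eta> * t"

text \<open>A representative with \<open>\<kappa> l\<close> copies of the left end point of cell
  \<open>l\<close>. The value of \<open>phi\<close> depends only on the positive entries with their
  multiplicities, so it is a function of the counts.\<close>

definition "psi \<kappa> = phi (SIGMA l:{..<m}. {..<\<kappa> l :: nat}) (%(l, _). \<eta> + real l * \<eta>\<^sup>2)"

lemma cell_unique: "t \<in> cell k ==> t \<in> cell l ==> k = l"
proof (rule ccontr)
 assume a: "t \<in> cell k" "t \<in> cell l" "k ~= l"
 have "False" if "k < l" "t \<in> cell k" "t \<in> cell l" for k l
 proof -
  have "real (Suc k) * \<eta>\<^sup>2 <= real l * \<eta>\<^sup>2" using that(1) by (intro mult_right_mono) auto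
  then show False using that unfolding cell_def by auto
 qed
 then show False using a by (metis linorder_less_linear)
qed

lemma cell_pos: "t \<in> cell l ==> \<eta> < t"
 unfolding cell_def using \<eta> by (auto intro: le_less_trans[rotated])

lemma disjoint_cells: "disjoint_family_on cell A"
 using cell_unique by (auto simp: disjoint_family_on_def)

lemma rounded_cell: "l < m ==> t \<in> cell l ==> rounded t = \<eta> + real l * \<eta>\<^sup>2"
 unfolding rounded_def using cell_unique by (auto intro!: arg_cong[where f = real] the_equality)

lemma cell_exists:
 assumes "\<eta> < t" "t <= \<eta> + real m * \<eta>\<^sup>2"
 shows "\<exists>l<m. t \<in> cell l"
proof -
 define n where "n = (LEAST n. t <= \<eta> + real n * \<eta>\<^sup>2)"
 have n: "t <= \<eta> + real n * \<eta>\<^sup>2" unfolding n_def by (rule LeastI[of _ m]) (rule assms(2))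
 have nm: "n <= m" unfolding n_def by (rule Least_le) (rule assms(2))
 obtain k where k: "n = Suc k" using n assms(1) by (cases n) auto
 then have "\<not> t <= \<eta> + real k * \<eta>\<^sup>2" unfolding n_def using not_less_Least by (metis lessI n_def k)
 then show ?thesis using n nm k unfolding cell_def by (intro exI[of _ k]) auto
qed

lemma rounded_nonneg: "0 <= rounded t"
 unfolding rounded_def using \<eta> by auto

lemma rounded_error:
 assumes "0 <= t"
 shows "\<bar>t - rounded t\<bar> <= rounding_error t"
proof (cases "\<exists>l<m. t \<in> cell l")
 case True
 then obtain l where l: "l < m" "t \<in> cell l" by auto
 have "\<bar>t - rounded t\<bar> <= \<eta>\<^sup>2"
  using l(2) unfolding rounded_cell[OF l] cell_def by (auto simp: algebra_simps)
 also have "... <= \<eta> * t" using cell_pos[OF l(2)] \<eta> by (simp add: power2_eq_square)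
 also have "... <= rounding_error t" unfolding rounding_error_def using assms by auto
 finally show ?thesis .
next
 case False
 then have "rounded t = 0" unfolding rounded_def by (rule if_not_P)
 moreover have "t <= \<eta> | \<eta> + real m * \<eta>\<^sup>2 < t" using cell_exists[of t] False by force
 moreover have "0 <= \<eta> * t" using \<eta> assms by simp
 ultimately show ?thesis using assms unfolding rounding_error_def by auto
qed

lemma rounded_le: "0 <= t ==> rounded t <= t"
proof (cases "\<exists>l<m. t \<in> cell l")
 case True
 then obtain l where l: "l < m" "t \<in> cell l" by auto
 then show ?thesis using rounded_cell[OF l] by (auto simp: cell_def)
next
 case False
 moreover assume "0 <= t"
 ultimately show ?thesis unfolding rounded_def by (simp only: if_not_P if_False)
qed

lemma summable_family_rounded:
 assumes "summable_family I a"
 shows "summable_family I (%i. rounded (a i))"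
proof -
 have "(\<integral>\<^sup>+i. ennreal (rounded (a i)) \<partial>count_space I) <= (\<integral>\<^sup>+i. ennreal (a i) \<partial>count_space I)"
  using assms rounded_le by (intro nn_integral_mono ennreal_leI) (auto simp: summable_family_def)
 then show ?thesis using assms rounded_nonneg by (auto simp: summable_family_def)
qed

lemma finite_tail_summable_family:
 assumes "summable_family I a" "0 < t"
 shows "finite {i\<in>I. t < a i}"
proof (cases "0 < total_mass I a")
 case True
 have "finite {i\<in>I. t / total_mass I a < a i / total_mass I a}"
  using True assms(2) by (intro mass_family_finite_tail[OF mass_family_normalized[OF assms(1) True]]) simp
 then show ?thesis using True by (simp add: divide_less_cancel)
next
 case False
 then have "(\<integral>\<^sup>+i. ennreal (a i) \<partial>count_space I) = 0"
  using ennreal_total_mass[OF assms(1)] total_mass_nonneg[of I a] by simp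
 then have "\<forall>i\<in>I. ennreal (a i) = 0" by (simp add: nn_integral_0_iff_AE AE_count_space)
 then have "{i\<in>I. t < a i} = {}" using assms by (auto simp: summable_family_def)
 then show ?thesis by (metis finite.emptyI)
qed

lemma phi_rounded:
 assumes a: "summable_family I a" and c: "!!l. l < m ==> c l = card {i\<in>I. a i \<in> cell l}"
 shows "phi I (%i. rounded (a i)) = psi c"
proof -
 let ?J = "SIGMA l:{..<m}. {..<c l}" and ?b = "\<lambda>(l, _ :: nat). \<eta> + real l * \<eta>\<^sup>2"
 have finJ: "finite ?J" by auto
 have b: "summable_family ?J ?b"
  using finJ \<eta> by (auto simp: summable_family_def countable_finite nn_integral_count_space_finite)
 have "finite {i\<in>I. rounded (a i) = v} & finite {j\<in>?J. ?b j = v} & card {i\<in>I. rounded (a i) = v} = card {j\<in>?J. ?b j = v}"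
  if v: "0 < v" for v
 proof (cases "\<exists>l<m. v = \<eta> + real l * \<eta>\<^sup>2")
  case True
  then obtain l where l: "l < m" "v = \<eta> + real l * \<eta>\<^sup>2" by auto
  have inj: "\<eta> + real k * \<eta>\<^sup>2 = v \<longleftrightarrow> k = l" for k using l(2) \<eta> by simp
  have 1: "{i\<in>I. rounded (a i) = v} = {i\<in>I. a i \<in> cell l}"
  proof (intro set_eqI iffI)
   fix i assume i: "i \<in> {i\<in>I. rounded (a i) = v}"
   then have "rounded (a i) ~= 0" using v by auto
   then obtain k where "k < m" "a i \<in> cell k" unfolding rounded_def by (auto split: if_splits)
   then show "i \<in> {i\<in>I. a i \<in> cell l}" using i rounded_cell[of k "a i"] inj[of k] by auto
  qed (use l rounded_cell in auto)
  have 2: "{j\<in>?J. ?b j = v} = {l} \<times> {..<c l}"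
  proof (intro set_eqI)
   fix x :: "nat \<times> nat"
   obtain k r where x: "x = (k, r)" by (cases x)
   show "x \<in> {j\<in>?J. ?b j = v} \<longleftrightarrow> x \<in> {l} \<times> {..<c l}"
    unfolding x using inj[of k] l(1)
    by (simp only: mem_Collect_eq mem_Sigma_iff prod.case singleton_iff lessThan_iff) blast
  qed
  have "{i\<in>I. a i \<in> cell l} \<subseteq> {i\<in>I. \<eta> < a i}" using cell_pos by auto
  then have "finite {i\<in>I. a i \<in> cell l}" using finite_tail_summable_family[OF a \<eta>] finite_subset by blast
  then show ?thesis unfolding 1 2 using c[OF l(1)] by simp
 next
  case False
  then have "{i\<in>I. rounded (a i) = v} = {}"
   using v rounded_cell unfolding rounded_def by (auto split: if_splits) (metis cell_unique the_equality)
  moreover have "{j\<in>?J. ?b j = v} = {}" using False by auto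
  ultimately show ?thesis by (metis card.empty finite.emptyI)
 qed
 then obtain \<pi> where "bij_betw \<pi> {i\<in>I. 0 < rounded (a i)} {j\<in>?J. 0 < ?b j}"
  "!!i. i \<in> I ==> 0 < rounded (a i) ==> rounded (a i) = ?b (\<pi> i)"
  using fibre_bijection[of I "%i. rounded (a i)" ?J ?b] by blast
 then show ?thesis unfolding psi_def by (rule phi_cong[OF summable_family_rounded[OF a] b])
qed

lemma psi_bound: "\<bar>psi k\<bar> <= B"
 unfolding psi_def by (rule phi_bound)

lemma phi_psi_error:
 assumes a: "summable_family I a" and k: "!!l. l < m ==> k l = card {i\<in>I. a i \<in> cell l}"
 shows "ennreal \<bar>phi I a - psi k\<bar> <= ennreal C * (\<integral>\<^sup>+i. ennreal (rounding_error (a i)) \<partial>count_space I)"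
proof -
 let ?D = "\<integral>\<^sup>+i. ennreal \<bar>a i - rounded (a i)\<bar> \<partial>count_space I"
 have "\<bar>phi I a - psi k\<bar> <= C * enn2real ?D"
  using phi_lipschitz[OF a summable_family_rounded[OF a]] phi_rounded[OF a k] by simp
 then have "ennreal \<bar>phi I a - psi k\<bar> <= ennreal C * ennreal (enn2real ?D)"
  using C_nonneg by (simp add: ennreal_mult'[symmetric] ennreal_leI)
 also have "ennreal (enn2real ?D) = ?D"
  using total_mass_diff_le(1)[OF a summable_family_rounded[OF a]] by simp
 also have "?D <= (\<integral>\<^sup>+i. ennreal (rounding_error (a i)) \<partial>count_space I)"
  using a rounded_error by (intro nn_integral_mono ennreal_leI) (auto simp: summable_family_def)
 finally show ?thesis by (simp add: mult_left_mono)
qed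

end

section \<open>Random cycle types with a geometric number of elements\<close>

text \<open>Copies of \<open>c\<close> are told apart by a second component, so that sums over a
  multiset become sums over a set.\<close>

definition mset_index :: "nat multiset => (nat \<times> nat) set" where
 "mset_index \<pi> = (SIGMA c:set_mset \<pi>. {..<count \<pi> c})"

lemma finite_mset_index: "finite (mset_index r)"
 by (simp add: mset_index_def)

lemma sum_mset_count:
 fixes h :: "'c => 'b :: comm_semiring_1"
 assumes "finite S" "set_mset r \<subseteq> S"
 shows "(\<Sum>c\<in>#r. h c) = (\<Sum>c\<in>S. of_nat (count r c) * h c)"
 using assms(2)
proof (induction r)
 case (add x r)
 have "(\<Sum>c\<in>S. of_nat (count (add_mset x r) c) * h c)
   = (\<Sum>c\<in>S. of_nat (count r c) * h c + (if c = x then h c else 0))"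
  by (intro sum.cong refl) (auto simp: distrib_right add.commute)
 also have "... = (\<Sum>c\<in>S. of_nat (count r c) * h c) + h x"
  using add.prems assms(1) by (simp add: sum.distrib)
 finally show ?case using add by (simp add: add.commute)
qed simp

lemma sum_mset_index:
 fixes h :: "nat => 'b :: comm_semiring_1"
 shows "(\<Sum>x\<in>mset_index u. h (fst x)) = (\<Sum>c\<in>#u. h c)"
proof -
 have "(\<Sum>x\<in>mset_index u. h (fst x)) = (\<Sum>c\<in>set_mset u. \<Sum>r<count u c. h c)"
  unfolding mset_index_def by (subst sum.Sigma) (auto simp: split_beta)
 then show ?thesis by (simp add: sum_mset_count[OF finite_set_mset subset_refl])
qed

lemma card_mset_index: "card {x\<in>mset_index r. P (fst x)} = size (filter_mset P r)"
proof -
 have "card {x\<in>mset_index r. P (fst x)} = (\<Sum>x\<in>mset_index r. if P (fst x) then 1 else 0)"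
  by (simp add: finite_mset_index sum.If_cases Int_def)
 also have "... = (\<Sum>c\<in>#r. if P c then 1 else 0)" by (rule sum_mset_index)
 also have "... = size (filter_mset P r)" by (induction r) auto
 finally show ?thesis .
qed

lemma nn_integral_mset_index:
 "(\<integral>\<^sup>+x. h (fst x) \<partial>count_space (mset_index r)) = (\<Sum>c\<in>#r. h c)"
 by (simp add: nn_integral_count_space_finite finite_mset_index sum_mset_index)

lemma summable_family_mset: "summable_family (mset_index r) (%x. real (fst x) / real K)"
 using finite_mset_index by (simp add: summable_family_def countable_finite nn_integral_count_space_finite)

lemma total_mass_mset: "total_mass (mset_index r) (%x. real (fst x) / real K) = real (sum_mset r) / real K"
proof -
 have "(\<Sum>x\<in>mset_index r. real (fst x)) = real (\<Sum>x\<in>mset_index r. fst x)" by simp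
 also have "(\<Sum>x\<in>mset_index r. fst x) = sum_mset r" using sum_mset_index[where h = "%c. c"] by simp
 finally have "(\<Sum>x\<in>mset_index r. real (fst x) / real K) = real (sum_mset r) / real K"
  by (simp flip: sum_divide_distrib)
 then show ?thesis
  unfolding total_mass_def nn_integral_count_space_finite[OF finite_mset_index]
  by (subst sum_ennreal) (auto simp only: enn2real_ennreal sum_nonneg divide_nonneg_nonneg of_nat_0_le_iff)
qed

lemma exp_minus_le_half: "0 <= x ==> x <= 1 ==> exp (- x) <= 1 - x / (2::real)"
proof -
 assume x: "0 <= x" "x <= 1"
 have "1 <= (1 + x) * (1 - x / 2)" using x mult_left_le[of x x] by (simp add: algebra_simps)
 also have "... <= exp x * (1 - x / 2)" using x exp_ge_add_one_self[of x] by (intro mult_right_mono) auto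
 finally have "exp (- x) * 1 <= exp (- x) * (exp x * (1 - x / 2))" by (intro mult_left_mono) auto
 also have "... = 1 - x / 2" by (simp add: mult.assoc[symmetric] flip: exp_add)
 finally show ?thesis by simp
qed

context grid_rounding
begin

text \<open>By the Mecke equation the mean of a sum over cycles is a sum over lengths
  \<open>j\<close> with weights \<open>z ^ j / j\<close>; for this \<open>z\<close>, and with
  \<open>t = j / K\<close>, it discretises the intensity \<open>exp (- t) / t\<close>. The
  denominator \<open>j\<close> turns the terms \<open>t\<close> of \<open>rounding_error\<close>
  into \<open>1 / K\<close>.\<close>

lemma mean_rounding_error_geo:
 assumes K: "1 <= K"
 defines "z \<equiv> exp (- (1 / real K))"
 shows "(\<integral>\<^sup>+r. (\<Sum>c\<in>#r. ennreal (rounding_error (real c / real K))) \<partial>(geo_cycle_type_pmf z))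
  <= ennreal (\<eta> + 4 * (\<eta> + exp (- (\<eta> + real m * \<eta>\<^sup>2) / 2)))"
proof -
 let ?T = "\<eta> + real m * \<eta>\<^sup>2"
 \<comment> \<open>The square root of \<open>z\<close>: for lengths beyond the last cell half of the
   exponential decay gives the factor \<open>exp (- ?T / 2)\<close>, and the other half keeps the
   series summable.\<close>
 define w where "w = exp (- (1 / (2 * real K)))"
 define e where "e = \<eta> + exp (- ?T / 2)"
 have K0: "0 < real K" using K by simp
 have e0: "0 <= e" using \<eta> by (simp add: e_def)
 have z: "0 < z" "z < 1" using K0 by (simp_all add: z_def)
 have w: "0 < w" "w < 1" using K0 by (simp_all add: w_def)
 have zj: "z ^ j = exp (- (real j / real K))" for j
  unfolding z_def by (simp flip: exp_of_nat_mult)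
 have wj: "w ^ j = exp (- (real j / real K) / 2)" for j
  unfolding w_def by (simp flip: exp_of_nat_mult)
 define \<Phi> :: "nat => nat multiset => ennreal" where
  "\<Phi> c r = ennreal (rounding_error (real c / real K) / real c)" for c r
 have re0: "0 <= rounding_error t" if "0 <= t" for t
  using that \<eta> unfolding rounding_error_def by auto
 have \<Phi>: "of_nat c * \<Phi> c r = ennreal (rounding_error (real c / real K))" for c r
 proof (cases "c = 0")
  case False
  then show ?thesis
   by (simp add: \<Phi>_def ennreal_of_nat_eq_real_of_nat flip: ennreal_mult')
 qed (simp add: rounding_error_def)
 have bnd: "ennreal (z ^ j) * \<Phi> j {#} <= ennreal (1 / real K) * indicator {1..nat \<lfloor>\<eta> * real K\<rfloor>} j + ennreal (e / real K) * ennreal (w ^ j)"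
  if j: "1 <= j" for j
 proof -
  let ?t = "real j / real K"
  have z1: "z ^ j <= w ^ j" unfolding zj wj using K0 by (simp add: field_simps)
  have z2: "z ^ j <= exp (- ?T / 2) * w ^ j" if "?T < ?t"
  proof -
   have "- b <= - a / 2 + - b / 2" if "a < b" for a b :: real using that by simp
   from this[OF that] show ?thesis unfolding zj wj exp_add[symmetric] exp_le_cancel_iff .
  qed
  have z3: "z ^ j <= 1" using z by (simp add: power_le_one)
  have "rounding_error ?t / real j = (1 / real K) * ((if ?t <= \<eta> then 1 else 0) + (if ?T < ?t then 1 else 0) + \<eta>)"
   using j K0 unfolding rounding_error_def by (auto simp: field_simps)
  then have "z ^ j * (rounding_error ?t / real j)
    = (1 / real K) * (z ^ j * (if ?t <= \<eta> then 1 else 0) + (z ^ j * (if ?T < ?t then 1 else 0) + z ^ j * \<eta>))"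
   by (simp add: algebra_simps)
  also have "... <= (1 / real K) * ((if ?t <= \<eta> then 1 else 0) + (exp (- ?T / 2) * w ^ j + w ^ j * \<eta>))"
   using z1 z2 z3 \<eta> K0 w by (intro mult_left_mono add_mono mult_right_mono) auto
  also have "... = (1 / real K) * (if ?t <= \<eta> then 1 else 0) + (e / real K) * w ^ j"
   unfolding e_def by (simp add: algebra_simps add_divide_distrib)
  also have "(if ?t <= \<eta> then 1 else 0) = (indicator {1..nat \<lfloor>\<eta> * real K\<rfloor>} j :: real)"
   using j K0 \<eta> by (auto simp: indicator_def field_simps le_nat_iff le_floor_iff nat_le_iff)
  finally have le: "z ^ j * (rounding_error ?t / real j) <= (1 / real K) * indicator {1..nat \<lfloor>\<eta> * real K\<rfloor>} j + (e / real K) * w ^ j" .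
  have "ennreal (z ^ j) * \<Phi> j {#} = ennreal (z ^ j * (rounding_error ?t / real j))"
   unfolding \<Phi>_def using z by (intro ennreal_mult'[symmetric]) simp
  also have "... <= ennreal ((1 / real K) * indicator {1..nat \<lfloor>\<eta> * real K\<rfloor>} j + (e / real K) * w ^ j)"
   by (rule ennreal_leI[OF le])
  also have "... = ennreal (1 / real K) * indicator {1..nat \<lfloor>\<eta> * real K\<rfloor>} j + ennreal (e / real K) * ennreal (w ^ j)"
  proof -
   have "ennreal ((1 / real K) * indicator {1..nat \<lfloor>\<eta> * real K\<rfloor>} j) = ennreal (1 / real K) * indicator {1..nat \<lfloor>\<eta> * real K\<rfloor>} j"
    by (simp add: indicator_def)
   moreover have "ennreal ((e / real K) * w ^ j) = ennreal (e / real K) * ennreal (w ^ j)"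
    using e0 K0 by (intro ennreal_mult') auto
   moreover have "0 <= (e / real K) * w ^ j" "0 <= (1 / real K) * indicator {1..nat \<lfloor>\<eta> * real K\<rfloor>} j"
    using e0 K0 w by auto
   ultimately show ?thesis by (metis ennreal_plus)
  qed
  finally show ?thesis .
 qed
 have "(\<integral>\<^sup>+r. (\<Sum>c\<in>#r. ennreal (rounding_error (real c / real K))) \<partial>(geo_cycle_type_pmf z))
   = (\<integral>\<^sup>+j. ennreal (z ^ j) * \<Phi> j {#} \<partial>count_space {1..})"
  using mecke_geo_cycle_type[OF z, of \<Phi>] unfolding \<Phi> by (simp add: \<Phi>_def measure_pmf.emeasure_space_1[unfolded space_measure_pmf])
 also have "... <= (\<integral>\<^sup>+j. ennreal (1 / real K) * indicator {1..nat \<lfloor>\<eta> * real K\<rfloor>} j + ennreal (e / real K) * ennreal (w ^ j) \<partial>count_space {1..})"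
  using bnd by (intro nn_integral_mono) auto
 also have "... <= (\<integral>\<^sup>+j. ennreal (1 / real K) * indicator {1..nat \<lfloor>\<eta> * real K\<rfloor>} j + ennreal (e / real K) * ennreal (w ^ j) \<partial>count_space UNIV)"
  by (subst nn_integral_count_space_indicator) (auto intro!: nn_integral_mono simp: indicator_def NO_MATCH_def)
 also have "... = ennreal (1 / real K) * of_nat (nat \<lfloor>\<eta> * real K\<rfloor>) + ennreal (e / real K) * ennreal (1 / (1 - w))"
 proof -
  have "(\<integral>\<^sup>+j. ennreal (w ^ j) \<partial>count_space UNIV) = ennreal (1 / (1 - w))"
   using w by (simp add: nn_integral_count_space_nat suminf_ennreal2 summable_geometric suminf_geometric)
  moreover have "(\<integral>\<^sup>+j. indicator {1..nat \<lfloor>\<eta> * real K\<rfloor>} j \<partial>count_space UNIV) = of_nat (nat \<lfloor>\<eta> * real K\<rfloor>)"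
  proof -
   have "(\<integral>\<^sup>+j. indicator {1..nat \<lfloor>\<eta> * real K\<rfloor>} j \<partial>count_space UNIV) = emeasure (count_space UNIV) {1..nat \<lfloor>\<eta> * real K\<rfloor>}"
    by (rule nn_integral_indicator) simp
   also have "... = of_nat (card {1..nat \<lfloor>\<eta> * real K\<rfloor>})"
    by (rule emeasure_count_space_finite) auto
   finally show ?thesis by (simp only: card_atLeastAtMost One_nat_def diff_Suc_Suc diff_zero)
  qed
  ultimately show ?thesis by (simp add: nn_integral_add nn_integral_cmult)
 qed
 also have "... = ennreal (1 / real K * real (nat \<lfloor>\<eta> * real K\<rfloor>) + (e / real K) * (1 / (1 - w)))"
  using K0 e0 w by (simp add: ennreal_of_nat_eq_real_of_nat ennreal_plus flip: ennreal_mult')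
 also have "... <= ennreal (\<eta> + 4 * e)"
 proof (rule ennreal_leI, rule add_mono)
  have "real (nat \<lfloor>\<eta> * real K\<rfloor>) <= \<eta> * real K" using \<eta> K0 by simp
  then show "1 / real K * real (nat \<lfloor>\<eta> * real K\<rfloor>) <= \<eta>" using K0 by (simp add: field_simps)
  have "w <= 1 - (1 / (2 * real K)) / 2" unfolding w_def using K by (intro exp_minus_le_half) auto
  then have "1 / (4 * real K) <= 1 - w" by simp
  then have "1 / (1 - w) <= 4 * real K" using w K0 by (simp add: field_simps)
  then have "(e / real K) * (1 / (1 - w)) <= (e / real K) * (4 * real K)"
   using e0 K0 by (intro mult_left_mono) auto
  then show "(e / real K) * (1 / (1 - w)) <= 4 * e" using K0 by simp
 qed
 finally show ?thesis by (simp add: e_def)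
qed

definition "mset_cell K l = {j. real j / real K \<in> cell l}"

lemma mset_cell:
 assumes "1 <= K"
 shows "finite (mset_cell K l)" "0 \<notin> mset_cell K l" "disjoint_family_on (mset_cell K) A"
proof -
 let ?u = "(\<eta> + real (Suc l) * \<eta>\<^sup>2)"
 show "0 \<notin> mset_cell K l" using cell_pos[of 0 l] \<eta> by (auto simp: mset_cell_def)
 show "disjoint_family_on (mset_cell K) A"
  using cell_unique by (auto simp: disjoint_family_on_def mset_cell_def)
 have "mset_cell K l \<subseteq> {..nat \<lceil>?u * real K\<rceil>}"
 proof
  fix j assume "j \<in> mset_cell K l"
  then have "real j <= ?u * real K"
   using assms by (simp add: mset_cell_def cell_def field_simps)
  then show "j \<in> {..nat \<lceil>?u * real K\<rceil>}" by simp linarith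
 qed
 then show "finite (mset_cell K l)" by (rule finite_subset) simp
qed

lemma phi_psi_geo:
 assumes K: "1 <= K"
 defines "z \<equiv> exp (- (1 / real K))"
 shows "\<bar>(\<integral>r. phi (mset_index r) (%x. real (fst x) / real K) \<partial>(geo_cycle_type_pmf z))
   - (\<integral>k. psi k \<partial>(map_pmf (class_counts m (mset_cell K)) (geo_cycle_type_pmf z)))\<bar>
  <= C * (\<eta> + 4 * (\<eta> + exp (- (\<eta> + real m * \<eta>\<^sup>2) / 2)))"
proof -
 let ?u = "(\<eta> + 4 * (\<eta> + exp (- (\<eta> + real m * \<eta>\<^sup>2) / 2)))"
 let ?G = "measure_pmf (geo_cycle_type_pmf z)" and ?X = "class_counts m (mset_cell K)"
 let ?p = "%r. phi (mset_index r) (%x. real (fst x) / real K)"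
 have i1: "integrable ?G ?p" and i2: "integrable ?G (%r. psi (?X r))"
  using phi_bound psi_bound by (auto intro!: measure_pmf.integrable_const_bound[of _ B] AE_I2)
 have "ennreal \<bar>?p r - psi (?X r)\<bar> <= ennreal C * (\<Sum>c\<in>#r. ennreal (rounding_error (real c / real K)))" for r
  unfolding nn_integral_mset_index[symmetric]
  by (rule phi_psi_error[OF summable_family_mset])
   (simp add: class_counts_def mset_cell_def card_mset_index[where P = "%c. real c / real K \<in> cell _"])
 then have "(\<integral>\<^sup>+r. ennreal \<bar>?p r - psi (?X r)\<bar> \<partial>?G)
   <= (\<integral>\<^sup>+r. ennreal C * (\<Sum>c\<in>#r. ennreal (rounding_error (real c / real K))) \<partial>?G)"
  by (intro nn_integral_mono) auto
 also have "... <= ennreal C * ennreal ?u"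
  using mean_rounding_error_geo[OF K] by (simp add: nn_integral_cmult z_def mult_left_mono)
 also have "... = ennreal (C * ?u)"
  using C_nonneg by (simp add: ennreal_mult')
 finally have "(\<integral>\<^sup>+r. ennreal \<bar>?p r - psi (?X r)\<bar> \<partial>?G) <= ennreal (C * ?u)" .
 moreover have "(\<integral>\<^sup>+r. ennreal \<bar>?p r - psi (?X r)\<bar> \<partial>?G) = ennreal (\<integral>r. \<bar>?p r - psi (?X r)\<bar> \<partial>?G)"
  using i1 i2 by (intro nn_integral_eq_integral) auto
 ultimately have "ennreal (\<integral>r. \<bar>?p r - psi (?X r)\<bar> \<partial>?G) <= ennreal (C * ?u)"
  by simp
 then have "(\<integral>r. \<bar>?p r - psi (?X r)\<bar> \<partial>?G) <= C * ?u"
  using C_nonneg \<eta> by (subst (asm) ennreal_le_iff) (auto intro!: mult_nonneg_nonneg add_nonneg_nonneg)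
 moreover have "\<bar>(\<integral>r. ?p r - psi (?X r) \<partial>?G)\<bar> <= (\<integral>r. \<bar>?p r - psi (?X r)\<bar> \<partial>?G)"
  by (rule integral_abs_bound)
 ultimately show ?thesis using i1 i2 by (simp add: Bochner_Integration.integral_diff)
qed

end

section \<open>Convergence of Poisson laws\<close>

text \<open>Scheffe's lemma: pointwise convergence of probability mass functions implies convergence
  in the mean, since the total mass is 1 throughout.\<close>

lemma expectation_pmf_tendsto:
 fixes f :: "'a => real"
 assumes lim: "!!x. (%n. pmf (p n) x) \<longlonglongrightarrow> pmf q x" and f: "!!x. \<bar>f x\<bar> <= B"
 shows "(%n. \<integral>x. f x \<partial>(p n)) \<longlonglongrightarrow> (\<integral>x. f x \<partial>q)"
proof -
 let ?u = "(\<integral>x. f x \<partial>q)"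
 have ip: "integrable (count_space UNIV) (pmf p)" for p :: "'a pmf" by (rule integrable_pmf)
 have "(%n. \<integral>\<^sup>+x. norm (pmf (p n) x - pmf q x) \<partial>count_space UNIV) \<longlonglongrightarrow> 0"
 proof (rule Scheffe_lemma1)
  show "limsup (%n. \<integral>\<^sup>+x. norm (pmf (p n) x) \<partial>count_space UNIV) <= (\<integral>\<^sup>+x. norm (pmf q x) \<partial>count_space UNIV)"
   by (simp add: nn_integral_pmf Limsup_const)
 qed (auto intro: ip lim)
 moreover have "(\<integral>\<^sup>+x. norm (pmf (p n) x - pmf q x) \<partial>count_space UNIV)
   = ennreal (\<integral>x. \<bar>pmf (p n) x - pmf q x\<bar> \<partial>count_space UNIV)" for n
  unfolding real_norm_def by (intro nn_integral_eq_integral integrable_abs Bochner_Integration.integrable_diff ip) auto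
 ultimately have "(%n. ennreal (\<integral>x. \<bar>pmf (p n) x - pmf q x\<bar> \<partial>count_space UNIV)) \<longlonglongrightarrow> ennreal 0" by simp
 then have 1: "(%n. \<integral>x. \<bar>pmf (p n) x - pmf q x\<bar> \<partial>count_space UNIV) \<longlonglongrightarrow> 0"
  by (subst (asm) tendsto_ennreal_iff) auto
 have "\<bar>(\<integral>x. f x \<partial>(p n)) - ?u\<bar> <= B * (\<integral>x. \<bar>pmf (p n) x - pmf q x\<bar> \<partial>count_space UNIV)" for n
 proof -
  have e: "(\<integral>x. f x \<partial>p) = (\<integral>x. pmf p x * f x \<partial>count_space UNIV)" for p :: "'a pmf"
   unfolding measure_pmf_eq_density by (subst integral_density) (auto simp: pmf_nonneg)
  have i: "integrable (count_space UNIV) (%x. pmf p x * f x)" for p :: "'a pmf"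
  proof (rule Bochner_Integration.integrable_bound)
   show "integrable (count_space UNIV) (%x. pmf p x * B)" using ip by simp
   show "AE x in count_space UNIV. norm (pmf p x * f x) <= norm (pmf p x * B)"
    using f by (intro AE_I2) (auto simp: abs_mult pmf_nonneg intro!: mult_left_mono order_trans[OF f abs_ge_self])
  qed simp
  have "\<bar>(\<integral>x. f x \<partial>(p n)) - ?u\<bar>
    = norm (\<integral>x. pmf (p n) x * f x - pmf q x * f x \<partial>count_space UNIV)"
   unfolding e using i by (simp add: Bochner_Integration.integral_diff)
  also have "... <= (\<integral>x. norm (pmf (p n) x * f x - pmf q x * f x) \<partial>count_space UNIV)"
   by (rule integral_norm_bound)
  also have "... <= (\<integral>x. B * \<bar>pmf (p n) x - pmf q x\<bar> \<partial>count_space UNIV)"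
  proof (rule integral_mono)
   fix x
   show "norm (pmf (p n) x * f x - pmf q x * f x) <= B * \<bar>pmf (p n) x - pmf q x\<bar>"
    using f[of x] by (simp add: abs_mult mult.commute[of B] mult_left_mono flip: left_diff_distrib)
  qed (intro integrable_norm integrable_mult_right integrable_abs Bochner_Integration.integrable_diff i ip)+
  finally show ?thesis by simp
 qed
 then have "\<forall>\<^sub>F n in sequentially. norm ((\<integral>x. f x \<partial>(p n)) - ?u)
   <= B * (\<integral>x. \<bar>pmf (p n) x - pmf q x\<bar> \<partial>count_space UNIV)" by simp
 moreover have "(%n. B * (\<integral>x. \<bar>pmf (p n) x - pmf q x\<bar> \<partial>count_space UNIV)) \<longlonglongrightarrow> 0"
  using tendsto_mult_left[OF 1, of B] by simp
 ultimately have "(%n. (\<integral>x. f x \<partial>(p n)) - ?u) \<longlonglongrightarrow> 0"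
  by (rule Lim_null_comparison)
 then show ?thesis by (simp add: LIM_zero_iff)
qed

lemma pmf_Pi_poisson_tendsto:
 fixes m :: nat and r :: "nat => nat => real"
 assumes "!!l. l < m ==> (%n. r n l) \<longlonglongrightarrow> s l" "!!l. l < m ==> 0 < s l"
 shows "(%n. pmf (Pi_pmf {..<m} 0 (%l. poisson_pmf (r n l))) k) \<longlonglongrightarrow> pmf (Pi_pmf {..<m} 0 (%l. poisson_pmf (s l))) k"
proof (cases "\<forall>l. l \<notin> {..<m} --> k l = 0")
 case True
 have "(%n. pmf (poisson_pmf (r n l)) (k l)) \<longlonglongrightarrow> pmf (poisson_pmf (s l)) (k l)" if l: "l < m" for l
 proof -
  have "(%n. r n l ^ k l / fact (k l) * exp (- r n l)) \<longlonglongrightarrow> s l ^ k l / fact (k l) * exp (- s l)"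
   using assms(1)[OF l] by (intro tendsto_intros) auto
  \<comment> \<open>The formula for Poisson probabilities requires a positive rate, which holds
    eventually because the limit is positive.\<close>
  moreover have "\<forall>\<^sub>F n in sequentially. 0 < r n l" using order_tendstoD(1)[OF assms(1)[OF l] assms(2)[OF l]] .
  then have "\<forall>\<^sub>F n in sequentially. pmf (poisson_pmf (r n l)) (k l) = r n l ^ k l / fact (k l) * exp (- r n l)"
   by eventually_elim simp
  ultimately show ?thesis using assms(2)[OF l] by (subst tendsto_cong) auto
 qed
 then have "(%n. \<Prod>l<m. pmf (poisson_pmf (r n l)) (k l)) \<longlonglongrightarrow> (\<Prod>l<m. pmf (poisson_pmf (s l)) (k l))"
  by (intro tendsto_prod) auto
 moreover have "pmf (Pi_pmf {..<m} 0 p) k = (\<Prod>l<m. pmf (p l) (k l))" for p :: "nat => nat pmf"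
  using True by (intro pmf_Pi') auto
 ultimately show ?thesis by simp
next
 case False
 then have "\<exists>x. x \<notin> {..<m} & k x ~= 0" by auto
 then show ?thesis by (simp add: pmf_Pi_outside)
qed

section \<open>The Poisson points\<close>

lemma sets_PD1: "sets PD1_intensity = sets (restrict_space lborel {0<..})"
 by (simp add: PD1_intensity_def)

lemma space_PD1: "space PD1_intensity = {0<..}"
 by (simp add: PD1_intensity_def space_restrict_space)

lemma nn_integral_PD1:
 assumes [measurable]: "h \<in> borel_measurable borel"
 shows "(\<integral>\<^sup>+t. h t \<partial>PD1_intensity) = (\<integral>\<^sup>+t. h t * ennreal (exp (- t) / t) * indicator {0<..} t \<partial>lborel)"
proof -
 have "(\<integral>\<^sup>+t. h t \<partial>PD1_intensity) = (\<integral>\<^sup>+t. ennreal (exp (- t) / t) * h t \<partial>restrict_space lborel {0<..})"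
  unfolding PD1_intensity_def by (intro nn_integral_density measurable_restrict_space1) measurable
 also have "... = (\<integral>\<^sup>+t. ennreal (exp (- t) / t) * h t * indicator {0<..} t \<partial>lborel)"
  by (rule nn_integral_restrict_space) simp
 finally show ?thesis by (simp add: mult_ac)
qed

lemma sets_PD1_Ioc: "0 <= s ==> {s<..t} \<in> sets PD1_intensity"
 unfolding sets_PD1 by (subst sets_restrict_space_iff) auto

lemma sets_PD1_Ioi: "0 <= s ==> {s<..} \<in> sets PD1_intensity"
 unfolding sets_PD1 by (subst sets_restrict_space_iff) auto

lemma exp_over_antimono: "0 < s ==> s <= t ==> exp (- t) / t <= exp (- s) / (s::real)"
 by (intro frac_le) auto

text \<open>The density decreases, so its values at the end points bracket the mass of an interval.
  The comparison with sums rests on this bracket.\<close>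

lemma emeasure_PD1_Ioc:
 assumes "0 < s" "s <= t"
 shows "emeasure PD1_intensity {s<..t} <= ennreal ((t - s) * (exp (- s) / s))"
  and "ennreal ((t - s) * (exp (- t) / t)) <= emeasure PD1_intensity {s<..t}"
proof -
 let ?u = "(\<integral>\<^sup>+x. ennreal (exp (- x) / x) * indicator {s<..t} x \<partial>lborel)"
 have e: "emeasure PD1_intensity {s<..t} = ?u"
 proof -
  have "emeasure PD1_intensity {s<..t} = (\<integral>\<^sup>+x. indicator {s<..t} x \<partial>PD1_intensity)"
   using assms by (intro nn_integral_indicator[symmetric] sets_PD1_Ioc) auto
  also have "... = (\<integral>\<^sup>+x. indicator {s<..t} x * ennreal (exp (- x) / x) * indicator {0<..} x \<partial>lborel)"
   by (rule nn_integral_PD1) simp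
  also have "... = ?u"
   using assms by (intro nn_integral_cong) (auto simp: indicator_def)
  finally show ?thesis .
 qed
 have i: "(\<integral>\<^sup>+x. ennreal c * indicator {s<..t} x \<partial>lborel) = ennreal ((t - s) * c)" if "0 <= c" for c
  using assms that by (subst nn_integral_cmult_indicator) (auto simp: mult.commute ennreal_mult')
 have "?u <= (\<integral>\<^sup>+x. ennreal (exp (- s) / s) * indicator {s<..t} x \<partial>lborel)"
  using assms exp_over_antimono[of s] by (intro nn_integral_mono) (auto simp: indicator_def intro!: ennreal_leI)
 then show "emeasure PD1_intensity {s<..t} <= ennreal ((t - s) * (exp (- s) / s))"
  using assms by (simp only: e i divide_nonneg_pos exp_ge_zero)
 have "(\<integral>\<^sup>+x. ennreal (exp (- t) / t) * indicator {s<..t} x \<partial>lborel) <= ?u"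
  using assms exp_over_antimono[of _ t] by (intro nn_integral_mono) (auto simp: indicator_def intro!: ennreal_leI)
 moreover have "0 <= exp (- t) / t" using assms by simp
 ultimately show "ennreal ((t - s) * (exp (- t) / t)) <= emeasure PD1_intensity {s<..t}"
  by (simp only: e i)
qed

definition "PD1_mass s t = measure PD1_intensity {s<..t}"

lemma PD1_mass:
 assumes "0 < s" "s <= t"
 shows "emeasure PD1_intensity {s<..t} = ennreal (PD1_mass s t)" "PD1_mass s t <= (t - s) * (exp (- s) / s)"
  "(t - s) * (exp (- t) / t) <= PD1_mass s t" "0 <= PD1_mass s t"
proof -
 have "emeasure PD1_intensity {s<..t} < \<infinity>"
  using le_less_trans[OF emeasure_PD1_Ioc(1)[OF assms] ennreal_less_top] by simp
 then show e: "emeasure PD1_intensity {s<..t} = ennreal (PD1_mass s t)"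
  unfolding PD1_mass_def by (simp add: emeasure_eq_ennreal_measure)
 show "0 <= PD1_mass s t" by (simp add: PD1_mass_def)
 have "0 <= (t - s) * (exp (- s) / s)" using assms by simp
 then show "PD1_mass s t <= (t - s) * (exp (- s) / s)"
  using emeasure_PD1_Ioc(1)[OF assms] unfolding e by (simp only: ennreal_le_iff)
 show "(t - s) * (exp (- t) / t) <= PD1_mass s t"
  using emeasure_PD1_Ioc(2)[OF assms] unfolding e by (subst (asm) ennreal_le_iff) (auto simp: PD1_mass_def)
qed

lemma PD1_mass_split:
 assumes "0 < s" "s <= t" "t <= u"
 shows "PD1_mass s u = PD1_mass s t + PD1_mass t u"
proof -
 have "{s<..u} = {s<..t} \<union> {t<..u}" using assms by auto
 then show ?thesis
  unfolding PD1_mass_def using assms PD1_mass(1)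
  by (simp only:) (subst measure_Union, auto intro!: sets_PD1_Ioc simp: PD1_mass(1))
qed

lemma PD1_mass_pos: "0 < s ==> s < t ==> 0 < PD1_mass s t"
proof -
 assume "0 < s" "s < t"
 then have "0 < (t - s) * (exp (- t) / t)" by (intro mult_pos_pos divide_pos_pos) auto
 then show ?thesis using PD1_mass(3)[of s t] \<open>0 < s\<close> \<open>s < t\<close> by linarith
qed

lemma PD1_mass_mono:
 assumes "0 < s" "s <= s'" "s' <= t'" "t' <= t"
 shows "PD1_mass s' t' <= PD1_mass s t"
 using PD1_mass_split[of s s' t] PD1_mass_split[of s' t' t] PD1_mass(4)[of s s'] PD1_mass(4)[of t' t] assms
 by linarith

lemma PD1_mass_telescope:
 fixes c :: "nat => real"
 assumes c: "!!j. c j <= c (Suc j)" "0 < c l" and lu: "l <= u"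
 shows "(\<Sum>j\<in>{l..<u}. PD1_mass (c j) (c (Suc j))) = PD1_mass (c l) (c u)"
 using lu
proof (induction u rule: dec_induct)
 case base
 then show ?case by (simp add: PD1_mass_def)
next
 case (step n)
 have "c l <= c n" using step(1) by (rule lift_Suc_mono_le[where f = c, OF c(1)])
 then show ?case using step PD1_mass_split[OF c(2) _ c(1)[of n]] by simp
qed

text \<open>
 Each summand lies between the masses of the grid cells to its right and to its left.
\<close>

lemma geometric_rate_approx:
 assumes a: "0 < a" "a < b" and K: "1 <= K" "2 / a < real K"
 shows "\<bar>(\<Sum>j | a < real j / real K & real j / real K <= b. exp (- (1 / real K)) ^ j / real j) - PD1_mass a b\<bar>
  <= (exp (- (a / 2)) / (a / 2) + exp (- a) / a) / real K"
proof -
 let ?h = "\<lambda>t::real. exp (- t) / t"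
 have K0: "0 < real K" using K by simp
 have aK: "2 < a * real K" using K a by (simp add: field_simps)
 define l where "l = nat \<lfloor>a * real K\<rfloor>"
 define u where "u = nat \<lfloor>b * real K\<rfloor>"
 define c where "c j = real j / real K" for j
 have ab: "a * real K < b * real K" using a K0 by simp
 have l: "real l <= a * real K" "a * real K < real l + 1" using aK unfolding l_def by linarith+
 have u: "real u <= b * real K" "b * real K < real u + 1" using aK ab unfolding u_def by linarith+
 have "real l < real u + 1" using l u ab by linarith
 then have lu: "l <= u" by linarith
 have J: "{j. a < real j / real K & real j / real K <= b} = {Suc l..<Suc u}"
 proof (rule set_eqI)
  fix j
  have "a < real j / real K & real j / real K <= b \<longleftrightarrow> a * real K < real j & real j <= b * real K"
   using K0 by (simp add: pos_less_divide_eq pos_divide_le_eq)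
  also have "... \<longleftrightarrow> Suc l <= j & j < Suc u" using l u by linarith
  finally show "j \<in> {j. a < real j / real K & real j / real K <= b} \<longleftrightarrow> j \<in> {Suc l..<Suc u}" by simp
 qed
 have cS: "c (Suc j) = c j + 1 / real K" for j by (simp add: c_def add_divide_distrib)
 have cm: "c j <= c (Suc j)" for j using K0 by (simp add: cS)
 have c0: "0 < c j" if "l <= j" for j
 proof -
  have "0 < real l" using l(2) aK by linarith
  then show ?thesis using that K0 by (simp add: c_def)
 qed
 have cl: "c l <= a" "a < c (Suc l)" "c u <= b" "b < c (Suc u)"
  using l u K0 by (simp_all add: c_def pos_less_divide_eq pos_divide_le_eq add.commute)
 \<comment> \<open>The bound on \<open>K\<close> keeps the last grid point up to \<open>a\<close>
   above \<open>a / 2\<close>; the density at \<open>a / 2\<close> then bounds the error at the left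
   end.\<close>
 have "1 / real K < a / 2" using aK K0 by (simp add: field_simps)
 then have ca: "a / 2 <= c l" using cl(2) unfolding cS by linarith
 let ?S = "\<Sum>j\<in>{Suc l..<Suc u}. (1 / real K) * ?h (c j)"
 have S: "(\<Sum>j | a < real j / real K & real j / real K <= b. exp (- (1 / real K)) ^ j / real j) = ?S"
  unfolding J using K0 by (intro sum.cong refl) (simp add: c_def flip: exp_of_nat_mult)
 have "?S = (\<Sum>j\<in>{l..<u}. (1 / real K) * ?h (c (Suc j)))" by (rule sum.shift_bounds_Suc_ivl)
 also have "... <= (\<Sum>j\<in>{l..<u}. PD1_mass (c j) (c (Suc j)))"
 proof (rule sum_mono)
  fix j assume "j \<in> {l..<u}"
  then show "(1 / real K) * ?h (c (Suc j)) <= PD1_mass (c j) (c (Suc j))"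
   using PD1_mass(3)[OF c0 cm, of j] by (simp add: cS)
 qed
 also have "... = PD1_mass (c l) (c u)" by (rule PD1_mass_telescope[where c = c and l = l, OF cm c0 lu]) simp
 also have "... <= PD1_mass (c l) b"
  using lift_Suc_mono_le[where f = c, OF cm lu] cl c0[of l] by (intro PD1_mass_mono) auto
 also have "... = PD1_mass (c l) a + PD1_mass a b" using cl c0[of l] a by (intro PD1_mass_split) auto
 also have "PD1_mass (c l) a <= (a - c l) * ?h (c l)" using cl c0[of l] by (intro PD1_mass(2)) auto
 also have "... <= (1 / real K) * ?h (a / 2)"
  using cl(1,2) ca a K0 exp_over_antimono[of "a / 2" "c l"] unfolding cS by (intro mult_mono) auto
 finally have 1: "?S <= PD1_mass a b + (1 / real K) * ?h (a / 2)" by simp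
 have "PD1_mass a b <= PD1_mass a (c (Suc u))" using a cl by (intro PD1_mass_mono) auto
 also have "... = PD1_mass a (c (Suc l)) + PD1_mass (c (Suc l)) (c (Suc u))"
  using a cl lift_Suc_mono_le[where f = c, OF cm, of "Suc l" "Suc u"] lu by (intro PD1_mass_split) auto
 also have "PD1_mass a (c (Suc l)) <= (c (Suc l) - a) * ?h a" using a cl by (intro PD1_mass(2)) auto
 also have "... <= (1 / real K) * ?h a" using cl(1) a by (intro mult_right_mono) (auto simp: cS)
 also have "PD1_mass (c (Suc l)) (c (Suc u)) = (\<Sum>j\<in>{Suc l..<Suc u}. PD1_mass (c j) (c (Suc j)))"
  using lu by (intro PD1_mass_telescope[where c = c and l = "Suc l", OF cm c0, symmetric]) auto
 also have "... <= ?S"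
 proof (rule sum_mono)
  fix j assume "j \<in> {Suc l..<Suc u}"
  then show "PD1_mass (c j) (c (Suc j)) <= (1 / real K) * ?h (c j)"
   using PD1_mass(2)[OF c0 cm, of j] by (simp add: cS)
 qed
 finally have 2: "PD1_mass a b <= (1 / real K) * ?h a + ?S" by simp
 have "0 <= (1 / real K) * ?h a" "0 <= (1 / real K) * ?h (a / 2)" using a K0 by simp_all
 moreover have "(?h (a / 2) + ?h a) / real K = (1 / real K) * ?h (a / 2) + (1 / real K) * ?h a"
  by (simp only: add_divide_distrib mult_1 times_divide_eq_left)
 ultimately show ?thesis using 1 2 unfolding S by linarith
qed

lemma geometric_rate_tendsto:
 assumes "0 < a" "a < b"
 shows "(%K. \<Sum>j | a < real j / real K & real j / real K <= b. exp (- (1 / real K)) ^ j / real j) \<longlonglongrightarrow> PD1_mass a b"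
proof -
 let ?c = "exp (- (a / 2)) / (a / 2) + exp (- a) / a"
 have "(%K. ?c / real K) \<longlonglongrightarrow> 0" by (rule lim_const_over_n)
 moreover have "\<forall>\<^sub>F K in sequentially. norm ((\<Sum>j | a < real j / real K & real j / real K <= b. exp (- (1 / real K)) ^ j / real j) - PD1_mass a b) <= ?c / real K"
  using eventually_ge_at_top[of "1::nat"] eventually_gt_at_top[of "nat \<lceil>2 / a\<rceil>"]
 proof eventually_elim
  case (elim K)
  then have "2 / a < real K" by linarith
  then show ?case using geometric_rate_approx[OF assms, of K] elim by simp
 qed
 ultimately have "(%K. (\<Sum>j | a < real j / real K & real j / real K <= b. exp (- (1 / real K)) ^ j / real j) - PD1_mass a b) \<longlonglongrightarrow> 0"
  by (rule Lim_null_comparison[rotated])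
 then show ?thesis by (rule LIM_zero_cancel)
qed

section \<open>Means of Poisson counts and Campbell's formula\<close>

lemma poisson_mean_sums: "(%k. real k * (exp (- r) * r ^ k / fact k)) sums (r :: real)"
proof -
 have "(%k. r * exp (- r) * (r ^ k / fact k)) sums (r * exp (- r) * exp r)"
  using exp_converges[of r] by (intro sums_mult) (simp add: field_simps)
 also have "(%k. r * exp (- r) * (r ^ k / fact k)) = (%k. real (Suc k) * (exp (- r) * r ^ Suc k / fact (Suc k)))"
  by (rule ext) (simp del: of_nat_Suc add: field_simps)
 finally show ?thesis
  by (subst (asm) sums_Suc_iff) (simp add: mult.assoc flip: exp_add)
qed

lemma nn_integral_poisson_count:
 fixes X :: "'w => nat"
 assumes "prob_space M" and X: "X \<in> M \<rightarrow>\<^sub>M count_space UNIV" and r: "0 <= r"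
  and law: "!!k. measure M {x\<in>space M. X x = k} = exp (- r) * r ^ k / fact k"
 shows "(\<integral>\<^sup>+x. of_nat (X x) \<partial>M) = ennreal r"
proof -
 interpret prob_space M by fact
 have [measurable]: "X \<in> M \<rightarrow>\<^sub>M count_space UNIV" by (rule X)
 have "(\<integral>\<^sup>+x. of_nat (X x) \<partial>M) = (\<integral>\<^sup>+x. (\<integral>\<^sup>+k. of_nat k * indicator {X x} k \<partial>count_space UNIV) \<partial>M)"
  by (intro nn_integral_cong) (simp add: nn_integral_count_space_indicator[symmetric] nn_integral_count_space_finite NO_MATCH_def)
 also have "... = (\<integral>\<^sup>+k. (\<integral>\<^sup>+x. of_nat k * indicator {X x} k \<partial>M) \<partial>count_space UNIV)"
  by (rule nn_integral_count_space_nn_integral) (auto simp: indicator_def)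
 also have "... = (\<integral>\<^sup>+k. ennreal (real k * (exp (- r) * r ^ k / fact k)) \<partial>count_space UNIV)"
 proof (rule nn_integral_cong)
  fix k
  have "(\<integral>\<^sup>+x. of_nat k * indicator {X x} k \<partial>M) = (\<integral>\<^sup>+x. of_nat k * indicator {x\<in>space M. X x = k} x \<partial>M)"
   by (rule nn_integral_cong) (auto simp: indicator_def)
  also have "... = of_nat k * emeasure M {x\<in>space M. X x = k}"
   by (rule nn_integral_cmult_indicator) measurable
  also have "... = ennreal (real k * (exp (- r) * r ^ k / fact k))"
   unfolding emeasure_eq_measure law ennreal_of_nat_eq_real_of_nat by (rule ennreal_mult'[symmetric]) simp
  finally show "(\<integral>\<^sup>+x. of_nat k * indicator {X x} k \<partial>M) = ennreal (real k * (exp (- r) * r ^ k / fact k))" .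
 qed
 also have "... = ennreal r"
  using poisson_mean_sums[of r] r by (simp add: nn_integral_count_space_nat suminf_ennreal2 sums_iff)
 finally show ?thesis .
qed

lemma nn_integral_exp_Ioi:
 assumes "0 < l"
 shows "(\<integral>\<^sup>+t. ennreal (exp (- (t * l))) * indicator {0<..} t \<partial>lborel) = ennreal (1 / l)"
proof -
 interpret E: prob_space "density lborel (exponential_density l)" by (rule prob_space_exponential_density[OF assms])
 have "1 = (\<integral>\<^sup>+t. ennreal (exponential_density l t) \<partial>lborel)"
  using E.emeasure_space_1 by (simp add: emeasure_density)
 also have "... = (\<integral>\<^sup>+t. ennreal l * (ennreal (exp (- (t * l))) * indicator {0<..} t) \<partial>lborel)"
 proof (rule nn_integral_cong_AE)
  show "AE t in lborel. ennreal (exponential_density l t) = ennreal l * (ennreal (exp (- (t * l))) * indicator {0<..} t)"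
   using AE_lborel_singleton[of 0]
  proof eventually_elim
   case (elim t)
   show ?case
   proof (cases "0 < t")
    case True
    have "ennreal (l * exp (- (t * l))) = ennreal l * ennreal (exp (- (t * l)))"
     using assms by (intro ennreal_mult') simp
    then show ?thesis using True by (simp add: exponential_density_def)
   qed (use elim in \<open>simp add: exponential_density_def\<close>)
  qed
 qed
 also have "... = ennreal l * (\<integral>\<^sup>+t. ennreal (exp (- (t * l))) * indicator {0<..} t \<partial>lborel)"
  by (rule nn_integral_cmult) measurable
 finally have 1: "ennreal l * (\<integral>\<^sup>+t. ennreal (exp (- (t * l))) * indicator {0<..} t \<partial>lborel) = 1" by simp
 have l: "ennreal (1 / l) * ennreal l = 1" using assms by (simp flip: ennreal_mult')
 have "(\<integral>\<^sup>+t. ennreal (exp (- (t * l))) * indicator {0<..} t \<partial>lborel)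
   = ennreal (1 / l) * (ennreal l * (\<integral>\<^sup>+t. ennreal (exp (- (t * l))) * indicator {0<..} t \<partial>lborel))"
  unfolding mult.assoc[symmetric] l by simp
 then show ?thesis unfolding 1 by simp
qed

lemma emeasure_PD1_Ioi_finite:
 assumes "0 < s"
 shows "emeasure PD1_intensity {s<..} < \<infinity>"
proof -
 have "emeasure PD1_intensity {s<..} = (\<integral>\<^sup>+x. indicator {s<..} x \<partial>PD1_intensity)"
  using assms by (intro nn_integral_indicator[symmetric] sets_PD1_Ioi) auto
 also have "... = (\<integral>\<^sup>+x. indicator {s<..} x * ennreal (exp (- x) / x) * indicator {0<..} x \<partial>lborel)"
  by (rule nn_integral_PD1) simp
 also have "... <= (\<integral>\<^sup>+x. ennreal (1 / s) * (ennreal (exp (- (x * 1))) * indicator {0<..} x) \<partial>lborel)"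
 proof (rule nn_integral_mono)
  fix x :: real
  show "indicator {s<..} x * ennreal (exp (- x) / x) * indicator {0<..} x <= ennreal (1 / s) * (ennreal (exp (- (x * 1))) * indicator {0<..} x)"
  proof (cases "s < x")
   case True
   have "exp (- x) / x <= 1 / s * exp (- x)" using assms True by (simp add: field_simps)
   then have "ennreal (exp (- x) / x) <= ennreal (1 / s * exp (- x))" by (rule ennreal_leI)
   also have "... = ennreal (1 / s) * ennreal (exp (- x))" using assms by (intro ennreal_mult') simp
   finally show ?thesis using True assms by simp
  qed simp
 qed
 also have "... = ennreal (1 / s) * ennreal (1 / 1)"
  by (subst nn_integral_cmult, measurable, subst nn_integral_exp_Ioi) auto
 also have "... < \<infinity>" by (simp add: ennreal_mult_less_top)
 finally show ?thesis .
qed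

context
 fixes M :: "'w measure" and pt :: "nat => 'w => real"
 assumes pp: "poisson_points M PD1_intensity pt"
begin

lemma pp_prob_space: "prob_space M"
 using pp by (simp add: poisson_points_def)

lemma pp_measurable: "pt j \<in> M \<rightarrow>\<^sub>M PD1_intensity"
 using pp by (simp add: poisson_points_def)

lemma pp_borel_measurable: "pt j \<in> borel_measurable M"
proof -
 have "(%x. x) \<in> PD1_intensity \<rightarrow>\<^sub>M borel"
  by (subst measurable_cong_sets[OF sets_PD1 refl]) (rule measurable_restrict_space1, simp)
 from measurable_compose[OF pp_measurable this] show ?thesis .
qed

lemma pp_pos: "x \<in> space M ==> 0 < pt j x"
 using measurable_space[OF pp_measurable[of j]] by (simp add: space_PD1)

lemma pp_counts:
 assumes "!!i. i < (m::nat) ==> A i \<in> sets PD1_intensity & emeasure PD1_intensity (A i) < \<infinity>" "disjoint_family_on A {..<m}"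
 shows "prob_space.indep_vars M (%_. count_space UNIV) (%i x. card {j. pt j x \<in> A i}) {..<m}"
 using pp assms unfolding poisson_points_def by blast

lemma pp_count:
 assumes "A \<in> sets PD1_intensity" "emeasure PD1_intensity A < \<infinity>"
 shows "AE x in M. finite {j. pt j x \<in> A}"
  and "measure M {x \<in> space M. card {j. pt j x \<in> A} = k} = exp (- measure PD1_intensity A) * measure PD1_intensity A ^ k / fact k"
  and "(%x. card {j. pt j x \<in> A}) \<in> M \<rightarrow>\<^sub>M count_space UNIV"
proof -
 interpret prob_space M by (rule pp_prob_space)
 show "AE x in M. finite {j. pt j x \<in> A}"
  "measure M {x \<in> space M. card {j. pt j x \<in> A} = k} = exp (- measure PD1_intensity A) * measure PD1_intensity A ^ k / fact k"
  using pp assms unfolding poisson_points_def by blast+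
 have "indep_vars (%_. count_space UNIV) (%i x. card {j. pt j x \<in> A}) {..<1::nat}"
  using assms by (intro pp_counts[of 1 "%_. A"]) (auto simp: disjoint_family_on_def)
 then show "(%x. card {j. pt j x \<in> A}) \<in> M \<rightarrow>\<^sub>M count_space UNIV"
  unfolding indep_vars_def by auto
qed

text \<open>Campbell's formula. The mean counting measure of the points agrees with the intensity on
  sets of finite intensity, because a Poisson variable has its parameter as mean; it is then
  identified on all sets.\<close>

lemma nn_integral_pp:
 assumes [measurable]: "h \<in> borel_measurable borel"
 shows "(\<integral>\<^sup>+w. (\<integral>\<^sup>+j. h (pt j w) \<partial>count_space UNIV) \<partial>M) = (\<integral>\<^sup>+t. h t \<partial>PD1_intensity)"
proof -
 interpret prob_space M by (rule pp_prob_space)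
 let ?P = "count_space (UNIV :: nat set) \<Otimes>\<^sub>M M"
 define N where "N = distr ?P PD1_intensity (%(j, w). pt j w)"
 have m: "(%(j, w). pt j w) \<in> ?P \<rightarrow>\<^sub>M PD1_intensity"
  by (rule measurable_pair_measure_countable1) (auto intro: pp_measurable)
 have N: "(\<integral>\<^sup>+t. h t \<partial>N) = (\<integral>\<^sup>+w. (\<integral>\<^sup>+j. h (pt j w) \<partial>count_space UNIV) \<partial>M)"
  if h: "h \<in> borel_measurable PD1_intensity" for h
 proof -
  have "(\<integral>\<^sup>+t. h t \<partial>N) = (\<integral>\<^sup>+x. h (case x of (j, w) => pt j w) \<partial>?P)"
   unfolding N_def by (rule nn_integral_distr[OF m]) (simp add: h)
  also have "... = (\<integral>\<^sup>+j. (\<integral>\<^sup>+w. h (pt j w) \<partial>M) \<partial>count_space UNIV)"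
   using nn_integral_fst[OF measurable_compose[OF m h]] by simp
  also have "... = (\<integral>\<^sup>+w. (\<integral>\<^sup>+j. h (pt j w) \<partial>count_space UNIV) \<partial>M)"
   by (rule nn_integral_count_space_nn_integral[symmetric]) (auto intro: measurable_compose[OF pp_measurable h])
  finally show ?thesis .
 qed
 have fin: "emeasure N A = emeasure PD1_intensity A"
  if A: "A \<in> sets PD1_intensity" "emeasure PD1_intensity A < \<infinity>" for A
 proof -
  have "emeasure N A = (\<integral>\<^sup>+t. indicator A t \<partial>N)"
   using A by (intro nn_integral_indicator[symmetric]) (simp add: N_def)
  also have "... = (\<integral>\<^sup>+w. (\<integral>\<^sup>+j. indicator A (pt j w) \<partial>count_space UNIV) \<partial>M)"
   using A by (intro N) simp
  also have "... = (\<integral>\<^sup>+w. of_nat (card {j. pt j w \<in> A}) \<partial>M)"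
  proof (rule nn_integral_cong_AE)
   show "AE w in M. (\<integral>\<^sup>+j. indicator A (pt j w) \<partial>count_space UNIV) = of_nat (card {j. pt j w \<in> A})"
    using pp_count(1)[OF A]
   proof eventually_elim
    case (elim w)
    have "(\<integral>\<^sup>+j. indicator A (pt j w) \<partial>count_space UNIV) = (\<integral>\<^sup>+j. indicator {j. pt j w \<in> A} j \<partial>count_space UNIV)"
     by (rule nn_integral_cong) (simp add: indicator_def)
    also have "... = emeasure (count_space UNIV) {j. pt j w \<in> A}" by (rule nn_integral_indicator) simp
    also have "... = of_nat (card {j. pt j w \<in> A})" using elim by (intro emeasure_count_space_finite) auto
    finally show ?case .
   qed
  qed
  also have "... = ennreal (measure PD1_intensity A)"
   by (rule nn_integral_poisson_count[OF pp_prob_space pp_count(3)[OF A] measure_nonneg pp_count(2)[OF A]])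
  also have "... = emeasure PD1_intensity A"
   using A by (simp add: emeasure_eq_ennreal_measure)
  finally show ?thesis .
 qed
 have "N = PD1_intensity"
 proof (rule measure_eqI)
  show "sets N = sets PD1_intensity" by (simp add: N_def)
  fix A assume "A \<in> sets N"
  then have A: "A \<in> sets PD1_intensity" by (simp add: N_def)
  \<comment> \<open>The intensity is infinite only near 0, so a set is exhausted by its parts away
    from 0.\<close>
  let ?A = "\<lambda>n::nat. A \<inter> {1 / real (Suc n)<..}"
  have sA: "?A n \<in> sets PD1_intensity" for n using A by (intro sets.Int sets_PD1_Ioi) auto
  have "emeasure PD1_intensity (?A n) <= emeasure PD1_intensity {1 / real (Suc n)<..}" for n
   by (rule emeasure_mono) (auto intro!: sets_PD1_Ioi)
  then have "emeasure PD1_intensity (?A n) < \<infinity>" for n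
   using emeasure_PD1_Ioi_finite[of "1 / real (Suc n)"] by (meson le_less_trans of_nat_0_less_iff zero_less_Suc zero_less_divide_1_iff)
  then have eq: "emeasure N (?A n) = emeasure PD1_intensity (?A n)" for n by (intro fin sA)
  have "A \<subseteq> {0<..}" using sets.sets_into_space[OF A] by (simp add: space_PD1)
  then have U: "(\<Union>n. ?A n) = A"
  proof (intro equalityI subsetI)
   fix x assume "x \<in> A"
   moreover from this obtain n where "1 / real (Suc n) < x"
    using \<open>A \<subseteq> {0<..}\<close> reals_Archimedean[of x] by (auto simp: inverse_eq_divide)
   ultimately show "x \<in> (\<Union>n. ?A n)" by blast
  qed auto
  have inc: "incseq ?A"
  proof (rule incseq_SucI)
   fix n
   have "1 / real (Suc (Suc n)) <= 1 / real (Suc n)" by (simp add: field_simps)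
   then show "?A n \<subseteq> ?A (Suc n)" by (auto simp del: of_nat_Suc)
  qed
  have "emeasure N A = emeasure N (\<Union>n. ?A n)" by (simp only: U)
  also have "... = (SUP n. emeasure N (?A n))"
   by (rule SUP_emeasure_incseq[OF _ inc, symmetric]) (use sA in \<open>auto simp: N_def\<close>)
  also have "... = (SUP n. emeasure PD1_intensity (?A n))" by (simp only: eq)
  also have "... = emeasure PD1_intensity (\<Union>n. ?A n)"
   by (rule SUP_emeasure_incseq[OF _ inc]) (use sA in auto)
  also have "... = emeasure PD1_intensity A" by (simp only: U)
  finally show "emeasure N A = emeasure PD1_intensity A" .
 qed
 moreover have "h \<in> borel_measurable PD1_intensity"
  by (subst measurable_cong_sets[OF sets_PD1 refl]) (rule measurable_restrict_space1, simp)
 ultimately show ?thesis using N[of h] by simp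
qed

text \<open>The mean of the sum of the points is the integral of \<open>t\<close> against the
  density \<open>exp (- t) / t\<close>, which is 1.\<close>

lemma pp_summable: "AE x in M. summable_family UNIV (%j. pt j x)"
proof -
 let ?u = "(\<integral>\<^sup>+x. (\<integral>\<^sup>+j. ennreal (pt j x) \<partial>count_space UNIV) \<partial>M)"
 interpret prob_space M by (rule pp_prob_space)
 have "?u
   = (\<integral>\<^sup>+t. ennreal t * ennreal (exp (- t) / t) * indicator {0<..} t \<partial>lborel)"
  by (subst nn_integral_pp) (simp_all add: nn_integral_PD1)
 also have "... = (\<integral>\<^sup>+t. ennreal (exp (- (t * 1))) * indicator {0<..} t \<partial>lborel)"
  by (intro nn_integral_cong) (auto simp: indicator_def simp flip: ennreal_mult')
 also have "... = 1" by (subst nn_integral_exp_Ioi) auto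
 finally have 1: "?u ~= \<infinity>" by simp
 note pp_borel_measurable[measurable]
 have "(%x. \<integral>\<^sup>+j. ennreal (pt j x) \<partial>count_space UNIV) \<in> borel_measurable M"
  unfolding nn_integral_count_space_nat by measurable
 from nn_integral_PInf_AE[OF this 1] show ?thesis
  using AE_space by eventually_elim (auto simp: summable_family_def pp_pos less_imp_le top.not_eq_extremum)
qed

text \<open>The vectors that vanish outside \<open>{..<m}\<close> form a countable set, so it is
  enough to compare the probabilities of single vectors, where independence and the Poisson laws
  give the product.\<close>

lemma pp_count_law:
 fixes F :: "(nat => nat) => real" and m :: nat
 assumes m: "0 < m" and A: "!!l. l < m ==> A l \<in> sets PD1_intensity & emeasure PD1_intensity (A l) < \<infinity> & 0 < measure PD1_intensity (A l)"
  and dis: "disjoint_family_on A {..<m}"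
 defines "X \<equiv> %w l. if l < m then card {j. pt j w \<in> A l} else 0"
 defines "Q \<equiv> Pi_pmf {..<m} 0 (%l. poisson_pmf (measure PD1_intensity (A l)))"
 shows "(\<integral>w. F (X w) \<partial>M) = (\<integral>k. F k \<partial>Q)" and "(%w. F (X w)) \<in> borel_measurable M"
proof -
 interpret prob_space M by (rule pp_prob_space)
 define S :: "(nat => nat) set" where "S = {k. \<forall>l. l \<notin> {..<m} --> k l = 0}"
 have "S \<subseteq> (%xs l. if l < length xs then xs ! l else 0) ` UNIV"
 proof
  fix k assume "k \<in> S"
  then have "k = (%l. if l < length (map k [0..<m]) then map k [0..<m] ! l else 0)"
   by (auto simp: S_def fun_eq_iff)
  then show "k \<in> (%xs l. if l < length xs then xs ! l else 0) ` UNIV" by blast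
 qed
 then have cS: "countable S" by (rule countable_subset) (intro countable_image countableI_type)
 let ?c = "%l w. card {j. pt j w \<in> A l}"
 have cm: "?c l \<in> M \<rightarrow>\<^sub>M count_space UNIV" if "l < m" for l using pp_count(3) A[OF that] by simp
 have fib: "X -` {k} \<inter> space M = (\<Inter>l\<in>{..<m}. ?c l -` {k l} \<inter> space M)" if "k \<in> S" for k
  using that m by (auto simp: X_def S_def fun_eq_iff)
 have fibm: "X -` {k} \<inter> space M \<in> sets M" if "k \<in> S" for k
  unfolding fib[OF that] using m cm by (intro sets.finite_INT measurable_sets[OF cm]) auto
 have XS: "X w \<in> S" for w by (simp add: X_def S_def)
 have Xm: "X \<in> M \<rightarrow>\<^sub>M count_space S"
  using measurable_count_space_eq_countable[OF cS, of X M] XS fibm by auto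
 have law: "emeasure (distr M (count_space S) X) {k} = ennreal (pmf Q k)" if k: "k \<in> S" for k
 proof -
  have "emeasure (distr M (count_space S) X) {k} = emeasure M (X -` {k} \<inter> space M)"
   using k by (intro emeasure_distr Xm) simp
  also have "... = ennreal (prob (\<Inter>l\<in>{..<m}. ?c l -` {k l} \<inter> space M))"
   unfolding fib[OF k] by (rule emeasure_eq_measure)
  also have "prob (\<Inter>l\<in>{..<m}. ?c l -` {k l} \<inter> space M) = (\<Prod>l\<in>{..<m}. prob (?c l -` {k l} \<inter> space M))"
   by (rule indep_varsD_finite[OF pp_counts]) (use A dis m in auto)
  also have "... = (\<Prod>l<m. pmf (poisson_pmf (measure PD1_intensity (A l))) (k l))"
  proof (intro prod.cong refl)
   fix l assume "l \<in> {..<m}"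
   then have l: "A l \<in> sets PD1_intensity" "emeasure PD1_intensity (A l) < \<infinity>" "0 < measure PD1_intensity (A l)"
    using A by auto
   have "?c l -` {k l} \<inter> space M = {w\<in>space M. ?c l w = k l}" by auto
   then show "prob (?c l -` {k l} \<inter> space M) = pmf (poisson_pmf (measure PD1_intensity (A l))) (k l)"
    using pp_count(2)[OF l(1,2), of "k l"] l(3) by simp
  qed
  also have "... = pmf Q k" unfolding Q_def using k by (subst pmf_Pi') (auto simp: S_def)
  finally show ?thesis .
 qed
 \<comment> \<open>The product law lives on all functions; \<open>t\<close> projects it to
   \<open>S\<close> without changing it almost surely, so that both laws become measures on
   \<open>count_space S\<close>.\<close>
 define t :: "(nat => nat) => nat => nat" where "t k = (%l. if l < m then k l else 0)" for k
 have tS: "t k \<in> S" for k by (simp add: t_def S_def)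
 have tid: "t k = k" if "k \<in> S" for k using that by (auto simp: t_def S_def fun_eq_iff)
 have QS: "k \<in> S" if "k \<in> set_pmf Q" for k
 proof (rule ccontr)
  assume "k \<notin> S"
  then have "\<exists>x. x \<notin> {..<m} & k x ~= 0" by (auto simp: S_def)
  then have "pmf Q k = 0" unfolding Q_def by (intro pmf_Pi_outside) auto
  then show False using that by (simp add: set_pmf_iff)
 qed
 have "distr M (count_space S) X = distr (measure_pmf Q) (count_space S) t"
 proof (rule measure_eqI_countable[OF _ _ cS])
  fix k assume k: "k \<in> S"
  have "emeasure (distr (measure_pmf Q) (count_space S) t) {k} = emeasure (measure_pmf Q) (t -` {k})"
   using k tS by (subst emeasure_distr) auto
  also have "... = emeasure (measure_pmf Q) {k}"
   by (rule emeasure_eq_AE) (auto simp: AE_measure_pmf_iff tid k QS)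
  also have "... = ennreal (pmf Q k)" by (rule emeasure_pmf_single)
  finally show "emeasure (distr M (count_space S) X) {k} = emeasure (distr (measure_pmf Q) (count_space S) t) {k}"
   by (simp only: law[OF k])
 qed auto
 moreover have "(\<integral>k. F k \<partial>distr M (count_space S) X) = (\<integral>w. F (X w) \<partial>M)"
  by (rule integral_distr[OF Xm]) simp
 moreover have "(\<integral>k. F k \<partial>distr (measure_pmf Q) (count_space S) t) = (\<integral>k. F (t k) \<partial>Q)"
  by (rule integral_distr) (use tS in auto)
 moreover have "(\<integral>k. F (t k) \<partial>Q) = (\<integral>k. F k \<partial>Q)"
  by (rule integral_cong_AE) (auto simp: AE_measure_pmf_iff tid QS)
 ultimately show "(\<integral>w. F (X w) \<partial>M) = (\<integral>k. F k \<partial>Q)" by simp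
 show "(%w. F (X w)) \<in> borel_measurable M"
  by (rule measurable_compose[OF Xm]) simp
qed

end

text \<open>The decomposition is that of the discrete case, with Campbell's formula instead of the
  Mecke equation. The integral of \<open>exp (- t / 2)\<close> is 2; it is enlarged to 4 in order to
  share one bound with the discrete case.\<close>

lemma (in grid_rounding) mean_rounding_error_pp:
 assumes pp: "poisson_points M PD1_intensity pt"
 shows "(\<integral>\<^sup>+x. (\<integral>\<^sup>+j. ennreal (rounding_error (pt j x)) \<partial>count_space UNIV) \<partial>M)
  <= ennreal (\<eta> + 4 * (\<eta> + exp (- (\<eta> + real m * \<eta>\<^sup>2) / 2)))"
proof -
 let ?u = "(\<integral>\<^sup>+t. ennreal (exp (- (t * (1 / 2)))) * indicator {0<..} t \<partial>lborel)"
 let ?T = "\<eta> + real m * \<eta>\<^sup>2"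
 define e where "e = \<eta> + exp (- ?T / 2)"
 have e0: "0 <= e" using \<eta> by (simp add: e_def)
 have [measurable]: "rounding_error \<in> borel_measurable borel"
  unfolding rounding_error_def[abs_def] by measurable
 have "(\<integral>\<^sup>+x. (\<integral>\<^sup>+j. ennreal (rounding_error (pt j x)) \<partial>count_space UNIV) \<partial>M)
   = (\<integral>\<^sup>+t. ennreal (rounding_error t) * ennreal (exp (- t) / t) * indicator {0<..} t \<partial>lborel)"
  by (subst nn_integral_pp[OF pp]) (simp_all add: nn_integral_PD1)
 also have "... <= (\<integral>\<^sup>+t. indicator {0<..\<eta>} t + ennreal e * (ennreal (exp (- (t * (1 / 2)))) * indicator {0<..} t) \<partial>lborel)"
 proof (rule nn_integral_mono)
  fix t :: real
  show "ennreal (rounding_error t) * ennreal (exp (- t) / t) * indicator {0<..} t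
   <= indicator {0<..\<eta>} t + ennreal e * (ennreal (exp (- (t * (1 / 2)))) * indicator {0<..} t)"
  proof (cases "0 < t")
   case True
   let ?w = "exp (- (t * (1 / 2)))"
   have z1: "exp (- t) <= ?w" using True by simp
   have z2: "exp (- t) <= exp (- ?T / 2) * ?w" if "?T < t"
   proof -
    have "- b <= - a / 2 + - (b * (1 / 2))" if "a < b" for a b :: real using that by simp
    from this[OF that] show ?thesis unfolding exp_add[symmetric] exp_le_cancel_iff .
   qed
   have z3: "exp (- t) <= 1" using True by simp
   have "rounding_error t * (exp (- t) / t)
     = exp (- t) * (if t <= \<eta> then 1 else 0) + (exp (- t) * (if ?T < t then 1 else 0) + exp (- t) * \<eta>)"
    using True unfolding rounding_error_def by (auto simp: field_simps)
   also have "... <= (if t <= \<eta> then 1 else 0) + (exp (- ?T / 2) * ?w + ?w * \<eta>)"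
    using z1 z2 z3 \<eta> by (intro add_mono mult_right_mono) auto
   also have "... = (if t <= \<eta> then 1 else 0) + e * ?w" unfolding e_def by (simp add: algebra_simps)
   finally have le: "rounding_error t * (exp (- t) / t) <= (if t <= \<eta> then 1 else 0) + e * ?w" .
   have "ennreal (rounding_error t) * ennreal (exp (- t) / t) = ennreal (rounding_error t * (exp (- t) / t))"
    using True by (intro ennreal_mult''[symmetric]) auto
   also have "... <= ennreal ((if t <= \<eta> then 1 else 0) + e * ?w)" by (rule ennreal_leI[OF le])
   also have "... = ennreal (if t <= \<eta> then 1 else 0) + ennreal (e * ?w)"
    using e0 by (intro ennreal_plus) auto
   also have "ennreal (e * ?w) = ennreal e * ennreal ?w" using e0 by (rule ennreal_mult')
   finally show ?thesis using True by (auto simp: indicator_def)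
  qed simp
 qed
 also have "... = ennreal \<eta> + ennreal e * ennreal (1 / (1 / 2))"
 proof -
  have 1: "(\<integral>\<^sup>+t. indicator {0<..\<eta>} t \<partial>lborel) = ennreal \<eta>" using \<eta> by simp
  have "(\<integral>\<^sup>+t. ennreal e * (ennreal (exp (- (t * (1 / 2)))) * indicator {0<..} t) \<partial>lborel)
    = ennreal e * ?u"
   by (rule nn_integral_cmult) measurable
  also have "?u = ennreal (1 / (1 / 2))"
   by (rule nn_integral_exp_Ioi) simp
  finally have 2: "(\<integral>\<^sup>+t. ennreal e * (ennreal (exp (- (t * (1 / 2)))) * indicator {0<..} t) \<partial>lborel)
    = ennreal e * ennreal (1 / (1 / 2))" .
  show ?thesis unfolding 1[symmetric] 2[symmetric] by (rule nn_integral_add) measurable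
 qed
 also have "... = ennreal (\<eta> + e * 2)"
  using \<eta> e0 by (simp add: ennreal_mult' ennreal_plus flip: ennreal_numeral)
 also have "... <= ennreal (\<eta> + 4 * e)" using e0 by (intro ennreal_leI) simp
 finally show ?thesis by (simp add: e_def)
qed

context grid_rounding
begin

lemma measure_cell_PD1: "measure PD1_intensity (cell l) = PD1_mass (\<eta> + real l * \<eta>\<^sup>2) (\<eta> + real (Suc l) * \<eta>\<^sup>2)"
 by (simp add: cell_def PD1_mass_def)

lemma cell_bounds: "0 < \<eta> + real l * \<eta>\<^sup>2" "\<eta> + real l * \<eta>\<^sup>2 < \<eta> + real (Suc l) * \<eta>\<^sup>2"
 using \<eta> by (auto simp: add_pos_nonneg algebra_simps)

lemma cell_PD1:
 "cell l \<in> sets PD1_intensity" "emeasure PD1_intensity (cell l) < \<infinity>" "0 < measure PD1_intensity (cell l)"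
proof -
 show "cell l \<in> sets PD1_intensity"
  unfolding cell_def using cell_bounds(1)[of l] by (intro sets_PD1_Ioc) simp
 show "0 < measure PD1_intensity (cell l)"
  unfolding measure_cell_PD1 by (rule PD1_mass_pos[OF cell_bounds])
 show "emeasure PD1_intensity (cell l) < \<infinity>"
  unfolding cell_def PD1_mass(1)[OF cell_bounds(1) less_imp_le[OF cell_bounds(2)]] by simp
qed

abbreviation "cell_law \<equiv> Pi_pmf {..<m} 0 (%l. poisson_pmf (measure PD1_intensity (cell l)))"

lemma phi_psi_pp:
 assumes pp: "poisson_points M PD1_intensity pt" and m: "0 < m"
  and meas: "(%x. phi UNIV (%j. pt j x)) \<in> borel_measurable M"
 shows "\<bar>(\<integral>x. phi UNIV (%j. pt j x) \<partial>M) - (\<integral>k. psi k \<partial>cell_law)\<bar>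
  <= C * (\<eta> + 4 * (\<eta> + exp (- (\<eta> + real m * \<eta>\<^sup>2) / 2)))"
proof -
 interpret prob_space M by (rule pp_prob_space[OF pp])
 define X where "X x l = (if l < m then card {j. pt j x \<in> cell l} else 0)" for x l
 let ?e = "\<eta> + 4 * (\<eta> + exp (- (\<eta> + real m * \<eta>\<^sup>2) / 2))"
 have law: "(\<integral>x. psi (X x) \<partial>M) = (\<integral>k. psi k \<partial>cell_law)"
  and Xm: "(%x. psi (X x)) \<in> borel_measurable M"
  unfolding X_def using pp_count_law[OF pp m, of cell psi] cell_PD1 disjoint_cells by auto
 have i1: "integrable M (%x. phi UNIV (%j. pt j x))"
  by (rule integrable_const_bound[of _ B]) (use phi_bound meas in \<open>auto intro: AE_I2\<close>)
 have i2: "integrable M (%x. psi (X x))"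
  by (rule integrable_const_bound[of _ B]) (use psi_bound Xm in \<open>auto intro: AE_I2\<close>)
 have "(\<integral>\<^sup>+x. ennreal \<bar>phi UNIV (%j. pt j x) - psi (X x)\<bar> \<partial>M)
   <= (\<integral>\<^sup>+x. ennreal C * (\<integral>\<^sup>+j. ennreal (rounding_error (pt j x)) \<partial>count_space UNIV) \<partial>M)"
 proof (rule nn_integral_mono_AE)
  show "AE x in M. ennreal \<bar>phi UNIV (%j. pt j x) - psi (X x)\<bar>
    <= ennreal C * (\<integral>\<^sup>+j. ennreal (rounding_error (pt j x)) \<partial>count_space UNIV)"
   using pp_summable[OF pp] by eventually_elim (rule phi_psi_error, auto simp: X_def)
 qed
 also have "... = ennreal C * (\<integral>\<^sup>+x. (\<integral>\<^sup>+j. ennreal (rounding_error (pt j x)) \<partial>count_space UNIV) \<partial>M)"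
 proof (rule nn_integral_cmult)
  have [measurable]: "rounding_error \<in> borel_measurable borel"
   unfolding rounding_error_def[abs_def] by measurable
  note pp_borel_measurable[OF pp, measurable]
  show "(%x. \<integral>\<^sup>+j. ennreal (rounding_error (pt j x)) \<partial>count_space UNIV) \<in> borel_measurable M"
   unfolding nn_integral_count_space_nat by measurable
 qed
 also have "... <= ennreal C * ennreal ?e"
  by (intro mult_left_mono mean_rounding_error_pp[OF pp]) simp
 also have "... = ennreal (C * ?e)" by (rule ennreal_mult'[symmetric, OF C_nonneg])
 finally have "(\<integral>\<^sup>+x. ennreal \<bar>phi UNIV (%j. pt j x) - psi (X x)\<bar> \<partial>M) <= ennreal (C * ?e)" .
 moreover have "(\<integral>\<^sup>+x. ennreal \<bar>phi UNIV (%j. pt j x) - psi (X x)\<bar> \<partial>M) = ennreal (\<integral>x. \<bar>phi UNIV (%j. pt j x) - psi (X x)\<bar> \<partial>M)"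
  using i1 i2 by (intro nn_integral_eq_integral) auto
 ultimately have "ennreal (\<integral>x. \<bar>phi UNIV (%j. pt j x) - psi (X x)\<bar> \<partial>M) <= ennreal (C * ?e)" by simp
 then have "(\<integral>x. \<bar>phi UNIV (%j. pt j x) - psi (X x)\<bar> \<partial>M) <= C * ?e"
  using C_nonneg \<eta> by (subst (asm) ennreal_le_iff) (auto intro!: mult_nonneg_nonneg add_nonneg_nonneg)
 moreover have "\<bar>\<integral>x. phi UNIV (%j. pt j x) - psi (X x) \<partial>M\<bar> <= (\<integral>x. \<bar>phi UNIV (%j. pt j x) - psi (X x)\<bar> \<partial>M)"
  by (rule integral_abs_bound)
 ultimately show ?thesis using i1 i2 law by (simp add: Bochner_Integration.integral_diff)
qed

lemma psi_geo_tendsto: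
 "(%K. \<integral>k. psi k \<partial>(map_pmf (class_counts m (mset_cell K)) (geo_cycle_type_pmf (exp (- (1 / real K))))))
  \<longlonglongrightarrow> (\<integral>k. psi k \<partial>cell_law)"
proof -
 define r where "r K l = (\<Sum>j\<in>mset_cell K l. exp (- (1 / real K)) ^ j / real j)" for K l
 have r: "(%K. r K l) \<longlonglongrightarrow> measure PD1_intensity (cell l)" for l
  using geometric_rate_tendsto[OF cell_bounds, of l]
  unfolding measure_cell_PD1 unfolding r_def mset_cell_def cell_def greaterThanAtMost_iff .
 have "(%K. \<integral>k. psi k \<partial>(Pi_pmf {..<m} 0 (%l. poisson_pmf (r K l)))) \<longlonglongrightarrow> (\<integral>k. psi k \<partial>cell_law)"
  by (rule expectation_pmf_tendsto[OF pmf_Pi_poisson_tendsto psi_bound]) (use r cell_PD1 in auto)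
 \<comment> \<open>A positive rate shows that the cell contains some \<open>j / K\<close>; the
   Poisson law of the counts requires non-empty classes.\<close>
 moreover have "\<forall>\<^sub>F K in sequentially. \<forall>l\<in>{..<m}. 0 < r K l"
  using order_tendstoD(1)[OF r cell_PD1(3)] by (intro eventually_ball_finite) auto
 then have "\<forall>\<^sub>F K in sequentially. map_pmf (class_counts m (mset_cell K)) (geo_cycle_type_pmf (exp (- (1 / real K))))
   = Pi_pmf {..<m} 0 (%l. poisson_pmf (r K l))"
  using eventually_ge_at_top[of "1::nat"]
 proof eventually_elim
  case (elim K)
  have "mset_cell K l ~= {}" if "l < m" for l
  proof
   assume "mset_cell K l = {}"
   then have "r K l = 0" by (simp add: r_def)
   then show False using elim(1) that by force
  qed
  then show ?case
   unfolding r_def using elim(2) mset_cell[OF elim(2)]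
   by (intro class_counts_geo_cycle_type) auto
 qed
 ultimately show ?thesis by (rule Lim_transform_eventually[OF _ eventually_mono]) simp
qed

end

context cone_test
begin

text \<open>On both sides the functional is replaced by one of finitely many counts, with an error
  that does not depend on \<open>K\<close>; only then does \<open>K\<close> tend to
  infinity.\<close>

lemma phi_geo_tendsto:
 assumes pp: "poisson_points M PD1_intensity pt"
  and meas: "(%w. phi UNIV (%j. pt j w)) \<in> borel_measurable M"
 shows "(%K. \<integral>u. phi (mset_index u) (%x. real (fst x) / real K) \<partial>(geo_cycle_type_pmf (exp (- (1 / real K)))))
  \<longlonglongrightarrow> (\<integral>w. phi UNIV (%j. pt j w) \<partial>M)"
proof (rule LIMSEQ_I)
 fix r :: real assume r: "0 < r"
 \<comment> \<open>With \<open>m\<close> as chosen below each replacement costs at most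
   \<open>9 * C * \<eta>\<close>, hence at most 3/10 of \<open>r\<close>; the convergence of the
   counts costs another 1/10.\<close>
 define \<eta> where "\<eta> = r / (30 * (C + 1))"
 have \<eta>: "0 < \<eta>" using r C_nonneg by (simp add: \<eta>_def)
 have C\<eta>: "C * \<eta> <= r / 30"
  unfolding \<eta>_def using r C_nonneg by (simp add: field_simps)
 obtain m where m: "0 < m" "exp (- (\<eta> + real m * \<eta>\<^sup>2) / 2) <= \<eta>"
 proof -
  define m where "m = Suc (nat \<lceil>2 * - ln \<eta> / \<eta>\<^sup>2\<rceil>)"
  have "2 * - ln \<eta> / \<eta>\<^sup>2 <= real m" unfolding m_def by linarith
  then have "2 * - ln \<eta> <= real m * \<eta>\<^sup>2" using \<eta> by (simp add: field_simps)
  then have "- (\<eta> + real m * \<eta>\<^sup>2) / 2 <= ln \<eta>" using \<eta> by (simp add: field_simps)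
  then have "exp (- (\<eta> + real m * \<eta>\<^sup>2) / 2) <= \<eta>" using \<eta> by (metis exp_le_cancel_iff exp_ln)
  then show ?thesis using that[of m] by (simp add: m_def)
 qed
 interpret grid_rounding f B L g \<alpha> G \<eta> m by unfold_locales (rule \<eta>)
 let ?e = "\<eta> + 4 * (\<eta> + exp (- (\<eta> + real m * \<eta>\<^sup>2) / 2))"
 have "C * ?e <= C * (9 * \<eta>)" using m C_nonneg by (intro mult_left_mono) auto
 then have e: "C * ?e <= r * 9 / 30" using C\<eta> by simp
 obtain K0 where K0: "!!K. K >= K0 ==> \<bar>(\<integral>k. psi k \<partial>(map_pmf (class_counts m (mset_cell K)) (geo_cycle_type_pmf (exp (- (1 / real K))))))
   - (\<integral>k. psi k \<partial>cell_law)\<bar> < r / 10"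
  using LIMSEQ_D[OF psi_geo_tendsto, of "r / 10"] r by auto
 show "\<exists>no. \<forall>K\<ge>no. norm ((\<integral>u. phi (mset_index u) (%x. real (fst x) / real K) \<partial>(geo_cycle_type_pmf (exp (- (1 / real K)))))
   - (\<integral>w. phi UNIV (%j. pt j w) \<partial>M)) < r"
 proof (intro exI allI impI)
  fix K assume K: "max 1 K0 <= K"
  have 3: "\<bar>a - d\<bar> < r" if "\<bar>a - b\<bar> <= r * 9 / 30" "\<bar>b - c\<bar> < r / 10" "\<bar>d - c\<bar> <= r * 9 / 30" for a b c d :: real
   using that r by linarith
  show "norm ((\<integral>u. phi (mset_index u) (%x. real (fst x) / real K) \<partial>(geo_cycle_type_pmf (exp (- (1 / real K)))))
   - (\<integral>w. phi UNIV (%j. pt j w) \<partial>M)) < r"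
   unfolding real_norm_def
   by (rule 3[OF order_trans[OF phi_psi_geo e] K0 order_trans[OF phi_psi_pp[OF pp m(1) meas] e]]) (use K in auto)
 qed
qed

end

section \<open>The cycle lengths of a uniform permutation\<close>

definition mset_partition :: "nat multiset => mass_partition" where
 "mset_partition \<pi> = rearranged (mset_index \<pi>) (%x. real (fst x) / real (sum_mset \<pi>))"

context finite_perm
begin

lemma sum_mset_cycle_type: "sum_mset (cycle_type \<sigma> V) = card V"
 using sum_card_orbits by (simp add: cycle_type_def sum_unfold_sum_mset)

lemma cycle_masses_cycle_type:
 assumes "V ~= {}"
 shows "cycle_masses V \<sigma> = mset_partition (cycle_type \<sigma> V)"
proof -
 let ?r = "cycle_type \<sigma> V" and ?O = "orbits \<sigma> V"
 have n: "0 < real (card V)" using assms fin by (simp add: card_gt_0_iff)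
 have F: "finite {C \<in> ?O. real (card C) / real (card V) = v} & finite {x \<in> mset_index ?r. real (fst x) / real (card V) = v}
   & card {C \<in> ?O. real (card C) / real (card V) = v} = card {x \<in> mset_index ?r. real (fst x) / real (card V) = v}" for v
 proof -
  have "card {x \<in> mset_index ?r. real (fst x) / real (card V) = v} = size (filter_mset (%c. real c / real (card V) = v) ?r)"
   by (rule card_mset_index)
  also have "... = card {C \<in> ?O. real (card C) / real (card V) = v}"
   unfolding cycle_type_def by (simp add: filter_mset_image_mset filter_mset_mset_set finite_orbits)
  finally show ?thesis using finite_orbits finite_mset_index by auto
 qed
 obtain r where r: "bij_betw r {C \<in> ?O. 0 < real (card C) / real (card V)} {x \<in> mset_index ?r. 0 < real (fst x) / real (card V)}"
  "!!C. C \<in> ?O ==> 0 < real (card C) / real (card V) ==> real (card C) / real (card V) = real (fst (r C)) / real (card V)"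
  by (rule fibre_bijection[of ?O "%C. real (card C) / real (card V)" "mset_index ?r" "%x. real (fst x) / real (card V)", OF F]) blast
 have "mass_family (mset_index ?r) (%x. real (fst x) / real (card V))"
 proof (rule mass_family_finite[OF finite_mset_index])
  have "(\<Sum>x\<in>mset_index ?r. real (fst x)) = real (\<Sum>x\<in>mset_index ?r. fst x)" by simp
  also have "(\<Sum>x\<in>mset_index ?r. fst x) = sum_mset ?r" using sum_mset_index[where h = "%c. c"] by simp
  finally have "(\<Sum>x\<in>mset_index ?r. real (fst x)) = real (sum_mset ?r)" .
  then show "(\<Sum>x\<in>mset_index ?r. real (fst x) / real (card V)) = 1"
   using n by (simp add: sum_mset_cycle_type flip: sum_divide_distrib)
 qed simp
 then show ?thesis
  unfolding cycle_masses_def mset_partition_def sum_mset_cycle_type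
  by (rule rearranged_reindex[OF _ r])
qed

text \<open>With \<open>n\<close> old elements, the larger denominator takes
  \<open>1 / (n + 1)\<close> in total from the old cycles, and the new element adds as much, either
  as a cycle of its own or within an old one.\<close>

lemma dist_cycle_masses_insert:
 assumes V: "V ~= {}" and v: "v \<notin> V" and u: "u \<in> insert v V"
 shows "dist (cycle_masses (insert v V) (swp v u \<circ> \<sigma>)) (cycle_masses V \<sigma>) <= 2 / (real (card V) + 1)"
proof -
 let ?O = "orbits \<sigma> V" and ?n = "real (card V)" and ?t = "swp v u \<circ> \<sigma>"
 interpret i: finite_perm "insert v V" \<sigma>
  using fin perm by unfold_locales (auto intro: permutes_imp_permutes_insert)
 interpret t: finite_perm "insert v V" ?t by (rule i.compose_transpose) (use u in auto)
 note oi = orbits_insert[OF v]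
 have n: "0 < ?n" using V fin by (simp add: card_gt_0_iff)
 have n1: "real (card (insert v V)) = ?n + 1" using fin v by simp
 have sumO: "(\<Sum>C\<in>?O. real (card C)) = ?n" using sum_card_orbits by (metis of_nat_sum)
 have diff: "\<bar>c / (?n + 1) - c / ?n\<bar> = c * (1 / ?n - 1 / (?n + 1))" if "0 <= c" for c
 proof -
  have "c / (?n + 1) <= c / ?n" using that n by (intro divide_left_mono) auto
  then show ?thesis by (simp add: algebra_simps)
 qed
 have total: "?n * (1 / ?n - 1 / (?n + 1)) + 1 / (?n + 1) = 2 / (?n + 1)"
 proof -
  have "?n * (1 / ?n) = 1" "?n / (?n + 1) + 1 / (?n + 1) = 1"
   using n by (simp_all add: add_divide_distrib[symmetric])
  then show ?thesis by (simp add: right_diff_distrib)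
 qed
 show ?thesis
 proof (cases "u = v")
  case True
  let ?I = "insert {v} ?O"
  define a where "a C = real (card C) / (?n + 1)" for C :: "'v set"
  \<comment> \<open>The cycle \<open>{v}\<close> is added to the old family with mass 0, which gives
    both families a common index set.\<close>
  define b where "b C = (if C = {v} then 0 else real (card C) / ?n)" for C
  have fI: "finite ?I" using finite_orbits by simp
  have "?t = \<sigma>" using True by simp
  then have A: "cycle_masses (insert v V) ?t = rearranged ?I a"
   unfolding cycle_masses_def by (simp only: oi n1 a_def[abs_def])
  have "b C = real (card C) / ?n" if "C \<in> ?O" for C using that oi(2) by (auto simp: b_def)
  then have sb: "sum b ?O = 1" using sumO n by (simp flip: sum_divide_distrib)
  have mb: "mass_family ?I b"
   by (rule mass_family_finite[OF fI]) (use sb oi(2) finite_orbits in \<open>auto simp: b_def\<close>)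
  have "sum a ?I = 1" using oi(2) finite_orbits sumO n by (simp add: a_def flip: sum_divide_distrib)
  then have ma: "mass_family ?I a" by (intro mass_family_finite[OF fI]) (auto simp: a_def)
  have B: "cycle_masses V \<sigma> = rearranged ?I b"
   unfolding cycle_masses_def
  proof (rule rearranged_reindex[OF mb, where \<pi> = "%C. C"])
   have "{C \<in> ?O. 0 < real (card C) / ?n} = {C \<in> ?I. 0 < b C}" using oi(2) by (auto simp: b_def)
   then show "bij_betw (%C. C) {C \<in> ?O. 0 < real (card C) / ?n} {C \<in> ?I. 0 < b C}"
    by (simp add: bij_betw_def)
  qed (use oi(2) in \<open>auto simp: b_def\<close>)
  have "dist (rearranged ?I a) (rearranged ?I b) <= (\<Sum>C\<in>?I. \<bar>a C - b C\<bar>)"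
   by (rule dist_rearranged_le_sum[OF ma mb fI])
  also have "... = \<bar>a {v} - b {v}\<bar> + (\<Sum>C\<in>?O. \<bar>a C - b C\<bar>)" using oi(2) finite_orbits by simp
  also have "\<bar>a {v} - b {v}\<bar> = 1 / (?n + 1)" by (simp add: a_def b_def)
  also have "(\<Sum>C\<in>?O. \<bar>a C - b C\<bar>) = (\<Sum>C\<in>?O. real (card C) * (1 / ?n - 1 / (?n + 1)))"
  proof (intro sum.cong refl)
   fix C assume "C \<in> ?O"
   then have "C ~= {v}" using oi(2) by auto
   then show "\<bar>a C - b C\<bar> = real (card C) * (1 / ?n - 1 / (?n + 1))" using diff[of "real (card C)"] by (simp add: a_def b_def)
  qed
  also have "... = ?n * (1 / ?n - 1 / (?n + 1))" by (simp only: sum_distrib_right[symmetric] sumO)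
  finally show ?thesis using total unfolding A B by linarith
 next
  case False
  then have uV: "u \<in> V" using u by simp
  let ?D = "orbit \<sigma> u"
  have D: "?D \<in> ?O" using uV by (auto simp: orbits_def)
  have vD: "v \<notin> ?D" using orbit_subset_V[OF uV] v by auto
  have "u \<notin> orbit \<sigma> v" using oi(3) False by auto
  then have "orbits ?t (insert v V) = insert (orbit \<sigma> v \<union> ?D) (orbits \<sigma> (insert v V) - {orbit \<sigma> v, ?D})"
   using uV by (intro i.orbits_merge) auto
  also have "... = insert (insert v ?D) (?O - {?D})"
   unfolding oi(3) oi(1) using oi(2) by auto
  finally have ot: "orbits ?t (insert v V) = insert (insert v ?D) (?O - {?D})" .
  define a where "a C = (real (card C) + (if C = ?D then 1 else 0)) / (?n + 1)" for C
  define b where "b C = real (card C) / ?n" for C :: "'v set"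
  have "sum a ?O = (?n + 1) / (?n + 1)"
   unfolding a_def sum_divide_distrib[symmetric] sum.distrib sumO using D finite_orbits by simp
  then have ma: "mass_family ?O a" using n by (intro mass_family_finite[OF finite_orbits]) (auto simp: a_def)
  have mb: "mass_family ?O b" using mass_family_orbits[OF V] by (simp add: b_def[abs_def])
  have nin: "insert v ?D \<notin> ?O" using Union_orbits v by blast
  have mt: "mass_family (orbits ?t (insert v V)) (%C. real (card C) / (?n + 1))"
   using t.mass_family_orbits unfolding n1 by simp
  have "rearranged ?O a = rearranged (orbits ?t (insert v V)) (%C. real (card C) / (?n + 1))"
  proof (rule rearranged_reindex[OF mt, where \<pi> = "(%C. C)(?D := insert v ?D)"])
   have 1: "{C \<in> ?O. 0 < a C} = ?O" using card_in_orbits_pos n by (auto simp: a_def intro!: divide_pos_pos add_pos_nonneg)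
   have 2: "{C \<in> orbits ?t (insert v V). 0 < real (card C) / (?n + 1)} = orbits ?t (insert v V)"
    using t.card_in_orbits_pos n by auto
   show "bij_betw ((%C. C)(?D := insert v ?D)) {C \<in> ?O. 0 < a C} {C \<in> orbits ?t (insert v V). 0 < real (card C) / (?n + 1)}"
    unfolding 1 2 unfolding ot bij_betw_def
   proof
    show "inj_on ((%C. C)(?D := insert v ?D)) ?O" using nin by (auto simp: inj_on_def)
    show "((%C. C)(?D := insert v ?D)) ` ?O = insert (insert v ?D) (?O - {?D})" using D by (auto simp: image_iff)
   qed
   fix C assume "C \<in> ?O"
   then show "a C = real (card (((%C. C)(?D := insert v ?D)) C)) / (?n + 1)"
    using vD finite_in_orbits[OF D] by (simp add: a_def)
  qed
  then have A: "cycle_masses (insert v V) ?t = rearranged ?O a" unfolding cycle_masses_def n1 by simp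
  have B: "cycle_masses V \<sigma> = rearranged ?O b" by (simp add: cycle_masses_def b_def[abs_def])
  have "dist (rearranged ?O a) (rearranged ?O b) <= (\<Sum>C\<in>?O. \<bar>a C - b C\<bar>)"
   by (rule dist_rearranged_le_sum[OF ma mb finite_orbits])
  also have "... <= (\<Sum>C\<in>?O. real (card C) * (1 / ?n - 1 / (?n + 1)) + (if C = ?D then 1 / (?n + 1) else 0))"
  proof (rule sum_mono)
   fix C assume "C \<in> ?O"
   have "a C - b C = (real (card C) / (?n + 1) - real (card C) / ?n) + (if C = ?D then 1 / (?n + 1) else 0)"
    by (simp add: a_def b_def add_divide_distrib)
   then have "\<bar>a C - b C\<bar> <= \<bar>real (card C) / (?n + 1) - real (card C) / ?n\<bar> + \<bar>if C = ?D then 1 / (?n + 1) else 0\<bar>"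
    by (simp only: abs_triangle_ineq)
   then show "\<bar>a C - b C\<bar> <= real (card C) * (1 / ?n - 1 / (?n + 1)) + (if C = ?D then 1 / (?n + 1) else 0)"
    using diff[of "real (card C)"] n by (simp split: if_splits)
  qed
  also have "... = ?n * (1 / ?n - 1 / (?n + 1)) + 1 / (?n + 1)"
   using D finite_orbits by (simp only: sum.distrib sum_distrib_right[symmetric] sumO sum.delta if_True)
  finally show ?thesis using total unfolding A B by linarith
 qed
qed

end

section \<open>Means over uniform permutations of a fixed number of elements\<close>

definition uniform_mean :: "(mass_partition => real) => nat => real" where
 "uniform_mean f n = (\<integral>\<pi>. f (mset_partition \<pi>) \<partial>(cycle_type_pmf n))"

lemma uniform_mean_eq:
 assumes "finite V" "V ~= {}"
 shows "uniform_mean f (card V) = (\<Sum>s | s permutes V. f (cycle_masses V s)) / fact (card V)"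
proof -
 let ?u = "(\<Sum>s | s permutes V. f (mset_partition (cycle_type s V)))"
 have ne: "{s. s permutes V} ~= {}" using permutes_id by blast
 have "uniform_mean f (card V) = (\<integral>s. f (mset_partition (cycle_type s V)) \<partial>(pmf_of_set {s. s permutes V}))"
  unfolding uniform_mean_def map_cycle_type_uniform[OF assms(1), symmetric] by simp
 also have "... = ?u / real (card {s. s permutes V})"
  by (rule integral_pmf_of_set[OF ne finite_permutations[OF assms(1)]])
 also have "real (card {s. s permutes V}) = fact (card V)"
  by (simp add: card_permutations[OF refl assms(1)])
 also have "?u = (\<Sum>s | s permutes V. f (cycle_masses V s))"
 proof (intro sum.cong refl)
  fix s assume "s \<in> {s. s permutes V}"
  then interpret finite_perm V s using assms by unfold_locales auto
  show "f (mset_partition (cycle_type s V)) = f (cycle_masses V s)"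
   by (simp add: cycle_masses_cycle_type[OF assms(2)])
 qed
 finally show ?thesis .
qed

context lipschitz_test
begin

lemma uniform_mean_bound: "\<bar>uniform_mean f n\<bar> <= B"
proof -
 have "\<bar>uniform_mean f n\<bar> <= (\<integral>r. \<bar>f (mset_partition r)\<bar> \<partial>(cycle_type_pmf n))"
  unfolding uniform_mean_def by (rule integral_abs_bound)
 also have "... <= (\<integral>r. B \<partial>(cycle_type_pmf n))"
  using bound B_nonneg by (intro integral_mono measure_pmf.integrable_const_bound[of _ B] AE_I2) auto
 finally show ?thesis by simp
qed

text \<open>A coupling: a uniform permutation of \<open>Suc n\<close> elements arises from one of
  \<open>n\<close> elements by a uniform insertion, which moves the partition by at most
  \<open>2 / Suc n\<close>.\<close>

lemma uniform_mean_Suc: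
 assumes "1 <= n"
 shows "\<bar>uniform_mean f (Suc n) - uniform_mean f n\<bar> <= 2 * L / real (Suc n)"
proof -
 let ?V = "{..<n}"
 have V: "finite ?V" "?V ~= {}" "n \<notin> ?V" using assms by (auto simp: lessThan_empty_iff)
 have ins: "insert n ?V = {..<Suc n}" by auto
 let ?S = "{g. g permutes ?V}"
 have cS: "card ?S = fact n" using card_permutations[OF refl V(1)] by simp
 have "uniform_mean f (Suc n) = (\<Sum>g | g permutes insert n ?V. f (cycle_masses (insert n ?V) g)) / fact (Suc n)"
  using uniform_mean_eq[of "insert n ?V" f] V by simp
 also have "... = (\<Sum>g\<in>?S. \<Sum>u\<in>insert n ?V. f (cycle_masses (insert n ?V) (swp n u \<circ> g))) / fact (Suc n)"
  by (subst sum_permutes_insert[OF V(1,3)]) simp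
 finally have 1: "uniform_mean f (Suc n) = (\<Sum>g\<in>?S. \<Sum>u\<in>insert n ?V. f (cycle_masses (insert n ?V) (swp n u \<circ> g))) / fact (Suc n)" .
 have "uniform_mean f n = (\<Sum>g\<in>?S. f (cycle_masses ?V g)) / fact n"
  using uniform_mean_eq[OF V(1,2), of f] by simp
 also have "... = (\<Sum>g\<in>?S. \<Sum>u\<in>insert n ?V. f (cycle_masses ?V g)) / fact (Suc n)"
  by (simp add: ins field_simps sum_distrib_left[symmetric] del: lessThan_Suc of_nat_Suc)
 finally have "uniform_mean f (Suc n) - uniform_mean f n
   = (\<Sum>g\<in>?S. \<Sum>u\<in>insert n ?V. f (cycle_masses (insert n ?V) (swp n u \<circ> g)) - f (cycle_masses ?V g)) / fact (Suc n)"
  unfolding 1 by (simp only: diff_divide_distrib[symmetric] sum_subtractf)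
 also have "\<bar>...\<bar> <= (\<Sum>g\<in>?S. \<Sum>u\<in>insert n ?V. L * (2 / real (Suc n))) / fact (Suc n)"
  unfolding abs_divide
 proof (rule frac_le)
  show "\<bar>\<Sum>g\<in>?S. \<Sum>u\<in>insert n ?V. f (cycle_masses (insert n ?V) (swp n u \<circ> g)) - f (cycle_masses ?V g)\<bar>
    <= (\<Sum>g\<in>?S. \<Sum>u\<in>insert n ?V. L * (2 / real (Suc n)))"
  proof (intro order_trans[OF sum_abs] sum_mono)
   fix g u assume s: "g \<in> ?S" and u: "u \<in> insert n ?V"
   interpret finite_perm ?V g using s by unfold_locales auto
   have "dist (cycle_masses (insert n ?V) (swp n u \<circ> g)) (cycle_masses ?V g) <= 2 / real (Suc n)"
    using dist_cycle_masses_insert[OF V(2,3) u] by (simp add: add.commute)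
   then show "\<bar>f (cycle_masses (insert n ?V) (swp n u \<circ> g)) - f (cycle_masses ?V g)\<bar> <= L * (2 / real (Suc n))"
    by (rule lip_le)
  qed
  show "0 <= (\<Sum>g\<in>?S. \<Sum>u\<in>insert n ?V. L * (2 / real (Suc n)))" using L_nonneg by (intro sum_nonneg) auto
 qed auto
 also have "... = real (fact n) * (real (Suc n) * (L * (2 / real (Suc n)))) / fact (Suc n)"
  by (simp add: ins cS del: lessThan_Suc of_nat_Suc)
 also have "... = 2 * L / real (Suc n)" by (simp add: field_simps del: of_nat_Suc)
 finally show ?thesis .
qed

text \<open>The means at sizes \<open>n\<close> and \<open>K\<close> are close when
  \<open>n / K\<close> is close to 1. This slow variation is what permits leaving the geometric
  size.\<close>

lemma uniform_mean_diff:
 assumes "1 <= K" "K <= n"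
 shows "\<bar>uniform_mean f n - uniform_mean f K\<bar> <= 2 * L / real K * real (n - K)"
 using assms(2)
proof (induction n rule: dec_induct)
 case (step n)
 have "2 * L / real (Suc n) <= 2 * L / real K"
  using step assms(1) L_nonneg by (intro divide_left_mono) auto
 then have "\<bar>uniform_mean f (Suc n) - uniform_mean f n\<bar> <= 2 * L / real K"
  using uniform_mean_Suc[of n] step assms(1) by linarith
 then have "\<bar>uniform_mean f (Suc n) - uniform_mean f K\<bar> <= 2 * L / real K * real (n - K) + 2 * L / real K"
  using step.IH by linarith
 also have "... = 2 * L / real K * real (Suc n - K)"
  using step by (simp add: Suc_diff_le distrib_left)
 finally show ?case .
qed simp

end

section \<open>From a geometric number of elements back to a fixed one\<close>

abbreviation geo_pmf :: "nat => nat pmf" where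
 "geo_pmf K \<equiv> geometric_pmf (1 - exp (- (1 / real K)))"

text \<open>Given \<open>n\<close> elements, the total mass is \<open>n / K\<close>, and normalising
  removes the scale \<open>K\<close> from the cycle lengths.\<close>

lemma (in cone_test) phi_geo_eq:
 assumes K: "1 <= K"
 shows "(\<integral>r. phi (mset_index r) (%x. real (fst x) / real K) \<partial>(geo_cycle_type_pmf (exp (- (1 / real K)))))
  = (\<integral>n. g (real n / real K) * uniform_mean f n \<partial>(geo_pmf K))"
proof -
 let ?u = "(%x. real (fst x) / real K)"
 have "(\<integral>r. phi (mset_index r) ?u \<partial>(geo_cycle_type_pmf (exp (- (1 / real K)))))
  = (\<integral>n. (\<integral>r. phi (mset_index r) ?u \<partial>(cycle_type_pmf n)) \<partial>(geo_pmf K))"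
  unfolding geo_cycle_type_pmf_def measure_pmf_bind
  by (rule integral_bind[where K = "count_space UNIV" and B = B and B' = 1])
   (auto intro!: phi_bound simp: measure_pmf.emeasure_space_1[unfolded space_measure_pmf] measure_pmf_in_subprob_algebra)
 also have "... = (\<integral>n. g (real n / real K) * uniform_mean f n \<partial>(geo_pmf K))"
 proof (rule Bochner_Integration.integral_cong[OF refl])
  fix n
  have "(\<integral>r. phi (mset_index r) ?u \<partial>(cycle_type_pmf n))
    = (\<integral>r. g (real n / real K) * f (mset_partition r) \<partial>(cycle_type_pmf n))"
  proof (rule integral_cong_AE)
   show "AE r in measure_pmf (cycle_type_pmf n). phi (mset_index r) ?u = g (real n / real K) * f (mset_partition r)"
   proof (rule AE_pmfI)
    fix r assume "r \<in> set_pmf (cycle_type_pmf n)"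
    then have s: "sum_mset r = n" by (rule sum_mset_cycle_type_pmf)
    have t: "total_mass (mset_index r) ?u = real n / real K"
     by (simp add: total_mass_mset s)
    show "phi (mset_index r) ?u = g (real n / real K) * f (mset_partition r)"
    proof (cases "n = 0")
     \<comment> \<open>Without elements both sides are 0, as \<open>g\<close> vanishes at 0.\<close>
     case True
     then show ?thesis using \<alpha> g_small[of 0] by (simp add: phi_def t)
    next
     case False
     have "real c / real K / (real n / real K) = real c / real n" for c :: nat
      using K by simp
     then show ?thesis using K by (simp add: phi_def t mset_partition_def s)
    qed
   qed
  qed auto
  then show "(\<integral>r. phi (mset_index r) ?u \<partial>(cycle_type_pmf n))
    = g (real n / real K) * uniform_mean f n" by (simp add: uniform_mean_def)
 qed
 finally show ?thesis .
qed

text \<open>The middle half of the window contains at least \<open>d * K / 4\<close> integers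
  \<open>n\<close>, each of probability at least \<open>exp (- 2) / (2 * K)\<close> since
  \<open>n <= 2 * K\<close>. The resulting bound does not depend on \<open>K\<close> and keeps later
  denominators away from 0.\<close>

lemma geo_window_mass:
 assumes K: "4 / d <= real K" "1 <= K" and d: "0 < d" "d <= 1"
  and g: "!!s. 0 <= g s" "!!s. g s <= 1" "!!s. 1 + d / 4 <= s ==> s <= 1 + 3 * d / 4 ==> c <= g s" and c: "0 <= c"
 shows "c * (d * exp (- 2) / 8) <= (\<integral>n. g (real n / real K) \<partial>(geo_pmf K))"
proof -
 let ?u = "(exp (- 2) / (2 * real K))"
 let ?v = "(measure_pmf (geo_pmf K))"
 let ?z = "exp (- (1 / real K))"
 have K0: "0 < real K" using K by simp
 define A where "A = {n. 1 + d / 4 <= real n / real K & real n / real K <= 1 + 3 * d / 4}"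
 define a b where "a = nat \<lceil>(1 + d / 4) * real K\<rceil>" and "b = nat \<lfloor>(1 + 3 * d / 4) * real K\<rfloor>"
 have "real a < (1 + d / 4) * real K + 1" unfolding a_def using d K0 by (simp add: add_nonneg_nonneg) linarith
 moreover have "(1 + 3 * d / 4) * real K - 1 < real b" unfolding b_def using d K0 by (simp add: add_nonneg_nonneg)
 moreover have "4 <= d * real K" using K d by (simp add: field_simps)
 ultimately have ab: "d * real K / 4 <= real b + 1 - real a" by (simp add: algebra_simps)
 have AB: "{a..b} \<subseteq> A"
 proof
  fix n assume n: "n \<in> {a..b}"
  have "(1 + d / 4) * real K <= real a" unfolding a_def by linarith
  moreover have "real b <= (1 + 3 * d / 4) * real K" unfolding b_def using d K0 by simp
  ultimately have "(1 + d / 4) * real K <= real n" "real n <= (1 + 3 * d / 4) * real K"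
   using n by (auto intro: order_trans)
  then show "n \<in> A" using K0 by (simp add: A_def pos_le_divide_eq pos_divide_le_eq)
 qed
 have p: "0 < 1 - ?z" "1 - ?z <= 1" using K0 by auto
 have z: "1 / (2 * real K) <= 1 - ?z" using exp_minus_le_half[of "1 / real K"] K by simp
 have "exp (- 2) / (2 * real K) <= pmf (geo_pmf K) n" if "n \<in> {a..b}" for n
 proof -
  have "real n / real K <= 2" using that AB d by (auto simp: A_def)
  then have "exp (- 2) <= ?z ^ n" by (simp flip: exp_of_nat_mult)
  then have "exp (- 2) * (1 / (2 * real K)) <= ?z ^ n * (1 - ?z)" using z K0 by (intro mult_mono) auto
  then show ?thesis using p by simp
 qed
 then have "(\<Sum>n\<in>{a..b}. exp (- 2) / (2 * real K)) <= (\<Sum>n\<in>{a..b}. pmf (geo_pmf K) n)" by (intro sum_mono)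
 also have "(\<Sum>n\<in>{a..b}. exp (- 2) / (2 * real K)) = real (card {a..b}) * ?u" by simp
 finally have 1: "real (card {a..b}) * ?u <= measure ?v {a..b}"
  by (simp add: measure_measure_pmf_finite)
 have "real b + 1 - real a <= real (card {a..b})" by (simp add: of_nat_diff)
 then have "d * real K / 4 * ?u <= real (card {a..b}) * ?u"
  using ab K0 by (intro mult_right_mono) auto
 moreover have "d * real K / 4 * ?u = d * exp (- 2) / 8" using K0 by simp
 ultimately have 2: "d * exp (- 2) / 8 <= measure ?v {a..b}" using 1 by linarith
 have "c * (d * exp (- 2) / 8) <= c * measure ?v {a..b}" using 2 c by (rule mult_left_mono)
 also have "... = (\<integral>n. c * indicator {a..b} n \<partial>(geo_pmf K))" by simp
 also have "... <= (\<integral>n. g (real n / real K) \<partial>(geo_pmf K))"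
 proof (rule integral_mono)
  show "integrable ?v (%n. c * indicat_real {a..b} n)" by (intro measure_pmf.integrable_const_bound[of _ c] AE_I2) (use c in \<open>auto simp: indicator_def\<close>)
  show "integrable ?v (%n. g (real n / real K))"
   using g by (intro measure_pmf.integrable_const_bound[of _ 1] AE_I2) auto
  fix n show "c * indicat_real {a..b} n <= g (real n / real K)"
   using g(1) g(3)[of "real n / real K"] AB by (auto simp: indicator_def A_def)
 qed
 finally show ?thesis .
qed

text \<open>Along a map that is not measurable, \<open>distr\<close> need not be an image measure.
  If some preimage were not measurable, the set and its complement would both get measure 0, which a
  probability excludes. This yields measurability of the normalised rearrangement, which
  \<open>is_PD1\<close> does not state.\<close>

lemma measurable_of_prob_distr:
 assumes "prob_space (distr M N X)" "space N = UNIV"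
 shows "X \<in> M \<rightarrow>\<^sub>M N"
proof (rule measurableI)
 interpret D: prob_space "distr M N X" by fact
 fix A assume A: "A \<in> sets N"
 have e: "emeasure (distr M N X) A = emeasure M (X -` A \<inter> space M)" if A: "A \<in> sets N" for A
 proof -
  have c: "emeasure (distr M N X) A = (if measure_space (space N) (sets N) (%A. emeasure M (X -` A \<inter> space M)) then emeasure M (X -` A \<inter> space M) else 0)"
   if "A \<in> sets N" for A
   using that unfolding distr_def by (subst emeasure_measure_of_conv) (simp_all add: sets.sigma_sets_eq)
  have "emeasure (distr M N X) (space N) = 1" using D.emeasure_space_1 by simp
  then have "measure_space (space N) (sets N) (%A. emeasure M (X -` A \<inter> space M))"
   using c[OF sets.top] by (auto split: if_splits)
  then show ?thesis using c[OF A] by simp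
 qed
 show "X -` A \<inter> space M \<in> sets M"
 proof (rule ccontr)
  assume n: "X -` A \<inter> space M \<notin> sets M"
  have "X -` (space N - A) \<inter> space M = space M - (X -` A \<inter> space M)" using assms(2) by auto
  then have "X -` (space N - A) \<inter> space M \<notin> sets M"
   using n sets.compl_sets[of "space M - (X -` A \<inter> space M)" M] by (auto simp: Diff_Diff_Int Int_absorb1)
  then have "emeasure (distr M N X) (space N - A) = 0" "emeasure (distr M N X) A = 0"
   using e[OF A] e[OF sets.compl_sets[OF A]] n by (simp_all add: emeasure_notin_sets)
  then have "emeasure (distr M N X) (space N) = 0"
   using plus_emeasure[of A "distr M N X" "space N - A"] A sets.sets_into_space[OF A] by (simp add: Un_absorb1)
  then show False using D.emeasure_space_1 by simp
 qed
qed (simp add: assms)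

locale PD1_sample = lipschitz_test f B L for f B L +
 fixes M :: "'w measure" and pt :: "nat => 'w => real" and R :: "'w => mass_partition"
 assumes pp: "poisson_points M PD1_intensity pt"
  and R_def: "R = (%\<omega>. rearranged UNIV (%j. pt j \<omega> / (\<Sum>k. pt k \<omega>)))"
  and prob_R: "prob_space (distr M borel R)"
begin

definition S :: "'w => real" where "S \<omega> = total_mass UNIV (%j. pt j \<omega>)"

lemma prob_space_M: "prob_space M"
 by (rule pp_prob_space[OF pp])

lemma R_measurable [measurable]: "R \<in> borel_measurable M"
 by (rule measurable_of_prob_distr[OF prob_R]) simp

lemma S_measurable [measurable]: "S \<in> borel_measurable M"
proof -
 note pp_borel_measurable[OF pp, measurable]
 show ?thesis unfolding S_def total_mass_def nn_integral_count_space_nat by measurable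
qed

lemma f_R_measurable [measurable]: "(%x. f (R x)) \<in> borel_measurable M"
 by (rule borel_measurable_continuous_on[OF _ R_measurable]) (rule continuous)

lemma S_eq_suminf:
 assumes "x \<in> space M" "summable (%j. pt j x)"
 shows "S x = (\<Sum>j. pt j x)"
proof -
 have p: "0 <= pt j x" for j using pp_pos[OF pp assms(1)] by (simp add: less_imp_le)
 have "(\<Sum>j. ennreal (pt j x)) = ennreal (\<Sum>j. pt j x)"
  by (rule suminf_ennreal2[OF p assms(2)])
 then show ?thesis using suminf_nonneg[OF assms(2) p]
  by (simp add: S_def total_mass_def nn_integral_count_space_nat)
qed

lemma summable_of_finite:
 assumes "x \<in> space M" "(\<integral>\<^sup>+j. ennreal (pt j x) \<partial>count_space UNIV) < \<infinity>"
 shows "summable (%j. pt j x)"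
proof -
 have p: "0 <= pt j x" for j using pp_pos[OF pp assms(1)] by (simp add: less_imp_le)
 show ?thesis using assms(2) by (intro summable_suminf_not_top[OF p]) (auto simp: nn_integral_count_space_nat)
qed

lemma S_pos: "AE x in M. 0 < S x"
 using pp_summable[OF pp] AE_space
proof eventually_elim
 case (elim x)
 then have "(\<integral>\<^sup>+j. ennreal (pt j x) \<partial>count_space UNIV) < \<infinity>" by (simp add: summable_family_def)
 from summable_of_finite[OF elim(2) this] show ?case
  using S_eq_suminf[OF elim(2)] pp_pos[OF pp elim(2)] by (simp add: suminf_pos)
qed

text \<open>\<open>R\<close> divides by a \<open>suminf\<close> and \<open>phi\<close> by
  \<open>total_mass\<close>. They agree when the points are summable; otherwise \<open>S x\<close>
  is 0 and the cutoff makes both sides 0.\<close>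

lemma phi_points:
 assumes "cone_test f B L g \<alpha> G" "x \<in> space M"
 shows "cone_test.phi f g UNIV (%j. pt j x) = g (S x) * f (R x)"
proof -
 interpret cone_test f B L g \<alpha> G by fact
 show ?thesis
 proof (cases "S x = 0")
  case True
  then show ?thesis using g_small[of 0] \<alpha> by (simp add: phi_def S_def)
 next
  case False
  then have "(\<integral>\<^sup>+j. ennreal (pt j x) \<partial>count_space UNIV) < \<infinity>"
   by (auto simp: S_def total_mass_def less_top[symmetric])
  from S_eq_suminf[OF assms(2) summable_of_finite[OF assms(2) this]]
  show ?thesis by (simp add: phi_def R_def S_def[symmetric])
 qed
qed

lemma geometric_mean_tendsto:
 assumes "cone_test f B L g \<alpha> G"
 shows "(%K. \<integral>n. g (real n / real K) * uniform_mean f n \<partial>(geo_pmf K)) \<longlonglongrightarrow> (\<integral>w. g (S w) * f (R w) \<partial>M)"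
proof -
 interpret cone_test f B L g \<alpha> G by fact
 have "continuous_on UNIV g"
  using g_lip G_nonneg by (intro lipschitz_on_continuous_on[of G] lipschitz_onI) (auto simp: dist_real_def)
 then have [measurable]: "g \<in> borel_measurable borel" by (rule borel_measurable_continuous_onI)
 have "(%w. g (S w) * f (R w)) \<in> borel_measurable M" by measurable
 then have "(%w. phi UNIV (%j. pt j w)) \<in> borel_measurable M"
  by (subst measurable_cong[OF phi_points[OF assms]])
 from phi_geo_tendsto[OF pp this]
 have "(%K. \<integral>r. phi (mset_index r) (%x. real (fst x) / real K) \<partial>(geo_cycle_type_pmf (exp (- (1 / real K)))))
   \<longlonglongrightarrow> (\<integral>w. g (S w) * f (R w) \<partial>M)"
  by (subst (asm) Bochner_Integration.integral_cong[OF refl phi_points[OF assms]])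
 then show ?thesis
  by (rule Lim_transform_eventually) (auto intro!: eventually_sequentiallyI[of 1] phi_geo_eq)
qed

text \<open>The case of the constant test function 1, whose means over permutations are all
  1.\<close>

lemma geometric_mass_tendsto:
 assumes "cone_test f B L g \<alpha> G"
 shows "(%K. \<integral>n. g (real n / real K) \<partial>(geo_pmf K)) \<longlonglongrightarrow> (\<integral>x. g (S x) \<partial>M)"
proof -
 interpret cone_test f B L g \<alpha> G by fact
 have one: "lipschitz_test (%_. 1) 1 0" by unfold_locales auto
 interpret s: PD1_sample "%_. 1" 1 0 M pt R
  using one pp R_def prob_R by (intro PD1_sample.intro PD1_sample_axioms.intro)
 have "cone_test (%_. 1) 1 0 g \<alpha> G"
  by (intro cone_test.intro one cone_test_axioms.intro \<alpha> g01 g_small g_lip G_nonneg)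
 from s.geometric_mean_tendsto[OF this] show ?thesis by (simp add: uniform_mean_def s.S_def S_def)
qed

text \<open>Under a window just above 1 only sizes \<open>n\<close> between \<open>K\<close> and
  \<open>(1 + \<delta>) * K\<close> are averaged, where by slow variation the mean differs little
  from the one at \<open>K\<close>. The windowed averages converge, so the means at \<open>K\<close>
  are eventually within \<open>e\<close> of a constant.\<close>

lemma uniform_mean_Cauchy:
 assumes e: "0 < e"
 shows "\<exists>r N. \<forall>K\<ge>N. \<bar>uniform_mean f K - r\<bar> < e"
proof -
 \<comment> \<open>The window is so narrow that the variation across it,
   \<open>2 * L * \<delta>\<close>, is at most \<open>e / 2\<close>; \<open>L + 1\<close> avoids a
   division by 0.\<close>
 define \<delta> where "\<delta> = min 1 (e / (4 * (L + 1)))"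
 have \<delta>: "0 < \<delta>" "\<delta> <= 1" using e L_nonneg by (auto simp: \<delta>_def)
 have "2 * L * \<delta> <= 2 * (L + 1) * \<delta>" using \<delta> by simp
 also have "... <= 2 * (L + 1) * (e / (4 * (L + 1)))" using L_nonneg by (intro mult_left_mono) (auto simp: \<delta>_def)
 also have "... = e / 2" using L_nonneg by (simp add: field_simps)
 finally have L\<delta>: "2 * L * \<delta> <= e / 2" .
 \<comment> \<open>A trapezoid on the interval from 1 to \<open>1 + \<delta>\<close> that equals 1
   on its middle half; hence the slope \<open>4 / \<delta>\<close>.\<close>
 define g where "g s = max 0 (min 1 (min ((s - 1) * (4 / \<delta>)) ((1 + \<delta> - s) * (4 / \<delta>))))" for s :: real
 have "cone_test f B L g 1 (4 / \<delta>)"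
 proof
  fix s t :: real
  show "0 <= g s" "g s <= 1" by (auto simp: g_def)
  show "g s = 0" if "s <= 1"
  proof -
   have "(s - 1) * (4 / \<delta>) <= 0" using that \<delta> by (intro mult_nonpos_nonneg) auto
   then show ?thesis by (simp add: g_def)
  qed
  have "\<bar>(s - 1) * c - (t - 1) * c\<bar> = c * \<bar>s - t\<bar>" "\<bar>(1 + \<delta> - s) * c - (1 + \<delta> - t) * c\<bar> = c * \<bar>s - t\<bar>" if "0 <= c" for c
  proof -
   have "(s - 1) * c - (t - 1) * c = c * (s - t)" "(1 + \<delta> - s) * c - (1 + \<delta> - t) * c = c * (t - s)" by algebra+
   then show "\<bar>(s - 1) * c - (t - 1) * c\<bar> = c * \<bar>s - t\<bar>" "\<bar>(1 + \<delta> - s) * c - (1 + \<delta> - t) * c\<bar> = c * \<bar>s - t\<bar>"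
    using that by (simp_all add: abs_mult abs_minus_commute)
  qed
  from this[of "4 / \<delta>"] have "\<bar>(s - 1) * (4 / \<delta>) - (t - 1) * (4 / \<delta>)\<bar> = 4 / \<delta> * \<bar>s - t\<bar>"
   "\<bar>(1 + \<delta> - s) * (4 / \<delta>) - (1 + \<delta> - t) * (4 / \<delta>)\<bar> = 4 / \<delta> * \<bar>s - t\<bar>" using \<delta> by simp_all
  moreover have "\<bar>max 0 (min 1 (min x y)) - max 0 (min 1 (min x' y'))\<bar> <= d"
   if "\<bar>x - x'\<bar> = d" "\<bar>y - y'\<bar> = d" for x y x' y' d :: real using that by (auto simp: max_def min_def)
  ultimately show "\<bar>g s - g t\<bar> <= 4 / \<delta> * \<bar>s - t\<bar>" unfolding g_def by blast
 qed (use \<delta> in auto)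
 note ct = this
 interpret cone_test f B L g 1 "4 / \<delta>" by (rule ct)
 define I where "I K = (\<integral>n. g (real n / real K) \<partial>(geo_pmf K))" for K
 define J where "J K = (\<integral>n. g (real n / real K) * uniform_mean f n \<partial>(geo_pmf K))" for K
 define i j where "i = (\<integral>w. g (S w) \<partial>M)" and "j = (\<integral>w. g (S w) * f (R w) \<partial>M)"
 have Ii: "I \<longlonglongrightarrow> i" and Jj: "J \<longlonglongrightarrow> j"
  unfolding I_def J_def i_def j_def by (rule geometric_mass_tendsto[OF ct], rule geometric_mean_tendsto[OF ct])
 define N where "N = max 1 (nat \<lceil>4 / \<delta>\<rceil>)"
 have Nd: "4 / \<delta> <= real K" "1 <= K" if "N <= K" for K using that unfolding N_def by linarith+
 define c where "c = \<delta> * exp (- 2) / 8"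
 have c: "0 < c" using \<delta> by (simp add: c_def)
 have cI: "c <= I K" if "N <= K" for K
 proof -
  have "1 * (\<delta> * exp (- 2) / 8) <= I K" unfolding I_def
  proof (rule geo_window_mass[OF Nd[OF that] \<delta> g01])
   fix s assume s: "1 + \<delta> / 4 <= s" "s <= 1 + 3 * \<delta> / 4"
   have "\<delta> / 4 * (4 / \<delta>) <= (s - 1) * (4 / \<delta>)" "\<delta> / 4 * (4 / \<delta>) <= (1 + \<delta> - s) * (4 / \<delta>)"
    using s \<delta> by (intro mult_right_mono; simp)+
   then show "1 <= g s" using \<delta> by (simp add: g_def)
  qed simp
  then show ?thesis by (simp add: c_def)
 qed
 \<comment> \<open>The lower bound passes to the limit, so that the quotient of the two limits may
   be formed.\<close>
 have "c <= i" by (rule LIMSEQ_le_const[OF Ii]) (use cI in blast)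
 then have "(%K. J K / I K) \<longlonglongrightarrow> j / i" using c by (intro tendsto_divide Jj Ii) auto
 from LIMSEQ_D[OF this, of "e / 2"] e obtain N' where N': "!!K. N' <= K ==> \<bar>J K / I K - j / i\<bar> < e / 2" by auto
 have "\<bar>uniform_mean f K - j / i\<bar> < e" if K: "max N N' <= K" for K
 proof -
  have K1: "1 <= K" using Nd K by auto
  have int: "integrable (measure_pmf (geo_pmf K)) (%n. g (real n / real K))"
   using g01 by (intro measure_pmf.integrable_const_bound[of _ 1] AE_I2) auto
  have int2: "integrable (measure_pmf (geo_pmf K)) (%n. g (real n / real K) * uniform_mean f n)"
  proof (intro measure_pmf.integrable_const_bound[of _ "1 * B"] AE_I2)
   fix n show "norm (g (real n / real K) * uniform_mean f n) <= 1 * B"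
    unfolding norm_mult using g01 uniform_mean_bound by (intro mult_mono) auto
  qed simp
  have "J K - uniform_mean f K * I K = (\<integral>n. g (real n / real K) * uniform_mean f n - uniform_mean f K * g (real n / real K) \<partial>(geo_pmf K))"
   unfolding J_def I_def using int int2 by simp
  also have "\<bar>...\<bar> <= (\<integral>n. \<bar>g (real n / real K) * uniform_mean f n - uniform_mean f K * g (real n / real K)\<bar> \<partial>(geo_pmf K))"
   by (rule integral_abs_bound)
  also have "... <= (\<integral>n. 2 * L * \<delta> * g (real n / real K) \<partial>(geo_pmf K))"
  proof (rule integral_mono)
   fix n
   have "\<bar>g (real n / real K) * uniform_mean f n - uniform_mean f K * g (real n / real K)\<bar> = \<bar>uniform_mean f n - uniform_mean f K\<bar> * g (real n / real K)"
    using g01 by (simp add: mult.commute[of "g _"] left_diff_distrib[symmetric] abs_mult)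
   also have "... <= 2 * L * \<delta> * g (real n / real K)"
   proof (cases "g (real n / real K) = 0")
    case False
    then have "1 < real n / real K" using g_small[of "real n / real K"] by force
    moreover have "real n / real K < 1 + \<delta>"
    proof (rule ccontr)
     assume "\<not> ?thesis"
     then have "(1 + \<delta> - real n / real K) * (4 / \<delta>) <= 0" using \<delta> by (intro mult_nonpos_nonneg) auto
     then show False using False by (simp add: g_def min_def)
    qed
    ultimately have n: "K < n" "real n <= (1 + \<delta>) * real K" using K1 by (simp_all add: field_simps)
    have "\<bar>uniform_mean f n - uniform_mean f K\<bar> <= 2 * L / real K * real (n - K)"
     using n by (intro uniform_mean_diff K1) auto
    also have "... <= 2 * L / real K * (\<delta> * real K)"
     using n L_nonneg by (intro mult_left_mono) (auto simp: of_nat_diff algebra_simps)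
    also have "... = 2 * L * \<delta>" using K1 by simp
    finally show ?thesis using g01 by (intro mult_right_mono)
   qed simp
   finally show "\<bar>g (real n / real K) * uniform_mean f n - uniform_mean f K * g (real n / real K)\<bar> <= 2 * L * \<delta> * g (real n / real K)" .
  qed (use int int2 in auto)
  also have "... = 2 * L * \<delta> * I K" by (simp add: I_def)
  also have "... <= e / 2 * I K" using L\<delta> cI[of K] c K by (intro mult_right_mono) auto
  finally have *: "\<bar>J K - uniform_mean f K * I K\<bar> <= e / 2 * I K" .
  have I0: "0 < I K" using cI[of K] c K by auto
  have "J K / I K - uniform_mean f K = (J K - uniform_mean f K * I K) / I K" using I0 by (simp add: field_simps)
  then have "\<bar>J K / I K - uniform_mean f K\<bar> = \<bar>J K - uniform_mean f K * I K\<bar> / I K" using I0 by simp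
  also have "... <= e / 2" using * I0 by (simp add: pos_divide_le_eq)
  finally show ?thesis using N'[of K] K by linarith
 qed
 then show ?thesis by blast
qed

lemma uniform_mean_convergent: "convergent (uniform_mean f)"
proof -
 have "Cauchy (uniform_mean f)"
 proof (rule CauchyI)
  fix e :: real assume "0 < e"
  then obtain r N where N: "!!K. N <= K ==> \<bar>uniform_mean f K - r\<bar> < e / 2"
   using uniform_mean_Cauchy[of "e / 2"] by auto
  have "norm (uniform_mean f m - uniform_mean f n) < e" if "N <= m" "N <= n" for m n
   using N[OF that(1)] N[OF that(2)] unfolding real_norm_def by linarith
  then show "\<exists>N. \<forall>m\<ge>N. \<forall>n\<ge>N. norm (uniform_mean f m - uniform_mean f n) < e" by blast
 qed
 then show ?thesis by (simp add: Cauchy_convergent_iff)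
qed

text \<open>The cutoff vanishes for \<open>n <= \<alpha> * K\<close>, so only large \<open>n\<close>
  enter, where the mean is uniformly close to \<open>a\<close>. In the limit \<open>f (R x)\<close>
  averages as if it were independent of \<open>S x\<close>, which separates the partition from the
  scale.\<close>

lemma weighted_mean_eq:
 assumes ct: "cone_test f B L g \<alpha> G" and a: "uniform_mean f \<longlonglongrightarrow> a"
 shows "(\<integral>x. g (S x) * f (R x) \<partial>M) = a * (\<integral>x. g (S x) \<partial>M)"
proof -
 interpret cone_test f B L g \<alpha> G by fact
 define I where "I K = (\<integral>n. g (real n / real K) \<partial>(geo_pmf K))" for K
 define J where "J K = (\<integral>n. g (real n / real K) * uniform_mean f n \<partial>(geo_pmf K))" for K
 have "(%K. J K - a * I K) \<longlonglongrightarrow> (\<integral>x. g (S x) * f (R x) \<partial>M) - a * (\<integral>x. g (S x) \<partial>M)"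
  unfolding I_def J_def by (intro tendsto_intros geometric_mass_tendsto[OF ct] geometric_mean_tendsto[OF ct])
 moreover have "(%K. J K - a * I K) \<longlonglongrightarrow> 0"
 proof (rule LIMSEQ_I)
  fix e :: real assume e: "0 < e"
  obtain N where N: "!!n. N <= n ==> \<bar>uniform_mean f n - a\<bar> < e / 2"
   using LIMSEQ_D[OF a, of "e / 2"] e by auto
  have "norm (J K - a * I K - 0) < e" if K: "max 1 (nat \<lceil>real N / \<alpha>\<rceil>) <= K" for K
  proof -
   have "real N / \<alpha> <= real K" using K by linarith
   then have NK: "real N <= \<alpha> * real K" using \<alpha> by (simp add: field_simps)
   have int: "integrable (measure_pmf (geo_pmf K)) (%n. g (real n / real K))"
    using g01 by (intro measure_pmf.integrable_const_bound[of _ 1] AE_I2) auto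
   have int2: "integrable (measure_pmf (geo_pmf K)) (%n. g (real n / real K) * uniform_mean f n)"
   proof (intro measure_pmf.integrable_const_bound[of _ "1 * B"] AE_I2)
    fix n show "norm (g (real n / real K) * uniform_mean f n) <= 1 * B"
     unfolding norm_mult using g01 uniform_mean_bound by (intro mult_mono) auto
   qed simp
   have "J K - a * I K = (\<integral>n. g (real n / real K) * uniform_mean f n - a * g (real n / real K) \<partial>(geo_pmf K))"
    unfolding J_def I_def using int int2 by simp
   also have "\<bar>...\<bar> <= (\<integral>n. \<bar>g (real n / real K) * uniform_mean f n - a * g (real n / real K)\<bar> \<partial>(geo_pmf K))"
    by (rule integral_abs_bound)
   also have "... <= (\<integral>n. e / 2 \<partial>(geo_pmf K))"
   proof (rule integral_mono)
    fix n
    have "\<bar>g (real n / real K) * uniform_mean f n - a * g (real n / real K)\<bar> = \<bar>uniform_mean f n - a\<bar> * g (real n / real K)"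
     using g01 by (simp add: mult.commute[of "g _"] left_diff_distrib[symmetric] abs_mult)
    also have "... <= e / 2"
    proof (cases "g (real n / real K) = 0")
     case False
     then have "\<alpha> < real n / real K" using g_small[of "real n / real K"] by force
     then have "\<alpha> * real K < real n" using K by (simp add: field_simps)
     then have "N <= n" using NK by linarith
     then have "\<bar>uniform_mean f n - a\<bar> * g (real n / real K) <= e / 2 * 1"
      using N[of n] g01 e by (intro mult_mono) auto
     then show ?thesis by simp
    qed (use e in simp)
    finally show "\<bar>g (real n / real K) * uniform_mean f n - a * g (real n / real K)\<bar> <= e / 2" .
   qed (use int int2 in auto)
   finally show ?thesis using e by simp
  qed
  then show "\<exists>no. \<forall>K\<ge>no. norm (J K - a * I K - 0) < e" by blast
 qed
 ultimately have "(\<integral>x. g (S x) * f (R x) \<partial>M) - a * (\<integral>x. g (S x) \<partial>M) = 0" by (rule LIMSEQ_unique)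
 then show ?thesis by simp
qed

text \<open>The cutoffs \<open>g k\<close> tend to 1 on the positive half-line and \<open>S\<close>
  is almost surely positive. The factorisation for each cutoff therefore passes to the limit and
  identifies \<open>a\<close> as the mean of \<open>f (R u)\<close>.\<close>

lemma uniform_mean_tendsto_R: "uniform_mean f \<longlonglongrightarrow> (\<integral>u. f (R u) \<partial>M)"
proof -
 interpret prob_space M by (rule prob_space_M)
 obtain a where a: "uniform_mean f \<longlonglongrightarrow> a" using uniform_mean_convergent by (auto simp: convergent_def)
 define g where "g k s = min 1 (max 0 (real (Suc k) * s - 1))" for k :: nat and s :: real
 have ct: "cone_test f B L (g k) (1 / real (Suc k)) (real (Suc k))" for k
 proof
  fix s t :: real
  show "g k s = 0" if "s <= 1 / real (Suc k)" using that by (simp add: g_def field_simps)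
  have "\<bar>(real (Suc k) * s - 1) - (real (Suc k) * t - 1)\<bar> = real (Suc k) * \<bar>s - t\<bar>"
   by (simp add: right_diff_distrib[symmetric] abs_mult del: of_nat_Suc)
  moreover have "\<bar>min 1 (max 0 x) - min 1 (max 0 y)\<bar> <= \<bar>x - y\<bar>" for x y :: real by (auto simp: max_def min_def)
  ultimately show "\<bar>g k s - g k t\<bar> <= real (Suc k) * \<bar>s - t\<bar>" unfolding g_def by metis
 qed (auto simp: g_def)
 have lim: "(%k. g k s) \<longlonglongrightarrow> 1" if "0 < s" for s
 proof (rule tendsto_eventually)
  have "2 / s <= real (Suc k)" if "nat \<lceil>2 / s\<rceil> <= k" for k using that by linarith
  then have "g k s = 1" if "nat \<lceil>2 / s\<rceil> <= k" for k using that \<open>0 < s\<close> by (simp add: g_def field_simps)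
  then show "\<forall>\<^sub>F k in sequentially. g k s = 1" by (rule eventually_sequentiallyI)
 qed
 have [measurable]: "g k \<in> borel_measurable borel" for k unfolding g_def[abs_def] by measurable
 have "(%k. \<integral>u. g k (S u) * f (R u) \<partial>M) \<longlonglongrightarrow> (\<integral>u. 1 * f (R u) \<partial>M)"
 proof (rule integral_dominated_convergence[where w = "%_. B"])
  show "AE u in M. (%k. g k (S u) * f (R u)) \<longlonglongrightarrow> 1 * f (R u)"
   using S_pos by eventually_elim (intro tendsto_mult lim tendsto_const)
  show "AE u in M. norm (g k (S u) * f (R u)) <= B" for k
  proof (rule AE_I2)
   fix u
   have "norm (g k (S u) * f (R u)) <= 1 * B"
    unfolding norm_mult using bound by (intro mult_mono) (auto simp: g_def)
   then show "norm (g k (S u) * f (R u)) <= B" by simp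
  qed
 qed measurable
 moreover have "(%k. \<integral>u. g k (S u) \<partial>M) \<longlonglongrightarrow> (\<integral>u. 1 \<partial>M)"
 proof (rule integral_dominated_convergence[where w = "%_. 1"])
  show "AE u in M. (%k. g k (S u)) \<longlonglongrightarrow> 1"
   using S_pos by eventually_elim (intro lim)
  show "AE u in M. norm (g k (S u)) <= 1" for k by (auto simp: g_def)
 qed measurable
 then have "(%k. a * (\<integral>u. g k (S u) \<partial>M)) \<longlonglongrightarrow> a * 1"
  by (intro tendsto_intros) (simp add: prob_space)
 ultimately have "(\<integral>u. 1 * f (R u) \<partial>M) = a * 1"
  unfolding weighted_mean_eq[OF ct a] by (rule LIMSEQ_unique)
 then show ?thesis using a by simp
qed

end

theorem (in lipschitz_test) uniform_mean_tendsto_PD1: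
 assumes "is_PD1 m" "prob_space m"
 shows "uniform_mean f \<longlonglongrightarrow> (\<integral>p. f p \<partial>m)"
proof -
 from assms(1) obtain M :: "(nat => real) measure" and pt where pp: "poisson_points M PD1_intensity pt"
  and m: "m = distr M borel (%x. rearranged UNIV (%j. pt j x / (\<Sum>k. pt k x)))"
  unfolding is_PD1_def by blast
 interpret PD1_sample f B L M pt "%x. rearranged UNIV (%j. pt j x / (\<Sum>k. pt k x))"
  by (intro PD1_sample.intro PD1_sample_axioms.intro lipschitz_test_axioms pp refl)
   (use assms(2) in \<open>simp only: m\<close>)
 have "f \<in> borel_measurable borel" by (rule borel_measurable_continuous_onI[OF continuous])
 then have "(\<integral>p. f p \<partial>m) = (\<integral>x. f (rearranged UNIV (%j. pt j x / (\<Sum>k. pt k x))) \<partial>M)"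
  unfolding m by (intro integral_distr R_measurable)
 then show ?thesis using uniform_mean_tendsto_R by simp
qed

section \<open>Jump chains with unit rates\<close>

lemma pair_measure_eq_of_rectangles:
 assumes sets: "sets m = sets (S1 \<Otimes>\<^sub>M S2)" "sets \<nu> = sets (S1 \<Otimes>\<^sub>M S2)"
  and fin: "emeasure m (space S1 \<times> space S2) ~= \<infinity>"
  and eq: "!!A B. A \<in> sets S1 ==> B \<in> sets S2 ==> emeasure m (A \<times> B) = emeasure \<nu> (A \<times> B)"
 shows "m = \<nu>"
proof (rule measure_eqI_generator_eq[OF Int_stable_pair_measure_generator[of S1 S2]])
 let ?E = "{a \<times> b |a b. a \<in> sets S1 & b \<in> sets S2}"
 show "?E \<subseteq> Pow (space S1 \<times> space S2)"
  using sets.space_closed[of S1] sets.space_closed[of S2] by auto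
 show "sets m = sigma_sets (space S1 \<times> space S2) ?E" "sets \<nu> = sigma_sets (space S1 \<times> space S2) ?E"
  by (simp_all add: sets sets_pair_measure)
 show "range (\<lambda>_::nat. space S1 \<times> space S2) \<subseteq> ?E" by auto
 show "(\<Union>i::nat. space S1 \<times> space S2) = space S1 \<times> space S2" by simp
qed (use fin eq in auto)

lemma emeasure_distr_density_indicator:
 assumes E: "E \<in> sets M" and X: "X \<in> M \<rightarrow>\<^sub>M N" and A: "A \<in> sets N"
 shows "emeasure (distr (density M (indicator E)) N X) A = emeasure M (E \<inter> (X -` A \<inter> space M))"
proof -
 let ?u = "(X -` A \<inter> space M)"
 have XA: "X -` A \<inter> space M \<in> sets M" by (rule measurable_sets[OF X A])
 have "emeasure (distr (density M (indicator E)) N X) A = emeasure (density M (indicator E)) ?u"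
  by (subst emeasure_distr[OF _ A]) (use X in simp_all)
 also have "... = (\<integral>\<^sup>+x. indicator E x * indicator ?u x \<partial>M)"
  by (rule emeasure_density) (use E XA in simp_all)
 also have "... = (\<integral>\<^sup>+x. indicator (E \<inter> ?u) x \<partial>M)"
  by (simp add: indicator_inter_arith)
 also have "... = emeasure M (E \<inter> ?u)"
  by (rule nn_integral_indicator) (use E XA in simp)
 finally show ?thesis .
qed

section \<open>Holding times of a chain with unit rates\<close>

definition exp_law :: "real measure" where
 "exp_law = density lborel (exponential_density 1)"

lemma prob_space_exp_law: "prob_space exp_law"
 unfolding exp_law_def by (rule prob_space_exponential_density) simp

lemma sets_exp_law [simp, measurable_cong]: "sets exp_law = sets borel"
 and space_exp_law [simp]: "space exp_law = UNIV"
 by (simp_all add: exp_law_def)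

lemma emeasure_exp_law_Ioi: "emeasure exp_law {s<..} = ennreal (exp (- max 0 s))"
proof -
 interpret prob_space exp_law by (rule prob_space_exp_law)
 have "distr exp_law lborel (%x. x) = exp_law"
  by (intro measure_eqI) (auto simp: emeasure_distr exp_law_def)
 then have D: "distributed exp_law lborel (%x. x) (exponential_density 1)"
  unfolding distributed_def by (auto simp: exp_law_def)
 have pos: "measure exp_law {s<..} = exp (- s)" if "0 <= s" for s
  using exponential_distributedD_gt[OF D that] by (simp add: greaterThan_def)
 have "measure exp_law {s<..} = exp (- max 0 s)"
 proof (cases "0 <= s")
  case False
  have "measure exp_law {0<..} <= measure exp_law {s<..}" using False by (intro finite_measure_mono) auto
  then have "measure exp_law {s<..} = 1" using pos[of 0] prob_le_1[of "{s<..}"] by simp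
  then show ?thesis using False by simp
 qed (simp add: pos)
 then show ?thesis by (simp add: emeasure_eq_measure)
qed

text \<open>All entries beyond \<open>n\<close> become \<open>z\<close>: this is the form of a
  trajectory frozen at time \<open>n + 1\<close>, as in \<open>stopped\<close>.\<close>

definition extend_traj :: "nat => (nat => 's) => 's => nat => 's" where
 "extend_traj n y z = (%k. if k <= n then y k else z)"

text \<open>The skeleton of a jump process with total rate 1. In \<open>cond\<close> the factor
  \<open>exp (- s)\<close> no longer depends on the state, which is the source of all independence
  below.\<close>

locale unit_rate_chain =
 fixes M :: "'w measure" and S :: "'s measure" and q :: "'s => 's measure"
  and Y :: "nat => 'w => 's" and W :: "nat => 'w => real"
 assumes prob: "prob_space M" and kernel: "rate_kernel S q"
  and unit_rate: "x \<in> space S ==> total_rate S q x = 1"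
  and Y_measurable [measurable]: "!!n. Y n \<in> M \<rightarrow>\<^sub>M S"
  and W_measurable [measurable]: "!!n. W n \<in> borel_measurable M"
  and W_pos: "!!n \<omega>. \<omega> \<in> space M ==> 0 < W n \<omega>"
  and cond: "!!n s A. A \<in> sets S ==> 0 <= s ==>
   (AE \<omega> in M. real_cond_exp M (jump_history M S Y W n) (indicator {\<omega>. s < W n \<omega> & Y (Suc n) \<omega> \<in> A}) \<omega>
    = exp (- s) * measure (q (Y n \<omega>)) A)"
begin

sublocale prob_space M by (rule prob)

abbreviation traj_space :: "(nat => 's) measure" where
 "traj_space \<equiv> \<Pi>\<^sub>M k\<in>UNIV. S"

text \<open>Freezing a trajectory, instead of restricting it to finitely many indices, keeps all of
  them in one product space whatever \<open>n\<close> is.\<close>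

definition stopped :: "nat => 'w => nat => 's" where
 "stopped n \<omega> = (%k. Y (min k n) \<omega>)"

lemma stopped_measurable [measurable]: "stopped n \<in> M \<rightarrow>\<^sub>M traj_space"
 unfolding stopped_def by (rule measurable_PiM_single') (auto simp: measurable_space[OF Y_measurable])

lemma sets_q: "x \<in> space S ==> sets (q x) = sets S"
 using kernel by (simp add: rate_kernel_def)

lemma space_q: "x \<in> space S ==> space (q x) = space S"
 using sets_q by (rule sets_eq_imp_space_eq)

lemma prob_space_q: "x \<in> space S ==> prob_space (q x)"
proof (rule prob_spaceI)
 assume x: "x \<in> space S"
 then have "emeasure (q x) (space S) < \<infinity>" "measure (q x) (space S) = 1"
  using kernel unit_rate[OF x] by (auto simp: rate_kernel_def total_rate_def)
 then show "emeasure (q x) (space (q x)) = 1"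
  using emeasure_eq_ennreal_measure[of "q x" "space S"] by (simp add: space_q[OF x])
qed

lemma q_measurable [measurable]: "q \<in> S \<rightarrow>\<^sub>M subprob_algebra S"
proof (rule measurable_subprob_algebra)
 show "subprob_space (q a)" if "a \<in> space S" for a
  using prob_space_q[OF that] by (rule prob_space_imp_subprob_space)
 show "sets (q a) = sets S" if "a \<in> space S" for a by (rule sets_q[OF that])
 show "(%a. emeasure (q a) A) \<in> borel_measurable S" if "A \<in> sets S" for A
  using kernel that by (simp add: rate_kernel_def)
qed

lemma emeasure_q_measurable [measurable]: "A \<in> sets S ==> (%x. emeasure (q x) A) \<in> borel_measurable S"
 using kernel by (simp add: rate_kernel_def)

lemma measurable_coordinate [measurable]: "(%y. y n) \<in> traj_space \<rightarrow>\<^sub>M S"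
 by (rule measurable_component_singleton) simp

lemma subalgebra_history: "subalgebra M (jump_history M S Y W n)"
 unfolding subalgebra_def jump_history_def
proof
 show "sets (vimage_algebra (space M) (%x. (\<lambda>k\<in>{..n}. Y k x, \<lambda>k\<in>{..<n}. W k x))
   ((\<Pi>\<^sub>M k\<in>{..n}. S) \<Otimes>\<^sub>M (\<Pi>\<^sub>M k\<in>{..<n}. borel))) \<subseteq> sets M"
  by (rule sets_image_in_sets) (auto intro!: measurable_Pair measurable_restrict)
qed simp

lemma history_measurable:
 shows "k <= n ==> Y k \<in> jump_history M S Y W n \<rightarrow>\<^sub>M S"
  and "k < n ==> W k \<in> borel_measurable (jump_history M S Y W n)"
proof -
 let ?f = "%x. (\<lambda>k\<in>{..n}. Y k x, \<lambda>k\<in>{..<n}. W k x)"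
 have f: "?f \<in> jump_history M S Y W n \<rightarrow>\<^sub>M (\<Pi>\<^sub>M k\<in>{..n}. S) \<Otimes>\<^sub>M (\<Pi>\<^sub>M k\<in>{..<n}. borel)"
  unfolding jump_history_def
  by (rule measurable_vimage_algebra1) (auto simp: space_pair_measure space_PiM measurable_space[OF Y_measurable])
 show "Y k \<in> jump_history M S Y W n \<rightarrow>\<^sub>M S" if "k <= n"
 proof -
  have "(%p. fst p k) \<in> (\<Pi>\<^sub>M k\<in>{..n}. S) \<Otimes>\<^sub>M (\<Pi>\<^sub>M k\<in>{..<n}. (borel :: real measure)) \<rightarrow>\<^sub>M S"
   using that by (intro measurable_compose[OF measurable_fst] measurable_component_singleton) simp
  from measurable_compose[OF f this] show ?thesis using that by simp
 qed
 show "W k \<in> borel_measurable (jump_history M S Y W n)" if "k < n"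
 proof -
  have "(%p. snd p k) \<in> (\<Pi>\<^sub>M k\<in>{..n}. S) \<Otimes>\<^sub>M (\<Pi>\<^sub>M k\<in>{..<n}. (borel :: real measure)) \<rightarrow>\<^sub>M borel"
   using that by (intro measurable_compose[OF measurable_snd] measurable_component_singleton) simp
  from measurable_compose[OF f this] show ?thesis using that by simp
 qed
qed

text \<open>The conditional probability in \<open>cond\<close> is integrated over \<open>E\<close>,
  which belongs to the history.\<close>

lemma one_step_event:
 assumes A': "A' \<in> sets traj_space" and B: "!!i. i < n ==> B i \<in> sets borel"
  and A: "A \<in> sets S" and s: "0 <= s"
 defines "E \<equiv> {x\<in>space M. stopped n x \<in> A' & (\<forall>i<n. W i x \<in> B i)}"
 shows "emeasure M {x\<in>E. s < W n x & Y (Suc n) x \<in> A}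
  = ennreal (exp (- s)) * (\<integral>\<^sup>+x. indicator E x * emeasure (q (Y n x)) A \<partial>M)"
proof -
 let ?F = "jump_history M S Y W n"
 interpret finite_measure_subalgebra M ?F
  by unfold_locales (rule subalgebra_history)
 have spF: "space ?F = space M" using subalg by (simp add: subalgebra_def)
 have "stopped n \<in> ?F \<rightarrow>\<^sub>M traj_space"
  unfolding stopped_def
  by (rule measurable_PiM_single') (auto intro!: history_measurable simp: spF measurable_space[OF Y_measurable])
 note [measurable] = this history_measurable(2) A' A
 have EF: "E \<in> sets ?F"
 proof -
  have "{x\<in>space ?F. stopped n x \<in> A'} \<in> sets ?F" by measurable
  moreover have "{x\<in>space ?F. \<forall>i\<in>{..<n}. W i x \<in> B i} \<in> sets ?F"
   using B by (intro sets.sets_Collect_finite_All) (auto intro!: measurable_sets_Collect history_measurable(2))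
  moreover have "E = {x\<in>space ?F. stopped n x \<in> A'} \<inter> {x\<in>space ?F. \<forall>i\<in>{..<n}. W i x \<in> B i}"
   by (auto simp: E_def spF)
  ultimately show ?thesis by simp
 qed
 then have EM[measurable]: "E \<in> sets M" using subalg by (auto simp: subalgebra_def)
 let ?D = "{x. s < W n x & Y (Suc n) x \<in> A}"
 have DM: "?D \<inter> space M \<in> sets M"
 proof -
  have "{x\<in>space M. s < W n x & Y (Suc n) x \<in> A} \<in> sets M" by measurable
  moreover have "{x\<in>space M. s < W n x & Y (Suc n) x \<in> A} = ?D \<inter> space M" by auto
  ultimately show ?thesis by simp
 qed
 have ind: "integrable M (indicator ?D :: 'w => real)"
  using DM by (intro integrable_const_bound[of _ 1] AE_I2) (auto simp: borel_measurable_indicator_iff)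
 have pq: "measure (q (Y n x)) A <= 1" if "x \<in> space M" for x
  using prob_space.prob_le_1[OF prob_space_q[OF measurable_space[OF Y_measurable that]]] .
 have mq[measurable]: "(%x. measure (q (Y n x)) A) \<in> borel_measurable M"
  unfolding measure_def by measurable
 have "{x\<in>E. s < W n x & Y (Suc n) x \<in> A} = E \<inter> (?D \<inter> space M)" by (auto simp: E_def)
 then have "measure M {x\<in>E. s < W n x & Y (Suc n) x \<in> A} = measure M (E \<inter> (?D \<inter> space M))" by simp
 also have "... = (\<integral>x. indicator (E \<inter> (?D \<inter> space M)) x \<partial>M)"
  using DM EM by (subst Bochner_Integration.integral_indicator) (auto simp: Int_assoc intro!: arg_cong[where f="measure M"])
 also have "... = (LINT x:E|M. indicator ?D x)"
  unfolding set_lebesgue_integral_def by (intro Bochner_Integration.integral_cong) (auto simp: indicator_def)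
 also have "... = (LINT x:E|M. real_cond_exp M ?F (indicator ?D) x)"
  by (rule real_cond_exp_intA[OF ind EF])
 also have "... = (LINT x:E|M. exp (- s) * measure (q (Y n x)) A)"
  unfolding set_lebesgue_integral_def using cond[OF A s, of n]
  by (intro integral_cong_AE) (auto elim: eventually_mono)
 also have "... = exp (- s) * (\<integral>x. indicator E x * measure (q (Y n x)) A \<partial>M)"
  unfolding set_lebesgue_integral_def real_scaleR_def mult.left_commute[of _ "exp (- s)"]
  by (rule integral_mult_right_zero)
 finally have "emeasure M {x\<in>E. s < W n x & Y (Suc n) x \<in> A}
   = ennreal (exp (- s)) * ennreal (\<integral>x. indicator E x * measure (q (Y n x)) A \<partial>M)"
  by (simp add: emeasure_eq_measure ennreal_mult')
 also have "ennreal (\<integral>x. indicator E x * measure (q (Y n x)) A \<partial>M) = (\<integral>\<^sup>+x. ennreal (indicator E x * measure (q (Y n x)) A) \<partial>M)"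
 proof (rule nn_integral_eq_integral[symmetric])
  show "integrable M (%x. indicator E x * measure (q (Y n x)) A)"
   using pq by (intro integrable_const_bound[of _ 1] AE_I2) (auto simp: indicator_def)
 qed auto
 also have "... = (\<integral>\<^sup>+x. indicator E x * emeasure (q (Y n x)) A \<partial>M)"
 proof (rule nn_integral_cong)
  fix x assume "x \<in> space M"
  then interpret Q: prob_space "q (Y n x)" by (intro prob_space_q measurable_space[OF Y_measurable])
  show "ennreal (indicator E x * measure (q (Y n x)) A) = indicator E x * emeasure (q (Y n x)) A"
   by (simp add: Q.emeasure_eq_measure indicator_def)
 qed
 finally show ?thesis .
qed

text \<open>Holding times are positive, so \<open>s = 0\<close> in \<open>one_step_event\<close>
  leaves only the condition on the next state.\<close>

lemma one_step_rectangle: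
 assumes A': "A' \<in> sets traj_space" and A: "A \<in> sets S"
 shows "emeasure M {x\<in>space M. stopped n x \<in> A' & Y (Suc n) x \<in> A}
  = (\<integral>\<^sup>+x. indicator A' (stopped n x) * emeasure (q (Y n x)) A \<partial>M)"
proof -
 have "{x\<in>space M. stopped n x \<in> A' & Y (Suc n) x \<in> A}
   = {x\<in>{x\<in>space M. stopped n x \<in> A' & (\<forall>i<n. W i x \<in> UNIV)}. 0 < W n x & Y (Suc n) x \<in> A}"
  using W_pos by auto
 also have "emeasure M ... = ennreal (exp (- 0)) * (\<integral>\<^sup>+x. indicator {x\<in>space M. stopped n x \<in> A' & (\<forall>i<n. W i x \<in> UNIV)} x * emeasure (q (Y n x)) A \<partial>M)"
  by (rule one_step_event) (use A' A in auto)
 also have "... = (\<integral>\<^sup>+x. indicator A' (stopped n x) * emeasure (q (Y n x)) A \<partial>M)"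
  by (simp, intro nn_integral_cong) (auto simp: indicator_def)
 finally show ?thesis .
qed

lemma extend_traj_measurable [measurable]:
 "(%(y, z). extend_traj n y z) \<in> traj_space \<Otimes>\<^sub>M S \<rightarrow>\<^sub>M traj_space"
proof (rule measurable_PiM_single')
 fix k :: nat
 have "(%p. if k <= n then fst p k else snd p) \<in> traj_space \<Otimes>\<^sub>M S \<rightarrow>\<^sub>M S"
  by (cases "k <= n") (auto intro: measurable_compose[OF measurable_fst])
 then show "(%p. (case p of (y, z) => extend_traj n y z) k) \<in> traj_space \<Otimes>\<^sub>M S \<rightarrow>\<^sub>M S"
  by (simp add: extend_traj_def case_prod_unfold)
qed (auto simp: space_pair_measure space_PiM extend_traj_def PiE_iff)

lemma stopped_Suc: "stopped (Suc n) x = extend_traj n (stopped n x) (Y (Suc n) x)"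
 by (auto simp: stopped_def extend_traj_def min_def fun_eq_iff le_Suc_eq)

lemma stopped_last: "stopped n x n = Y n x"
 by (simp add: stopped_def)

lemma one_step_expectation:
 fixes H :: "(nat => 's) => real"
 assumes H[measurable]: "H \<in> borel_measurable traj_space" and B: "!!y. \<bar>H y\<bar> <= B"
 shows "(\<integral>x. H (stopped (Suc n) x) \<partial>M) = (\<integral>x. (\<integral>z. H (extend_traj n (stopped n x) z) \<partial>q (Y n x)) \<partial>M)"
proof -
 let ?u = "(%x. (stopped n x, Y (Suc n) x))"
 let ?P = "traj_space \<Otimes>\<^sub>M S"
 define K where "K y = distr (q (y n)) ?P (%z. (y, z))" for y :: "nat => 's"
 define \<mu> where "\<mu> = distr M traj_space (stopped n)"
 have K[measurable]: "K \<in> traj_space \<rightarrow>\<^sub>M subprob_algebra ?P"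
  unfolding K_def by (rule measurable_distr2[where M = S]) measurable
 have K\<mu>: "K \<in> \<mu> \<rightarrow>\<^sub>M subprob_algebra ?P" by (simp add: \<mu>_def)
 interpret \<mu>: prob_space \<mu> unfolding \<mu>_def by (rule prob_space_distr) simp
 have sy: "y n \<in> space S" if "y \<in> space traj_space" for y using that by (simp add: space_PiM PiE_iff)
 have mp: "(%z. (y, z)) \<in> q (y n) \<rightarrow>\<^sub>M ?P" if "y \<in> space traj_space" for y
  using that by (subst measurable_cong_sets[OF sets_q[OF sy[OF that]] refl]) simp
 have ne: "space \<mu> ~= {}" by (rule \<mu>.not_empty)
 have law: "distr M ?P ?u = \<mu> \<bind> K"
 proof (rule pair_measure_eq_of_rectangles)
  show "sets (\<mu> \<bind> K) = sets ?P" using ne by (subst sets_bind[where N = ?P]) (auto simp: \<mu>_def K_def)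
  show "emeasure (distr M ?P ?u) (space traj_space \<times> space S) ~= \<infinity>"
   by (subst emeasure_distr) (auto simp: emeasure_eq_measure)
  fix A' A assume A'[measurable]: "A' \<in> sets traj_space" and A[measurable]: "A \<in> sets S"
  have "emeasure (distr M ?P ?u) (A' \<times> A)
    = emeasure M {x\<in>space M. stopped n x \<in> A' & Y (Suc n) x \<in> A}"
   by (subst emeasure_distr) (auto intro!: arg_cong[where f = "emeasure M"])
  also have "... = (\<integral>\<^sup>+x. indicator A' (stopped n x) * emeasure (q (Y n x)) A \<partial>M)"
   by (rule one_step_rectangle) (rule A' A)+
  also have "... = (\<integral>\<^sup>+y. indicator A' y * emeasure (q (y n)) A \<partial>\<mu>)"
   unfolding \<mu>_def by (subst nn_integral_distr) (auto simp: stopped_last)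
  also have "... = (\<integral>\<^sup>+y. emeasure (K y) (A' \<times> A) \<partial>\<mu>)"
  proof (rule nn_integral_cong)
   fix y assume "y \<in> space \<mu>"
   then have y: "y \<in> space traj_space" by (simp add: \<mu>_def)
   have "emeasure (K y) (A' \<times> A) = emeasure (q (y n)) ((%z. (y, z)) -` (A' \<times> A) \<inter> space (q (y n)))"
    unfolding K_def by (rule emeasure_distr[OF mp[OF y]]) simp
   also have "(%z. (y, z)) -` (A' \<times> A) \<inter> space (q (y n)) = (if y \<in> A' then A else {})"
    using sets.sets_into_space[OF A] space_q[OF sy[OF y]] by auto
   finally show "indicator A' y * emeasure (q (y n)) A = emeasure (K y) (A' \<times> A)" by (simp add: indicator_def)
  qed
  also have "... = emeasure (\<mu> \<bind> K) (A' \<times> A)"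
   by (rule emeasure_bind[OF ne K\<mu>, symmetric]) measurable
  finally show "emeasure (distr M ?P ?u) (A' \<times> A) = emeasure (\<mu> \<bind> K) (A' \<times> A)" .
 qed simp
 define G where "G = (%p. H (extend_traj n (fst p) (snd p)))"
 have G[measurable]: "G \<in> borel_measurable ?P"
 proof -
  have "H \<circ> (%(y, z). extend_traj n y z) \<in> borel_measurable ?P"
   by (rule measurable_comp[OF extend_traj_measurable H])
  then show ?thesis by (simp add: G_def comp_def case_prod_unfold)
 qed
 have "(\<integral>x. H (stopped (Suc n) x) \<partial>M) = (\<integral>p. G p \<partial>distr M ?P ?u)"
  by (subst integral_distr) (auto simp: G_def stopped_Suc)
 also have "... = (\<integral>y. (\<integral>p. G p \<partial>K y) \<partial>\<mu>)"
  unfolding law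
 proof (rule integral_bind[OF _ _ _ , where K = ?P and B = B and B' = 1])
  show "K \<in> \<mu> \<rightarrow>\<^sub>M subprob_algebra ?P" by (rule K\<mu>)
  show "\<bar>G y\<bar> <= B" for y using B by (simp add: G_def)
  show "AE y in \<mu>. emeasure (K y) (space (K y)) <= ennreal 1"
   using subprob_space.subprob_emeasure_le_1[OF subprob_space_kernel[OF K\<mu>]] by (intro AE_I2) simp
 qed (use ne in \<open>auto intro: \<mu>.finite_measure_axioms\<close>)
 also have "... = (\<integral>x. (\<integral>p. G p \<partial>K (stopped n x)) \<partial>M)"
  unfolding \<mu>_def using measurable_compose[OF K integral_measurable_subprob_algebra[OF G]]
  by (intro integral_distr stopped_measurable)
 also have "... = (\<integral>x. (\<integral>z. H (extend_traj n (stopped n x) z) \<partial>q (Y n x)) \<partial>M)"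
 proof (rule Bochner_Integration.integral_cong[OF refl])
  fix x assume "x \<in> space M"
  then have y: "stopped n x \<in> space traj_space" by (rule measurable_space[OF stopped_measurable])
  show "(\<integral>p. G p \<partial>K (stopped n x)) = (\<integral>z. H (extend_traj n (stopped n x) z) \<partial>q (Y n x))"
   unfolding K_def by (subst integral_distr[OF mp[OF y]]) (auto simp: G_def stopped_last)
 qed
 finally show ?thesis .
qed

lemma holding_times_independent_stopped:
 assumes B: "!!i. i < n ==> B i \<in> sets borel" and A: "A \<in> sets traj_space"
 shows "emeasure M {x\<in>space M. stopped n x \<in> A & (\<forall>i<n. W i x \<in> B i)}
  = (\<Prod>i<n. emeasure exp_law (B i)) * emeasure M {x\<in>space M. stopped n x \<in> A}"
 using B A
proof (induction n arbitrary: A)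
 case 0
 then show ?case by simp
next
 case (Suc n)
 let ?P = "traj_space \<Otimes>\<^sub>M S"
 define c where "c = (\<Prod>i<n. emeasure exp_law (B i))"
 define D where "D = {x\<in>space M. \<forall>i<n. W i x \<in> B i}"
 have B: "i < n ==> B i \<in> sets borel" for i using Suc.prems(1) by simp
 have D[measurable]: "D \<in> sets M"
 proof -
  have "D = {x\<in>space M. \<forall>i\<in>{..<n}. W i x \<in> B i}" by (auto simp: D_def)
  also have "... \<in> sets M"
  proof (rule sets.sets_Collect_finite_All)
   fix i assume "i \<in> {..<n}"
   then have "W i -` B i \<inter> space M \<in> sets M" using B by (intro measurable_sets[OF W_measurable]) simp
   moreover have "W i -` B i \<inter> space M = {x\<in>space M. W i x \<in> B i}" by auto
   ultimately show "{x\<in>space M. W i x \<in> B i} \<in> sets M" by simp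
  qed simp
  finally show ?thesis .
 qed
 interpret EL: prob_space exp_law by (rule prob_space_exp_law)
 have cfin: "c ~= \<infinity>" unfolding c_def by (simp add: EL.emeasure_eq_measure prod_ennreal)
 \<comment> \<open>The induction hypothesis as an identity of measures, so that it can be applied to
   functions of the trajectory.\<close>
 have law: "distr (density M (indicator D)) traj_space (stopped n) = scale_measure c (distr M traj_space (stopped n))"
 proof (rule measure_eqI)
  fix A' assume "A' \<in> sets (distr (density M (indicator D)) traj_space (stopped n))"
  then have A'[measurable]: "A' \<in> sets traj_space" by simp
  have "emeasure (distr (density M (indicator D)) traj_space (stopped n)) A' = emeasure M (D \<inter> (stopped n -` A' \<inter> space M))"
   by (rule emeasure_distr_density_indicator[OF D stopped_measurable A'])
  also have "D \<inter> (stopped n -` A' \<inter> space M) = {x\<in>space M. stopped n x \<in> A' & (\<forall>i<n. W i x \<in> B i)}" by (auto simp: D_def)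
  also have "emeasure M {x\<in>space M. stopped n x \<in> A' & (\<forall>i<n. W i x \<in> B i)} = c * emeasure M {x\<in>space M. stopped n x \<in> A'}"
   unfolding c_def by (rule Suc.IH[OF B A'])
  also have "... = emeasure (scale_measure c (distr M traj_space (stopped n))) A'"
  proof -
   have "stopped n -` A' \<inter> space M = {x\<in>space M. stopped n x \<in> A'}" by auto
   then show ?thesis by (simp add: emeasure_distr)
  qed
  finally show "emeasure (distr (density M (indicator D)) traj_space (stopped n)) A' = emeasure (scale_measure c (distr M traj_space (stopped n))) A'" .
 qed simp
 have IH: "(\<integral>\<^sup>+x. indicator D x * g (stopped n x) \<partial>M) = c * (\<integral>\<^sup>+x. g (stopped n x) \<partial>M)"
  if [measurable]: "g \<in> borel_measurable traj_space" for g
 proof -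
  have "(\<integral>\<^sup>+x. indicator D x * g (stopped n x) \<partial>M) = (\<integral>\<^sup>+y. g y \<partial>distr (density M (indicator D)) traj_space (stopped n))"
   by (subst nn_integral_distr) (auto simp: nn_integral_density)
  also have "... = c * (\<integral>\<^sup>+x. g (stopped n x) \<partial>M)"
   unfolding law by (subst nn_integral_scale_measure) (auto simp: nn_integral_distr)
  finally show ?thesis .
 qed
 define d where "d A' A'' = emeasure M {x\<in>space M. stopped n x \<in> A' & Y (Suc n) x \<in> A''}" for A' A''
 have W_law: "emeasure M {x\<in>space M. stopped n x \<in> A' & (\<forall>i<n. W i x \<in> B i) & W n x \<in> B n & Y (Suc n) x \<in> A''}
   = c * emeasure exp_law (B n) * d A' A''"
  if A'[measurable]: "A' \<in> sets traj_space" and A''[measurable]: "A'' \<in> sets S" for A' A''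
 proof -
  define E where "E = (stopped n -` A' \<inter> space M) \<inter> D \<inter> (Y (Suc n) -` A'' \<inter> space M)"
  have E: "E \<in> sets M" unfolding E_def by measurable
  have E_iff: "x \<in> E \<longleftrightarrow> x \<in> space M & stopped n x \<in> A' & (\<forall>i<n. W i x \<in> B i) & Y (Suc n) x \<in> A''" for x
   by (auto simp: E_def D_def)
  \<comment> \<open>The values on the half-lines \<open>{s<..}\<close> determine a finite measure,
    and \<open>one_step_event\<close> evaluates them.\<close>
  have "distr (density M (indicator E)) borel (W n) = scale_measure (c * d A' A'') exp_law"
  proof (rule measure_eqI_lessThan)
   have em: "emeasure (distr (density M (indicator E)) borel (W n)) {s<..} = emeasure M {x\<in>E. s < W n x}" for s
   proof -
    have "E \<inter> (W n -` {s<..} \<inter> space M) = {x\<in>E. s < W n x}" by (auto simp: E_iff)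
    then show ?thesis using emeasure_distr_density_indicator[OF E W_measurable[of n], of "{s<..}"] by simp
   qed
   show "emeasure (distr (density M (indicator E)) borel (W n)) {s<..} < \<infinity>" for s
    unfolding em by (simp add: emeasure_eq_measure)
   fix s
   \<comment> \<open>Holding times are positive, so a negative \<open>s\<close> may be replaced by
     0, as \<open>one_step_event\<close> demands.\<close>
   have "{x\<in>E. s < W n x} = {x\<in>{x\<in>space M. stopped n x \<in> A' & (\<forall>i<n. W i x \<in> B i)}. max 0 s < W n x & Y (Suc n) x \<in> A''}"
    using W_pos by (auto simp: E_iff)
   then have "emeasure M {x\<in>E. s < W n x} = ennreal (exp (- max 0 s))
     * (\<integral>\<^sup>+x. indicator {x\<in>space M. stopped n x \<in> A' & (\<forall>i<n. W i x \<in> B i)} x * emeasure (q (Y n x)) A'' \<partial>M)"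
    using one_step_event[OF A' B A'', where s = "max 0 s"] by simp
   also have "(\<integral>\<^sup>+x. indicator {x\<in>space M. stopped n x \<in> A' & (\<forall>i<n. W i x \<in> B i)} x * emeasure (q (Y n x)) A'' \<partial>M)
     = (\<integral>\<^sup>+x. indicator D x * (indicator A' (stopped n x) * emeasure (q (stopped n x n)) A'') \<partial>M)"
    by (intro nn_integral_cong) (auto simp: indicator_def D_def stopped_last)
   also have "... = c * (\<integral>\<^sup>+x. indicator A' (stopped n x) * emeasure (q (stopped n x n)) A'' \<partial>M)"
    by (rule IH[of "%y. indicator A' y * emeasure (q (y n)) A''"]) measurable
   also have "(\<integral>\<^sup>+x. indicator A' (stopped n x) * emeasure (q (stopped n x n)) A'' \<partial>M) = d A' A''"
    unfolding d_def one_step_rectangle[OF A' A''] by (simp add: stopped_last)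
   finally show "emeasure (distr (density M (indicator E)) borel (W n)) {s<..} = emeasure (scale_measure (c * d A' A'') exp_law) {s<..}"
    unfolding em by (simp add: emeasure_exp_law_Ioi mult_ac)
  qed auto
  from arg_cong[OF this, of "%m. emeasure m (B n)"]
  have 1: "emeasure (distr (density M (indicator E)) borel (W n)) (B n) = c * d A' A'' * emeasure exp_law (B n)" by simp
  have "B n \<in> sets borel" using Suc.prems(1) by simp
  from emeasure_distr_density_indicator[OF E W_measurable this]
  have "emeasure (distr (density M (indicator E)) borel (W n)) (B n) = emeasure M (E \<inter> (W n -` B n \<inter> space M))" .
  also have "E \<inter> (W n -` B n \<inter> space M) = {x\<in>space M. stopped n x \<in> A' & (\<forall>i<n. W i x \<in> B i) & W n x \<in> B n & Y (Suc n) x \<in> A''}"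
   by (auto simp: E_iff)
  finally show ?thesis using 1 by (simp add: mult_ac)
 qed
 define D' where "D' = D \<inter> (W n -` B n \<inter> space M)"
 have D': "D' \<in> sets M"
  using measurable_sets[OF W_measurable[of n], of "B n"] Suc.prems(1) by (simp add: D'_def)
 have D'_iff: "x \<in> D' \<longleftrightarrow> x \<in> space M & (\<forall>i<n. W i x \<in> B i) & W n x \<in> B n" for x
  by (auto simp: D'_def D_def)
 have pm[measurable]: "(%x. (stopped n x, Y (Suc n) x)) \<in> M \<rightarrow>\<^sub>M ?P" by measurable
 have em: "emeasure (distr (density M (indicator D')) ?P (%x. (stopped n x, Y (Suc n) x))) X
   = emeasure M {x\<in>D'. (stopped n x, Y (Suc n) x) \<in> X}" if "X \<in> sets ?P" for X
 proof -
  have "D' \<inter> ((%x. (stopped n x, Y (Suc n) x)) -` X \<inter> space M) = {x\<in>D'. (stopped n x, Y (Suc n) x) \<in> X}"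
   by (auto simp: D'_iff)
  then show ?thesis using emeasure_distr_density_indicator[OF D' pm that] by simp
 qed
 have "distr (density M (indicator D')) ?P (%x. (stopped n x, Y (Suc n) x))
   = scale_measure (c * emeasure exp_law (B n)) (distr M ?P (%x. (stopped n x, Y (Suc n) x)))"
 proof (rule pair_measure_eq_of_rectangles)
  show "emeasure (distr (density M (indicator D')) ?P (%x. (stopped n x, Y (Suc n) x))) (space traj_space \<times> space S) ~= \<infinity>"
   by (subst em) (auto simp: emeasure_eq_measure)
  fix A' A'' assume A'[measurable]: "A' \<in> sets traj_space" and A''[measurable]: "A'' \<in> sets S"
  have "emeasure (distr (density M (indicator D')) ?P (%x. (stopped n x, Y (Suc n) x))) (A' \<times> A'')
    = emeasure M {x\<in>space M. stopped n x \<in> A' & (\<forall>i<n. W i x \<in> B i) & W n x \<in> B n & Y (Suc n) x \<in> A''}"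
   by (subst em) (auto simp: D'_iff intro!: arg_cong[where f = "emeasure M"])
  also have "... = c * emeasure exp_law (B n) * d A' A''" by (rule W_law[OF A' A''])
  also have "d A' A'' = emeasure (distr M ?P (%x. (stopped n x, Y (Suc n) x))) (A' \<times> A'')"
   unfolding d_def by (subst emeasure_distr) (auto intro!: arg_cong[where f = "emeasure M"])
  finally show "emeasure (distr (density M (indicator D')) ?P (%x. (stopped n x, Y (Suc n) x))) (A' \<times> A'')
    = emeasure (scale_measure (c * emeasure exp_law (B n)) (distr M ?P (%x. (stopped n x, Y (Suc n) x)))) (A' \<times> A'')"
   by simp
 qed simp_all
 note pair_law = this
 define X where "X = (%(y, z). extend_traj n y z) -` A \<inter> space ?P"
 have X[measurable]: "X \<in> sets ?P" unfolding X_def by (rule measurable_sets[OF extend_traj_measurable Suc.prems(2)])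
 have inX: "(stopped n x, Y (Suc n) x) \<in> X \<longleftrightarrow> stopped (Suc n) x \<in> A" if "x \<in> space M" for x
  using measurable_space[OF pm that] by (auto simp: X_def stopped_Suc)
 have "{x\<in>space M. stopped (Suc n) x \<in> A & (\<forall>i<Suc n. W i x \<in> B i)} = {x\<in>D'. (stopped n x, Y (Suc n) x) \<in> X}"
  using inX by (auto simp: D'_iff less_Suc_eq)
 then have "emeasure M {x\<in>space M. stopped (Suc n) x \<in> A & (\<forall>i<Suc n. W i x \<in> B i)}
   = c * emeasure exp_law (B n) * emeasure (distr M ?P (%x. (stopped n x, Y (Suc n) x))) X"
  using em[OF X] unfolding pair_law by simp
 also have "emeasure (distr M ?P (%x. (stopped n x, Y (Suc n) x))) X = emeasure M {x\<in>space M. stopped (Suc n) x \<in> A}"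
  using inX by (subst emeasure_distr) (auto intro!: arg_cong[where f = "emeasure M"])
 finally show ?case by (simp add: c_def)
qed

text \<open>The preceding lemma covers the first \<open>n\<close> holding times with the trajectory
  frozen at \<open>n\<close>. For \<open>n >= m\<close> the trajectory frozen at \<open>m\<close> is
  a function of that one, so all cylinder events of the infinite sequence of holding times are
  reached.\<close>

lemma traj_holding_law:
 "distr M (traj_space \<Otimes>\<^sub>M (\<Pi>\<^sub>M k\<in>UNIV. borel)) (%x. (stopped m x, %k. W k x))
  = distr M traj_space (stopped m) \<Otimes>\<^sub>M (\<Pi>\<^sub>M k\<in>UNIV. exp_law)"
proof -
 let ?u = "(%x. (stopped m x, %k. W k x))"
 let ?v = "(distr M traj_space (stopped m))"
 interpret EL: prob_space exp_law by (rule prob_space_exp_law)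
 interpret PE: product_prob_space "%_. exp_law" "UNIV :: nat set" by unfold_locales
 have sE: "sets (\<Pi>\<^sub>M k\<in>(UNIV::nat set). exp_law) = sets (\<Pi>\<^sub>M k\<in>UNIV. borel)" by (rule sets_PiM_cong) simp_all
 have W[measurable]: "(%x k. W k x) \<in> M \<rightarrow>\<^sub>M (\<Pi>\<^sub>M k\<in>UNIV. borel)"
  by (rule measurable_PiM_single') auto
 have cyl: "emeasure M {x\<in>space M. stopped m x \<in> A & (\<forall>i<n. W i x \<in> B i)}
   = (\<Prod>i<n. emeasure exp_law (B i)) * emeasure M {x\<in>space M. stopped m x \<in> A}"
  if mn: "m <= n" and B: "!!i. i < n ==> B i \<in> sets borel" and A: "A \<in> sets traj_space" for n A and B :: "nat => real set"
 proof -
  let ?r = "%y k. y (min k m) :: 's"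
  have r: "?r \<in> traj_space \<rightarrow>\<^sub>M traj_space"
   by (rule measurable_PiM_single') (auto simp: space_PiM PiE_iff)
  let ?A = "?r -` A \<inter> space traj_space"
  have "stopped m x = ?r (stopped n x)" for x using mn by (simp add: stopped_def fun_eq_iff)
  then have eq: "stopped n x \<in> ?A \<longleftrightarrow> stopped m x \<in> A" if "x \<in> space M" for x
   using measurable_space[OF stopped_measurable that, of n] by simp
  have "{x\<in>space M. stopped m x \<in> A & (\<forall>i<n. W i x \<in> B i)} = {x\<in>space M. stopped n x \<in> ?A & (\<forall>i<n. W i x \<in> B i)}"
   "{x\<in>space M. stopped m x \<in> A} = {x\<in>space M. stopped n x \<in> ?A}" using eq by blast+
  then show ?thesis using holding_times_independent_stopped[OF B measurable_sets[OF r A]] by simp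
 qed
 have law: "distr (density M (indicator (stopped m -` A \<inter> space M))) (\<Pi>\<^sub>M k\<in>UNIV. borel) (%x k. W k x)
   = scale_measure (emeasure M (stopped m -` A \<inter> space M)) (\<Pi>\<^sub>M k\<in>UNIV. exp_law)"
  if A[measurable]: "A \<in> sets traj_space" for A
 proof (rule measure_eqI_PiM_infinite)
  let ?E = "stopped m -` A \<inter> space M"
  have em: "emeasure (distr (density M (indicator ?E)) (\<Pi>\<^sub>M k\<in>UNIV. borel) (%x k. W k x)) X
    = emeasure M {x\<in>?E. (%k. W k x) \<in> X}" if "X \<in> sets (\<Pi>\<^sub>M k\<in>UNIV. borel)" for X
  proof -
   have "?E \<inter> ((%x k. W k x) -` X \<inter> space M) = {x\<in>?E. (%k. W k x) \<in> X}" by auto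
   then show ?thesis using emeasure_distr_density_indicator[OF measurable_sets[OF stopped_measurable A] W that] by simp
  qed
  show "finite_measure (distr (density M (indicator ?E)) (\<Pi>\<^sub>M k\<in>UNIV. borel) (%x k. W k x))"
   by (rule finite_measureI) (subst space_distr, subst em, auto simp: emeasure_eq_measure sets.top[of "\<Pi>\<^sub>M k\<in>UNIV. borel", simplified])
  fix F :: "nat => real set" and J :: "nat set"
  assume J: "finite J" "J \<subseteq> UNIV" and F: "!!i. i \<in> J ==> F i \<in> sets borel"
  obtain n0 where n0: "J \<subseteq> {..<n0}" using J(1) finite_nat_iff_bounded by auto
  define n where "n = max m n0"
  define B where "B i = (if i \<in> J then F i else UNIV)" for i
  have X: "prod_emb UNIV (%_. borel) J (Pi\<^sub>E J F) \<in> sets (\<Pi>\<^sub>M k\<in>(UNIV::nat set). (borel :: real measure))"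
   using J F by (intro sets_PiM_I) auto
  have in_X: "(%k. W k x) \<in> prod_emb UNIV (%_. borel) J (Pi\<^sub>E J F) \<longleftrightarrow> (\<forall>i<n. W i x \<in> B i)" for x
   using n0 by (auto simp: prod_emb_def B_def n_def PiE_iff)
  have "emeasure (distr (density M (indicator ?E)) (\<Pi>\<^sub>M k\<in>UNIV. borel) (%x k. W k x)) (prod_emb UNIV (%_. borel) J (Pi\<^sub>E J F))
    = emeasure M {x\<in>space M. stopped m x \<in> A & (\<forall>i<n. W i x \<in> B i)}"
   unfolding em[OF X] in_X by (intro arg_cong[where f = "emeasure M"]) auto
  also have "... = (\<Prod>i<n. emeasure exp_law (B i)) * emeasure M {x\<in>space M. stopped m x \<in> A}"
   by (rule cyl) (auto simp: n_def B_def F A)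
  also have "{x\<in>space M. stopped m x \<in> A} = ?E" by auto
  also have "(\<Prod>i<n. emeasure exp_law (B i)) = (\<Prod>i\<in>J. emeasure exp_law (F i))"
   using n0 EL.emeasure_space_1 by (intro prod.mono_neutral_cong_right) (auto simp: B_def n_def)
  also have "... = emeasure (\<Pi>\<^sub>M k\<in>UNIV. exp_law) (prod_emb UNIV (%_. exp_law) J (Pi\<^sub>E J F))"
   using J F by (intro PE.emeasure_PiM_emb[symmetric]) auto
  also have "prod_emb UNIV (%_. exp_law) J (Pi\<^sub>E J F) = prod_emb UNIV (%_. borel) J (Pi\<^sub>E J F)" by (simp add: prod_emb_def)
  finally show "emeasure (distr (density M (indicator ?E)) (\<Pi>\<^sub>M k\<in>UNIV. borel) (%x k. W k x)) (prod_emb UNIV (%_. borel) J (Pi\<^sub>E J F))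
    = emeasure (scale_measure (emeasure M ?E) (\<Pi>\<^sub>M k\<in>UNIV. exp_law)) (prod_emb UNIV (%_. borel) J (Pi\<^sub>E J F))"
   by (simp add: mult.commute)
 qed (simp_all add: sE)
 show ?thesis
 proof (rule pair_measure_eqI[symmetric])
  show "sigma_finite_measure ?v"
   by (intro prob_space_imp_sigma_finite prob_space_distr) simp
  show "sigma_finite_measure (\<Pi>\<^sub>M k\<in>(UNIV::nat set). exp_law)"
   by (intro prob_space_imp_sigma_finite prob_space_PiM prob_space_exp_law)
  show "sets (distr M traj_space (stopped m) \<Otimes>\<^sub>M (\<Pi>\<^sub>M k\<in>UNIV. exp_law))
    = sets (distr M (traj_space \<Otimes>\<^sub>M (\<Pi>\<^sub>M k\<in>UNIV. borel)) ?u)"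
   by (simp add: sE cong: sets_pair_measure_cong)
  fix A B assume "A \<in> sets ?v" "B \<in> sets (\<Pi>\<^sub>M k\<in>(UNIV::nat set). exp_law)"
  then have A[measurable]: "A \<in> sets traj_space" and B[measurable]: "B \<in> sets (\<Pi>\<^sub>M k\<in>(UNIV::nat set). borel)" by (simp_all add: sE)
  let ?E = "stopped m -` A \<inter> space M" and ?X = "(%x k. W k x) -` B \<inter> space M"
  have "emeasure ?v A * emeasure (\<Pi>\<^sub>M k\<in>UNIV. exp_law) B
    = emeasure (scale_measure (emeasure M ?E) (\<Pi>\<^sub>M k\<in>UNIV. exp_law)) B" by (simp add: emeasure_distr)
  also have "... = emeasure (distr (density M (indicator ?E)) (\<Pi>\<^sub>M k\<in>UNIV. borel) (%x k. W k x)) B"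
   by (simp add: law[OF A])
  also have "... = emeasure M (?E \<inter> ?X)"
   by (rule emeasure_distr_density_indicator[OF measurable_sets[OF stopped_measurable A] W B])
  also have "?E \<inter> ?X = ?u -` (A \<times> B) \<inter> space M" by auto
  also have "emeasure M ... = emeasure (distr M (traj_space \<Otimes>\<^sub>M (\<Pi>\<^sub>M k\<in>UNIV. borel)) ?u) (A \<times> B)"
   by (rule emeasure_distr[symmetric]) measurable
  finally show "emeasure ?v A * emeasure (\<Pi>\<^sub>M k\<in>UNIV. exp_law) B
    = emeasure (distr M (traj_space \<Otimes>\<^sub>M (\<Pi>\<^sub>M k\<in>UNIV. borel)) ?u) (A \<times> B)" .
 qed
qed

end

section \<open>The discrete torus\<close>

definition torus_step :: "nat => (nat => nat) => nat => nat => nat" where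
 "torus_step n x i = x(i := (x i + 1) mod n)"

lemma finite_torus: "finite (torus d n)"
 by (auto simp: torus_def intro!: finite_PiE)

lemma card_torus: "card (torus d n) = n ^ d"
 by (simp add: torus_def card_PiE)

lemma torus_step_in:
 assumes "x \<in> torus d n" "i < d"
 shows "torus_step n x i \<in> torus d n"
proof -
 have "x i < n" using assms by (auto simp: torus_def)
 then have "0 < n" by simp
 then show ?thesis using assms by (auto simp: torus_def torus_step_def PiE_iff extensional_def)
qed

lemma torus_edges_eq: "torus_edges d n = (%(x, i). {x, torus_step n x i}) ` (torus d n \<times> {..<d})"
 by (auto simp: torus_edges_def torus_step_def image_iff)

lemma torus_step_ne:
 assumes "x \<in> torus d n" "i < d" "2 <= n"
 shows "torus_step n x i i ~= x i"
proof -
 have "x i < n" using assms by (auto simp: torus_def)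
 then show ?thesis using assms(3) by (cases "x i + 1 = n") (auto simp: torus_step_def)
qed

lemma torus_step_other: "i ~= j ==> torus_step n x i j = x j"
 by (simp add: torus_step_def)

text \<open>Every edge has a unique starting point and direction. Side length 2 must be excluded:
  there the steps from both end points give the same edge.\<close>

lemma card_torus_edges:
 assumes "3 <= n"
 shows "card (torus_edges d n) = d * n ^ d"
proof -
 have "inj_on (%(x, i). {x, torus_step n x i}) (torus d n \<times> {..<d})"
 proof (rule inj_onI, clarify)
  fix x i y j assume x: "x \<in> torus d n" "i < d" and y: "y \<in> torus d n" "j < d"
   and eq: "{x, torus_step n x i} = {y, torus_step n y j}"
  have n2: "2 <= n" using assms by simp
  have "x = y & torus_step n x i = torus_step n y j | x = torus_step n y j & torus_step n x i = y"
   using eq by (auto simp: doubleton_eq_iff)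
  then show "x = y & i = j"
  proof
   assume *: "x = y & torus_step n x i = torus_step n y j"
   then show ?thesis using torus_step_ne[OF x n2] torus_step_other[of j i n x] by metis
  next
   assume *: "x = torus_step n y j & torus_step n x i = y"
   show ?thesis
   proof (cases "i = j")
    case True
    have b: "y j < n" using y by (auto simp: torus_def)
    have "((y j + 1) mod n + 1) mod n = y j" using * True by (metis fun_upd_same torus_step_def)
    then have "(y j + 2) mod n = y j" by (simp add: mod_Suc_eq)
    then show ?thesis using b assms by (cases "y j + 2 < n") (auto simp: mod_if split: if_splits)
   next
    case False
    then have "y j = x j" using * torus_step_other[of i j n x] by metis
    then show ?thesis using * torus_step_ne[OF y n2] by metis
   qed
  qed
 qed
 then show ?thesis unfolding torus_edges_eq by (simp add: card_image card_torus card_cartesian_product)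
qed

lemma finite_torus_edges: "finite (torus_edges d n)"
 unfolding torus_edges_eq by (simp add: finite_torus)

lemma torus_edgesE:
 assumes "b \<in> torus_edges d n" "2 <= n"
 obtains x y where "b = {x, y}" "x ~= y" "x \<in> torus d n" "y \<in> torus d n"
proof -
 obtain x i where xi: "b = {x, torus_step n x i}" "x \<in> torus d n" "i < d"
  using assms(1) by (auto simp: torus_edges_eq)
 have "x ~= torus_step n x i" using torus_step_ne[OF xi(2,3) assms(2)] by metis
 then show thesis using that xi torus_step_in[OF xi(2,3)] by blast
qed

text \<open>In each direction a vertex begins one edge and ends one. \<open>?back\<close> is the
  vertex before it, with \<open>n\<close> added before the subtraction of natural numbers.\<close>

lemma card_incident_edges_le: "card {b\<in>torus_edges d n. v \<in> b} <= 2 * d"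
proof -
 let ?u = "(%i. {v, torus_step n v i})"
 let ?back = "%i. v(i := (v i + n - 1) mod n)"
 have "{b\<in>torus_edges d n. v \<in> b} \<subseteq> ?u ` {..<d} \<union> (%i. {?back i, v}) ` {..<d}"
 proof
  fix b assume "b \<in> {b\<in>torus_edges d n. v \<in> b}"
  then obtain x i where xi: "b = {x, torus_step n x i}" "x \<in> torus d n" "i < d" "v = x | v = torus_step n x i"
   by (auto simp: torus_edges_eq)
  have "?back i = x" if "v = torus_step n x i"
  proof -
   have b: "x i < n" using xi by (auto simp: torus_def)
   then have "((x i + 1) mod n + n - 1) mod n = x i"
    by (cases "x i + 1 = n") auto
   then show ?thesis using that by (auto simp: torus_step_def)
  qed
  then show "b \<in> ?u ` {..<d} \<union> (%i. {?back i, v}) ` {..<d}"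
   using xi(1,3,4) by (metis (no_types, lifting) UnI1 UnI2 image_eqI lessThan_iff)
 qed
 then have "card {b\<in>torus_edges d n. v \<in> b} <= card (?u ` {..<d} \<union> (%i. {?back i, v}) ` {..<d})"
  by (intro card_mono) auto
 also have "... <= card (?u ` {..<d}) + card ((%i. {?back i, v}) ` {..<d})" by (rule card_Un_le)
 also have "... <= card {..<d} + card {..<d}" by (intro add_mono card_image_le) auto
 finally show ?thesis by simp
qed

lemma edge_transposition_doubleton: "edge_transposition {x, y} = swp x y"
 unfolding edge_transposition_def
proof (rule the_equality)
 show "\<exists>x' y'. {x, y} = {x', y'} & swp x y = swp x' y'" by blast
next
 fix t assume "\<exists>x' y'. {x, y} = {x', y'} & t = swp x' y'"
 then show "t = swp x y" by (auto simp: doubleton_eq_iff transpose_commute)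
qed

lemma cycle_partition_eq: "cycle_partition d n s = cycle_masses (torus d n) s"
 by (simp add: cycle_partition_def cycle_masses_def orbits_def card_torus)

lemma edge_transposition_permutes:
 assumes "b \<in> torus_edges d n" "2 <= n"
 shows "edge_transposition b permutes torus d n"
 using torus_edgesE[OF assms] by (metis edge_transposition_doubleton permutes_swap_id)

lemma edge_move_in:
 assumes "b \<in> torus_edges d n" "2 <= n" "s \<in> torus_perms d n"
 shows "edge_transposition b \<circ> s \<in> torus_perms d n"
 using assms by (auto simp: torus_perms_def intro: permutes_compose edge_transposition_permutes)

lemma stirring_rates_integral:
 fixes h :: "((nat => nat) => nat => nat) => real"
 assumes n: "3 <= n" and s: "s \<in> torus_perms d n"
 shows "(\<integral>t. h t \<partial>stirring_rates d n s)
  = (\<Sum>b\<in>torus_edges d n. h (edge_transposition b \<circ> s)) / card (torus_edges d n)"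
proof -
 let ?E = "torus_edges d n" and ?c = "1 / (real d * real (n ^ d))"
 have m: "(%b. edge_transposition b \<circ> s) \<in> point_measure ?E (%b. ennreal ?c) \<rightarrow>\<^sub>M count_space (torus_perms d n)"
  using edge_move_in[OF _ _ s] n by (auto simp: measurable_def space_point_measure sets_point_measure)
 have "(\<integral>t. h t \<partial>stirring_rates d n s) = (\<integral>b. h (edge_transposition b \<circ> s) \<partial>point_measure ?E (%b. ennreal ?c))"
  unfolding stirring_rates_def by (rule integral_distr[OF m]) simp
 also have "... = (\<Sum>b\<in>?E. ?c *\<^sub>R h (edge_transposition b \<circ> s))"
  by (rule lebesgue_integral_point_measure_finite[OF finite_torus_edges]) simp
 also have "... = (\<Sum>b\<in>?E. h (edge_transposition b \<circ> s)) / card ?E"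
  unfolding card_torus_edges[OF n] by (simp add: sum_divide_distrib)
 finally show ?thesis .
qed

lemma total_rate_stirring:
 assumes d: "1 <= d" and n: "3 <= n" and g: "g \<in> torus_perms d n"
 shows "total_rate (count_space (torus_perms d n)) (stirring_rates d n) g = 1"
proof -
 have s: "space (stirring_rates d n g) = torus_perms d n" by (simp add: stirring_rates_def)
 have "measure (stirring_rates d n g) (torus_perms d n) = (\<integral>t. 1 \<partial>stirring_rates d n g)"
  using s by simp
 also have "... = 1" unfolding stirring_rates_integral[OF n g] using d n card_torus_edges[OF n, of d] by simp
 finally show ?thesis by (simp add: total_rate_def)
qed

section \<open>Cycle partitions along random transpositions\<close>

text \<open>A conjugating permutation maps cycles onto cycles of the same length.\<close>

lemma cycle_masses_conjugate:
 assumes V: "finite V" "V ~= {}" and \<sigma>: "\<sigma> permutes V" and \<sigma>': "\<sigma>' permutes V" and \<pi>: "\<pi> permutes V"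
  and eq: "!!x. \<sigma>' (\<pi> x) = \<pi> (\<sigma> x)"
 shows "cycle_masses V \<sigma>' = cycle_masses V \<sigma>"
proof -
 interpret s: finite_perm V \<sigma> using V \<sigma> by unfold_locales
 interpret s': finite_perm V \<sigma>' using V \<sigma>' by unfold_locales
 have inj: "inj \<pi>" using \<pi> by (rule permutes_inj)
 have orb: "orbit \<sigma>' (\<pi> a) = \<pi> ` orbit \<sigma> a" for a
  by (rule orbit_inverse[symmetric, OF s.self_in_orbit]) (rule eq)
 have "orbits \<sigma>' V = (%a. orbit \<sigma>' (\<pi> a)) ` V"
  unfolding orbits_def using permutes_image[OF \<pi>] by (metis image_image)
 also have "... = (`) \<pi> ` orbits \<sigma> V" by (simp add: orb orbits_def image_image)
 finally have im: "orbits \<sigma>' V = (`) \<pi> ` orbits \<sigma> V" .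
 have c: "card (\<pi> ` C) = card C" for C using inj by (simp add: card_image inj_on_subset)
 have "rearranged (orbits \<sigma> V) (%C. real (card C) / real (card V)) = rearranged (orbits \<sigma>' V) (%C. real (card C) / real (card V))"
 proof (rule rearranged_reindex[OF s'.mass_family_orbits[OF V(2)], where \<pi> = "(`) \<pi>"])
  have "inj_on ((`) \<pi>) {C \<in> orbits \<sigma> V. 0 < real (card C) / real (card V)}"
   using inj by (auto simp: inj_on_def inj_image_eq_iff)
  moreover have "(`) \<pi> ` {C \<in> orbits \<sigma> V. 0 < real (card C) / real (card V)} = {C \<in> orbits \<sigma>' V. 0 < real (card C) / real (card V)}"
   unfolding im by (auto simp: c)
  ultimately show "bij_betw ((`) \<pi>) {C \<in> orbits \<sigma> V. 0 < real (card C) / real (card V)} {C \<in> orbits \<sigma>' V. 0 < real (card C) / real (card V)}"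
   by (simp add: bij_betw_def)
 qed (simp add: c)
 then show ?thesis by (simp add: cycle_masses_def)
qed

lemma mean_close_of_good:
 fixes g :: "'i => real"
 assumes A: "finite A" "A ~= {}" and good: "!!a. a \<in> A ==> a \<notin> X ==> g a = c"
  and bnd: "!!a. a \<in> A ==> \<bar>g a\<bar> <= B" "\<bar>c\<bar> <= B" and X: "real (card (A \<inter> X)) <= r * real (card A)"
 shows "\<bar>(\<Sum>a\<in>A. g a) / real (card A) - c\<bar> <= 2 * B * r"
proof -
 have cA: "0 < real (card A)" using A by (simp add: card_gt_0_iff)
 have "(\<Sum>a\<in>A. g a) / real (card A) - c = (\<Sum>a\<in>A. g a - c) / real (card A)"
  using cA by (simp add: sum_subtractf field_simps)
 also have "\<bar>...\<bar> = \<bar>\<Sum>a\<in>A. g a - c\<bar> / real (card A)" by simp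
 also have "\<bar>\<Sum>a\<in>A. g a - c\<bar> <= (\<Sum>a\<in>A. if a \<in> X then 2 * B else 0)"
 proof (intro order_trans[OF sum_abs] sum_mono)
  fix a assume "a \<in> A"
  then show "\<bar>g a - c\<bar> <= (if a \<in> X then 2 * B else 0)" using good[of a] bnd(1)[of a] bnd(2) by auto
 qed
 also have "... = 2 * B * real (card (A \<inter> X))" using A by (simp add: sum.If_cases)
 also have "... <= 2 * B * (r * real (card A))" using X bnd(2) by (intro mult_left_mono) auto
 finally show ?thesis using cA by (simp add: divide_right_mono field_simps)
qed

text \<open>Bounded Lipschitz functions of the states 0 to \<open>k\<close>. Integrating out the
  last state against the split-and-merge kernel leads back to this class, which is what an induction
  on \<open>k\<close> requires.\<close>

definition traj_test :: "nat => ((nat => mass_partition) => real) => real => real => bool" where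
 "traj_test k h B L \<longleftrightarrow> 0 <= L & (\<forall>y. \<bar>h y\<bar> <= B) & (\<forall>y y'. \<bar>h y - h y'\<bar> <= L * (\<Sum>i\<le>k. dist (y i) (y' i)))"

lemma traj_test_section:
 assumes "traj_test (Suc k) h B L"
 shows "lipschitz_test (%z. h (extend_traj k y z)) B L"
proof
 fix p q
 have "\<bar>h (extend_traj k y p) - h (extend_traj k y q)\<bar> <= L * (\<Sum>i\<le>Suc k. dist (extend_traj k y p i) (extend_traj k y q i))"
  using assms by (simp add: traj_test_def)
 also have "(\<Sum>i\<le>Suc k. dist (extend_traj k y p i) (extend_traj k y q i)) = dist p q"
  by (simp add: extend_traj_def)
 finally show "\<bar>h (extend_traj k y p) - h (extend_traj k y q)\<bar> <= L * dist p q" .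
qed (use assms in \<open>auto simp: traj_test_def\<close>)

text \<open>At total rate 1, a function plus its generator is its mean after one jump. The formula
  uses the generator rather than a kernel, so that it can also be evaluated along stirred
  permutations.\<close>

definition split_merge_step :: "nat => ((nat => mass_partition) => real) => (nat => mass_partition) => real" where
 "split_merge_step k h y = h (extend_traj k y (y k)) + split_merge_generator (%z. h (extend_traj k y z)) (y k)"

text \<open>What enters from the torus: degrees at most \<open>2 * D\<close> and \<open>D\<close>
  edges per vertex. The edges that meet a bounded number of vertices are then a fraction of order
  \<open>1 / card V\<close>.\<close>

locale edge_walk =
 fixes V :: "'v set" and E :: "'v set set" and D :: nat
 assumes finV: "finite V" and neV: "V ~= {}" and D_pos: "0 < D"
  and edges: "b \<in> E ==> \<exists>x y. b = {x, y} & x ~= y & x \<in> V & y \<in> V"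
  and degree: "card {b\<in>E. v \<in> b} <= 2 * D" and card_E: "card E = D * card V"
begin

lemma card_E_pos: "0 < card E"
 using card_E D_pos finV neV by (simp add: card_gt_0_iff)

lemma finE: "finite E" and neE: "E ~= {}"
 using card_E_pos by (simp_all add: card_gt_0_iff)

lemma cV_pos: "0 < real (card V)"
 using finV neV by (simp add: card_gt_0_iff)

text \<open>The most recent edge stands at the head of the list; beyond the length of the list the
  walk stays constant.\<close>

primrec walk :: "'v set list => nat => 'v => 'v" where
 "walk [] = (%_. id)"
| "walk (b # bs) = extend_traj (length bs) (walk bs) (edge_transposition b \<circ> walk bs (length bs))"

definition masses_along :: "'v set list => ('v => 'v) => nat => mass_partition" where
 "masses_along bs \<sigma> = (%i. cycle_masses V (walk bs i \<circ> \<sigma>))"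

lemma masses_along_Cons:
 "masses_along (b # bs) s = extend_traj (length bs) (masses_along bs s) (cycle_masses V (edge_transposition b \<circ> (walk bs (length bs) \<circ> s)))"
 by (auto simp: masses_along_def extend_traj_def comp_assoc)

text \<open>The walk moves only end points of edges used so far; a relabelling that fixes these
  vertices commutes with it.\<close>

lemma walk_permutes:
 assumes "set bs \<subseteq> E"
 shows "walk bs i permutes \<Union> (set bs)"
 using assms
proof (induction bs arbitrary: i)
 case (Cons b bs)
 obtain x y where b: "b = {x, y}" using edges[of b] Cons.prems by auto
 have 1: "edge_transposition b permutes \<Union> (set (b # bs))"
  unfolding b edge_transposition_doubleton by (rule permutes_swap_id) auto
 have 2: "walk bs i permutes \<Union> (set (b # bs))" for i
  by (rule permutes_subset[OF Cons.IH]) (use Cons.prems in auto)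
 show ?case using permutes_compose[OF 2 1] 2 by (auto simp: extend_traj_def)
qed (simp add: permutes_id)

lemma support_subset: "set bs \<subseteq> E ==> \<Union> (set bs) \<subseteq> V"
 using edges by fastforce

lemma card_support_le: "set bs \<subseteq> E ==> card (\<Union> (set bs)) <= 2 * length bs"
proof (induction bs)
 case (Cons b bs)
 obtain x y where b: "b = {x, y}" using edges[of b] Cons.prems by auto
 have "card (\<Union> (set (b # bs))) <= card b + card (\<Union> (set bs))" by (simp add: card_Un_le)
 also have "card b <= 2" unfolding b by (simp add: card_insert_if)
 finally show ?case using Cons by simp
qed simp

text \<open>\<open>\<tau>\<close> stands for the next transposition, be it along an edge or of an
  arbitrary pair, while the past \<open>bs\<close> is kept fixed.\<close>

definition pair_sum :: "((nat => mass_partition) => real) => 'v set list => ('v => 'v) => real" where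
 "pair_sum h bs \<tau> = (\<Sum>\<sigma> | \<sigma> permutes V. h (extend_traj (length bs) (masses_along bs \<sigma>) (cycle_masses V (\<tau> \<circ> (walk bs (length bs) \<circ> \<sigma>)))))"

text \<open>
 The uniform law on permutations is conjugation invariant, so relabelling the vertices away from
 the edges used so far does not change the mean: all fresh pairs are alike.
\<close>

lemma pair_sum_fresh:
 assumes bs: "set bs \<subseteq> E" and x: "x \<in> V - \<Union> (set bs)" "y \<in> V - \<Union> (set bs)" "x ~= y"
  and x': "x' \<in> V - \<Union> (set bs)" "y' \<in> V - \<Union> (set bs)" "x' ~= y'"
 shows "pair_sum h bs (swp x y) = pair_sum h bs (swp x' y')"
proof -
 let ?U = "\<Union> (set bs)"
 \<comment> \<open>\<open>z\<close> is the place to which the exchange of \<open>x\<close> and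
   \<open>x'\<close> moves \<open>y\<close>; a second exchange brings it to \<open>y'\<close>
   without disturbing \<open>x'\<close>.\<close>
 define z where "z = swp x x' y"
 define \<pi> where "\<pi> = swp z y' \<circ> swp x x'"
 have z: "z \<in> V - ?U" "z ~= x'" using x x' by (auto simp: z_def Transposition.transpose_def)
 have \<pi>: "\<pi> permutes V" unfolding \<pi>_def using z x x' by (intro permutes_compose permutes_swap_id) auto
 have \<pi>x: "\<pi> x = x'" using z x' by (simp add: \<pi>_def)
 have \<pi>y: "\<pi> y = y'" by (simp add: \<pi>_def z_def[symmetric])
 have fixU: "\<pi> u = u" if "u \<in> ?U" for u
 proof -
  have "u ~= x" "u ~= x'" "u ~= z" "u ~= y'" using that x x' z by auto
  then show ?thesis by (simp add: \<pi>_def)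
 qed
 have inj: "inj \<pi>" using \<pi> by (rule permutes_inj)
 have comm: "\<pi> (walk bs i u) = walk bs i (\<pi> u)" for i u
 proof (cases "u \<in> ?U")
  case True
  then show ?thesis using fixU permutes_in_image[OF walk_permutes[OF bs]] by simp
 next
  case False
  then have "\<pi> u \<notin> ?U" using fixU inj by (metis injD)
  then show ?thesis using False permutes_not_in[OF walk_permutes[OF bs]] by simp
 qed
 have tr: "swp x' y' (\<pi> u) = \<pi> (swp x y u)" for u
  using inj_eq[OF inj, of u x] inj_eq[OF inj, of u y] \<pi>x \<pi>y by (auto simp: Transposition.transpose_def)
 have walkV: "walk bs i permutes V" for i by (rule permutes_subset[OF walk_permutes[OF bs] support_subset[OF bs]])
 have inv: "\<pi> (inv \<pi> u) = u" "inv \<pi> (\<pi> u) = u" for u using permutes_inverses[OF \<pi>] by auto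
 let ?c = "%s. inv \<pi> \<circ> s \<circ> \<pi>"
 have cp: "?c s permutes V" if "s permutes V" for s
  by (intro permutes_compose \<pi> that permutes_inv)
 \<comment> \<open>Conjugating the initial permutation preserves the whole past, not merely the last
   state; this is where the walk must commute with \<open>\<pi>\<close>.\<close>
 have eq1: "masses_along bs (?c s) = masses_along bs s" if "s permutes V" for s
  unfolding masses_along_def
 proof (rule ext, rule cycle_masses_conjugate[OF finV neV _ _ \<pi>, symmetric])
  fix i u
  show "walk bs i \<circ> ?c s permutes V" "walk bs i \<circ> s permutes V"
   by (intro permutes_compose walkV cp that)+
  show "(walk bs i \<circ> s) (\<pi> u) = \<pi> ((walk bs i \<circ> ?c s) u)" by (simp add: comm inv)
 qed
 have eq2: "cycle_masses V (swp x y \<circ> (walk bs i \<circ> ?c s)) = cycle_masses V (swp x' y' \<circ> (walk bs i \<circ> s))"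
  if "s permutes V" for i s
 proof (rule cycle_masses_conjugate[OF finV neV _ _ \<pi>, symmetric])
  show "swp x y \<circ> (walk bs i \<circ> ?c s) permutes V" "swp x' y' \<circ> (walk bs i \<circ> s) permutes V"
   using x x' by (auto intro!: permutes_compose walkV cp that permutes_swap_id)
  show "(swp x' y' \<circ> (walk bs i \<circ> s)) (\<pi> u) = \<pi> ((swp x y \<circ> (walk bs i \<circ> ?c s)) u)" for u
   by (simp add: comm inv tr[symmetric])
 qed
 show ?thesis unfolding pair_sum_def
 proof (rule sum.reindex_bij_witness[where i = ?c and j = "%s. \<pi> \<circ> s \<circ> inv \<pi>"])
  fix s assume "s \<in> {s. s permutes V}"
  then have s: "s permutes V" by simp
  show p: "\<pi> \<circ> s \<circ> inv \<pi> \<in> {s. s permutes V}" using s by (simp add: permutes_compose permutes_inv \<pi>)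
  show c: "?c (\<pi> \<circ> s \<circ> inv \<pi>) = s" by (simp add: fun_eq_iff inv)
  show "?c s \<in> {s. s permutes V}" using cp[OF s] by simp
  show "\<pi> \<circ> ?c s \<circ> inv \<pi> = s" by (simp add: fun_eq_iff inv)
  have p': "\<pi> \<circ> s \<circ> inv \<pi> permutes V" using p by simp
  show "h (extend_traj (length bs) (masses_along bs (\<pi> \<circ> s \<circ> inv \<pi>)) (cycle_masses V (swp x' y' \<circ> (walk bs (length bs) \<circ> (\<pi> \<circ> s \<circ> inv \<pi>)))))
    = h (extend_traj (length bs) (masses_along bs s) (cycle_masses V (swp x y \<circ> (walk bs (length bs) \<circ> s))))"
   using eq1[OF p'] eq2[OF p'] unfolding c by simp
 qed
qed

lemma card_perms: "card {s. s permutes V} = fact (card V)"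
 by (rule card_permutations[OF refl finV])

text \<open>Both means are compared with the common value \<open>c\<close> at fresh pairs. After
  \<open>k\<close> steps at most \<open>2 * k\<close> vertices are touched, so the exceptional
  fraction is at most \<open>4 * k / card V\<close> among edges and
  \<open>(1 + 4 * k) / card V\<close> among ordered pairs, the 1 being due to the diagonal.\<close>

lemma edge_mean_close_pair_mean:
 assumes bs: "set bs \<subseteq> E" and h: "!!y. \<bar>h y\<bar> <= B"
 shows "\<bar>(\<Sum>b\<in>E. pair_sum h bs (edge_transposition b)) / real (card E)
   - (\<Sum>x\<in>V. \<Sum>y\<in>V. pair_sum h bs (swp x y)) / (real (card V))\<^sup>2\<bar>
  <= fact (card V) * B * (16 * real (length bs) + 2) / real (card V)"
proof -
 let ?U = "\<Union> (set bs)" and ?n = "real (card V)" and ?B = "fact (card V) * B"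
 have U: "finite ?U" "card ?U <= 2 * length bs" "?U \<subseteq> V"
  using finite_subset[OF support_subset[OF bs] finV] card_support_le[OF bs] support_subset[OF bs] by auto
 have bnd: "\<bar>pair_sum h bs t\<bar> <= ?B" for t
 proof -
  have "\<bar>pair_sum h bs t\<bar> <= (\<Sum>s | s permutes V. B)"
   unfolding pair_sum_def by (intro order_trans[OF sum_abs] sum_mono h)
  then show ?thesis by (simp add: card_perms)
 qed
 have "\<exists>c. \<bar>c\<bar> <= ?B & (\<forall>x y. x \<in> V - ?U --> y \<in> V - ?U --> x ~= y --> pair_sum h bs (swp x y) = c)"
 proof (cases "\<exists>x y. x \<in> V - ?U & y \<in> V - ?U & x ~= y")
  case True
  then obtain x y where xy: "x \<in> V - ?U" "y \<in> V - ?U" "x ~= y" by blast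
  have "pair_sum h bs (swp x' y') = pair_sum h bs (swp x y)"
   if "x' \<in> V - ?U" "y' \<in> V - ?U" "x' ~= y'" for x' y' by (rule pair_sum_fresh[OF bs that xy])
  then show ?thesis
   by (intro exI[of _ "pair_sum h bs (swp x y)"] conjI bnd allI impI)
 next
  \<comment> \<open>Without two fresh vertices the condition on \<open>c\<close> is void, and any
    value within the bound will do.\<close>
  case False
  have "\<bar>pair_sum h bs id\<bar> <= ?B" by (rule bnd)
  then show ?thesis using False by (intro exI[of _ "pair_sum h bs id"] conjI allI impI) auto
 qed
 then obtain c where c0: "\<bar>c\<bar> <= ?B & (\<forall>x y. x \<in> V - ?U --> y \<in> V - ?U --> x ~= y --> pair_sum h bs (swp x y) = c)"
  by (elim exE)
 then have c: "\<bar>c\<bar> <= ?B" "!!x y. x \<in> V - ?U ==> y \<in> V - ?U ==> x ~= y ==> pair_sum h bs (swp x y) = c"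
  by simp_all
 have 1: "\<bar>(\<Sum>b\<in>E. pair_sum h bs (edge_transposition b)) / real (card E) - c\<bar> <= 2 * ?B * (4 * real (length bs) / ?n)"
 proof (rule mean_close_of_good[OF finE neE])
  fix b assume b: "b \<in> E" "b \<notin> {b. b \<inter> ?U ~= {}}"
  obtain x y where xy: "b = {x, y}" "x ~= y" "x \<in> V" "y \<in> V" using edges[OF b(1)] by blast
  then show "pair_sum h bs (edge_transposition b) = c"
   using b(2) by (simp add: edge_transposition_doubleton) (intro c(2); auto)
 next
  have "E \<inter> {b. b \<inter> ?U ~= {}} \<subseteq> (\<Union>u\<in>?U. {b\<in>E. u \<in> b})" by auto
  then have "card (E \<inter> {b. b \<inter> ?U ~= {}}) <= card (\<Union>u\<in>?U. {b\<in>E. u \<in> b})"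
   by (intro card_mono finite_subset[OF _ finE]) auto
  also have "... <= (\<Sum>u\<in>?U. card {b\<in>E. u \<in> b})" by (rule card_UN_le[OF U(1)])
  also have "... <= (\<Sum>u\<in>?U. 2 * D)" by (intro sum_mono degree)
  also have "... = card ?U * (2 * D)" by simp
  also have "... <= 2 * length bs * (2 * D)" using U(2) by (intro mult_right_mono) auto
  finally have "real (card (E \<inter> {b. b \<inter> ?U ~= {}})) <= real (2 * length bs * (2 * D))" by (simp only: of_nat_le_iff)
  also have "... = 4 * real (length bs) / ?n * real (card E)" using cV_pos by (simp add: card_E)
  finally show "real (card (E \<inter> {b. b \<inter> ?U ~= {}})) <= 4 * real (length bs) / ?n * real (card E)" .
 qed (use bnd c(1) in auto)
 have "\<bar>(\<Sum>p\<in>V \<times> V. pair_sum h bs (swp (fst p) (snd p))) / real (card (V \<times> V)) - c\<bar> <= 2 * ?B * ((1 + 4 * real (length bs)) / ?n)"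
 proof (rule mean_close_of_good)
  fix p assume p: "p \<in> V \<times> V" "p \<notin> {p. fst p = snd p | fst p \<in> ?U | snd p \<in> ?U}"
  then show "pair_sum h bs (swp (fst p) (snd p)) = c" by (intro c(2)) auto
 next
  have "V \<times> V \<inter> {p. fst p = snd p | fst p \<in> ?U | snd p \<in> ?U} \<subseteq> (%x. (x, x)) ` V \<union> (?U \<times> V \<union> V \<times> ?U)" by auto
  then have "card (V \<times> V \<inter> {p. fst p = snd p | fst p \<in> ?U | snd p \<in> ?U}) <= card ((%x. (x, x)) ` V \<union> (?U \<times> V \<union> V \<times> ?U))"
   using U finV by (intro card_mono) auto
  also have "... <= card ((%x. (x, x)) ` V) + (card (?U \<times> V) + card (V \<times> ?U))"
   using card_Un_le[of "(%x. (x, x)) ` V" "?U \<times> V \<union> V \<times> ?U"] card_Un_le[of "?U \<times> V" "V \<times> ?U"] by linarith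
  also have "... <= card V + (card ?U * card V + card V * card ?U)"
   using finV by (simp add: card_cartesian_product card_image_le)
  also have "... <= card V + (2 * length bs * card V + card V * (2 * length bs))"
   using U(2) by (intro add_mono mult_mono) auto
  finally have "real (card (V \<times> V \<inter> {p. fst p = snd p | fst p \<in> ?U | snd p \<in> ?U})) <= real (card V + (2 * length bs * card V + card V * (2 * length bs)))"
   by (simp only: of_nat_le_iff)
  also have "... = (1 + 4 * real (length bs)) / ?n * real (card (V \<times> V))"
   using cV_pos by (simp add: card_cartesian_product distrib_left distrib_right add_divide_distrib mult_ac)
  finally show "real (card (V \<times> V \<inter> {p. fst p = snd p | fst p \<in> ?U | snd p \<in> ?U})) <= (1 + 4 * real (length bs)) / ?n * real (card (V \<times> V))" .
 qed (use bnd c(1) finV neV in auto)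
 moreover have "(\<Sum>p\<in>V \<times> V. pair_sum h bs (swp (fst p) (snd p))) / real (card (V \<times> V))
   = (\<Sum>x\<in>V. \<Sum>y\<in>V. pair_sum h bs (swp x y)) / ?n\<^sup>2"
  by (simp add: sum.cartesian_product card_cartesian_product power2_eq_square case_prod_unfold)
 ultimately have 2: "\<bar>(\<Sum>x\<in>V. \<Sum>y\<in>V. pair_sum h bs (swp x y)) / ?n\<^sup>2 - c\<bar> <= 2 * ?B * ((1 + 4 * real (length bs)) / ?n)" by simp
 have "2 * ?B * (4 * real (length bs) / ?n) + 2 * ?B * ((1 + 4 * real (length bs)) / ?n) = ?B * (16 * real (length bs) + 2) / ?n"
  using cV_pos by (simp add: field_simps)
 then show ?thesis using 1 2 by linarith
qed

text \<open>The passage from edges to pairs holds after summation over the initial permutation, the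
  one from pairs to the generator for each permutation separately.\<close>

lemma edge_step_close:
 assumes bs: "set bs \<subseteq> E" and h: "traj_test (Suc (length bs)) h B L"
 shows "\<bar>(\<Sum>b\<in>E. \<Sum>s | s permutes V. h (masses_along (b # bs) s)) / real (card E)
   - (\<Sum>s | s permutes V. split_merge_step (length bs) h (masses_along bs s))\<bar>
  <= fact (card V) * (B * (16 * real (length bs) + 2) + 2 * L) / real (card V)"
proof -
 let ?u = "(\<Sum>x\<in>V. \<Sum>y\<in>V. pair_sum h bs (swp x y))"
 let ?n = "real (card V)" and ?k = "length bs"
 have a: "(\<Sum>s | s permutes V. h (masses_along (b # bs) s)) = pair_sum h bs (edge_transposition b)" for b
  by (simp only: pair_sum_def masses_along_Cons)
 have 1: "\<bar>(\<Sum>b\<in>E. pair_sum h bs (edge_transposition b)) / real (card E)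
   - ?u / ?n\<^sup>2\<bar> <= fact (card V) * B * (16 * real ?k + 2) / ?n"
  by (rule edge_mean_close_pair_mean[OF bs]) (use h in \<open>auto simp: traj_test_def\<close>)
 let ?f = "%s z. h (extend_traj ?k (masses_along bs s) z)"
 let ?g = "%s. (\<Sum>x\<in>V. \<Sum>y\<in>V. ?f s (cycle_masses V (swp x y \<circ> (walk bs ?k \<circ> s)))) / ?n\<^sup>2"
 have "?u
   = (\<Sum>x\<in>V. \<Sum>s | s permutes V. \<Sum>y\<in>V. ?f s (cycle_masses V (swp x y \<circ> (walk bs ?k \<circ> s))))"
  unfolding pair_sum_def by (intro sum.cong refl sum.swap)
 also have "... = (\<Sum>s | s permutes V. \<Sum>x\<in>V. \<Sum>y\<in>V. ?f s (cycle_masses V (swp x y \<circ> (walk bs ?k \<circ> s))))"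
  by (rule sum.swap)
 finally have "?u / ?n\<^sup>2 = (\<Sum>s | s permutes V. ?g s)"
  by (simp add: sum_divide_distrib)
 moreover have "\<bar>(\<Sum>s | s permutes V. ?g s) - (\<Sum>s | s permutes V. split_merge_step ?k h (masses_along bs s))\<bar> <= (\<Sum>s | s permutes V. 2 * L / ?n)"
  unfolding sum_subtractf[symmetric]
 proof (intro order_trans[OF sum_abs] sum_mono)
  fix s assume "s \<in> {s. s permutes V}"
  then have "walk bs ?k \<circ> s permutes V"
   using permutes_subset[OF walk_permutes[OF bs] support_subset[OF bs]] by (auto intro: permutes_compose)
  then interpret p: finite_perm V "walk bs ?k \<circ> s" using finV by unfold_locales
  from p.split_merge_generator_cycle_masses[OF neV traj_test_section[OF h, of "masses_along bs s"]]
  show "\<bar>?g s - split_merge_step ?k h (masses_along bs s)\<bar> <= 2 * L / ?n"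
   by (simp add: split_merge_step_def masses_along_def)
 qed
 moreover have "(\<Sum>s | s permutes V. 2 * L / ?n) = fact (card V) * (2 * L) / ?n" by (simp add: card_perms)
 moreover have "fact (card V) * B * (16 * real ?k + 2) / ?n + fact (card V) * (2 * L) / ?n = fact (card V) * (B * (16 * real ?k + 2) + 2 * L) / ?n"
  by (simp add: add_divide_distrib algebra_simps)
 ultimately show ?thesis using 1 unfolding a by linarith
qed

section \<open>Averages over edge sequences and initial permutations\<close>

definition edge_lists :: "nat => 'v set list set" where
 "edge_lists k = {bs. set bs \<subseteq> E & length bs = k}"

lemma card_edge_lists: "card (edge_lists k) = card E ^ k"
 unfolding edge_lists_def by (rule card_lists_length_eq[OF finE])

lemma sum_edge_lists_Suc: "(\<Sum>bs\<in>edge_lists (Suc k). F bs) = (\<Sum>bs\<in>edge_lists k. \<Sum>b\<in>E. F (b # bs))"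
proof -
 have "edge_lists (Suc k) = (%(bs, b). b # bs) ` (edge_lists k \<times> E)"
  unfolding edge_lists_def by (rule lists_length_Suc_eq)
 moreover have "inj_on (%(bs, b). b # bs) (edge_lists k \<times> E)" by (auto simp: inj_on_def)
 ultimately show ?thesis by (simp add: sum.reindex sum.cartesian_product case_prod_unfold)
qed

definition walk_mean :: "nat => ((nat => 'v => 'v) => real) => real" where
 "walk_mean k H = (\<Sum>bs\<in>edge_lists k. \<Sum>\<sigma> | \<sigma> permutes V. H (%i. walk bs i \<circ> \<sigma>)) / (real (card E) ^ k * fact (card V))"

lemma walk_mean_0: "walk_mean 0 H = (\<Sum>s | s permutes V. H (%_. s)) / fact (card V)"
proof -
 have "edge_lists 0 = {[]}" by (auto simp: edge_lists_def)
 then show ?thesis by (simp add: walk_mean_def)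
qed

lemma walk_mean_Suc:
 "walk_mean (Suc k) H = walk_mean k (%y. (\<Sum>b\<in>E. H (extend_traj k y (edge_transposition b \<circ> y k))) / real (card E))"
proof -
 have "(\<Sum>bs\<in>edge_lists (Suc k). \<Sum>s | s permutes V. H (%i. walk bs i \<circ> s))
   = (\<Sum>bs\<in>edge_lists k. \<Sum>b\<in>E. \<Sum>s | s permutes V. H (extend_traj k (%i. walk bs i \<circ> s) (edge_transposition b \<circ> (walk bs k \<circ> s))))"
  unfolding sum_edge_lists_Suc
 proof (intro sum.cong refl)
  fix bs b s assume "bs \<in> edge_lists k"
  then have "length bs = k" by (simp add: edge_lists_def)
  then show "H (%i. walk (b # bs) i \<circ> s) = H (extend_traj k (%i. walk bs i \<circ> s) (edge_transposition b \<circ> (walk bs k \<circ> s)))"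
   by (intro arg_cong[where f = H]) (auto simp: extend_traj_def fun_eq_iff)
 qed
 also have "... = (\<Sum>bs\<in>edge_lists k. \<Sum>s | s permutes V. \<Sum>b\<in>E. H (extend_traj k (%i. walk bs i \<circ> s) (edge_transposition b \<circ> (walk bs k \<circ> s))))"
  by (intro sum.cong refl sum.swap)
 finally show ?thesis
  by (simp add: walk_mean_def sum_divide_distrib[symmetric] mult_ac)
qed

lemma walk_mean_step_close:
 assumes h: "traj_test (Suc k) h B L"
 shows "\<bar>walk_mean (Suc k) (%y. h (%i. cycle_masses V (y i))) - walk_mean k (%y. split_merge_step k h (%i. cycle_masses V (y i)))\<bar>
  <= (B * (16 * real k + 2) + 2 * L) / real (card V)"
proof -
 let ?e = "real (card E)" and ?f = "fact (card V) :: real" and ?C = "(B * (16 * real k + 2) + 2 * L) / real (card V)"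
 have e: "0 < ?e" using finE neE by (simp add: card_gt_0_iff)
 have m: "(%i. cycle_masses V (walk bs i \<circ> s)) = masses_along bs s" for bs s by (simp add: masses_along_def)
 have "walk_mean (Suc k) (%y. h (%i. cycle_masses V (y i)))
   = (\<Sum>bs\<in>edge_lists k. (\<Sum>b\<in>E. \<Sum>s | s permutes V. h (masses_along (b # bs) s)) / ?e) / (?e ^ k * ?f)"
  unfolding walk_mean_def m sum_edge_lists_Suc by (simp add: sum_divide_distrib[symmetric] mult_ac)
 then have "walk_mean (Suc k) (%y. h (%i. cycle_masses V (y i))) - walk_mean k (%y. split_merge_step k h (%i. cycle_masses V (y i)))
   = (\<Sum>bs\<in>edge_lists k. (\<Sum>b\<in>E. \<Sum>s | s permutes V. h (masses_along (b # bs) s)) / ?e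
     - (\<Sum>s | s permutes V. split_merge_step k h (masses_along bs s))) / (?e ^ k * ?f)"
  unfolding walk_mean_def m by (simp only: diff_divide_distrib sum_subtractf)
 also have "\<bar>...\<bar> = \<bar>\<Sum>bs\<in>edge_lists k. (\<Sum>b\<in>E. \<Sum>s | s permutes V. h (masses_along (b # bs) s)) / ?e
     - (\<Sum>s | s permutes V. split_merge_step k h (masses_along bs s))\<bar> / (?e ^ k * ?f)"
  using e by (simp add: abs_mult)
 also have "... <= (\<Sum>bs\<in>edge_lists k. ?f * ?C) / (?e ^ k * ?f)"
 proof (intro divide_right_mono order_trans[OF sum_abs] sum_mono)
  fix bs assume "bs \<in> edge_lists k"
  then have bs: "set bs \<subseteq> E" "length bs = k" by (auto simp: edge_lists_def)
  show "\<bar>(\<Sum>b\<in>E. \<Sum>s | s permutes V. h (masses_along (b # bs) s)) / ?e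
     - (\<Sum>s | s permutes V. split_merge_step k h (masses_along bs s))\<bar> <= ?f * ?C"
   using edge_step_close[OF bs(1), of h B L] h bs(2) by simp
 qed simp
 also have "... = ?C" using e by (simp add: card_edge_lists)
 finally show ?thesis .
qed

end

lemma edge_walk_torus:
 assumes "1 <= d" "3 <= n"
 shows "edge_walk (torus d n) (torus_edges d n) d"
proof
 have "0 < card (torus d n)" using assms by (simp add: card_torus)
 then show "torus d n ~= {}" by auto
 show "\<exists>x y. b = {x, y} & x ~= y & x \<in> torus d n & y \<in> torus d n" if "b \<in> torus_edges d n" for b
  by (rule torus_edgesE[OF that]) (use assms in auto)
qed (use assms in \<open>auto simp: finite_torus card_incident_edges_le card_torus_edges card_torus\<close>)

section \<open>Jump paths in the Skorohod space\<close>

definition arrival :: "(nat => real) => nat => real" where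
 "arrival w n = (\<Sum>k<n. w k)"

definition jump_index :: "(nat => real) => real => nat" where
 "jump_index w t = (LEAST n. t < arrival w (Suc n))"

definition jump_path :: "real => (nat => 'a) => (nat => real) => real => 'a" where
 "jump_path T y w = (\<lambda>t\<in>{0..T}. y (jump_index w t))"

definition holding_times :: "(nat => real) => bool" where
 "holding_times w \<longleftrightarrow> (\<forall>k. 0 < w k) & (\<forall>t. \<exists>n. t < arrival w n)"

lemma arrival_0 [simp]: "arrival w 0 = 0"
 and arrival_Suc: "arrival w (Suc n) = arrival w n + w n"
 by (simp_all add: arrival_def)

lemma arrival_mono:
 assumes "!!k. k < n ==> 0 <= w k" "m <= n"
 shows "arrival w m <= arrival w n"
 unfolding arrival_def using assms by (intro sum_mono2) auto

lemma arrival_cong: "(!!k. k < n ==> v k = w k) ==> arrival v n = arrival w n"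
 by (simp add: arrival_def)

lemma jump_index_bounds:
 assumes w: "holding_times w" and t: "0 <= t"
 shows "arrival w (jump_index w t) <= t" "t < arrival w (Suc (jump_index w t))"
proof -
 obtain n where n: "t < arrival w n" using w by (auto simp: holding_times_def)
 then obtain n' where "n = Suc n'" using t by (cases n) auto
 then have ex: "\<exists>n. t < arrival w (Suc n)" using n by blast
 show "t < arrival w (Suc (jump_index w t))" unfolding jump_index_def using ex by (rule LeastI_ex)
 show "arrival w (jump_index w t) <= t"
 proof (cases "jump_index w t")
  case (Suc j)
  then have "\<not> t < arrival w (Suc j)" unfolding jump_index_def by (intro not_less_Least) simp
  then show ?thesis using Suc by simp
 qed (simp add: t)
qed

lemma jump_index_eqI:
 assumes w: "holding_times w" and n: "arrival w n <= t" "t < arrival w (Suc n)"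
 shows "jump_index w t = n"
 unfolding jump_index_def
proof (rule Least_equality, rule n(2))
 fix m assume m: "t < arrival w (Suc m)"
 show "n <= m"
 proof (rule ccontr)
  assume "\<not> n <= m"
  then have "arrival w (Suc m) <= arrival w n"
   using w by (intro arrival_mono) (auto simp: holding_times_def less_imp_le)
  then show False using n m by simp
 qed
qed

lemma jump_path_cadlag:
 fixes y :: "nat => 'a::metric_space"
 assumes w: "holding_times w"
 shows "jump_path T y w \<in> cadlag_paths T"
 unfolding cadlag_paths_def
proof (intro CollectI conjI ballI)
 show "jump_path T y w \<in> extensional {0..T}" by (simp add: jump_path_def)
next
 fix t assume t: "t \<in> {0..<T}"
 let ?n = "jump_index w t"
 have b: "arrival w ?n <= t" "t < arrival w (Suc ?n)" using jump_index_bounds[OF w, of t] t by auto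
 show "(jump_path T y w \<longlongrightarrow> jump_path T y w t) (at_right t)"
 proof (rule tendsto_eventually)
  have "jump_path T y w s = jump_path T y w t" if s: "t < s" "s < min T (arrival w (Suc ?n))" for s
  proof -
   have "jump_index w s = ?n" using s b by (intro jump_index_eqI[OF w]) auto
   then show ?thesis using s t by (simp add: jump_path_def)
  qed
  moreover have "t < min T (arrival w (Suc ?n))" using t b by simp
  ultimately show "\<forall>\<^sub>F s in at_right t. jump_path T y w s = jump_path T y w t"
   unfolding eventually_at_right_field by blast
 qed
next
 fix t assume t: "t \<in> {0<..T}"
 define n where "n = (LEAST n. t <= arrival w (Suc n))"
 have ex: "\<exists>n. t <= arrival w (Suc n)"
  using jump_index_bounds(2)[OF w, of t] t by (intro exI[of _ "jump_index w t"]) simp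
 have n2: "t <= arrival w (Suc n)" unfolding n_def using ex by (rule LeastI_ex)
 have n1: "arrival w n < t"
 proof (cases n)
  case (Suc j)
  then have "\<not> t <= arrival w (Suc j)" unfolding n_def by (intro not_less_Least) simp
  then show ?thesis using Suc by simp
 qed (use t in simp)
 have "(jump_path T y w \<longlongrightarrow> y n) (at_left t)"
 proof (rule tendsto_eventually)
  have "jump_path T y w s = y n" if s: "max 0 (arrival w n) < s" "s < t" for s
  proof -
   have "jump_index w s = n" using s n2 by (intro jump_index_eqI[OF w]) auto
   then show ?thesis using s t by (simp add: jump_path_def)
  qed
  moreover have "max 0 (arrival w n) < t" using t n1 by simp
  ultimately show "\<forall>\<^sub>F s in at_left t. jump_path T y w s = y n"
   unfolding eventually_at_left_field by blast
 qed
 then show "\<exists>l. (jump_path T y w \<longlongrightarrow> l) (at_left t)" by blast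
qed

text \<open>
 The piecewise linear time change that maps the successive intervals of lengths \<open>v i\<close> onto those
 of lengths \<open>v' i\<close>.
\<close>

definition interval_change :: "(nat => real) => (nat => real) => nat => real => real" where
 "interval_change v v' m t = (\<Sum>i<m. v' i * max 0 (min 1 ((t - arrival v i) / v i)))"

text \<open>On interval \<open>j\<close> the summands before \<open>j\<close> are saturated and
  those after \<open>j\<close> are still 0.\<close>

lemma interval_change_piece:
 assumes v: "!!i. i < m ==> 0 < v i" and j: "j < m" and t: "arrival v j <= t" "t <= arrival v (Suc j)"
 shows "interval_change v v' m t = arrival v' j + v' j * ((t - arrival v j) / v j)"
proof -
 let ?c = "%i. max 0 (min 1 ((t - arrival v i) / v i))"
 have c1: "?c i = 1" if "i < j" for i
 proof -
  have "arrival v (Suc i) <= arrival v j" using that j v by (intro arrival_mono) (auto intro: less_imp_le)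
  then have "v i <= t - arrival v i" using t by (simp add: arrival_Suc)
  then show ?thesis using v[of i] that j by simp
 qed
 have c0: "?c i = 0" if "j < i" "i < m" for i
 proof -
  have "arrival v (Suc j) <= arrival v i" using that v by (intro arrival_mono) (auto intro: less_imp_le)
  then have "(t - arrival v i) / v i <= 0" using t v[of i] that by (intro divide_nonpos_pos) auto
  then show ?thesis by simp
 qed
 have cj: "?c j = (t - arrival v j) / v j" using t v[OF j] by (simp add: arrival_Suc)
 have "interval_change v v' m t = (\<Sum>i\<in>{..<Suc j}. v' i * ?c i)"
  unfolding interval_change_def using j c0 by (intro sum.mono_neutral_right) auto
 also have "... = (\<Sum>i<j. v' i * ?c i) + v' j * ((t - arrival v j) / v j)" using cj by simp
 also have "(\<Sum>i<j. v' i * ?c i) = arrival v' j" unfolding arrival_def[of v'] using c1 by (intro sum.cong) auto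
 finally show ?thesis .
qed

lemma partition_index:
 assumes "0 <= t" "t < arrival v m"
 obtains j where "j < m" "arrival v j <= t" "t < arrival v (Suc j)"
proof -
 define j where "j = (LEAST j. t < arrival v j)"
 have j: "t < arrival v j" unfolding j_def using assms(2) by (rule LeastI)
 have "j <= m" unfolding j_def using assms(2) by (rule Least_le)
 obtain i where i: "j = Suc i" using j assms(1) by (cases j) auto
 have "\<not> t < arrival v i" using i unfolding j_def by (intro not_less_Least) simp
 then show thesis using that[of i] j i \<open>j <= m\<close> by simp
qed

lemma interval_change_id:
 assumes v: "!!i. i < m ==> 0 < v i" and t: "0 <= t" "t <= arrival v m"
 shows "interval_change v v m t = t"
proof (cases "t < arrival v m")
 case True
 obtain j where j: "j < m" "arrival v j <= t" "t < arrival v (Suc j)" by (rule partition_index[OF t(1) True])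
 then show ?thesis using interval_change_piece[where v = v and v' = v and m = m, OF v j(1,2)] v[OF j(1)] by simp
next
 case False
 then have tm: "t = arrival v m" using t by simp
 show ?thesis
 proof (cases m)
  case 0
  then show ?thesis using tm by (simp add: interval_change_def)
 next
  case (Suc j)
  then show ?thesis using interval_change_piece[where v = v and v' = v and m = m and j = j and t = t, OF v] v[of j] tm by (simp add: arrival_Suc less_imp_le)
 qed
qed

context
 fixes v v' :: "nat => real" and m :: nat and T :: real
 assumes v: "!!i. i < m ==> 0 < v i" and v': "!!i. i < m ==> 0 < v' i"
  and T: "arrival v m = T" "arrival v' m = T"
begin

lemma interval_change_end: "interval_change v v' m T = T"
proof (cases m)
 case 0
 then show ?thesis using T by (simp add: interval_change_def)
next
 case (Suc j)
 have "T - arrival v j = v j" using Suc T by (simp add: arrival_Suc)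
 then show ?thesis
  using interval_change_piece[where v = v and v' = v' and m = m and j = j and t = T, OF v] v[of j] T Suc
  by (simp add: arrival_Suc less_imp_le)
qed

lemma interval_change_deviation:
 assumes t: "t \<in> {0..T}"
 shows "\<bar>interval_change v v' m t - t\<bar> <= (\<Sum>i<m. \<bar>v' i - v i\<bar>)"
proof -
 have "interval_change v v' m t - t = interval_change v v' m t - interval_change v v m t"
  using interval_change_id[where v = v and m = m and t = t, OF v] t T by simp
 also have "... = (\<Sum>i<m. (v' i - v i) * max 0 (min 1 ((t - arrival v i) / v i)))"
  by (simp add: interval_change_def sum_subtractf left_diff_distrib)
 also have "\<bar>...\<bar> <= (\<Sum>i<m. \<bar>v' i - v i\<bar>)"
 proof (intro order_trans[OF sum_abs] sum_mono)
  fix i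
  have "\<bar>v' i - v i\<bar> * \<bar>max 0 (min 1 ((t - arrival v i) / v i))\<bar> <= \<bar>v' i - v i\<bar> * 1"
   by (intro mult_left_mono) auto
  then show "\<bar>(v' i - v i) * max 0 (min 1 ((t - arrival v i) / v i))\<bar> <= \<bar>v' i - v i\<bar>" by (simp add: abs_mult)
 qed
 finally show ?thesis .
qed

lemma interval_change_time_change: "interval_change v v' m \<in> time_changes T"
proof -
 let ?th = "interval_change v v' m"
 have T0: "0 <= T" unfolding T(1)[symmetric] arrival_def using v by (intro sum_nonneg) (auto intro: less_imp_le)
 have cont: "continuous_on {0..T} ?th"
  unfolding interval_change_def[abs_def] by (intro continuous_intros) (use v in force)
 have sm: "strict_mono_on {0..T} ?th"
 proof (rule strict_mono_onI)
  fix s t assume st: "s \<in> {0..T}" "t \<in> {0..T}" "s < t"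
  then obtain j where j: "j < m" "arrival v j <= s" "s < arrival v (Suc j)"
   using partition_index[of s v m] T by (metis atLeastAtMost_iff order_less_le_trans)
  show "?th s < ?th t"
   unfolding interval_change_def
  proof (rule sum_strict_mono_ex1)
   have cm: "max 0 (min 1 x) <= max 0 (min 1 y)" if "x <= y" for x y :: real using that by auto
   have "(s - arrival v i) / v i <= (t - arrival v i) / v i" if "i < m" for i
    using st v[OF that] by (intro divide_right_mono) auto
   then show "\<forall>i\<in>{..<m}. v' i * max 0 (min 1 ((s - arrival v i) / v i)) <= v' i * max 0 (min 1 ((t - arrival v i) / v i))"
    using v' by (intro ballI mult_left_mono cm) (auto intro: less_imp_le)
   have a: "0 <= (s - arrival v j) / v j" "(s - arrival v j) / v j < 1" "(s - arrival v j) / v j < (t - arrival v j) / v j"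
    using j v[OF j(1)] st by (auto simp: arrival_Suc divide_strict_right_mono)
   have "max 0 (min 1 ((s - arrival v j) / v j)) < max 0 (min 1 ((t - arrival v j) / v j))"
    using a by (auto simp: max_def min_def)
   then show "\<exists>i\<in>{..<m}. v' i * max 0 (min 1 ((s - arrival v i) / v i)) < v' i * max 0 (min 1 ((t - arrival v i) / v i))"
    using j(1) v'[OF j(1)] by (intro bexI[of _ j] mult_strict_left_mono) auto
  qed simp
 qed
 have 0: "?th 0 = 0"
 proof -
  have "max 0 (min 1 ((0 - arrival v i) / v i)) = 0" if "i < m" for i
  proof -
   have "0 <= arrival v i" unfolding arrival_def using v that by (intro sum_nonneg) (auto intro: less_imp_le)
   then have "(0 - arrival v i) / v i <= 0" using v[OF that] by (intro divide_nonpos_pos) auto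
   then show ?thesis by simp
  qed
  then show ?thesis by (simp add: interval_change_def)
 qed
 have "?th ` {0..T} = {0..T}"
 proof
  show "?th ` {0..T} \<subseteq> {0..T}"
  proof
   fix x assume "x \<in> ?th ` {0..T}"
   then obtain t where t: "t \<in> {0..T}" "x = ?th t" by blast
   have "?th 0 <= ?th t" "?th t <= ?th T"
    using t T0 strict_mono_on_leD[OF sm] by auto
   then show "x \<in> {0..T}" using t 0 interval_change_end by simp
  qed
  show "{0..T} \<subseteq> ?th ` {0..T}"
  proof
   fix x assume "x \<in> {0..T}"
   then have "\<exists>t\<ge>0. t <= T & ?th t = x"
    using 0 interval_change_end T0 cont by (intro IVT') auto
   then show "x \<in> ?th ` {0..T}" by auto
  qed
 qed
 then show ?thesis using cont sm by (simp add: time_changes_def)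
qed

text \<open>\<open>v\<close> and \<open>v'\<close> are the holding times, possibly with the last one
  cut at \<open>T\<close>. The time change matches the successive jumps, so at corresponding times
  both paths have made equally many jumps and only the states differ.\<close>

lemma skorohod_dist_jump_path_le:
 fixes y y' :: "nat => 'a::metric_space"
 assumes w: "holding_times w" and w': "holding_times w'"
  and vw: "!!j. j < m ==> arrival v j = arrival w j & arrival v (Suc j) <= arrival w (Suc j)"
  and vw': "!!j. j < m ==> arrival v' j = arrival w' j & arrival v' (Suc j) <= arrival w' (Suc j)"
  and n: "jump_index w T = n" "jump_index w' T = n" "m <= Suc n"
  and e: "0 < e" "(\<Sum>i<m. \<bar>v' i - v i\<bar>) <= e" "(\<Sum>i\<le>n. dist (y i) (y' i)) <= e"
 shows "skorohod_dist T (jump_path T y w) (jump_path T y' w') <= e"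
proof (rule skorohod_dist_le[OF e(1) interval_change_time_change])
 fix t assume t: "t \<in> {0..T}"
 show "\<bar>interval_change v v' m t - t\<bar> <= e" using interval_change_deviation[OF t] e(2) by linarith
 have "jump_index w' (interval_change v v' m t) = jump_index w t & jump_index w t <= n"
 proof (cases "t < T")
  case True
  obtain j where j: "j < m" "arrival v j <= t" "t < arrival v (Suc j)"
   using partition_index[of t v m] True t T by (metis atLeastAtMost_iff)
  have "jump_index w t = j" using j vw[OF j(1)] by (intro jump_index_eqI[OF w]) auto
  moreover have "jump_index w' (interval_change v v' m t) = j"
  proof (rule jump_index_eqI[OF w'])
   have "0 <= (t - arrival v j) / v j" "(t - arrival v j) / v j < 1" using j v[OF j(1)] by (simp_all add: arrival_Suc)
   then have "0 <= v' j * ((t - arrival v j) / v j)" "v' j * ((t - arrival v j) / v j) < v' j * 1"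
    using v'[OF j(1)] by (intro mult_nonneg_nonneg mult_strict_left_mono; simp)+
   then have "arrival v' j <= interval_change v v' m t" "interval_change v v' m t < arrival v' (Suc j)"
    using interval_change_piece[where v = v and v' = v' and m = m, OF v j(1,2)] j(3) by (simp_all add: arrival_Suc)
   then show "arrival w' j <= interval_change v v' m t" "interval_change v v' m t < arrival w' (Suc j)"
    using vw'[OF j(1)] by auto
  qed
  ultimately show ?thesis using j n by simp
 next
  case False
  then have "t = T" using t by simp
  then show ?thesis using n interval_change_end by simp
 qed
 moreover have "interval_change v v' m t \<in> {0..T}" by (rule time_changes_in[OF interval_change_time_change t])
 ultimately have "dist (jump_path T y w t) (jump_path T y' w' (interval_change v v' m t)) = dist (y (jump_index w t)) (y' (jump_index w t))" "jump_index w t <= n"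
  using t by (auto simp: jump_path_def)
 moreover have "dist (y (jump_index w t)) (y' (jump_index w t)) <= (\<Sum>i\<le>n. dist (y i) (y' i))" if "jump_index w t <= n"
  using that by (intro member_le_sum[where f = "%i. dist (y i) (y' i)"]) auto
 ultimately show "dist (jump_path T y w t) (jump_path T y' w' (interval_change v v' m t)) <= e" using e(3) by linarith
qed

end

text \<open>
 Near-by holding times need not give near-by paths when a jump crosses the end point \<open>T\<close>, so paths
 with a jump at \<open>T\<close> form separate pieces.
\<close>

definition in_piece :: "real => nat => bool => (nat => real) => bool" where
 "in_piece T n b w \<longleftrightarrow> (if b then arrival w n < T & T < arrival w (Suc n) else arrival w n = T)"

text \<open>The factor 2 pays for the last interval, which ends at \<open>T\<close> and absorbs the
  accumulated change of the others.\<close>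

definition piece_gap :: "nat => (nat => 'a::metric_space) \<times> (nat => real) => (nat => 'a) \<times> (nat => real) => real" where
 "piece_gap n p p' = (\<Sum>i\<le>n. dist (fst p i) (fst p' i)) + 2 * (\<Sum>i<n. \<bar>snd p' i - snd p i\<bar>)"

lemma skorohod_dist_piece_le:
 fixes p p' :: "(nat => 'a::metric_space) \<times> (nat => real)"
 assumes w: "holding_times (snd p)" "holding_times (snd p')" and T: "0 < T"
  and pc: "in_piece T n b (snd p)" "in_piece T n b (snd p')" and e: "0 < e" "piece_gap n p p' <= e"
 shows "skorohod_dist T (jump_path T (fst p) (snd p)) (jump_path T (fst p') (snd p')) <= e"
proof -
 obtain y w where p: "p = (y, w)" by (cases p)
 obtain y' w' where p': "p' = (y', w')" by (cases p')
 have hw: "holding_times w" "holding_times w'" using w by (simp_all add: p p')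
 have pos: "0 < w k" "0 < w' k" for k using hw by (simp_all add: holding_times_def)
 have d0: "0 <= (\<Sum>i\<le>n. dist (y i) (y' i))" "0 <= (\<Sum>i<n. \<bar>w' i - w i\<bar>)" by (auto intro!: sum_nonneg)
 have gap: "(\<Sum>i\<le>n. dist (y i) (y' i)) <= e" "2 * (\<Sum>i<n. \<bar>w' i - w i\<bar>) <= e"
  using e(2) d0 unfolding piece_gap_def p p' fst_conv snd_conv by linarith+
 have ji: "jump_index w T = n" "jump_index w' T = n"
  using pc pos by (auto intro!: jump_index_eqI hw simp: in_piece_def p p' arrival_Suc split: if_splits)
 have "skorohod_dist T (jump_path T y w) (jump_path T y' w') <= e"
 proof (cases b)
  case True
  \<comment> \<open>Replacing the holding time of the last state by the time left until
    \<open>T\<close> yields partitions of the interval from 0 to \<open>T\<close> into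
    \<open>n + 1\<close> parts for both paths.\<close>
  let ?v = "%w i. if i < n then w i else T - arrival w n"
  have av: "arrival (?v w) j = arrival w j" if "j <= n" for w j
   using that by (intro arrival_cong) auto
  have aS: "arrival (?v w) (Suc n) = T" for w by (simp add: arrival_Suc[of _ n] av)
  have pcs: "arrival w n < T" "T < arrival w (Suc n)" "arrival w' n < T" "T < arrival w' (Suc n)"
   using pc True by (auto simp: in_piece_def p p')
  have le: "arrival (?v w) (Suc j) <= arrival w (Suc j)" if "T < arrival w (Suc n)" "j < Suc n" for w j
   using that av[of "Suc j" w] aS[of w] by (cases "j = n") auto
  have "\<bar>(T - arrival w' n) - (T - arrival w n)\<bar> = \<bar>\<Sum>i<n. w' i - w i\<bar>"
   by (simp add: arrival_def sum_subtractf abs_minus_commute)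
  also have "... <= (\<Sum>i<n. \<bar>w' i - w i\<bar>)" by (rule sum_abs)
  finally have "(\<Sum>i<Suc n. \<bar>?v w' i - ?v w i\<bar>) <= e" using gap(2) by simp
  then show ?thesis
   using pos pcs by (intro skorohod_dist_jump_path_le[where v = "?v w" and v' = "?v w'" and m = "Suc n" and n = n] aS hw ji e gap)
    (auto simp: av le)
 next
  case False
  then have "arrival w n = T" "arrival w' n = T" using pc by (auto simp: in_piece_def p p')
  moreover have "(\<Sum>i<n. \<bar>w' i - w i\<bar>) <= e" using gap(2) d0(2) by linarith
  ultimately show ?thesis
   using pos by (intro skorohod_dist_jump_path_le[where v = w and v' = w' and m = n and n = n] hw ji e gap) auto
 qed
 then show ?thesis by (simp add: p p')
qed

lemma piece_exists:
 assumes "holding_times w" "0 < T"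
 shows "\<exists>n b. in_piece T n b w"
proof -
 let ?n = "jump_index w T"
 have "arrival w ?n <= T" "T < arrival w (Suc ?n)" using jump_index_bounds[OF assms(1), of T] assms(2) by auto
 then show ?thesis unfolding in_piece_def by (metis (full_types) order_le_less)
qed

lemma open_piece_ball: "open {p'. piece_gap n p p' < r}"
proof (rule open_Collect_less)
 have c1: "continuous_on UNIV (\<lambda>p' :: (nat => 'a) \<times> (nat => real). fst p' i)" for i
  by (rule continuous_on_compose2[OF continuous_on_product_coordinates continuous_on_fst[OF continuous_on_id]]) simp
 have c2: "continuous_on UNIV (\<lambda>p' :: (nat => 'a) \<times> (nat => real). snd p' i)" for i
  by (rule continuous_on_compose2[OF continuous_on_product_coordinates continuous_on_snd[OF continuous_on_id]]) simp
 show "continuous_on UNIV (%p'. piece_gap n p p')"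
  unfolding piece_gap_def by (intro continuous_intros c1 c2)
qed simp

text \<open>On each piece, paths with a small gap to a given one are close to it. The preimage of an
  open set is therefore, piece by piece, the trace of an open set of pairs of states and times; the
  pieces are measurable and countable in number.\<close>

lemma jump_path_measurable:
 fixes y :: "'w => nat => 'a::{metric_space, second_countable_topology}"
 assumes y: "y \<in> M \<rightarrow>\<^sub>M (\<Pi>\<^sub>M k\<in>UNIV. borel)" and w: "w \<in> M \<rightarrow>\<^sub>M (\<Pi>\<^sub>M k\<in>UNIV. borel)"
  and hw: "!!u. u \<in> space M ==> holding_times (w u)" and T: "0 < T"
 shows "(%u. jump_path T (y u) (w u)) \<in> M \<rightarrow>\<^sub>M borel_of (skorohod_topology T)"
proof -
 let ?Z = "%u. (y u, w u)" and ?X = "%u. jump_path T (y u) (w u)"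
 interpret K: Metric_space "cadlag_paths T" "skorohod_dist T :: (real => 'a) => _" by (rule Metric_space_skorohod)
 have "?Z \<in> M \<rightarrow>\<^sub>M borel"
 proof -
  have "?Z \<in> M \<rightarrow>\<^sub>M borel \<Otimes>\<^sub>M borel"
   using y w by (intro measurable_Pair) (simp_all cong: measurable_cong_sets add: measurable_cong_sets[OF refl sets_PiM_equal_borel])
  then show ?thesis by (simp add: borel_prod)
 qed
 note Z = this
 have arr: "(%u. arrival (w u) n) \<in> borel_measurable M" for n
 proof -
  have "(%u. w u k) \<in> borel_measurable M" for k
   by (rule measurable_compose[OF w measurable_component_singleton]) simp
  then show ?thesis unfolding arrival_def by (intro borel_measurable_sum)
 qed
 show ?thesis
  unfolding borel_of_def
 proof (rule measurable_measure_of)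
  show "{U. openin (skorohod_topology T) U} \<subseteq> Pow (topspace (skorohod_topology T :: (real => 'a) topology))"
   using openin_subset by blast
  show "?X \<in> space M \<rightarrow> topspace (skorohod_topology T)"
   using hw by (auto simp: skorohod_topology_def intro!: jump_path_cadlag)
  fix U :: "(real => 'a) set" assume "U \<in> {U. openin (skorohod_topology T) U}"
  then have U: "U \<subseteq> cadlag_paths T" "!!x. x \<in> U ==> \<exists>r>0. K.mball x r \<subseteq> U"
   by (auto simp: skorohod_topology_def K.openin_mtopology)
  define good where "good n b = {p :: (nat => 'a) \<times> (nat => real). holding_times (snd p) & in_piece T n b (snd p) & jump_path T (fst p) (snd p) \<in> U}" for n b
  have "\<forall>x\<in>U. \<exists>r. 0 < r & K.mball x r \<subseteq> U" using U(2) by blast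
  from bchoice[OF this] obtain r where r: "!!x. x \<in> U ==> 0 < r x & K.mball x (r x) \<subseteq> U" by blast
  \<comment> \<open>A union of gap balls over arbitrarily many centres, open all the same. The
    radius is halved because \<open>skorohod_dist_piece_le\<close> gives a weak inequality where
    \<open>mball\<close> asks for a strict one.\<close>
  define Op where "Op n b = (\<Union>p\<in>good n b. {p'. piece_gap n p p' < r (jump_path T (fst p) (snd p)) / 2})" for n b
  have oO: "open (Op n b)" for n b unfolding Op_def by (intro open_UN ballI open_piece_ball)
  have iff: "?X u \<in> U \<longleftrightarrow> (\<exists>n b. in_piece T n b (w u) & ?Z u \<in> Op n b)" if u: "u \<in> space M" for u
  proof
   assume X: "?X u \<in> U"
   obtain n b where nb: "in_piece T n b (w u)" using piece_exists[OF hw[OF u] T] by blast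
   have "?Z u \<in> good n b" using X nb hw[OF u] by (simp add: good_def)
   moreover have "piece_gap n (?Z u) (?Z u) < r (?X u) / 2" using r[OF X] by (simp add: piece_gap_def)
   ultimately have "?Z u \<in> Op n b" unfolding Op_def by force
   then show "\<exists>n b. in_piece T n b (w u) & ?Z u \<in> Op n b" using nb by blast
  next
   assume "\<exists>n b. in_piece T n b (w u) & ?Z u \<in> Op n b"
   then obtain n b p where nb: "in_piece T n b (w u)" and p: "p \<in> good n b"
    and gap: "piece_gap n p (?Z u) < r (jump_path T (fst p) (snd p)) / 2" by (auto simp: Op_def)
   let ?x = "jump_path T (fst p) (snd p)"
   have pU: "?x \<in> U" "holding_times (snd p)" "in_piece T n b (snd p)" using p by (auto simp: good_def)
   have "skorohod_dist T ?x (?X u) <= r ?x / 2"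
    using skorohod_dist_piece_le[OF pU(2), of "?Z u" T n b "r ?x / 2"] hw[OF u] T pU(3) nb r[OF pU(1)] gap by simp
   then have "?X u \<in> K.mball ?x (r ?x)"
    using r[OF pU(1)] U(1) pU(1) jump_path_cadlag[OF hw[OF u], of T "y u"] by (auto simp: K.mball_def)
   then show "?X u \<in> U" using r[OF pU(1)] by blast
  qed
  have "?X -` U \<inter> space M = (\<Union>n. \<Union>b. {u\<in>space M. in_piece T n b (w u)} \<inter> (?Z -` Op n b \<inter> space M))"
   using iff by auto
  also have "... \<in> sets M"
  proof (rule sets.countable_UN''[OF countableI_type], rule sets.countable_UN''[OF countableI_type], rule sets.Int)
   fix n b
   show "?Z -` Op n b \<inter> space M \<in> sets M" by (rule measurable_sets[OF Z]) (simp add: oO)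
   show "{u\<in>space M. in_piece T n b (w u)} \<in> sets M"
   proof (cases b)
    case True
    note arr[measurable]
    have "{u\<in>space M. arrival (w u) n < T} \<inter> {u\<in>space M. T < arrival (w u) (Suc n)} \<in> sets M"
     by measurable
    also have "{u\<in>space M. arrival (w u) n < T} \<inter> {u\<in>space M. T < arrival (w u) (Suc n)} = {u\<in>space M. in_piece T n b (w u)}"
     using True by (auto simp: in_piece_def)
    finally show ?thesis .
   next
    case False
    have "(%u. arrival (w u) n) -` {T} \<inter> space M \<in> sets M" by (rule measurable_sets[OF arr]) simp
    also have "(%u. arrival (w u) n) -` {T} \<inter> space M = {u\<in>space M. in_piece T n b (w u)}"
     using False by (auto simp: in_piece_def)
    finally show ?thesis .
   qed
  qed
  finally show "?X -` U \<inter> space M \<in> sets M" .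
 qed
qed

section \<open>Convergence tested by Lipschitz functions\<close>

lemma space_borel_of [simp]: "space (borel_of X) = topspace X"
 by (simp add: borel_of_def space_measure_of_conv)

lemma openin_in_sets_borel_of: "openin X U ==> U \<in> sets (borel_of X)"
 unfolding borel_of_def using openin_subset by (subst sets_measure_of) blast+

lemma continuous_map_borel_of:
 assumes "continuous_map X euclideanreal F"
 shows "F \<in> borel_measurable (borel_of X)"
proof (rule borel_measurableI)
 fix S :: "real set" assume "open S"
 then have "openin X {x \<in> topspace X. F x \<in> S}"
  using assms by (intro openin_continuous_map_preimage[where Y = euclideanreal]) auto
 moreover have "{x \<in> topspace X. F x \<in> S} = F -` S \<inter> space (borel_of X)" by auto
 ultimately show "F -` S \<inter> space (borel_of X) \<in> sets (borel_of X)"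
  using openin_in_sets_borel_of by metis
qed

text \<open>The Pasch--Hausdorff envelope: for \<open>F\<close> bounded below, the largest minorant
  on \<open>A\<close> with Lipschitz constant \<open>k\<close>. As \<open>k\<close> grows it
  approximates a bounded continuous \<open>F\<close> pointwise from below.\<close>

definition inf_regularization :: "'a set => ('a => 'a => real) => ('a => real) => real => 'a => real" where
 "inf_regularization A d F k x = (if x \<in> A then Inf ((%z. F z + k * d x z) ` A) else 0)"

context Metric_space
begin

context
 fixes F :: "'a => real" and B :: real
 assumes F: "!!x. x \<in> M ==> \<bar>F x\<bar> <= B"
begin

lemma inf_regularization_bdd:
 assumes "0 <= k"
 shows "bdd_below ((%z. F z + k * d x z) ` M)"
proof (rule bdd_belowI2)
 fix z assume "z \<in> M"
 then show "- B <= F z + k * d x z" using F[of z] assms mult_nonneg_nonneg[OF assms nonneg[of x z]] by linarith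
qed

lemma inf_regularization_le:
 assumes "0 <= k" "x \<in> M"
 shows "inf_regularization M d F k x <= F x"
proof -
 have "Inf ((%z. F z + k * d x z) ` M) <= F x + k * d x x"
  by (intro cInf_lower inf_regularization_bdd imageI assms)
 then show ?thesis using assms by (simp add: inf_regularization_def)
qed

lemma inf_regularization_ge:
 assumes "0 <= k" "x \<in> M" and c: "!!z. z \<in> M ==> c <= F z + k * d x z"
 shows "c <= inf_regularization M d F k x"
 using assms by (auto simp: inf_regularization_def intro!: cInf_greatest)

lemma inf_regularization_bound:
 assumes "0 <= k" "0 <= B"
 shows "\<bar>inf_regularization M d F k x\<bar> <= B"
proof (cases "x \<in> M")
 case True
 have "- B <= inf_regularization M d F k x"
 proof (rule inf_regularization_ge[OF assms(1) True])
  fix z assume "z \<in> M"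
  then show "- B <= F z + k * d x z" using F[of z] mult_nonneg_nonneg[OF assms(1) nonneg[of x z]] by linarith
 qed
 then show ?thesis using inf_regularization_le[OF assms(1) True] F[OF True] by linarith
qed (simp add: inf_regularization_def assms)

lemma inf_regularization_lipschitz:
 assumes k: "0 <= k" and x: "x \<in> M" and y: "y \<in> M"
 shows "\<bar>inf_regularization M d F k x - inf_regularization M d F k y\<bar> <= k * d x y"
proof -
 have *: "inf_regularization M d F k x - k * d x y <= inf_regularization M d F k y" if x: "x \<in> M" and y: "y \<in> M" for x y
 proof (rule inf_regularization_ge[OF k y])
  fix z assume z: "z \<in> M"
  have "inf_regularization M d F k x <= F z + k * d x z"
   using x z k inf_regularization_bdd by (auto simp: inf_regularization_def intro!: cInf_lower)
  also have "k * d x z <= k * d x y + k * d y z"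
   using mult_left_mono[OF triangle[OF x y z] k] by (simp add: distrib_left)
  finally show "inf_regularization M d F k x - k * d x y <= F z + k * d y z" by simp
 qed
 show ?thesis using *[OF x y] *[OF y x] commute[of x y] by (simp add: abs_le_iff)
qed

text \<open>At distance at least \<open>r\<close> the penalty outweighs any gain once
  \<open>k * r\<close> reaches \<open>2 * B\<close>; closer points have values above
  \<open>F x - e / 2\<close> by continuity.\<close>

lemma inf_regularization_tendsto:
 assumes cont: "continuous_map mtopology euclideanreal F" and x: "x \<in> M"
 shows "(%k. inf_regularization M d F (real k) x) \<longlonglongrightarrow> F x"
proof (rule LIMSEQ_I)
 fix e :: real assume e: "0 < e"
 have "openin mtopology {z \<in> topspace mtopology. F z \<in> {F x - e / 2<..}}"
  by (rule openin_continuous_map_preimage[OF cont]) simp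
 then obtain r where r: "0 < r" "mball x r \<subseteq> {z \<in> M. F x - e / 2 < F z}"
  using x e by (auto simp: openin_mtopology)
 define k0 where "k0 = nat \<lceil>2 * B / r\<rceil>"
 show "\<exists>no. \<forall>k\<ge>no. norm (inf_regularization M d F (real k) x - F x) < e"
 proof (intro exI allI impI)
  fix k assume k: "k0 <= k"
  have "2 * B / r <= real k" using k unfolding k0_def by linarith
  then have kr: "2 * B <= real k * r" using r(1) by (simp add: field_simps)
  have "F x - e / 2 <= inf_regularization M d F (real k) x"
  proof (rule inf_regularization_ge[OF _ x])
   fix z assume z: "z \<in> M"
   show "F x - e / 2 <= F z + real k * d x z"
   proof (cases "d x z < r")
    case True
    then have "z \<in> mball x r" using x z by simp
    then have "F x - e / 2 < F z" using r(2) by blast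
    moreover have "0 <= real k * d x z" by simp
    ultimately show ?thesis by linarith
   next
    case False
    then have "real k * r <= real k * d x z" by (intro mult_left_mono) auto
    then show ?thesis using kr F[OF x] F[OF z] e by linarith
   qed
  qed simp
  then show "norm (inf_regularization M d F (real k) x - F x) < e"
   using inf_regularization_le[of "real k" x] x e by simp
 qed
qed

lemma inf_regularization_measurable:
 assumes k: "0 <= k"
 shows "inf_regularization M d F k \<in> borel_measurable (borel_of mtopology)"
proof (rule continuous_map_borel_of)
 have "\<exists>r>0. \<forall>y. y \<in> M & d x y < r --> dist (inf_regularization M d F k y) (inf_regularization M d F k x) < e"
  if x: "x \<in> M" and e: "0 < e" for x e
 proof (intro exI conjI allI impI)
  show "0 < e / (k + 1)" using e k by simp
  fix y assume y: "y \<in> M & d x y < e / (k + 1)"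
  have "\<bar>inf_regularization M d F k x - inf_regularization M d F k y\<bar> <= (k + 1) * d x y"
   using inf_regularization_lipschitz[OF k x, of y] y nonneg[of x y] unfolding distrib_right mult_1 by linarith
  also have "... < e" using y k by (simp add: pos_less_divide_eq mult.commute)
  finally show "dist (inf_regularization M d F k y) (inf_regularization M d F k x) < e"
   by (simp add: dist_real_def abs_minus_commute)
 qed
 then have "\<forall>x\<in>M. \<forall>e>0. \<exists>r>0. \<forall>y. y \<in> M & d x y < r --> inf_regularization M d F k y \<in> UNIV & dist (inf_regularization M d F k x) (inf_regularization M d F k y) < e"
  by (simp add: dist_commute)
 then have "continuous_map mtopology (Metric_space.mtopology UNIV dist) (inf_regularization M d F k)"
  by (subst metric_continuous_map[OF Met_TC.Metric_space_axioms]) auto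
 then show "continuous_map mtopology euclideanreal (inf_regularization M d F k)" by simp
qed

end

text \<open>Lipschitz minorants bound the expectations of \<open>F\<close> from below, and their
  limits come arbitrarily close to the expectation of \<open>F\<close> under the limiting element.
  The same argument for \<open>- F\<close> gives the bound from above.\<close>

lemma expectation_tendsto_of_lipschitz:
 fixes N :: "nat => 'w measure" and N' :: "'v measure"
 assumes re: "\<forall>\<^sub>F n in sequentially. random_element (N n) mtopology (Z n)" and re': "random_element N' mtopology Z'"
  and lip: "!!G B K. G \<in> borel_measurable (borel_of mtopology) ==> (!!x. \<bar>G x\<bar> <= B) ==> 0 <= K ==>
   (!!x y. x \<in> M ==> y \<in> M ==> \<bar>G x - G y\<bar> <= K * d x y) ==>
   (%n. \<integral>u. G (Z n u) \<partial>N n) \<longlonglongrightarrow> (\<integral>u. G (Z' u) \<partial>N')"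
  and cont: "continuous_map mtopology euclideanreal F" and bdd: "bounded (F ` topspace mtopology)"
 shows "(%n. \<integral>u. F (Z n u) \<partial>N n) \<longlonglongrightarrow> (\<integral>u. F (Z' u) \<partial>N')"
proof -
 obtain B where B: "0 < B" "!!x. x \<in> M ==> \<bar>F x\<bar> <= B"
  using bdd by (auto simp: bounded_pos)
 interpret N': prob_space N' using re' by (simp add: random_element_def)
 have Z': "Z' \<in> N' \<rightarrow>\<^sub>M borel_of mtopology" using re' by (simp add: random_element_def)
 have lower: "\<forall>\<^sub>F n in sequentially. (\<integral>u. F (Z' u) \<partial>N') - e < (\<integral>u. F (Z n u) \<partial>N n)"
  if e: "0 < e" and cont: "continuous_map mtopology euclideanreal F" and B: "0 < B" "!!x. x \<in> M ==> \<bar>F x\<bar> <= B"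
  for F B and e :: real
 proof -
  let ?F = "%k. inf_regularization M d F (real k)"
  note Fm = continuous_map_borel_of[OF cont]
  have m: "?F k \<in> borel_measurable (borel_of mtopology)" for k
   by (rule inf_regularization_measurable[where B = B]) (use B in auto)
  have bd: "\<bar>?F k x\<bar> <= B" for k x
   by (rule inf_regularization_bound) (use B in auto)
  have inM: "Z' u \<in> M" if "u \<in> space N'" for u using measurable_space[OF Z' that] by simp
  have "(%k. \<integral>u. ?F k (Z' u) \<partial>N') \<longlonglongrightarrow> (\<integral>u. F (Z' u) \<partial>N')"
  proof (rule integral_dominated_convergence[where w = "%_. B"])
   show "AE u in N'. (%k. ?F k (Z' u)) \<longlonglongrightarrow> F (Z' u)"
    by (intro AE_I2 inf_regularization_tendsto[where B = B] B cont inM)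
   show "AE u in N'. norm (?F k (Z' u)) <= B" for k using bd by (intro AE_I2) simp
  qed (use measurable_compose[OF Z' m] measurable_compose[OF Z' Fm] in auto)
  from order_tendstoD(1)[OF this, of "(\<integral>u. F (Z' u) \<partial>N') - e"] e
  obtain k where k: "(\<integral>u. F (Z' u) \<partial>N') - e < (\<integral>u. ?F k (Z' u) \<partial>N')"
   by (auto simp: eventually_sequentially)
  have "(%n. \<integral>u. ?F k (Z n u) \<partial>N n) \<longlonglongrightarrow> (\<integral>u. ?F k (Z' u) \<partial>N')"
   using inf_regularization_lipschitz[where F = F and B = B and k = "real k"] B
   by (intro lip[OF m bd of_nat_0_le_iff]) auto
  from order_tendstoD(1)[OF this k] re show ?thesis
  proof eventually_elim
   case (elim n)
   then interpret N: prob_space "N n" by (simp add: random_element_def)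
   have Z: "Z n \<in> N n \<rightarrow>\<^sub>M borel_of mtopology" using elim by (simp add: random_element_def)
   have inM: "Z n u \<in> M" if "u \<in> space (N n)" for u using measurable_space[OF Z that] by simp
   have "(\<integral>u. ?F k (Z n u) \<partial>N n) <= (\<integral>u. F (Z n u) \<partial>N n)"
   proof (rule integral_mono)
    show "integrable (N n) (%u. ?F k (Z n u))"
     using bd measurable_compose[OF Z m] by (intro N.integrable_const_bound[of _ B] AE_I2) auto
    show "integrable (N n) (%u. F (Z n u))"
     using B inM measurable_compose[OF Z Fm] by (intro N.integrable_const_bound[of _ B] AE_I2) auto
    show "?F k (Z n u) <= F (Z n u)" if "u \<in> space (N n)" for u
     by (rule inf_regularization_le[where B = B]) (use B inM[OF that] in auto)
   qed
   then show ?case using elim by simp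
  qed
 qed
 have contm: "continuous_map mtopology euclideanreal (%x. - F x)" using cont by (rule continuous_map_minus)
 show ?thesis
 proof (rule tendstoI)
  fix e :: real assume e: "0 < e"
  have Bm: "!!x. x \<in> M ==> \<bar>- F x\<bar> <= B" using B by simp
  have "\<forall>\<^sub>F n in sequentially. (\<integral>u. F (Z' u) \<partial>N') - e < (\<integral>u. F (Z n u) \<partial>N n)"
   by (rule lower[OF e cont B])
  moreover have "\<forall>\<^sub>F n in sequentially. (\<integral>u. - F (Z' u) \<partial>N') - e < (\<integral>u. - F (Z n u) \<partial>N n)"
   by (rule lower[OF e contm B(1) Bm])
  ultimately show "\<forall>\<^sub>F n in sequentially. dist (\<integral>u. F (Z n u) \<partial>N n) (\<integral>u. F (Z' u) \<partial>N') < e"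
   by eventually_elim (auto simp: dist_real_def abs_less_iff)
 qed
qed

end

section \<open>Disintegration over the holding times\<close>

lemma markov_jump_process_unit_rate:
 assumes X: "markov_jump_process M S q X" and r: "!!x. x \<in> space S ==> total_rate S q x = 1"
 shows "\<exists>Y W. unit_rate_chain M S q Y W & (\<forall>w\<in>space M. holding_times (%k. W k w)) &
  (\<forall>w\<in>space M. \<forall>t\<ge>0. X t w = Y (jump_index (%k. W k w) t) w)"
proof -
 from X obtain Y W where p: "prob_space M" and k: "rate_kernel S q"
  and Y: "\<forall>n. Y n \<in> M \<rightarrow>\<^sub>M S" and W: "\<forall>n. W n \<in> borel_measurable M"
  and pos: "\<forall>n. \<forall>w\<in>space M. 0 < W n w"
  and ex: "\<forall>w\<in>space M. \<forall>t. \<exists>n. t < (\<Sum>k<n. W k w)"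
  and c: "\<forall>n s. \<forall>A\<in>sets S. 0 <= s --> (AE w in M.
       real_cond_exp M (jump_history M S Y W n)
        (indicator {w. s < W n w & Y (Suc n) w \<in> A}) w =
       exp (- total_rate S q (Y n w) * s) *
        (measure (q (Y n w)) A / total_rate S q (Y n w)))"
  and XY: "\<forall>w\<in>space M. \<forall>n t. (\<Sum>k<n. W k w) <= t & t < (\<Sum>k<Suc n. W k w) --> X t w = Y n w"
  unfolding markov_jump_process_def by (elim conjE exE) (rule that; assumption)
 have "AE w in M. real_cond_exp M (jump_history M S Y W n) (indicator {w. s < W n w & Y (Suc n) w \<in> A}) w
    = exp (- s) * measure (q (Y n w)) A" if "A \<in> sets S" "0 <= s" for n s A
  using c[rule_format, OF that, of n] AE_space
 proof eventually_elim
  case (elim w)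
  then show ?case using r[OF measurable_space[OF Y[rule_format] elim(2)], of n] by simp
 qed
 then have ch: "unit_rate_chain M S q Y W"
  by (intro unit_rate_chain.intro p k r Y[rule_format] W[rule_format] pos[rule_format])
 have h: "holding_times (%k. W k w)" if "w \<in> space M" for w
  using pos ex that by (simp add: holding_times_def arrival_def)
 have "X t w = Y (jump_index (%k. W k w) t) w" if "w \<in> space M" "0 <= t" for t w
  by (rule XY[rule_format, OF that(1)]) (use jump_index_bounds[OF h[OF that(1)] that(2)] in \<open>simp add: arrival_def\<close>)
 then show ?thesis using ch h by (intro exI[of _ Y] exI[of _ W]) simp
qed

text \<open>\<open>p\<close> maps states to the space in which the path runs:
  \<open>cycle_partition\<close> for stirring, the identity for split-and-merge. One set of lemmas
  thus serves both processes.\<close>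

locale unit_rate_path = unit_rate_chain M S q Y W
 for M :: "'w measure" and S :: "'s measure" and q Y W +
 fixes p :: "'s => 'a::{metric_space, second_countable_topology}" and T :: real
 assumes holding: "\<omega> \<in> space M ==> holding_times (%k. W k \<omega>)"
  and p_measurable: "p \<in> borel_measurable S" and T_pos: "0 < T"
begin

abbreviation holding_path :: "'w => nat => real" where
 "holding_path \<omega> \<equiv> (%k. W k \<omega>)"

definition jump_process :: "'w => real => 'a" where
 "jump_process \<omega> = jump_path T (%k. p (Y k \<omega>)) (holding_path \<omega>)"

definition stopped_process :: "nat => 'w => real => 'a" where
 "stopped_process m \<omega> = jump_path T (%k. p (stopped m \<omega> k)) (holding_path \<omega>)"

lemma holding_path_measurable: "holding_path \<in> M \<rightarrow>\<^sub>M (\<Pi>\<^sub>M k\<in>UNIV. borel)"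
 by (rule measurable_PiM_single') auto

lemma jump_process_random_element: "random_element M (skorohod_topology T) jump_process"
proof -
 have "(%x k. p (Y k x)) \<in> M \<rightarrow>\<^sub>M (\<Pi>\<^sub>M k\<in>UNIV. borel)"
  by (rule measurable_PiM_single') (auto intro: measurable_compose[OF Y_measurable p_measurable])
 from jump_path_measurable[OF this holding_path_measurable holding T_pos]
 show ?thesis by (simp add: random_element_def prob jump_process_def[abs_def])
qed

lemma stopped_process_measurable: "stopped_process m \<in> M \<rightarrow>\<^sub>M borel_of (skorohod_topology T)"
proof -
 have "(%x k. p (stopped m x k)) \<in> M \<rightarrow>\<^sub>M (\<Pi>\<^sub>M k\<in>UNIV. borel)"
  by (rule measurable_PiM_single') (auto simp: stopped_def intro: measurable_compose[OF Y_measurable p_measurable])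
 from jump_path_measurable[OF this holding_path_measurable holding T_pos]
 show ?thesis by (simp add: stopped_process_def[abs_def])
qed

lemma prob_space_holding_law: "prob_space (\<Pi>\<^sub>M k\<in>(UNIV::nat set). exp_law)"
 by (rule prob_space_PiM) (rule prob_space_exp_law)

lemma sets_holding_law: "sets (\<Pi>\<^sub>M k\<in>(UNIV::nat set). exp_law) = sets (\<Pi>\<^sub>M k\<in>UNIV. borel)"
 by (rule sets_PiM_cong) simp_all

lemma holding_law: "distr M (\<Pi>\<^sub>M k\<in>UNIV. borel) holding_path = (\<Pi>\<^sub>M k\<in>UNIV. exp_law)"
proof (rule measure_eqI)
 let ?u = "(distr M (\<Pi>\<^sub>M k\<in>UNIV. borel) holding_path)"
 let ?v = "(%x. (stopped 0 x, holding_path x))"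
 let ?w = "(\<Pi>\<^sub>M k\<in>UNIV. exp_law)"
 show "sets ?u = sets (\<Pi>\<^sub>M k\<in>(UNIV::nat set). exp_law)"
  by (simp add: sets_holding_law)
 fix A assume "A \<in> sets ?u"
 then have A: "A \<in> sets (\<Pi>\<^sub>M k\<in>(UNIV::nat set). (borel :: real measure))" by simp
 interpret E: prob_space "\<Pi>\<^sub>M k\<in>(UNIV::nat set). exp_law" by (rule prob_space_holding_law)
 interpret D: prob_space "distr M traj_space (stopped 0)" by (rule prob_space_distr) simp
 have zm: "?v \<in> M \<rightarrow>\<^sub>M traj_space \<Otimes>\<^sub>M (\<Pi>\<^sub>M k\<in>UNIV. borel)"
  using holding_path_measurable by (intro measurable_Pair) auto
 have "emeasure ?w A
   = emeasure (distr M traj_space (stopped 0) \<Otimes>\<^sub>M ?w) (space traj_space \<times> A)"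
  using A D.emeasure_space_1 by (subst E.emeasure_pair_measure_Times) (auto simp: sets_holding_law)
 also have "... = emeasure M (?v -` (space traj_space \<times> A) \<inter> space M)"
  unfolding traj_holding_law[symmetric] using A by (intro emeasure_distr[OF zm]) auto
 also have "?v -` (space traj_space \<times> A) \<inter> space M = holding_path -` A \<inter> space M"
  using measurable_space[OF stopped_measurable, of _ 0] by auto
 also have "emeasure M ... = emeasure ?u A"
  by (rule emeasure_distr[OF holding_path_measurable A, symmetric])
 finally show "emeasure ?u A = emeasure ?w A" by simp
qed

text \<open>The probability of more than \<open>m\<close> jumps by time \<open>T\<close>. Written
  with the law of the holding times alone, it is the same for every chain, which makes truncation
  uniform in the volume.\<close>

definition late_mass :: "nat => real" where
 "late_mass m = measure (\<Pi>\<^sub>M k\<in>(UNIV::nat set). exp_law) {w. arrival w (Suc m) <= T}"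

lemma late_set: "{w. arrival w (Suc m) <= T} \<in> sets (\<Pi>\<^sub>M k\<in>(UNIV::nat set). (borel :: real measure))"
proof -
 have "(%w. arrival w (Suc m)) \<in> borel_measurable (\<Pi>\<^sub>M k\<in>(UNIV::nat set). (borel :: real measure))"
  unfolding arrival_def by (intro borel_measurable_sum measurable_component_singleton) simp
 from measurable_sets[OF this, of "{..T}"] show ?thesis by (simp add: vimage_def space_PiM)
qed

lemma late_mass_eq: "late_mass m = measure M {x\<in>space M. arrival (holding_path x) (Suc m) <= T}"
 unfolding late_mass_def holding_law[symmetric]
 by (subst measure_distr[OF holding_path_measurable late_set]) (auto intro!: arg_cong[where f = "measure M"])

lemma late_mass_tendsto: "late_mass \<longlonglongrightarrow> 0"
proof -
 have arr: "(%x. arrival (holding_path x) n) \<in> borel_measurable M" for n unfolding arrival_def by measurable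
 have s: "{x\<in>space M. arrival (holding_path x) (Suc m) <= T} \<in> sets M" for m using arr by measurable
 have "(%m. \<integral>x. indicator {x\<in>space M. arrival (holding_path x) (Suc m) <= T} x \<partial>M) \<longlonglongrightarrow> (\<integral>x. (0::real) \<partial>M)"
 proof (rule integral_dominated_convergence[where w = "%_. 1"])
  show "AE x in M. (%m. indicator {x\<in>space M. arrival (holding_path x) (Suc m) <= T} x) \<longlonglongrightarrow> (0::real)"
  proof (rule AE_I2)
   fix x assume x: "x \<in> space M"
   obtain n where n: "T < arrival (holding_path x) n" using holding[OF x] by (auto simp: holding_times_def)
   have "indicator {x\<in>space M. arrival (holding_path x) (Suc m) <= T} x = (0::real)" if "n <= m" for m
   proof -
    have "arrival (holding_path x) n <= arrival (holding_path x) (Suc m)"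
     using that W_pos[OF x] by (intro arrival_mono) (auto intro: less_imp_le)
    then show ?thesis using n by (simp add: indicator_def)
   qed
   then show "(%m. indicator {x\<in>space M. arrival (holding_path x) (Suc m) <= T} x) \<longlonglongrightarrow> (0::real)"
    by (intro tendsto_eventually eventually_sequentiallyI)
  qed
 qed (use s in auto)
 moreover have "(\<integral>x. indicator {x\<in>space M. arrival (holding_path x) (Suc m) <= T} x \<partial>M) = late_mass m" for m
  unfolding late_mass_eq using s[of m] by (simp add: Int_def conj_commute)
 ultimately show ?thesis by simp
qed

context
 fixes G :: "(real => 'a) => real" and B :: real
 assumes G: "G \<in> borel_measurable (borel_of (skorohod_topology T))" and B: "!!x. \<bar>G x\<bar> <= B"
begin

text \<open>The truncated path can differ from the original one only if more than \<open>m\<close>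
  jumps occur by time \<open>T\<close>.\<close>

lemma truncation_error:
 "\<bar>(\<integral>x. G (jump_process x) \<partial>M) - (\<integral>x. G (stopped_process m x) \<partial>M)\<bar> <= 2 * B * late_mass m"
proof -
 let ?L = "{x\<in>space M. arrival (holding_path x) (Suc m) <= T}"
 have L: "?L \<in> sets M"
  using measurable_sets[OF holding_path_measurable late_set[of m]] by (simp add: vimage_def Int_def conj_commute)
 have jm: "jump_process \<in> M \<rightarrow>\<^sub>M borel_of (skorohod_topology T)" using jump_process_random_element by (simp add: random_element_def)
 have i1: "integrable M (%x. G (jump_process x))"
  using B measurable_compose[OF jm G] by (intro integrable_const_bound[of _ B] AE_I2) auto
 have i2: "integrable M (%x. G (stopped_process m x))"
  using B measurable_compose[OF stopped_process_measurable G] by (intro integrable_const_bound[of _ B] AE_I2) auto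
 have same: "stopped_process m x = jump_process x" if x: "x \<in> space M" "x \<notin> ?L" for x
 proof -
  have "jump_index (holding_path x) t <= m" if "t \<in> {0..T}" for t
  proof -
   have "t < arrival (holding_path x) (Suc m)" using x that by auto
   then show ?thesis unfolding jump_index_def by (rule Least_le)
  qed
  then show ?thesis by (auto simp: stopped_process_def jump_process_def jump_path_def stopped_def fun_eq_iff min_absorb1)
 qed
 have "(\<integral>x. G (jump_process x) \<partial>M) - (\<integral>x. G (stopped_process m x) \<partial>M) = (\<integral>x. G (jump_process x) - G (stopped_process m x) \<partial>M)"
  using i1 i2 by simp
 also have "\<bar>...\<bar> <= (\<integral>x. \<bar>G (jump_process x) - G (stopped_process m x)\<bar> \<partial>M)" by (rule integral_abs_bound)
 also have "... <= (\<integral>x. 2 * B * indicator ?L x \<partial>M)"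
 proof (rule integral_mono)
  show "integrable M (%x. \<bar>G (jump_process x) - G (stopped_process m x)\<bar>)" using i1 i2 by simp
  show "integrable M (%x. 2 * B * indicator ?L x)"
   using L by (intro integrable_mult_right integrable_real_indicator) (auto simp: emeasure_eq_measure)
  fix x assume x: "x \<in> space M"
  show "\<bar>G (jump_process x) - G (stopped_process m x)\<bar> <= 2 * B * indicator ?L x"
  proof (cases "x \<in> ?L")
   case True
   then show ?thesis using B[of "jump_process x"] B[of "stopped_process m x"] by simp
  next
   case False
   then show ?thesis using same[OF x False] by (auto simp: indicator_def)
  qed
 qed
 also have "... = 2 * B * measure M ?L" using L by (simp add: Int_def conj_commute)
 finally show ?thesis by (simp only: late_mass_eq)
qed

text \<open>States and holding times are independent, so the times may be integrated last, against a
  law common to all chains. The case distinction is there because \<open>jump_path\<close> is known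
  to yield paths of the Skorohod space only for admissible times.\<close>

lemma stopped_process_expectation:
 "(\<integral>x. G (stopped_process m x) \<partial>M)
  = (\<integral>w. (\<integral>x. (if holding_times w then G (jump_path T (%k. p (stopped m x k)) w) else 0) \<partial>M) \<partial>(\<Pi>\<^sub>M k\<in>UNIV. exp_law))"
 and stopped_process_expectation_measurable:
 "(%w. \<integral>x. (if holding_times w then G (jump_path T (%k. p (stopped m x k)) w) else 0) \<partial>M) \<in> borel_measurable (\<Pi>\<^sub>M k\<in>UNIV. exp_law)"
proof -
 let ?B = "\<Pi>\<^sub>M k\<in>(UNIV::nat set). (borel :: real measure)" and ?E = "\<Pi>\<^sub>M k\<in>(UNIV::nat set). exp_law"
 let ?P = "traj_space \<Otimes>\<^sub>M ?B"
 define g where "g = (%z. if holding_times (snd z) then G (jump_path T (%k. p (fst z k)) (snd z)) else 0)"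
 interpret E: prob_space ?E by (rule prob_space_holding_law)
 interpret D: prob_space "distr M traj_space (stopped m)" by (rule prob_space_distr) simp
 interpret pair_sigma_finite "distr M traj_space (stopped m)" ?E ..
 have H: "{w. holding_times w} \<in> sets ?B"
 proof -
  have c[measurable]: "(%w. w k) \<in> borel_measurable ?B" for k by (rule measurable_component_singleton) simp
  then have a[measurable]: "(%w. arrival w n) \<in> borel_measurable ?B" for n unfolding arrival_def by (intro borel_measurable_sum)
  \<comment> \<open>Real times are replaced by integers, which makes the condition a countable
    one.\<close>
  have iff: "(\<forall>t. \<exists>n. t < arrival w n) \<longleftrightarrow> (\<forall>j::nat. \<exists>n. real j < arrival w n)" for w
  proof (intro iffI allI)
   fix t assume r: "\<forall>j::nat. \<exists>n. real j < arrival w n"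
   obtain j where "t < real j" using reals_Archimedean2 by blast
   moreover obtain n where "real j < arrival w n" using r by blast
   ultimately show "\<exists>n. t < arrival w n" by (intro exI[of _ n]) simp
  qed blast
  have "{w\<in>space ?B. (\<forall>k. 0 < w k) & (\<forall>j::nat. \<exists>n. real j < arrival w n)} \<in> sets ?B"
   by measurable
  then show ?thesis by (simp add: holding_times_def iff space_PiM)
 qed
 define \<Omega> where "\<Omega> = {z. holding_times (snd z)} \<inter> space ?P"
 have \<Omega>: "\<Omega> \<in> sets ?P"
  using measurable_sets[OF measurable_snd H, of traj_space] by (simp add: \<Omega>_def vimage_def)
 have "(%z. jump_path T (%k. p (fst z k)) (snd z)) \<in> restrict_space ?P \<Omega> \<rightarrow>\<^sub>M borel_of (skorohod_topology T)"
 proof (rule jump_path_measurable[OF _ _ _ T_pos])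
  have "(%z k. p (fst z k)) \<in> ?P \<rightarrow>\<^sub>M (\<Pi>\<^sub>M k\<in>UNIV. borel)"
  proof (rule measurable_PiM_single')
   fix k :: nat
   show "(%z. p (fst z k)) \<in> borel_measurable ?P"
    by (rule measurable_compose[OF measurable_compose[OF measurable_fst measurable_coordinate] p_measurable])
  qed simp
  then show "(%z k. p (fst z k)) \<in> restrict_space ?P \<Omega> \<rightarrow>\<^sub>M (\<Pi>\<^sub>M k\<in>UNIV. borel)" by (rule measurable_restrict_space1)
  show "snd \<in> restrict_space ?P \<Omega> \<rightarrow>\<^sub>M ?B" by (rule measurable_restrict_space1) simp
 qed (auto simp: space_restrict_space \<Omega>_def)
 from measurable_compose[OF this G]
 have "(%z. indicator \<Omega> z *\<^sub>R G (jump_path T (%k. p (fst z k)) (snd z))) \<in> borel_measurable ?P"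
  using \<Omega> by (subst (asm) borel_measurable_restrict_space_iff) auto
 then have gm: "g \<in> borel_measurable ?P"
  by (rule measurable_cong[THEN iffD1, rotated]) (auto simp: g_def \<Omega>_def indicator_def)
 have PE: "sets (distr M traj_space (stopped m) \<Otimes>\<^sub>M ?E) = sets ?P"
  by (intro sets_pair_measure_cong) (simp_all add: sets_holding_law)
 have gm': "g \<in> borel_measurable (distr M traj_space (stopped m) \<Otimes>\<^sub>M ?E)"
  using gm measurable_cong_sets[OF PE refl] by blast
 interpret PP: prob_space "distr M traj_space (stopped m) \<Otimes>\<^sub>M ?E"
  by (intro prob_space_pair D.prob_space_axioms E.prob_space_axioms)
 have B0: "0 <= B" using B[of undefined] by linarith
 have gi: "integrable (distr M traj_space (stopped m) \<Otimes>\<^sub>M ?E) g"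
  using gm' B B0 by (intro PP.integrable_const_bound[of _ B] AE_I2) (auto simp: g_def)
 have inner: "(\<integral>y. g (y, w) \<partial>distr M traj_space (stopped m)) = (\<integral>x. g (stopped m x, w) \<partial>M)" if w: "w \<in> space ?E" for w
 proof (rule integral_distr[OF stopped_measurable])
  have "w \<in> space ?B" using w by (simp add: space_PiM)
  then have "(%y. (y, w)) \<in> traj_space \<rightarrow>\<^sub>M ?P" by simp
  from measurable_compose[OF this gm] show "(%y. g (y, w)) \<in> borel_measurable traj_space" .
 qed
 have zm: "(%x. (stopped m x, holding_path x)) \<in> M \<rightarrow>\<^sub>M ?P"
  using holding_path_measurable by (intro measurable_Pair) auto
 have "(\<integral>x. G (stopped_process m x) \<partial>M) = (\<integral>x. g (stopped m x, holding_path x) \<partial>M)"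
  by (intro Bochner_Integration.integral_cong) (auto simp: g_def stopped_process_def holding)
 also have "... = (\<integral>z. g z \<partial>distr M ?P (%x. (stopped m x, holding_path x)))"
  by (rule integral_distr[OF zm gm, symmetric])
 also have "... = (\<integral>z. g z \<partial>(distr M traj_space (stopped m) \<Otimes>\<^sub>M ?E))" by (simp only: traj_holding_law)
 also have "... = (\<integral>w. (\<integral>y. g (y, w) \<partial>distr M traj_space (stopped m)) \<partial>?E)"
  using integral_snd[of "%y w. g (y, w)"] gi by simp
 also have "... = (\<integral>w. (\<integral>x. g (stopped m x, w) \<partial>M) \<partial>?E)"
  by (rule Bochner_Integration.integral_cong[OF refl inner])
 finally show "(\<integral>x. G (stopped_process m x) \<partial>M)
  = (\<integral>w. (\<integral>x. (if holding_times w then G (jump_path T (%k. p (stopped m x k)) w) else 0) \<partial>M) \<partial>?E)"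
  unfolding g_def fst_conv snd_conv .
 have "(%w. \<integral>y. g (y, w) \<partial>distr M traj_space (stopped m)) \<in> borel_measurable ?E"
 proof (rule D.borel_measurable_lebesgue_integral)
  have "(%z. (snd z, fst z)) \<in> ?E \<Otimes>\<^sub>M distr M traj_space (stopped m) \<rightarrow>\<^sub>M distr M traj_space (stopped m) \<Otimes>\<^sub>M ?E"
   by (intro measurable_Pair) auto
  from measurable_compose[OF this gm']
  show "(%(w, y). g (y, w)) \<in> borel_measurable (?E \<Otimes>\<^sub>M distr M traj_space (stopped m))" by (simp add: case_prod_unfold)
 qed
 then have "(%w. \<integral>x. g (stopped m x, w) \<partial>M) \<in> borel_measurable ?E"
  by (rule measurable_cong[THEN iffD1, rotated]) (rule inner)
 then show "(%w. \<integral>x. (if holding_times w then G (jump_path T (%k. p (stopped m x k)) w) else 0) \<partial>M) \<in> borel_measurable ?E"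
  unfolding g_def fst_conv snd_conv .
qed

end

end

text \<open>The identity serves as time change; \<open>e\<close> is added because
  \<open>skorohod_dist_le\<close> asks for a positive bound.\<close>

lemma skorohod_dist_same_times_le:
 fixes y y' :: "nat => 'a::metric_space"
 assumes w: "holding_times w"
 shows "skorohod_dist T (jump_path T (%k. y (min k m)) w) (jump_path T (%k. y' (min k m)) w) <= (\<Sum>i\<le>m. dist (y i) (y' i))"
proof (rule field_le_epsilon)
 fix e :: real assume e: "0 < e"
 have s0: "0 <= (\<Sum>i\<le>m. dist (y i) (y' i))" by (intro sum_nonneg) simp
 show "skorohod_dist T (jump_path T (%k. y (min k m)) w) (jump_path T (%k. y' (min k m)) w) <= (\<Sum>i\<le>m. dist (y i) (y' i)) + e"
 proof (rule skorohod_dist_le[OF _ time_changes_id])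
  fix t assume t: "t \<in> {0..T}"
  let ?i = "min (jump_index w t) m"
  have "dist (y ?i) (y' ?i) <= (\<Sum>i\<le>m. dist (y i) (y' i))"
   by (rule member_le_sum[where f = "%i. dist (y i) (y' i)"]) auto
  then show "dist (jump_path T (%k. y (min k m)) w t) (jump_path T (%k. y' (min k m)) w t) <= (\<Sum>i\<le>m. dist (y i) (y' i)) + e"
   using t e by (simp add: jump_path_def)
 qed (use e s0 in auto)
qed

section \<open>Convergence of random stirring\<close>

lemma traj_test_measurable:
 assumes h: "traj_test k h B L"
 shows "h \<in> borel_measurable (\<Pi>\<^sub>M i\<in>UNIV. borel)"
proof -
 have "isCont h y" for y
 proof -
  let ?g = "%y'. L * (\<Sum>i\<le>k. dist (y' i) (y i))"
  have "continuous_on UNIV ?g" by (intro continuous_intros continuous_on_product_coordinates)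
  then have "isCont ?g y" by (simp add: continuous_on_eq_continuous_at)
  then have g: "(?g \<longlongrightarrow> 0) (at y)" by (simp add: isCont_def)
  have "((%y'. h y' - h y) \<longlongrightarrow> 0) (at y)"
   by (rule Lim_null_comparison[OF _ g]) (use h in \<open>auto simp: traj_test_def\<close>)
  then show ?thesis unfolding isCont_def by (rule LIM_zero_cancel)
 qed
 then have "continuous_on UNIV h" by (simp add: continuous_on_eq_continuous_at)
 then have "h \<in> borel_measurable borel" by (rule borel_measurable_continuous_onI)
 then show ?thesis using measurable_cong_sets[OF sets_PiM_equal_borel refl] by blast
qed

text \<open>The kernel \<open>q\<close> is accessible only through its generator on bounded
  continuous functions; there, as the total rate is 1, the generator determines all means.\<close>

locale split_merge_chain = unit_rate_chain P borel q Y W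
 for P :: "'w measure" and q :: "mass_partition => mass_partition measure" and Y W +
 assumes generator: "continuous_on UNIV f ==> bounded (range f) ==> jump_generator q f x = split_merge_generator f x"
begin

lemma integrable_kernel: "lipschitz_test f B L ==> integrable (q x) f"
proof -
 assume f: "lipschitz_test f B L"
 interpret Q: prob_space "q x" by (rule prob_space_q) simp
 have "f \<in> borel_measurable borel" by (rule borel_measurable_continuous_onI[OF lipschitz_test.continuous[OF f]])
 then have "f \<in> borel_measurable (q x)" by (subst measurable_cong_sets[OF sets_q refl]) simp_all
 then show ?thesis using lipschitz_test.bound[OF f] by (intro Q.integrable_const_bound[of _ B] AE_I2) auto
qed

lemma kernel_mean:
 assumes f: "lipschitz_test f B L"
 shows "(\<integral>z. f z \<partial>q x) = f x + split_merge_generator f x"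
proof -
 interpret Q: prob_space "q x" by (rule prob_space_q) simp
 have "bounded (range f)" using lipschitz_test.bound[OF f] by (auto simp: bounded_iff)
 from generator[OF lipschitz_test.continuous[OF f] this, of x]
 have "split_merge_generator f x = (\<integral>z. f z - f x \<partial>q x)" by (simp add: jump_generator_def)
 also have "... = (\<integral>z. f z \<partial>q x) - f x" using integrable_kernel[OF f] by (simp add: Q.prob_space)
 finally show ?thesis by simp
qed

lemma split_merge_step_eq:
 assumes "traj_test (Suc k) h B L"
 shows "split_merge_step k h y = (\<integral>z. h (extend_traj k y z) \<partial>q (y k))"
 unfolding split_merge_step_def by (rule kernel_mean[OF traj_test_section[OF assms], symmetric])

text \<open>A change of any state moves the integrand with constant \<open>L\<close>. A change of
  the last one also moves the starting point of the kernel, which the formula with the generator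
  controls with constant \<open>L + (16 * B + 8 * L)\<close>. The bound \<open>B\<close> persists
  because the step is a mean.\<close>

lemma split_merge_step_test:
 assumes h: "traj_test (Suc k) h B L"
 shows "traj_test k (split_merge_step k h) B (L + (16 * B + 9 * L))"
proof -
 have L: "0 <= L" and bd: "\<bar>h y\<bar> <= B" for y using h by (auto simp: traj_test_def)
 have B: "0 <= B" using bd[of undefined] by linarith
 note sec = traj_test_section[OF h]
 have bound: "\<bar>split_merge_step k h y\<bar> <= B" for y
 proof -
  interpret Q: prob_space "q (y k)" by (rule prob_space_q) simp
  have "\<bar>\<integral>z. h (extend_traj k y z) \<partial>q (y k)\<bar> <= (\<integral>z. \<bar>h (extend_traj k y z)\<bar> \<partial>q (y k))" by (rule integral_abs_bound)
  also have "... <= (\<integral>z. B \<partial>q (y k))"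
   using integrable_kernel[OF sec] bd by (intro integral_mono) auto
  finally show ?thesis by (simp add: split_merge_step_eq[OF h] Q.prob_space)
 qed
 have lip: "\<bar>split_merge_step k h y - split_merge_step k h y'\<bar> <= (L + (16 * B + 9 * L)) * (\<Sum>i\<le>k. dist (y i) (y' i))" for y y'
 proof -
  interpret Q: prob_space "q (y k)" by (rule prob_space_q) simp
  interpret f': lipschitz_test "%z. h (extend_traj k y' z)" B L by (rule sec)
  let ?D = "\<Sum>i\<le>k. dist (y i) (y' i)" and ?f = "%y z. h (extend_traj k y z)"
  have pw: "\<bar>?f y z - ?f y' z\<bar> <= L * ?D" for z
  proof -
   have "\<bar>?f y z - ?f y' z\<bar> <= L * (\<Sum>i\<le>Suc k. dist (extend_traj k y z i) (extend_traj k y' z i))"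
    using h by (simp add: traj_test_def)
   also have "(\<Sum>i\<le>Suc k. dist (extend_traj k y z i) (extend_traj k y' z i)) = ?D" by (simp add: extend_traj_def)
   finally show ?thesis .
  qed
  have "\<bar>(\<integral>z. ?f y z \<partial>q (y k)) - (\<integral>z. ?f y' z \<partial>q (y k))\<bar> = \<bar>\<integral>z. ?f y z - ?f y' z \<partial>q (y k)\<bar>"
   using integrable_kernel[OF sec] by simp
  also have "... <= (\<integral>z. \<bar>?f y z - ?f y' z\<bar> \<partial>q (y k))" by (rule integral_abs_bound)
  also have "... <= (\<integral>z. L * ?D \<partial>q (y k))"
   using integrable_kernel[OF sec] pw by (intro integral_mono) auto
  finally have 1: "\<bar>(\<integral>z. ?f y z \<partial>q (y k)) - (\<integral>z. ?f y' z \<partial>q (y k))\<bar> <= L * ?D" by (simp add: Q.prob_space)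
  have dk: "dist (y k) (y' k) <= ?D" by (rule member_le_sum[where f = "%i. dist (y i) (y' i)"]) auto
  have "\<bar>(\<integral>z. ?f y' z \<partial>q (y k)) - (\<integral>z. ?f y' z \<partial>q (y' k))\<bar>
    <= \<bar>?f y' (y k) - ?f y' (y' k)\<bar> + \<bar>split_merge_generator (?f y') (y k) - split_merge_generator (?f y') (y' k)\<bar>"
   unfolding kernel_mean[OF sec] by linarith
  also have "... <= L * dist (y k) (y' k) + (16 * B + 8 * L) * dist (y k) (y' k)"
   by (intro add_mono f'.lip f'.split_merge_generator_lip)
  also have "... = (16 * B + 9 * L) * dist (y k) (y' k)" by (simp add: algebra_simps)
  also have "... <= (16 * B + 9 * L) * ?D" using dk B L by (intro mult_left_mono) auto
  finally show ?thesis using 1 unfolding split_merge_step_eq[OF h] distrib_right[of L] by linarith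
 qed
 show ?thesis using bound lip B L by (auto simp: traj_test_def)
qed

lemma expectation_step:
 assumes h: "traj_test (Suc k) h B L"
 shows "(\<integral>x. h (stopped (Suc k) x) \<partial>P) = (\<integral>x. split_merge_step k h (stopped k x) \<partial>P)"
proof -
 have "!!y. \<bar>h y\<bar> <= B" using h by (simp add: traj_test_def)
 from one_step_expectation[OF traj_test_measurable[OF h] this, of k]
 show ?thesis by (simp add: split_merge_step_eq[OF h] stopped_last)
qed

end

locale stirring_chain = unit_rate_chain M "count_space (torus_perms d n)" "stirring_rates d n" Y W
 for M :: "'w measure" and d n :: nat and Y W +
 assumes d: "1 <= d" and n: "3 <= n"
  and init: "distr M (count_space (torus_perms d n)) (Y 0) = uniform_count_measure (torus_perms d n)"
begin

sublocale edge_walk "torus d n" "torus_edges d n" d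
 by (rule edge_walk_torus[OF d n])

text \<open>The start and every edge are uniform, so each history of edges has the same weight; the
  induction peels off the last edge.\<close>

lemma expectation_walk_mean:
 assumes "H \<in> borel_measurable traj_space" "!!y. \<bar>H y\<bar> <= B"
 shows "(\<integral>x. H (stopped k x) \<partial>M) = walk_mean k H"
 using assms
proof (induction k arbitrary: H)
 case 0
 have fin: "finite (torus_perms d n)" unfolding torus_perms_def by (rule finite_permutations[OF finV])
 have "(\<integral>x. H (stopped 0 x) \<partial>M) = (\<integral>x. H (%_. Y 0 x) \<partial>M)" by (simp add: stopped_def)
 also have "... = (\<integral>s. H (%_. s) \<partial>distr M (count_space (torus_perms d n)) (Y 0))"
  by (rule integral_distr[symmetric, OF Y_measurable]) simp
 also have "... = (\<Sum>s\<in>torus_perms d n. H (%_. s)) / card (torus_perms d n)"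
  unfolding init using fin by (rule integral_uniform_count_measure)
 also have "... = walk_mean 0 H" by (simp add: walk_mean_0 torus_perms_def card_perms)
 finally show ?case .
next
 case (Suc k)
 let ?E = "torus_edges d n"
 define H' where "H' = (%y. (\<Sum>b\<in>?E. H (extend_traj k y (edge_transposition b \<circ> y k))) / real (card ?E))"
 have "(\<integral>x. H (stopped (Suc k) x) \<partial>M) = (\<integral>x. (\<integral>z. H (extend_traj k (stopped k x) z) \<partial>stirring_rates d n (Y k x)) \<partial>M)"
  by (rule one_step_expectation[OF Suc.prems])
 also have "... = (\<integral>x. H' (stopped k x) \<partial>M)"
 proof (rule Bochner_Integration.integral_cong[OF refl])
  fix x assume "x \<in> space M"
  then have "Y k x \<in> torus_perms d n" using measurable_space[OF Y_measurable[of k]] by simp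
  from stirring_rates_integral[OF n this]
  show "(\<integral>z. H (extend_traj k (stopped k x) z) \<partial>stirring_rates d n (Y k x)) = H' (stopped k x)"
   by (simp add: H'_def stopped_last)
 qed
 also have "... = walk_mean k H'"
 proof (rule Suc.IH)
  have "(%y. H (extend_traj k y (edge_transposition b \<circ> y k))) \<in> borel_measurable traj_space" if b: "b \<in> ?E" for b
  proof -
   have "(%s. edge_transposition b \<circ> s) \<in> count_space (torus_perms d n) \<rightarrow>\<^sub>M count_space (torus_perms d n)"
    using edge_move_in[OF b] n by simp
   from measurable_compose[OF measurable_coordinate this]
   have "(%y. (y, edge_transposition b \<circ> y k)) \<in> traj_space \<rightarrow>\<^sub>M traj_space \<Otimes>\<^sub>M count_space (torus_perms d n)"
    by (intro measurable_Pair) auto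
   from measurable_compose[OF measurable_compose[OF this extend_traj_measurable[of k]] Suc.prems(1)]
   show ?thesis by simp
  qed
  then show "H' \<in> borel_measurable traj_space" unfolding H'_def by (intro borel_measurable_divide borel_measurable_sum) auto
  fix y
  have "\<bar>\<Sum>b\<in>?E. H (extend_traj k y (edge_transposition b \<circ> y k))\<bar> <= (\<Sum>b\<in>?E. B)"
   by (intro order_trans[OF sum_abs] sum_mono Suc.prems(2))
  then show "\<bar>H' y\<bar> <= B" using card_E_pos by (simp add: H'_def pos_divide_le_eq mult.commute)
 qed
 also have "... = walk_mean (Suc k) H" by (simp only: walk_mean_Suc H'_def)
 finally show ?case .
qed

lemma traj_test_expectation:
 assumes h: "traj_test k h B L"
 shows "(\<integral>x. h (%i. cycle_partition d n (Y (min i k) x)) \<partial>M) = walk_mean k (%y. h (%i. cycle_masses (torus d n) (y i)))"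
proof -
 have "(%y i. cycle_masses (torus d n) (y i)) \<in> traj_space \<rightarrow>\<^sub>M (\<Pi>\<^sub>M i\<in>UNIV. borel)"
  by (rule measurable_PiM_single') (auto intro: measurable_compose[OF measurable_coordinate])
 from measurable_compose[OF this traj_test_measurable[OF h]]
 have "(\<integral>x. h (%i. cycle_masses (torus d n) (stopped k x i)) \<partial>M) = walk_mean k (%y. h (%i. cycle_masses (torus d n) (y i)))"
  by (rule expectation_walk_mean[where B = B]) (use h in \<open>simp add: traj_test_def\<close>)
 then show ?thesis by (simp add: stopped_def cycle_partition_eq)
qed

end

locale stirring_limit = split_merge_chain P q Y' W'
 for P :: "'v measure" and q Y' W' +
 fixes d :: nat and M :: "nat => 'w measure" and Y :: "nat => nat => 'w => (nat => nat) => nat => nat"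
  and W :: "nat => nat => 'w => real"
 assumes stirring: "3 <= n ==> stirring_chain (M n) d n (Y n) (W n)"
  and PD1: "is_PD1 (distr P borel (Y' 0))"
begin

lemma dim_pos: "1 <= d"
 using stirring_chain.d[OF stirring[of 3]] by simp

lemma volume_at_top: "filterlim (\<lambda>n::nat. n ^ d) at_top sequentially"
proof (rule filterlim_at_top_mono[OF filterlim_ident])
 show "\<forall>\<^sub>F n in sequentially. n <= n ^ d"
  using dim_pos by (intro eventually_sequentiallyI[of 1] self_le_power) auto
qed

text \<open>Induction on the number of steps, for all test functions at once: the last step is
  exchanged for the generator step at a cost of order \<open>1 / n ^ d\<close>, which leaves a test
  function of one state fewer. The base is the convergence of means over uniform permutations of
  \<open>n ^ d\<close> vertices.\<close>

lemma chain_expectation_tendsto: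
 assumes "traj_test k h B L"
 shows "(%n. \<integral>w. h (%i. cycle_partition d n (Y n (min i k) w)) \<partial>M n) \<longlonglongrightarrow> (\<integral>w. h (stopped k w) \<partial>P)"
 using assms
proof (induction k arbitrary: h B L)
 case 0
 define f where "f x = h (%_. x)" for x
 have f: "lipschitz_test f B L"
 proof
  show "\<bar>f x\<bar> <= B" "0 <= L" for x using 0 by (auto simp: traj_test_def f_def)
  fix x x'
  have "\<bar>h (%_. x) - h (%_. x')\<bar> <= L * (\<Sum>i\<le>(0::nat). dist x x')" using 0 unfolding traj_test_def by blast
  then show "\<bar>f x - f x'\<bar> <= L * dist x x'" by (simp add: f_def)
 qed
 have "prob_space (distr P borel (Y' 0))" by (rule prob_space_distr) simp
 from lipschitz_test.uniform_mean_tendsto_PD1[OF f PD1 this]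
 have "(%n. uniform_mean f (n ^ d)) \<longlonglongrightarrow> (\<integral>p. f p \<partial>distr P borel (Y' 0))"
  by (rule filterlim_compose[OF _ volume_at_top])
 also have "(\<integral>p. f p \<partial>distr P borel (Y' 0)) = (\<integral>w. h (stopped 0 w) \<partial>P)"
  using borel_measurable_continuous_onI[OF lipschitz_test.continuous[OF f]]
  by (subst integral_distr) (auto simp: f_def stopped_def)
 finally show ?case
 proof (rule Lim_transform_eventually)
  show "\<forall>\<^sub>F n in sequentially. uniform_mean f (n ^ d) = (\<integral>w. h (%i. cycle_partition d n (Y n (min i 0) w)) \<partial>M n)"
  proof (rule eventually_sequentiallyI[of 3])
   fix n :: nat assume "3 <= n"
   then interpret s: stirring_chain "M n" d n "Y n" "W n" by (rule stirring)
   have "(\<integral>w. h (%i. cycle_partition d n (Y n (min i 0) w)) \<partial>M n) = (\<Sum>g | g permutes torus d n. f (cycle_masses (torus d n) g)) / fact (card (torus d n))"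
    by (simp only: s.traj_test_expectation[OF 0] s.walk_mean_0 f_def)
   also have "... = uniform_mean f (card (torus d n))" by (rule uniform_mean_eq[OF s.finV s.neV, symmetric])
   finally show "uniform_mean f (n ^ d) = (\<integral>w. h (%i. cycle_partition d n (Y n (min i 0) w)) \<partial>M n)"
    by (simp add: card_torus)
  qed
 qed
next
 case (Suc k)
 note h = Suc.prems and h' = split_merge_step_test[OF Suc.prems]
 let ?C = "B * (16 * real k + 2) + 2 * L"
 let ?a = "%n. \<integral>w. h (%i. cycle_partition d n (Y n (min i (Suc k)) w)) \<partial>M n"
 let ?b = "%n. \<integral>w. split_merge_step k h (%i. cycle_partition d n (Y n (min i k) w)) \<partial>M n"
 have b: "?b \<longlonglongrightarrow> (\<integral>w. h (stopped (Suc k) w) \<partial>P)"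
  using Suc.IH[OF h'] by (simp only: expectation_step[OF h])
 have "(%n. ?a n - ?b n) \<longlonglongrightarrow> 0"
 proof (rule Lim_null_comparison)
  show "\<forall>\<^sub>F n in sequentially. norm (?a n - ?b n) <= ?C / real (n ^ d)"
  proof (rule eventually_sequentiallyI[of 3])
   fix n :: nat assume "3 <= n"
   then interpret s: stirring_chain "M n" d n "Y n" "W n" by (rule stirring)
   show "norm (?a n - ?b n) <= ?C / real (n ^ d)"
    unfolding s.traj_test_expectation[OF h] s.traj_test_expectation[OF h'] real_norm_def
    using s.walk_mean_step_close[OF h] by (simp only: card_torus)
  qed
  have "filterlim (%n. real (n ^ d)) at_top sequentially"
   by (rule filterlim_compose[OF filterlim_real_sequentially volume_at_top])
  then show "(%n. ?C / real (n ^ d)) \<longlonglongrightarrow> 0"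
   by (intro tendsto_divide_0[OF tendsto_const] filterlim_at_top_imp_at_infinity)
 qed
 from tendsto_add[OF this b] show ?case by simp
qed

text \<open>The number of jumps is truncated at \<open>m\<close>, uniformly in \<open>n\<close>. For
  fixed holding times the functional is a Lipschitz function of finitely many states; the holding
  times are then integrated by dominated convergence.\<close>

lemma path_expectation_tendsto:
 fixes T :: real
 assumes T: "0 < T"
  and hold': "!!u. u \<in> space P ==> holding_times (%k. W' k u)"
  and hold: "!!n u. 3 <= n ==> u \<in> space (M n) ==> holding_times (%k. W n k u)"
  and G: "G \<in> borel_measurable (borel_of (skorohod_topology T))" and B: "!!x. \<bar>G x\<bar> <= B" and K: "0 <= K"
  and lip: "!!x y. x \<in> cadlag_paths T ==> y \<in> cadlag_paths T ==> \<bar>G x - G y\<bar> <= K * skorohod_dist T x y"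
 shows "(%n. \<integral>u. G (jump_path T (%k. cycle_partition d n (Y n k u)) (%k. W n k u)) \<partial>M n)
  \<longlonglongrightarrow> (\<integral>u. G (jump_path T (%k. Y' k u) (%k. W' k u)) \<partial>P)"
proof -
 let ?u = "(\<integral>u. G (jump_path T (%k. Y' k u) (%k. W' k u)) \<partial>P)"
 let ?E = "\<Pi>\<^sub>M k\<in>(UNIV::nat set). exp_law"
 interpret z: unit_rate_path P borel q Y' W' "%x. x" T
  by unfold_locales (use hold' T in auto)
 have path: "unit_rate_path (M n) (count_space (torus_perms d n)) (stirring_rates d n) (Y n) (W n) (cycle_partition d n) T" if "3 <= n" for n
 proof -
  interpret s: stirring_chain "M n" d n "Y n" "W n" by (rule stirring[OF that])
  show ?thesis by unfold_locales (use hold[OF that] T in auto)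
 qed
 have B0: "0 <= B" using B[of undefined] by linarith
 interpret E: prob_space ?E by (rule z.prob_space_holding_law)
 define J where "J n = (\<integral>u. G (jump_path T (%k. cycle_partition d n (Y n k u)) (%k. W n k u)) \<partial>M n)" for n
 define A where "A m n w = (\<integral>u. (if holding_times w then G (jump_path T (%k. cycle_partition d n (Y n (min k m) u)) w) else 0) \<partial>M n)" for m n w
 define A' where "A' m w = (\<integral>u. (if holding_times w then G (jump_path T (%k. Y' (min k m) u) w) else 0) \<partial>P)" for m w
 have err: "\<bar>J n - (\<integral>w. A m n w \<partial>?E)\<bar> <= 2 * B * z.late_mass m" and Am: "A m n \<in> borel_measurable ?E" if n: "3 <= n" for m n
 proof -
  interpret s: unit_rate_path "M n" "count_space (torus_perms d n)" "stirring_rates d n" "Y n" "W n" "cycle_partition d n" T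
   by (rule path[OF n])
  show "\<bar>J n - (\<integral>w. A m n w \<partial>?E)\<bar> <= 2 * B * z.late_mass m"
   using s.truncation_error[OF G B, of m] unfolding s.stopped_process_expectation[OF G B] s.jump_process_def s.stopped_def s.late_mass_def
   by (simp only: J_def A_def z.late_mass_def)
  show "A m n \<in> borel_measurable ?E"
   using s.stopped_process_expectation_measurable[OF G B, of m] unfolding A_def[abs_def] s.stopped_def .
 qed
 have err': "\<bar>?u - (\<integral>w. A' m w \<partial>?E)\<bar> <= 2 * B * z.late_mass m"
  and A'm: "A' m \<in> borel_measurable ?E" for m
  using z.truncation_error[OF G B, of m] z.stopped_process_expectation_measurable[OF G B, of m]
  unfolding z.stopped_process_expectation[OF G B] z.jump_process_def stopped_def A'_def[abs_def] by auto
 have AA': "(%n. A m n w) \<longlonglongrightarrow> A' m w" for m w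
 proof (cases "holding_times w")
  case True
  have "traj_test m (%y. G (jump_path T (%k. y (min k m)) w)) B K"
   unfolding traj_test_def
  proof (intro conjI allI B K)
   fix y y' :: "nat => mass_partition"
   have "\<bar>G (jump_path T (%k. y (min k m)) w) - G (jump_path T (%k. y' (min k m)) w)\<bar>
     <= K * skorohod_dist T (jump_path T (%k. y (min k m)) w) (jump_path T (%k. y' (min k m)) w)"
    by (intro lip jump_path_cadlag True)
   also have "... <= K * (\<Sum>i\<le>m. dist (y i) (y' i))"
    by (intro mult_left_mono K skorohod_dist_same_times_le True)
   finally show "\<bar>G (jump_path T (%k. y (min k m)) w) - G (jump_path T (%k. y' (min k m)) w)\<bar> <= K * (\<Sum>i\<le>m. dist (y i) (y' i))" .
  qed
  from chain_expectation_tendsto[OF this] show ?thesis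
   using True by (simp add: A_def A'_def stopped_def)
 qed (simp add: A_def A'_def)
 \<comment> \<open>The chains are available from side length 3 on, while dominated convergence asks
   for a bound at every index; hence the shift.\<close>
 have lim: "(%n. \<integral>w. A m (n + 3) w \<partial>?E) \<longlonglongrightarrow> (\<integral>w. A' m w \<partial>?E)" for m
 proof (rule integral_dominated_convergence[where w = "%_. B"])
  show "AE w in ?E. (%n. A m (n + 3) w) \<longlonglongrightarrow> A' m w"
   by (intro AE_I2 LIMSEQ_ignore_initial_segment AA')
  show "AE w in ?E. norm (A m (n + 3) w) <= B" for n
  proof (rule AE_I2)
   fix w
   have "3 <= n + 3" by simp
   then interpret s: stirring_chain "M (n + 3)" d "n + 3" "Y (n + 3)" "W (n + 3)" by (rule stirring)
   show "norm (A m (n + 3) w) <= B"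
   \<comment> \<open>If the integrand is not integrable, its integral is 0 by convention, which also
     satisfies the bound.\<close>
   proof (cases "integrable (M (n + 3)) (%u. if holding_times w then G (jump_path T (%k. cycle_partition d (n + 3) (Y (n + 3) (min k m) u)) w) else 0)")
    case True
    have "norm (A m (n + 3) w) <= (\<integral>u. B \<partial>M (n + 3))"
     unfolding A_def real_norm_def using True B B0
     by (intro order_trans[OF integral_abs_bound] integral_mono) auto
    then show ?thesis by (simp add: s.prob_space)
   qed (simp add: A_def not_integrable_integral_eq B0)
  qed
 qed (use Am A'm in auto)
 have "J \<longlonglongrightarrow> ?u"
 proof (rule LIMSEQ_offset[where k = 3], rule LIMSEQ_I)
  fix e :: real assume e: "0 < e"
  have "(%m. 2 * B * z.late_mass m) \<longlonglongrightarrow> 2 * B * 0" by (intro tendsto_intros z.late_mass_tendsto)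
  then have "\<exists>no. \<forall>m\<ge>no. norm (2 * B * z.late_mass m - 2 * B * 0) < e / 3" by (rule LIMSEQ_D) (use e in simp)
  then obtain m where "norm (2 * B * z.late_mass m - 2 * B * 0) < e / 3" by blast
  then have m: "2 * B * z.late_mass m < e / 3" by simp
  from LIMSEQ_D[OF lim[of m], of "e / 3"] e obtain N where N: "!!n. N <= n ==> \<bar>(\<integral>w. A m (n + 3) w \<partial>?E) - (\<integral>w. A' m w \<partial>?E)\<bar> < e / 3" by auto
  have "norm (J (n + 3) - ?u) < e" if "N <= n" for n
   using N[OF that] err[of "n + 3" m] err'[of m] m unfolding real_norm_def by linarith
  then show "\<exists>no. \<forall>n\<ge>no. norm (J (n + 3) - ?u) < e" by blast
 qed
 then show ?thesis by (simp only: J_def[abs_def])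
qed

end

theorem corollary1:
 fixes d :: nat and T :: real
  and M :: "nat \<Rightarrow> 'a measure"
  and \<eta> :: "nat \<Rightarrow> real \<Rightarrow> 'a \<Rightarrow> (nat \<Rightarrow> nat) \<Rightarrow> nat \<Rightarrow> nat"
  and \<xi> :: "nat \<Rightarrow> real \<Rightarrow> 'a \<Rightarrow> mass_partition"
  and P :: "'b measure"
  and \<zeta> :: "real \<Rightarrow> 'b \<Rightarrow> mass_partition"
 assumes "1 \<le> d" and "0 < T"
  and "\<And>n. 3 \<le> n \<Longrightarrow> stirring_process d n (M n) (\<eta> n)"
  and "\<And>n. 3 \<le> n \<Longrightarrow>
   distr (M n) (count_space (torus_perms d n)) (\<eta> n 0) = uniform_count_measure (torus_perms d n)"
  and "\<And>n t \<omega>. \<xi> n t \<omega> = cycle_partition d n (\<eta> n t \<omega>)"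
  and "split_merge_process P \<zeta>"
  and "is_PD1 (distr P borel (\<zeta> 0))"
 shows "converges_in_distribution (skorohod_topology T)
  M (\<lambda>n. path_on T (\<xi> n)) P (path_on T \<zeta>)"
proof -
 \<comment> \<open>Skeleton and holding times are chosen as one pair for each \<open>n\<close>, with
   the requirement void for \<open>n < 3\<close>, in order to obtain sequences.\<close>
 have "\<exists>YW. 3 <= n --> unit_rate_chain (M n) (count_space (torus_perms d n)) (stirring_rates d n) (fst YW) (snd YW) &
   (\<forall>\<omega>\<in>space (M n). holding_times (%k. snd YW k \<omega>)) &
   (\<forall>\<omega>\<in>space (M n). \<forall>t\<ge>0. \<eta> n t \<omega> = fst YW (jump_index (%k. snd YW k \<omega>) t) \<omega>)" for n
 proof (cases "3 <= n")
  case True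
  from markov_jump_process_unit_rate[OF assms(3)[OF True, unfolded stirring_process_def]]
  show ?thesis using total_rate_stirring[OF assms(1) True] by simp
 qed simp
 then obtain YW where YW: "!!n. 3 <= n --> unit_rate_chain (M n) (count_space (torus_perms d n)) (stirring_rates d n) (fst (YW n)) (snd (YW n)) &
   (\<forall>\<omega>\<in>space (M n). holding_times (%k. snd (YW n) k \<omega>)) &
   (\<forall>\<omega>\<in>space (M n). \<forall>t\<ge>0. \<eta> n t \<omega> = fst (YW n) (jump_index (%k. snd (YW n) k \<omega>) t) \<omega>)"
  by metis
 define Y where "Y n = fst (YW n)" for n
 define W where "W n = snd (YW n)" for n
 have chain: "unit_rate_chain (M n) (count_space (torus_perms d n)) (stirring_rates d n) (Y n) (W n)"
  and hold: "!!\<omega>. \<omega> \<in> space (M n) ==> holding_times (%k. W n k \<omega>)"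
  and \<eta>: "!!\<omega> t. \<omega> \<in> space (M n) ==> 0 <= t ==> \<eta> n t \<omega> = Y n (jump_index (%k. W n k \<omega>) t) \<omega>"
  if "3 <= n" for n using YW[of n] that by (simp_all add: Y_def W_def)
 obtain q where q: "markov_jump_process P borel q \<zeta>" "!!p. total_rate borel q p = 1"
  and gen: "!!f p. continuous_on UNIV f ==> bounded (range f) ==> jump_generator q f p = split_merge_generator f p"
  using assms(6) unfolding split_merge_process_def by blast
 obtain Y' W' where chain': "unit_rate_chain P borel q Y' W'"
  and hold': "!!\<omega>. \<omega> \<in> space P ==> holding_times (%k. W' k \<omega>)"
  and \<zeta>: "!!\<omega> t. \<omega> \<in> space P ==> 0 <= t ==> \<zeta> t \<omega> = Y' (jump_index (%k. W' k \<omega>) t) \<omega>"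
  using markov_jump_process_unit_rate[OF q] by auto
 \<comment> \<open>The first holding time is positive, so the state at time 0 is the first state of
   the skeleton, which thereby inherits the initial law.\<close>
 have j0: "jump_index w 0 = 0" if "holding_times w" for w
  using that by (intro jump_index_eqI) (auto simp: holding_times_def arrival_Suc)
 interpret z: split_merge_chain P q Y' W'
  by (intro split_merge_chain.intro split_merge_chain_axioms.intro chain' gen)
 have st: "stirring_chain (M n) d n (Y n) (W n)" if n: "3 <= n" for n
 proof (intro stirring_chain.intro stirring_chain_axioms.intro chain[OF n] assms(1) n)
  have "distr (M n) (count_space (torus_perms d n)) (Y n 0) = distr (M n) (count_space (torus_perms d n)) (\<eta> n 0)"
   by (rule distr_cong) (simp_all add: \<eta>[OF n] j0[OF hold[OF n]])
  then show "distr (M n) (count_space (torus_perms d n)) (Y n 0) = uniform_count_measure (torus_perms d n)"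
   by (simp only: assms(4)[OF n])
 qed
 have "distr P borel (Y' 0) = distr P borel (\<zeta> 0)"
  by (rule distr_cong) (simp_all add: \<zeta> j0[OF hold'])
 then have PD1: "is_PD1 (distr P borel (Y' 0))" using assms(7) by simp
 interpret l: stirring_limit P q Y' W' d M Y W
  by (intro stirring_limit.intro stirring_limit_axioms.intro z.split_merge_chain_axioms st PD1)
 have path': "path_on T \<zeta> \<omega> = jump_path T (%k. Y' k \<omega>) (%k. W' k \<omega>)" if "\<omega> \<in> space P" for \<omega>
  unfolding path_on_def jump_path_def by (rule restrict_ext) (simp add: \<zeta>[OF that])
 have path: "path_on T (\<xi> n) \<omega> = jump_path T (%k. cycle_partition d n (Y n k \<omega>)) (%k. W n k \<omega>)"
  if "3 <= n" "\<omega> \<in> space (M n)" for n \<omega>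
  unfolding path_on_def jump_path_def by (rule restrict_ext) (simp add: \<eta>[OF that] assms(5))
 interpret K: Metric_space "cadlag_paths T" "skorohod_dist T :: (real => mass_partition) => _" by (rule Metric_space_skorohod)
 have re': "random_element P (skorohod_topology T) (path_on T \<zeta>)"
 proof -
  interpret p: unit_rate_path P borel q Y' W' "%x. x" T by unfold_locales (use hold' assms(2) in auto)
  from p.jump_process_random_element show ?thesis
   unfolding random_element_def p.jump_process_def[abs_def] by (simp add: path' cong: measurable_cong)
 qed
 have re: "random_element (M n) (skorohod_topology T) (path_on T (\<xi> n))" if n: "3 <= n" for n
 proof -
  interpret s: stirring_chain "M n" d n "Y n" "W n" by (rule st[OF n])
  interpret p: unit_rate_path "M n" "count_space (torus_perms d n)" "stirring_rates d n" "Y n" "W n" "cycle_partition d n" T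
   by unfold_locales (use hold[OF n] assms(2) in auto)
  from p.jump_process_random_element show ?thesis
   unfolding random_element_def p.jump_process_def[abs_def] by (simp add: path[OF n] cong: measurable_cong)
 qed
 have lip: "(%n. \<integral>\<omega>. G (path_on T (\<xi> n) \<omega>) \<partial>M n) \<longlonglongrightarrow> (\<integral>\<omega>. G (path_on T \<zeta> \<omega>) \<partial>P)"
  if G: "G \<in> borel_measurable (borel_of (skorohod_topology T))" "!!x. \<bar>G x\<bar> <= B" "0 <= L"
   "!!x y. x \<in> cadlag_paths T ==> y \<in> cadlag_paths T ==> \<bar>G x - G y\<bar> <= L * skorohod_dist T x y" for G B L
 proof -
  have "(\<integral>\<omega>. G (path_on T \<zeta> \<omega>) \<partial>P) = (\<integral>\<omega>. G (jump_path T (%k. Y' k \<omega>) (%k. W' k \<omega>)) \<partial>P)"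
   by (rule Bochner_Integration.integral_cong) (simp_all add: path')
  moreover have "\<forall>\<^sub>F n in sequentially. (\<integral>\<omega>. G (jump_path T (%k. cycle_partition d n (Y n k \<omega>)) (%k. W n k \<omega>)) \<partial>M n) = (\<integral>\<omega>. G (path_on T (\<xi> n) \<omega>) \<partial>M n)"
   by (rule eventually_sequentiallyI[of 3], rule Bochner_Integration.integral_cong) (simp_all add: path)
  ultimately show ?thesis
   using Lim_transform_eventually[OF l.path_expectation_tendsto[OF assms(2) hold' hold G]] by simp
 qed
 have "\<forall>\<^sub>F n in sequentially. random_element (M n) (skorohod_topology T) (path_on T (\<xi> n))"
  using re by (rule eventually_sequentiallyI)
 moreover note re'
 moreover have "(%n. \<integral>\<omega>. F (path_on T (\<xi> n) \<omega>) \<partial>M n) \<longlonglongrightarrow> (\<integral>\<omega>. F (path_on T \<zeta> \<omega>) \<partial>P)"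
  if "continuous_map (skorohod_topology T) euclideanreal F" "bounded (F ` topspace (skorohod_topology T))" for F
  using K.expectation_tendsto_of_lipschitz[of M "%n. path_on T (\<xi> n)" P "path_on T \<zeta>" F] lip that calculation
  unfolding skorohod_topology_def by blast
 ultimately show ?thesis unfolding converges_in_distribution_def by blast
qed

end
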